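(* For $0<r<1$ consider the self-similar IFS on $\mathbb R^4=\mathbb R^3\times\mathbb R$ $$\Phi_r=\left\{f_{O,b,c}(x,y)=(rOx+be_1,\ ry+c)\right\}_{O\in\mathcal R_5,\ b,c\in\{0,1\}},\qquad x\in\mathbb R^3,\ y\in\mathbb R,$$ where $\mathcal R_5\subset\mathrm{SO}(3)$ is the Ramanujan set associated to $p=5$. For every $\eta>0$ and every $\tau>0$ there exist $0<r<1$ and a self-similar measure $\nu\in\mathcal P(\mathbb R^4)$ with respect to $\Phi_r$ such that $\nu\perp\mathrm{Leb}_{\mathbb R^4}$ and $\dim_F\nu<\eta$; however, for every $1\le k\le 3$ and every $W\in G_{4,k}$, $$\pi_W\nu\ll\mathrm{Leb}_W\iff e_4\notin W.$$ In fact, if $e_4\notin W$, then $\pi_W\nu\in H^t(W)$ for every $0\le t<\frac{4-k}{2}-\tau$.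
   Context: For a prime $p\equiv 1\pmod 4$, let $$\Omega_p:=\Big\{\tfrac{1}{\sqrt p}(a,b,c,d)\in S^3: a,b,c,d\in\mathbb Z,\ a^2+b^2+c^2+d^2=p,\ a>0\text{ odd},\ b,c,d\text{ even}\Big\},$$ regarded as a set of unit quaternions. The Ramanujan set is $\mathcal R_p:=\{\mathrm{Ad}_\omega:\omega\in\Omega_p\}\subset\mathrm{SO}(3)$, where $\mathrm{Ad}_\omega(x)=\omega x\omega^{-1}$ acts on purely imaginary quaternions, identified with $\mathbb R^3$ via the basis $(i,j,k)$. It has $p+1$ elements (so $|\mathcal R_5|=6$). A self-similar measure with respect to an IFS $\{f_i\}$ is the unique Borel probability measure with $\nu=\sum_ip_if_i\nu$ (push-forwards) for some strictly positive probability vector $(p_i)$. The vectors $e_1$ and $e_4$ are standard basis vectors of $\mathbb R^3$ and $\mathbb R^4$ respectively. $\mathcal F_\xi(\nu)=\widehat\nu(\xi)=\int e^{-2\pi i\langle x,\xi\rangle}d\nu(x)$, and for $\nu\in\mathcal P(\mathbb R^d)$, $\dim_F\nu=\sup\{0\le s\le d:|\mathcal F_\xi(\nu)|\lesssim|\xi|^{-s/2}\}$. $G_{4,k}$ is the Grassmannian of $k$-dimensional linear subspaces of $\mathbb R^4$, $\pi_W$ the orthogonal projection onto $W$, $\pi_W\nu$ the push-forward. $H^t(W)$, $t\ge0$, is the $L^2$-Sobolev space of order $t$ on $W$. *)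

theory Defs
  imports "HOL-Analysis.Analysis"
begin

section \<open>Quaternions and the Ramanujan sets\<close>

text \<open>A quaternion \<open>a + u\<^sub>1 i + u\<^sub>2 j + u\<^sub>3 k\<close> is the pair \<open>(a, u)\<close> of its real part and its
  imaginary part, so that the norm on the product type is the quaternion norm.\<close>

type_synonym quat = "real \<times> (real^3)"

definition qmult :: "quat \<Rightarrow> quat \<Rightarrow> quat" where
  "qmult p q = (fst p * fst q - snd p \<bullet> snd q,
                fst p *\<^sub>R snd q + fst q *\<^sub>R snd p + cross3 (snd p) (snd q))"

definition qinverse :: "quat \<Rightarrow> quat" where
  "qinverse q = (1 / (norm q)\<^sup>2) *\<^sub>R (fst q, - snd q)"

lemma qmult_qinverse: "q \<noteq> 0 \<Longrightarrow> qmult q (qinverse q) = (1, 0)"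
proof -
  assume "q \<noteq> 0"
  then have "norm q \<noteq> 0" by simp
  moreover have "(norm q)\<^sup>2 = fst q * fst q + snd q \<bullet> snd q"
    by (simp add: dot_square_norm[symmetric] inner_prod_def)
  ultimately have "fst q * fst q + snd q \<bullet> snd q \<noteq> 0"
    by (metis power_not_zero)
  with \<open>(norm q)\<^sup>2 = _\<close> show ?thesis
    by (simp add: qmult_def qinverse_def cross_minus_right cross_mult_right
        add_divide_distrib[symmetric])
qed

definition Ad :: "quat \<Rightarrow> real^3 \<Rightarrow> real^3" where
  "Ad \<omega> x = snd (qmult (qmult \<omega> (0, x)) (qinverse \<omega>))"

lemma Ad_imaginary: "qmult (qmult \<omega> (0, x)) (qinverse \<omega>) = (0, Ad \<omega> x)"
proof -
  have "fst (qmult (qmult \<omega> (0, x)) (qinverse \<omega>)) = 0"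
    by (simp add: qmult_def qinverse_def inner_add_left inner_add_right dot_cross_self inner_commute)
  then show ?thesis
    by (simp add: Ad_def prod_eq_iff)
qed

text \<open>Intended for primes \<open>p\<close> congruent to 1 modulo 4.\<close>

definition Omega :: "nat \<Rightarrow> quat set" where
  "Omega p = {(1 / sqrt (real p)) *\<^sub>R (real_of_int a, vector [real_of_int b, real_of_int c, real_of_int d]) |
     a b c d :: int. a\<^sup>2 + b\<^sup>2 + c\<^sup>2 + d\<^sup>2 = int p \<and> a > 0 \<and> odd a \<and> even b \<and> even c \<and> even d}"

definition Ramanujan :: "nat \<Rightarrow> (real^3 \<Rightarrow> real^3) set" where
  "Ramanujan p = Ad ` Omega p"


section \<open>Self-similar measures\<close>

text \<open>For a finite system of contractions the weights \<open>p\<close> determine \<open>\<nu>\<close> uniquely. The condition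
  \<open>sum p I = 1\<close> excludes infinite \<open>I\<close>, for which \<open>sum p I = 0\<close> by convention.\<close>

definition self_similar_measure ::
    "'i set \<Rightarrow> ('i \<Rightarrow> 'a \<Rightarrow> 'a) \<Rightarrow> ('a::topological_space) measure \<Rightarrow> bool" where
  "self_similar_measure I f \<nu> \<longleftrightarrow>
     sets \<nu> = sets borel \<and> emeasure \<nu> UNIV = 1 \<and>
     (\<exists>p :: 'i \<Rightarrow> real. (\<forall>i\<in>I. p i > 0) \<and> sum p I = 1 \<and>
        (\<forall>A\<in>sets borel. measure \<nu> A = (\<Sum>i\<in>I. p i * measure (distr \<nu> borel (f i)) A)))"

text \<open>\<open>\<real>\<^sup>4\<close> is represented as \<open>\<real>\<^sup>3 \<times> \<real>\<close>.\<close>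

type_synonym R4 = "(real^3) \<times> real"

definition e4 :: R4 where
  "e4 = (0, 1)"

definition Phi_index :: "((real^3 \<Rightarrow> real^3) \<times> real \<times> real) set" where
  "Phi_index = Ramanujan 5 \<times> {0, 1} \<times> {0, 1}"

definition Phi :: "real \<Rightarrow> (real^3 \<Rightarrow> real^3) \<times> real \<times> real \<Rightarrow> R4 \<Rightarrow> R4" where
  "Phi r = (\<lambda>(Q, b, c) (x, y). (r *\<^sub>R Q x + b *\<^sub>R axis 1 1, r * y + c))"


section \<open>Singularity and Fourier dimension\<close>

definition mutually_singular :: "'a measure \<Rightarrow> 'a measure \<Rightarrow> bool" where
  "mutually_singular M N \<longleftrightarrow>
     (\<exists>A\<in>sets M \<inter> sets N. emeasure M A = 0 \<and> emeasure N (space N - A) = 0)"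

definition fourier :: "('a::euclidean_space) measure \<Rightarrow> 'a \<Rightarrow> complex" where
  "fourier \<nu> \<xi> = (\<integral>x. exp (- 2 * of_real pi * \<i> * of_real (x \<bullet> \<xi>)) \<partial>\<nu>)"

text \<open>The origin is excluded because \<open>0 powr a = 0\<close>.\<close>

definition fourier_dim :: "('a::euclidean_space) measure \<Rightarrow> real" where
  "fourier_dim \<nu> = Sup {s. 0 \<le> s \<and> s \<le> real DIM('a) \<and>
     (\<exists>C. \<forall>\<xi>. \<xi> \<noteq> 0 \<longrightarrow> cmod (fourier \<nu> \<xi>) \<le> C * norm \<xi> powr (- s / 2))}"


section \<open>Measures on linear subspaces\<close>

definition grassmannian :: "nat \<Rightarrow> ('a::euclidean_space) set set" where
  "grassmannian k = {W. subspace W \<and> dim W = k}"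

definition proj_on :: "('a::euclidean_space) set \<Rightarrow> 'a \<Rightarrow> 'a" where
  "proj_on W x = (THE y. y \<in> W \<and> (\<forall>w\<in>W. orthogonal (x - y) w))"

definition orthonormal_basis_of :: "('a::euclidean_space) set \<Rightarrow> 'a set \<Rightarrow> bool" where
  "orthonormal_basis_of W B \<longleftrightarrow> pairwise orthogonal B \<and> (\<forall>b\<in>B. norm b = 1) \<and> span B = W"

text \<open>Measures on a subspace \<open>W\<close> are represented as Borel measures on the ambient space that are
  concentrated on \<open>W\<close>. Lebesgue measure on \<open>W\<close> is product Lebesgue measure in the coordinates of
  an orthonormal basis of \<open>W\<close> (compare the definition of \<^const>\<open>lborel\<close>); by rotation invariance it does not
  depend on the chosen basis.\<close>

definition leb_on :: "('a::euclidean_space) set \<Rightarrow> 'a measure" where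
  "leb_on W = (let B = (SOME B. orthonormal_basis_of W B) in
     distr (\<Pi>\<^sub>M b\<in>B. (lborel :: real measure)) borel (\<lambda>g. \<Sum>b\<in>B. g b *\<^sub>R b))"

lemma ex_orthonormal_basis_of: "subspace W \<Longrightarrow> \<exists>B. orthonormal_basis_of W B"
  unfolding orthonormal_basis_of_def by (metis orthonormal_basis_subspace)

definition proj_measure :: "('a::euclidean_space) set \<Rightarrow> 'a measure \<Rightarrow> 'a measure" where
  "proj_measure W \<nu> = distr \<nu> borel (proj_on W)"

text \<open>A finite Borel measure \<open>\<mu>\<close> on \<open>W\<close> belongs to \<open>H\<^sup>t(W)\<close>, where \<open>t \<ge> 0\<close>, if it has a density
  \<open>h \<in> L\<^sup>2(W)\<close> and \<open>(1 + |\<xi>|\<^sup>2)\<^bsup>t/2\<^esup>\<close> times the Fourier transform of \<open>h\<close> is in \<open>L\<^sup>2(W)\<close>. As \<open>\<mu>\<close> is finite,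
  \<open>h\<close> is also in \<open>L\<^sup>1(W)\<close>, so its Fourier transform is the restriction to \<open>W\<close> of that of \<open>\<mu>\<close>.\<close>

definition in_sobolev :: "real \<Rightarrow> ('a::euclidean_space) set \<Rightarrow> 'a measure \<Rightarrow> bool" where
  "in_sobolev t W \<mu> \<longleftrightarrow>
     (\<exists>h \<in> borel_measurable borel. (\<forall>x. 0 \<le> h x) \<and>
        \<mu> = density (leb_on W) (\<lambda>x. ennreal (h x)) \<and>
        integrable (leb_on W) (\<lambda>x. (h x)\<^sup>2)) \<and>
     integrable (leb_on W) (\<lambda>\<xi>. (1 + (norm \<xi>)\<^sup>2) powr t * (cmod (fourier \<mu> \<xi>))\<^sup>2)"

end

theory Submission
  imports Defs "HOL-Number_Theory.Number_Theory" "HOL-Probability.Probability"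
begin

text \<open>The measure is built so that its vertical marginal is singular while every frequency with a
  large horizontal part is damped. Take \<open>r = 1 - 1/q\<close> with \<open>q\<close> a large power of two, let the six
  rotations and the two horizontal translations be chosen uniformly, and let the vertical
  translation be \<open>1\<close> with a very small probability \<open>e\<close>. Such an \<open>e\<close> makes the vertical marginal,
  which is a biased Bernoulli convolution, singular (\<open>singular_marginal\<close>): typical words of length
  \<open>n\<close> are far fewer than \<open>r\<^sup>-\<^sup>n\<close>. It also makes the Fourier transform along the vertical axis
  decay arbitrarily slowly (\<open>fourier_dim_ifs_measure_le\<close>). The null set that carries the vertical
  marginal can be pulled back to any subspace that contains \<open>e\<^sub>4\<close>, so projections to such
  subspaces are not absolutely continuous (\<open>not_absolutely_continuous_proj_measure\<close>).

  The main point is that \<open>|fourier \<nu> (\<xi>, t)| \<le> K |\<xi>|\<^sup>-\<^sup>6\<close> for horizontal \<open>\<xi>\<close> with \<open>|\<xi>| \<ge> 1\<close>,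
  uniformly in \<open>t\<close>. By self-similarity the function \<open>F(\<xi>) = sup\<^sub>t |fourier \<nu> (\<xi>, t)|\<^sup>2\<close> is at most
  \<open>cos\<^sup>2(\<pi> \<xi>\<^sub>1)\<close> times the average of \<open>F(r O \<xi>)\<close> over the six rotations; the proof uses the
  slightly larger factor \<open>damp \<xi>\<^sub>1\<close>, whose logarithm is Lipschitz (\<open>mean_damped_ifs_measure\<close>). For
  \<open>|\<xi>| = R\<close> this is iterated \<open>n + L\<close> times, with \<open>n\<close> about \<open>6 ln R\<close> and \<open>L\<close> a small multiple of
  \<open>ln R\<close>. The first \<open>n\<close> steps randomise the direction of \<open>\<xi>\<close>: at scale \<open>1/R\<close> the random walk
  generated by the rotations is as well distributed as Haar measure, up to a small power of \<open>R\<close>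
  (\<open>walk_collision_bound\<close>). This is arithmetic: products of \<open>n\<close> rotations are integer quaternions
  of norm \<open>5\<^sup>n\<close>, and collisions of two walks are counted by integer quaternions of norm \<open>25\<^sup>n\<close>
  close to the real axis, that is, by representations of integers as sums of two squares. The last
  \<open>L\<close> steps then damp on average over all directions (\<open>net_damped_sum_le\<close>). Expanding the product
  of the damping factors into cosines gives a constant term \<open>(3/4)\<^sup>L\<close> and cosines whose
  frequencies \<open>v\<close> are combinations of \<open>r\<^sup>i O\<^sub>i e\<^sub>1\<close>. Since \<open>r = (q - 1)/q\<close> with \<open>q\<close> even, a parity
  argument keeps these frequencies away from \<open>0\<close> (\<open>odd_frequency_step\<close>), and cosines at nonzero
  frequencies average out over the sphere.

  Altogether the \<open>n + L\<close> steps gain a factor \<open>R\<^sup>-\<^sup>c\<close>, with \<open>c\<close> of order \<open>1/ln q\<close>, while the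
  frequency shrinks only from \<open>R\<close> to its power with exponent \<open>1 - 16/q\<close>
  (\<open>mean_damped_decay_step\<close>). For \<open>q\<close> as large as here the gain dominates the loss until \<open>F(\<xi>)\<close> is
  \<open>O(|\<xi>|\<^sup>-\<^sup>1\<^sup>2)\<close> (\<open>mean_damped_decay\<close>). The condition on \<open>q\<close> does not involve \<open>e\<close>, so \<open>r\<close> can be
  fixed first and \<open>e\<close> chosen afterwards.

  If \<open>e\<^sub>4\<close> is not in \<open>W\<close>, the horizontal part is bounded below on \<open>W\<close> by a multiple of the norm,
  hence the Fourier transform of the projected measure, which is the restriction of \<open>fourier \<nu>\<close> to
  \<open>W\<close>, decays like \<open>|\<xi>|\<^sup>-\<^sup>6\<close> in all directions. On a space of dimension at most three this is
  integrable and square integrable with all weights that are needed. A bounded density is obtained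
  by comparing the measure with its Gaussian smoothings (\<open>gaussian_smoothing_le\<close>,
  \<open>dominated_measure\<close>).\<close>

section \<open>Sums of two squares\<close>

lemma divisors_prime_power_times_le:
  fixes p a m :: nat
  assumes "prime p" "m > 0"
  shows "card {d. d dvd p ^ a * m} \<le> (a + 1) * card {d. d dvd m}"
proof -
  have "{d. d dvd p ^ a * m} \<subseteq> (\<lambda>(i, e). p ^ i * e) ` ({..a} \<times> {d. d dvd m})"
  proof
    fix d assume "d \<in> {d. d dvd p ^ a * m}"
    then obtain b c where bc: "d = b * c" "b dvd p ^ a" "c dvd m"
      using division_decomp by blast
    then obtain i where "i \<le> a" "b = p ^ i"
      using divides_primepow_nat[OF assms(1)] by blast
    with bc show "d \<in> (\<lambda>(i, e). p ^ i * e) ` ({..a} \<times> {d. d dvd m})"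
      by auto
  qed
  moreover have fin: "finite ({..a} \<times> {d. d dvd m})"
    using assms by simp
  ultimately have "card {d. d dvd p ^ a * m} \<le> card ({..a} \<times> {d. d dvd m})"
    by (meson card_image_le card_mono finite_imageI le_trans)
  then show ?thesis by (simp add: card_cartesian_product)
qed

text \<open>Splitting off a prime power \<open>p\<^sup>a\<close> multiplies the number of divisors by at most \<open>a + 1\<close>. For
  \<open>p > P\<close> this is at most \<open>2\<^sup>a\<close>, which is absorbed by the factor \<open>p powr (a * \<epsilon>)\<close>; each of the
  boundedly many small primes costs one factor \<open>1 + 2 / \<epsilon>\<close>.\<close>
lemma divisor_bound_small_primes:
  fixes \<epsilon> :: real and P m :: nat
  assumes eps: "\<epsilon> > 0" and P: "2 powr (1 / \<epsilon>) \<le> real P" and m: "m > 0"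
  shows "real (card {d. d dvd m})
    \<le> (1 + 2 / \<epsilon>) ^ card {p. prime p \<and> p dvd m \<and> p \<le> P} * real m powr \<epsilon>"
  using m
proof (induction m rule: less_induct)
  case (less m)
  define K where "K = 1 + 2 / \<epsilon>"
  have K1: "K \<ge> 1" using eps by (simp add: K_def)
  define S where "S m = {p. prime p \<and> p dvd m \<and> p \<le> P}" for m :: nat
  have finS: "finite (S m)" for m by (rule finite_subset[of _ "{..P}"]) (auto simp: S_def)
  show ?case
  proof (cases "m = 1")
    case True
    have "1 \<le> K ^ n" for n using K1 by simp
    with True show ?thesis by (simp add: K_def)
  next
    case False
    then obtain p where p: "prime p" "p dvd m" using prime_factor_nat by blast
    define a where "a = multiplicity p m"
    have "m \<noteq> 0" "\<not> is_unit p" using less.prems p by auto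
    then obtain m' where m': "m = p ^ a * m'" "\<not> p dvd m'"
      unfolding a_def by (metis multiplicity_decompose')
    have a1: "a \<ge> 1" using p(2) m' by (cases a) auto
    have p2: "p \<ge> 2" using p prime_ge_2_nat by blast
    have m'0: "m' > 0" using m' less.prems by (cases m') auto
    have lt: "m' < m"
    proof -
      have "1 < p ^ a" using p2 a1 by (intro one_less_power) auto
      then show ?thesis using m' m'0 by simp
    qed
    have IH: "real (card {d. d dvd m'}) \<le> K ^ card (S m') * real m' powr \<epsilon>"
      using less.IH[OF lt m'0] by (simp add: K_def S_def)
    have le: "real (card {d. d dvd m}) \<le> (real a + 1) * real (card {d. d dvd m'})"
      using divisors_prime_power_times_le[OF p(1) m'0, of a] unfolding m'(1)
      by (metis (mono_tags, lifting) of_nat_1 of_nat_add of_nat_le_iff of_nat_mult)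
    have mp: "real m powr \<epsilon> = (real p powr \<epsilon>) ^ a * real m' powr \<epsilon>"
      using p2 m'0 unfolding m'(1)
      by (simp add: powr_mult powr_realpow[symmetric] powr_powr mult.commute)
    have xp: "x = p" if "prime x" "x dvd p ^ a" for x
      using that p(1) prime_dvd_power primes_dvd_imp_eq by blast
    have main: "(real a + 1) * K ^ card (S m') \<le> K ^ card (S m) * (real p powr \<epsilon>) ^ a"
    proof (cases "p \<le> P")
      case True
      have "S m = insert p (S m')"
        using p True m' by (auto simp: S_def prime_dvd_mult_iff dest: xp)
      moreover have "p \<notin> S m'" using m' by (simp add: S_def)
      ultimately have c: "card (S m) = Suc (card (S m'))" using finS by simp
      have "(1 + \<epsilon> / 2) \<le> 2 powr \<epsilon>"
      proof -
        have "1 + \<epsilon> / 2 \<le> 1 + \<epsilon> * ln 2" using ln2_ge_two_thirds eps by simp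
        also have "\<dots> \<le> exp (\<epsilon> * ln 2)" by (rule exp_ge_add_one_self)
        finally show ?thesis by (simp add: powr_def)
      qed
      also have "\<dots> \<le> real p powr \<epsilon>" using p2 eps by (intro powr_mono2) auto
      finally have "(1 + \<epsilon> / 2) ^ a \<le> (real p powr \<epsilon>) ^ a"
        using eps by (intro power_mono) auto
      moreover have "1 + real a * (\<epsilon> / 2) \<le> (1 + \<epsilon> / 2) ^ a"
        using Bernoulli_inequality[of "\<epsilon> / 2" a] eps by simp
      ultimately have "1 + real a * (\<epsilon> / 2) \<le> (real p powr \<epsilon>) ^ a" by linarith
      then have "K * (1 + real a * (\<epsilon> / 2)) \<le> K * (real p powr \<epsilon>) ^ a"
        using K1 by (intro mult_left_mono) auto
      moreover have "real a + 1 \<le> K * (1 + real a * (\<epsilon> / 2))"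
        using eps by (simp add: K_def field_simps)
      ultimately have "real a + 1 \<le> K * (real p powr \<epsilon>) ^ a" by linarith
      then have "(real a + 1) * K ^ card (S m') \<le> (K * (real p powr \<epsilon>) ^ a) * K ^ card (S m')"
        using K1 by (intro mult_right_mono) auto
      then show ?thesis by (simp add: c mult_ac)
    next
      case False
      have Seq: "S m = S m'"
        using p False m' by (auto simp: S_def prime_dvd_mult_iff dest: xp)
      have "2 = (2 powr (1 / \<epsilon>)) powr \<epsilon>" using eps by (simp add: powr_powr)
      also have "\<dots> \<le> real p powr \<epsilon>" using P False eps by (intro powr_mono2) auto
      finally have "2 ^ a \<le> (real p powr \<epsilon>) ^ a" by (intro power_mono) auto
      moreover have "real a + 1 \<le> 2 ^ a"
        using Bernoulli_inequality[of "1::real" a] by (simp add: add.commute)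
      ultimately have "real a + 1 \<le> (real p powr \<epsilon>) ^ a" by linarith
      then show ?thesis unfolding Seq using K1 by (simp add: mult.commute mult_left_mono)
    qed
    have "real (card {d. d dvd m}) \<le> (real a + 1) * (K ^ card (S m') * real m' powr \<epsilon>)"
      by (rule order_trans[OF le mult_left_mono[OF IH]]) simp
    also have "\<dots> = ((real a + 1) * K ^ card (S m')) * real m' powr \<epsilon>" by simp
    also have "\<dots> \<le> (K ^ card (S m) * (real p powr \<epsilon>) ^ a) * real m' powr \<epsilon>"
      using main by (intro mult_right_mono) auto
    also have "\<dots> = K ^ card (S m) * real m powr \<epsilon>" by (simp add: mp)
    finally show ?thesis by (simp add: K_def S_def)
  qed
qed

lemma divisor_bound:
  fixes \<epsilon> :: real
  assumes "\<epsilon> > 0"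
  obtains C where "C > 0" "\<And>m::nat. m > 0 \<Longrightarrow> real (card {d. d dvd m}) \<le> C * real m powr \<epsilon>"
proof -
  define P where "P = nat \<lceil>2 powr (1 / \<epsilon>)\<rceil>"
  have P: "2 powr (1 / \<epsilon>) \<le> real P" unfolding P_def by (rule real_nat_ceiling_ge)
  have K1: "1 + 2 / \<epsilon> \<ge> 1" using assms by simp
  show ?thesis
  proof (rule that[of "(1 + 2 / \<epsilon>) ^ P"])
    show "0 < (1 + 2 / \<epsilon>) ^ P" using K1 by (intro zero_less_power) linarith
    fix m :: nat assume m: "m > 0"
    have "{p. prime p \<and> p dvd m \<and> p \<le> P} \<subseteq> {1..P}" using prime_ge_1_nat by auto
    then have "card {p. prime p \<and> p dvd m \<and> p \<le> P} \<le> P"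
      using card_mono[of "{1..P}"] by fastforce
    then have "(1 + 2 / \<epsilon>) ^ card {p. prime p \<and> p dvd m \<and> p \<le> P} \<le> (1 + 2 / \<epsilon>) ^ P"
      using K1 by (intro power_increasing)
    then show "real (card {d. d dvd m}) \<le> (1 + 2 / \<epsilon>) ^ P * real m powr \<epsilon>"
      using divisor_bound_small_primes[OF assms P m] by (meson mult_right_mono order_trans powr_ge_zero)
  qed
qed

definition two_squares :: "int \<Rightarrow> (int \<times> int) set" where
  "two_squares m = {(x, y). x\<^sup>2 + y\<^sup>2 = m}"

lemma two_squares_bounded:
  "two_squares m \<subseteq> {-m..m} \<times> {-m..m}"
proof -
  have "\<bar>z\<bar> \<le> z\<^sup>2" for z :: int
    using self_le_power[of "\<bar>z\<bar>" 2] by (cases "z = 0") auto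
  moreover have "0 \<le> z\<^sup>2" for z :: int by simp
  ultimately show ?thesis unfolding two_squares_def
    by (auto simp: abs_le_iff) (smt (verit))+
qed

lemma finite_two_squares [simp]: "finite (two_squares m)"
  by (rule finite_subset[OF two_squares_bounded]) simp

text \<open>Since \<open>m\<close> divides \<open>(x0 * y - x * y0) * (x0 * y + x * y0)\<close>, the gcd \<open>e\<close> of \<open>m\<close> with the first
  factor decides how \<open>m\<close> splits: \<open>e\<close> divides the first factor and \<open>m / e\<close> the second. For two
  solutions with the same \<open>e\<close> it follows that \<open>m\<close> divides twice their determinant. This leaves
  five values for the determinant, and the inner product is then known up to sign.\<close>
lemma card_same_gcd_le:
  fixes m x0 y0 e :: int
  assumes m: "m > 0" and x0: "x0\<^sup>2 + y0\<^sup>2 = m" "coprime x0 y0"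
  shows "card {(x, y). x\<^sup>2 + y\<^sup>2 = m \<and> coprime x y \<and> gcd m (x0 * y - x * y0) = e} \<le> 10"
    (is "card ?A \<le> 10")
proof (cases "?A = {}")
  case False
  then obtain x y where xy: "x\<^sup>2 + y\<^sup>2 = m" "coprime x y" "gcd m (x0 * y - x * y0) = e" by auto
  have cop: "coprime a m \<and> coprime b m" if "a\<^sup>2 + b\<^sup>2 = m" "coprime a b" for a b :: int
  proof -
    have "coprime c (d\<^sup>2 + c * c)" if "coprime c d" for c d :: int
    proof -
      have "gcd c (c * c + d\<^sup>2) = gcd c (d\<^sup>2)" by (rule gcd_add_mult)
      then show ?thesis using that by (simp add: coprime_iff_gcd_eq_1[symmetric] add.commute)
    qed
    then have "coprime a (b\<^sup>2 + a * a)" "coprime b (a\<^sup>2 + b * b)"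
      using that(2) by (simp_all add: coprime_commute)
    then show ?thesis using that(1) by (simp add: power2_eq_square add.commute)
  qed
  have e: "e dvd m" "e > 0" using xy(3) m by (auto simp: gcd_pos_int)
  define g where "g = m div e"
  have mg: "m = e * g" using e by (simp add: g_def)
  have key: "g dvd x0 * b + a * y0 \<and> e dvd x0 * b - a * y0"
    if ab: "a\<^sup>2 + b\<^sup>2 = m" "gcd m (x0 * b - a * y0) = e" for a b
  proof -
    have "(x0 * b - a * y0) * (x0 * b + a * y0) = x0\<^sup>2 * b\<^sup>2 - a\<^sup>2 * y0\<^sup>2"
      by (simp add: algebra_simps power2_eq_square)
    also have "\<dots> = m * (b\<^sup>2 - y0\<^sup>2)"
      proof -
      have h: "x0\<^sup>2 = m - y0\<^sup>2" "a\<^sup>2 = m - b\<^sup>2" using ab(1) x0(1) by auto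
      show ?thesis unfolding h by (simp add: algebra_simps)
    qed
    finally have d: "m dvd (x0 * b - a * y0) * (x0 * b + a * y0)" by simp
    obtain t where t: "x0 * b - a * y0 = e * t" using ab(2) by (metis dvd_def gcd_dvd2)
    have "coprime g t"
    proof -
      have "gcd (e * g) (e * t) = e" using ab(2) t mg by simp
      then have "e * gcd g t = e" using e gcd_mult_left[of e g t] by simp
      then have "gcd g t = 1" using e by simp
      then show ?thesis by (simp add: coprime_iff_gcd_eq_1)
    qed
    moreover have "e * g dvd e * (t * (x0 * b + a * y0))" using d t mg by (simp add: mult.assoc)
    then have "g dvd t * (x0 * b + a * y0)" using e by simp
    ultimately have "g dvd x0 * b + a * y0" by (simp add: coprime_dvd_mult_right_iff)
    then show ?thesis using t by simp
  qed
  have c0: "coprime x0 m" "coprime y0 m" using cop x0 by auto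
  have cxy: "coprime x m" "coprime y m" using cop xy by auto
  have g2: "gcd e g dvd 2"
  proof -
    have "gcd e g dvd (x0 * y - x * y0) + (x0 * y + x * y0)"
      using key[OF xy(1,3)] by (meson dvd_add dvd_trans gcd_dvd1 gcd_dvd2)
    then have "gcd e g dvd 2 * (x0 * y)" by simp
    moreover have "coprime (x0 * y) m" using c0 cxy by simp
    then have "coprime (gcd e g) (x0 * y)"
      by (metis coprime_commute coprime_divisors dvd_refl dvd_triv_left gcd_dvd1 dvd_trans mg)
    ultimately show ?thesis by (metis coprime_dvd_mult_left_iff)
  qed
  \<comment> \<open>\<open>E + \<i> D\<close> is the product of \<open>x + \<i> y\<close> and the conjugate of \<open>a + \<i> b\<close>, so it determines \<open>(a,
    b)\<close>.\<close>
  define D where "D = (\<lambda>(a::int, b::int). a * y - x * b)"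
  define E where "E = (\<lambda>(a::int, b::int). x * a + y * b)"
  define F where "F p = (2 * D p div m, E p \<ge> 0)" for p
  have DE: "m dvd 2 * D p \<and> \<bar>D p\<bar> \<le> m \<and> (E p)\<^sup>2 + (D p)\<^sup>2 = m\<^sup>2 \<and>
      m * fst p = x * E p + y * D p \<and> m * snd p = y * E p - x * D p" if p: "p \<in> ?A" for p
  proof -
    obtain a b where ab: "p = (a, b)" by (cases p)
    have h: "a\<^sup>2 + b\<^sup>2 = m" "coprime a b" "gcd m (x0 * b - a * y0) = e" using p ab by auto
    have Dp: "D p = a * y - x * b" "E p = x * a + y * b" by (auto simp: D_def E_def ab)
    have "e dvd y0 * (a * y - x * b)"
    proof -
      have "e dvd b * (x0 * y - x * y0) - y * (x0 * b - a * y0)"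
        using key[OF xy(1,3)] key[OF h(1,3)] by (simp add: dvd_diff)
      also have "b * (x0 * y - x * y0) - y * (x0 * b - a * y0) = y0 * (a * y - x * b)"
        by (simp add: algebra_simps)
      finally show ?thesis .
    qed
    moreover have "coprime e y0" "coprime g y0"
      using c0 mg by (auto simp: coprime_commute)
    moreover have "g dvd y0 * (a * y - x * b)"
    proof -
      have "g dvd y * (x0 * b + a * y0) - b * (x0 * y + x * y0)"
        using key[OF xy(1,3)] key[OF h(1,3)] by (simp add: dvd_diff)
      also have "y * (x0 * b + a * y0) - b * (x0 * y + x * y0) = y0 * (a * y - x * b)"
        by (simp add: algebra_simps)
      finally show ?thesis .
    qed
    ultimately have "e dvd D p" "g dvd D p" by (auto simp: Dp coprime_dvd_mult_right_iff)
    then have "lcm e g dvd D p" by simp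
    moreover have "m dvd 2 * lcm e g"
    proof -
      have "m = gcd e g * lcm e g" 
        using prod_gcd_lcm_int[of e g] mg m by (simp add: abs_mult[symmetric])
      then show ?thesis using g2 by (metis dvd_refl mult_dvd_mono)
    qed
    ultimately have "m dvd 2 * D p" by (meson dvd_refl dvd_trans mult_dvd_mono)
    moreover have sq: "(E p)\<^sup>2 + (D p)\<^sup>2 = m\<^sup>2"
    proof -
      have "(E p)\<^sup>2 + (D p)\<^sup>2 = (x\<^sup>2 + y\<^sup>2) * (a\<^sup>2 + b\<^sup>2)"
        by (simp add: Dp power2_eq_square algebra_simps)
      also have "\<dots> = m * m" by (simp only: xy(1) h(1))
      finally show ?thesis by (simp add: power2_eq_square)
    qed
    moreover have "\<bar>D p\<bar> \<le> m"
    proof -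
      have "(D p)\<^sup>2 \<le> m\<^sup>2" using sq zero_le_power2[of "E p"] by linarith
      then show ?thesis using m by (simp flip: abs_le_square_iff)
    qed
    moreover have "m * a = x * E p + y * D p" "m * b = y * E p - x * D p"
      by (auto simp: Dp algebra_simps power2_eq_square simp flip: xy(1))
    ultimately show ?thesis by (simp add: ab)
  qed
  have "inj_on F ?A"
  proof (rule inj_onI)
    fix p p' assume pp: "p \<in> ?A" "p' \<in> ?A" "F p = F p'"
    have "2 * D p div m = 2 * D p' div m" using pp(3) by (simp add: F_def)
    moreover have "m dvd 2 * D p" "m dvd 2 * D p'" using DE[OF pp(1)] DE[OF pp(2)] by blast+
    ultimately have "2 * D p = 2 * D p'" by (simp add: dvd_div_eq_iff)
    then have DD: "D p = D p'" by simp
    have "(E p)\<^sup>2 + (D p)\<^sup>2 = m\<^sup>2" "(E p')\<^sup>2 + (D p')\<^sup>2 = m\<^sup>2" using DE[OF pp(1)] DE[OF pp(2)] by blast+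
    then have "(E p)\<^sup>2 = (E p')\<^sup>2" using DD by simp
    then have "E p = E p' \<or> E p = - E p'" by (simp add: power2_eq_iff)
    moreover have "(E p \<ge> 0) = (E p' \<ge> 0)" using pp(3) by (simp add: F_def)
    ultimately have EE: "E p = E p'" by linarith
    have "m * fst p = m * fst p'" "m * snd p = m * snd p'"
      using DE[OF pp(1)] DE[OF pp(2)] DD EE by auto
    then show "p = p'" using m by (simp add: prod_eq_iff)
  qed
  moreover have "F ` ?A \<subseteq> {-2..2} \<times> UNIV"
  proof
    fix u assume "u \<in> F ` ?A"
    then obtain p where p: "p \<in> ?A" "u = F p" by auto
    obtain k where k: "2 * D p = m * k" using DE[OF p(1)] by (auto elim: dvdE)
    have "\<bar>m * k\<bar> \<le> 2 * m" using DE[OF p(1)] k by linarith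
    then have "\<bar>k\<bar> \<le> 2" using m by (simp add: abs_mult)
    then show "u \<in> {-2..2} \<times> UNIV" using k m by (auto simp: p F_def abs_le_iff)
  qed
  ultimately have "card ?A \<le> card ({-2..2::int} \<times> (UNIV :: bool set))"
    by (intro card_inj_on_le) auto
  then show ?thesis by (simp add: card_cartesian_product)
next
  case True
  then show ?thesis by (simp only: card.empty)
qed

text \<open>The coprime solutions are classified by the gcd of \<open>m\<close> and their determinant with a fixed
  one.\<close>
lemma card_coprime_two_squares_le:
  fixes m :: int
  assumes m: "m > 0"
  shows "card {(x, y). x\<^sup>2 + y\<^sup>2 = m \<and> coprime x y} \<le> 10 * card {d. d dvd nat m}"
    (is "card ?A \<le> _")
proof (cases "?A = {}")
  case False
  then obtain x0 y0 where x0: "x0\<^sup>2 + y0\<^sup>2 = m" "coprime x0 y0" by auto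
  define D where "D = {d. d dvd nat m}"
  have finD: "finite D" using m by (simp add: D_def)
  define B where "B d = {(x, y). x\<^sup>2 + y\<^sup>2 = m \<and> coprime x y \<and> gcd m (x0 * y - x * y0) = int d}" for d
  have "?A \<subseteq> (\<Union>d\<in>D. B d)"
  proof
    fix p assume "p \<in> ?A"
    then obtain x y where p: "p = (x, y)" "x\<^sup>2 + y\<^sup>2 = m" "coprime x y" by auto
    let ?g = "gcd m (x0 * y - x * y0)"
    have "nat ?g dvd nat m" using m by (simp add: nat_dvd_iff)
    then have "nat ?g \<in> D" by (simp add: D_def)
    moreover have "p \<in> B (nat ?g)" using p by (simp add: B_def)
    ultimately show "p \<in> (\<Union>d\<in>D. B d)" by blast
  qed
  moreover have "finite (B d)" for d
    by (rule finite_subset[OF _ finite_two_squares[of m]]) (auto simp: B_def two_squares_def)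
  ultimately have "card ?A \<le> card (\<Union>d\<in>D. B d)" using finD by (intro card_mono) auto
  also have "\<dots> \<le> (\<Sum>d\<in>D. card (B d))" by (rule card_UN_le[OF finD])
  also have "\<dots> \<le> (\<Sum>d\<in>D. 10)"
    unfolding B_def by (intro sum_mono card_same_gcd_le[OF m x0])
  finally show ?thesis by (simp add: D_def)
next
  case True
  then show ?thesis by (simp only: card.empty)
qed

text \<open>Dividing a solution by the gcd \<open>g\<close> of its coordinates makes it coprime, and \<open>g\<close> divides
  \<open>m\<close>.\<close>
lemma card_two_squares_le:
  fixes m :: int
  assumes m: "m > 0"
  shows "card (two_squares m) \<le> 10 * (card {d. d dvd nat m})\<^sup>2"
proof -
  define D where "D = {d. d dvd nat m}"
  have finD: "finite D" using m by (simp add: D_def)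
  define B where "B k = {(x, y). x\<^sup>2 + y\<^sup>2 = (k::int) \<and> coprime x y}" for k
  define h where "h g = (\<lambda>(x, y). (int g * x, int g * y)) ` B (m div (int g)\<^sup>2)" for g
  have finB: "finite (B k)" for k
    by (rule finite_subset[OF _ finite_two_squares[of k]]) (auto simp: B_def two_squares_def)
  define D' where "D' = {g \<in> D. (int g)\<^sup>2 dvd m}"
  have finD': "finite D'" using finD by (simp add: D'_def)
  have "two_squares m \<subseteq> (\<Union>g\<in>D'. h g)"
  proof
    fix p assume "p \<in> two_squares m"
    then obtain x y where p: "p = (x, y)" "x\<^sup>2 + y\<^sup>2 = m" by (auto simp: two_squares_def)
    let ?g = "gcd x y"
    have g0: "?g \<noteq> 0" using p m by auto
    obtain x' y' where xy: "x = ?g * x'" "y = ?g * y'" "coprime x' y'"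
      using gcd_coprime_exists[OF g0] by (metis mult.commute)
    have m': "m = ?g\<^sup>2 * (x'\<^sup>2 + y'\<^sup>2)" using p xy(1,2)
      by (metis distrib_left power_mult_distrib)
    have "nat ?g \<in> D'"
    proof -
      have "?g dvd m" by (subst m') (simp add: power2_eq_square)
      then have "nat ?g dvd nat m" using m by (simp add: nat_dvd_iff)
      moreover have "?g\<^sup>2 dvd m" by (subst m') simp
      ultimately show ?thesis by (simp add: D'_def D_def)
    qed
    moreover have "m div (int (nat ?g))\<^sup>2 = x'\<^sup>2 + y'\<^sup>2" using g0 by (subst m') simp
    then have "p \<in> h (nat ?g)" unfolding h_def B_def using xy p(1) by (auto intro!: image_eqI[of _ _ "(x', y')"])
    ultimately show "p \<in> (\<Union>g\<in>D'. h g)" by blast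
  qed
  then have "card (two_squares m) \<le> card (\<Union>g\<in>D'. h g)"
    using finD' finB by (intro card_mono) (auto simp: h_def)
  also have "\<dots> \<le> (\<Sum>g\<in>D'. card (h g))" by (rule card_UN_le[OF finD'])
  also have "\<dots> \<le> (\<Sum>g\<in>D'. 10 * card D)"
  proof (rule sum_mono)
    fix g assume g: "g \<in> D'"
    let ?k = "m div (int g)\<^sup>2"
    have k: "m = (int g)\<^sup>2 * ?k" using g by (simp add: D'_def)
    then have "0 < (int g)\<^sup>2 * ?k" using m by linarith
    then have k0: "?k > 0" by (simp add: zero_less_mult_iff)
    have "?k dvd m" using k by (metis dvd_triv_right)
    then have kd: "nat ?k dvd nat m" using m k0 by (simp add: nat_dvd_iff)
    have "card (h g) \<le> card (B ?k)" unfolding h_def by (rule card_image_le[OF finB])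
    also have "\<dots> \<le> 10 * card {d. d dvd nat ?k}" unfolding B_def by (rule card_coprime_two_squares_le[OF k0])
    also have "card {d. d dvd nat ?k} \<le> card D"
      using kd finD by (intro card_mono) (auto simp: D_def intro: dvd_trans)
    finally show "card (h g) \<le> 10 * card D" by simp
  qed
  also have "\<dots> = card D' * (10 * card D)" by simp
  also have "\<dots> \<le> card D * (10 * card D)"
    using finD by (intro mult_right_mono card_mono) (auto simp: D'_def)
  finally show ?thesis by (simp add: D_def power2_eq_square)
qed

lemma two_squares_bound:
  fixes \<epsilon> :: real
  assumes "\<epsilon> > 0"
  obtains C where "C > 0" "\<And>m::int. m > 0 \<Longrightarrow> real (card (two_squares m)) \<le> C * real_of_int m powr \<epsilon>"
proof -
  obtain C where C: "C > 0" "\<And>m::nat. m > 0 \<Longrightarrow> real (card {d. d dvd m}) \<le> C * real m powr (\<epsilon> / 2)"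
    using divisor_bound[of "\<epsilon> / 2"] assms by auto
  show ?thesis
  proof (rule that[of "10 * C\<^sup>2"])
    fix m :: int assume m: "m > 0"
    have "real (card (two_squares m)) \<le> real (10 * (card {d. d dvd nat m})\<^sup>2)"
      using card_two_squares_le[OF m] by (rule of_nat_mono)
    also have "\<dots> = 10 * (real (card {d. d dvd nat m}))\<^sup>2" by simp
    also have "\<dots> \<le> 10 * (C * real (nat m) powr (\<epsilon> / 2))\<^sup>2"
      using C(2)[of "nat m"] m by (intro mult_left_mono power_mono) auto
    also have "\<dots> = 10 * C\<^sup>2 * real_of_int m powr \<epsilon>"
      using m by (simp add: power_mult_distrib power2_eq_square powr_add[symmetric])
    finally show "real (card (two_squares m)) \<le> 10 * C\<^sup>2 * real_of_int m powr \<epsilon>" .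
  qed (use C in simp)
qed

section \<open>The random walk on integer quaternions\<close>

text \<open>Integer quaternions are kept apart from the real ones: as tuples of integers they turn the
  algebraic laws into polynomial identities in the coordinates, and divisibility by an integer is
  a condition on each coordinate.\<close>
type_synonym iquat = "int \<times> int \<times> int \<times> int"

fun imul :: "iquat \<Rightarrow> iquat \<Rightarrow> iquat" where
  "imul (a, b, c, d) (a', b', c', d') =
     (a * a' - b * b' - c * c' - d * d', a * b' + b * a' + c * d' - d * c',
      a * c' + c * a' + d * b' - b * d', a * d' + d * a' + b * c' - c * b')"

fun iconj :: "iquat \<Rightarrow> iquat" where
  "iconj (a, b, c, d) = (a, - b, - c, - d)"

fun inorm :: "iquat \<Rightarrow> int" where
  "inorm (a, b, c, d) = a\<^sup>2 + b\<^sup>2 + c\<^sup>2 + d\<^sup>2"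

fun idiff :: "iquat \<Rightarrow> iquat \<Rightarrow> iquat" where
  "idiff (a, b, c, d) (a', b', c', d') = (a - a', b - b', c - c', d - d')"

fun iscale :: "int \<Rightarrow> iquat \<Rightarrow> iquat" where
  "iscale k (a, b, c, d) = (k * a, k * b, k * c, k * d)"

fun idvd :: "int \<Rightarrow> iquat \<Rightarrow> bool" where
  "idvd k (a, b, c, d) \<longleftrightarrow> k dvd a \<and> k dvd b \<and> k dvd c \<and> k dvd d"

definition ione :: iquat where "ione = (1, 0, 0, 0)"

lemma imul_ione [simp]: "imul ione A = A" "imul A ione = A"
  by (cases A, simp add: ione_def)+

lemma imul_assoc: "imul (imul A B) C = imul A (imul B C)"
  by (cases A; cases B; cases C) (simp add: algebra_simps)

lemma iconj_imul: "iconj (imul A B) = imul (iconj B) (iconj A)"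
  by (cases A; cases B) (simp add: algebra_simps)

lemma iconj_iconj [simp]: "iconj (iconj A) = A"
  by (cases A) simp

lemma inorm_iconj [simp]: "inorm (iconj A) = inorm A"
  by (cases A) simp

lemma inorm_imul: "inorm (imul A B) = inorm A * inorm B"
  by (cases A; cases B) (simp add: algebra_simps power2_eq_square)

lemma inorm_iscale: "inorm (iscale k A) = k\<^sup>2 * inorm A"
  by (cases A) (simp add: algebra_simps power2_eq_square)

lemma imul_iconj_imul: "imul (iconj A) (imul A B) = iscale (inorm A) B"
  by (cases A; cases B) (simp add: algebra_simps power2_eq_square)

lemma iscale_inject: "k \<noteq> 0 \<Longrightarrow> iscale k A = iscale k B \<longleftrightarrow> A = B"
  by (cases A; cases B) simp

lemma imul_iscale: "imul A (iscale k B) = iscale k (imul A B)"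
  by (cases A; cases B) (simp add: algebra_simps)

lemma idvd_imul: "idvd k B \<Longrightarrow> idvd k (imul A B)"
  by (cases A; cases B) (auto intro!: dvd_diff dvd_add)

lemma idvd_iff_iscale: "idvd k A \<longleftrightarrow> (\<exists>B. A = iscale k B)"
  by (cases A) (auto simp: dvd_def; metis)

lemma idvd_iscale: "k \<noteq> 0 \<Longrightarrow> idvd (k * j) (iscale k A) \<longleftrightarrow> idvd j A"
  by (cases A) auto

lemma idvd_iscale_coprime: "coprime k j \<Longrightarrow> idvd k (iscale j A) \<Longrightarrow> idvd k A"
  by (cases A) (auto simp: coprime_dvd_mult_right_iff)

lemma idvd_idiff_imul: "idvd k (imul A C) \<Longrightarrow> idvd k (imul B C) \<Longrightarrow> idvd k (imul (idiff A B) C)"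
proof -
  assume "idvd k (imul A C)" "idvd k (imul B C)"
  moreover have "imul (idiff A B) C = idiff (imul A C) (imul B C)"
    by (cases A; cases B; cases C) (simp add: algebra_simps)
  moreover have "idvd k D \<Longrightarrow> idvd k E \<Longrightarrow> idvd k (idiff D E)" for D E
    by (cases D; cases E) (auto intro: dvd_diff)
  ultimately show ?thesis by simp
qed

lemma inorm_idiff: "inorm (idiff A B) = inorm A + inorm B - 2 * fst (imul (iconj A) B)"
  by (cases A; cases B) (simp add: algebra_simps power2_eq_square)

text \<open>Normalised to length one, these are the elements of \<^term>\<open>Omega 5\<close>.\<close>
definition gens :: "iquat set" where
  "gens = {(1, 2, 0, 0), (1, -2, 0, 0), (1, 0, 2, 0), (1, 0, -2, 0), (1, 0, 0, 2), (1, 0, 0, -2)}"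

lemma finite_gens [simp]: "finite gens" and card_gens [simp]: "card gens = 6"
  by (simp_all add: gens_def)

lemma inorm_gens: "\<alpha> \<in> gens \<Longrightarrow> inorm \<alpha> = 5"
  by (auto simp: gens_def)

lemma iconj_gens: "iconj ` gens = gens"
  by (auto simp: gens_def)

text \<open>What matters is that these norms are prime to 5.\<close>
lemma inorm_idiff_gens:
  "\<alpha> \<in> gens \<Longrightarrow> \<beta> \<in> gens \<Longrightarrow> \<alpha> \<noteq> \<beta> \<Longrightarrow> inorm (idiff (iconj \<alpha>) (iconj \<beta>)) \<in> {8, 16}"
  by (auto simp: gens_def)

text \<open>The expectation of \<open>g\<close> at a product of \<open>n\<close> independent, uniformly distributed generators.\<close>
primrec walk_mean :: "nat \<Rightarrow> (iquat \<Rightarrow> real) \<Rightarrow> real" where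
  "walk_mean 0 g = g ione"
| "walk_mean (Suc n) g = (\<Sum>\<alpha>\<in>gens. walk_mean n (\<lambda>B. g (imul \<alpha> B))) / 6"

lemma walk_mean_mono:
  "(\<And>B. inorm B = 5 ^ n \<Longrightarrow> g B \<le> h B) \<Longrightarrow> walk_mean n g \<le> walk_mean n h"
proof (induction n arbitrary: g h)
  case 0
  then show ?case by (simp add: ione_def)
next
  case (Suc n)
  show ?case unfolding walk_mean.simps
    by (intro divide_right_mono sum_mono Suc.IH Suc.prems) (simp_all add: inorm_imul inorm_gens)
qed

lemma walk_mean_cong:
  "(\<And>B. inorm B = 5 ^ n \<Longrightarrow> g B = h B) \<Longrightarrow> walk_mean n g = walk_mean n h"
  by (intro antisym walk_mean_mono) auto

lemma walk_mean_const [simp]: "walk_mean n (\<lambda>_. c) = c"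
  by (induction n) auto

lemma walk_mean_nonneg: "(\<And>B. inorm B = 5 ^ n \<Longrightarrow> 0 \<le> g B) \<Longrightarrow> 0 \<le> walk_mean n g"
  using walk_mean_mono[of n "\<lambda>_. 0" g] by simp

lemma walk_mean_mult_left: "walk_mean n (\<lambda>B. c * g B) = c * walk_mean n g"
  by (induction n arbitrary: g) (auto simp: sum_distrib_left)

lemma walk_mean_mult_right: "walk_mean n (\<lambda>B. g B * c) = walk_mean n g * c"
  using walk_mean_mult_left[of n c g] by (simp add: mult.commute)

lemma walk_mean_sum: "walk_mean n (\<lambda>B. \<Sum>i\<in>I. g i B) = (\<Sum>i\<in>I. walk_mean n (g i))"
proof (induction n arbitrary: g)
  case (Suc n)
  have "walk_mean (Suc n) (\<lambda>B. \<Sum>i\<in>I. g i B) = (\<Sum>\<alpha>\<in>gens. \<Sum>i\<in>I. walk_mean n (\<lambda>B. g i (imul \<alpha> B))) / 6"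
    by (simp add: Suc.IH)
  then show ?case by (subst (asm) sum.swap) (simp add: sum_divide_distrib)
qed auto

lemma walk_mean_add:
  "walk_mean (m + n) g = walk_mean m (\<lambda>A. walk_mean n (\<lambda>B. g (imul A B)))"
  by (induction m arbitrary: g) (simp_all add: imul_assoc)

lemma walk_mean_Suc_right:
  "walk_mean (Suc n) g = (\<Sum>\<alpha>\<in>gens. walk_mean n (\<lambda>B. g (imul B \<alpha>))) / 6"
proof -
  have "walk_mean (Suc n) g = walk_mean n (\<lambda>A. walk_mean 1 (\<lambda>B. g (imul A B)))"
    using walk_mean_add[of n 1 g] by (simp only: Suc_eq_plus1)
  also have "\<dots> = walk_mean n (\<lambda>A. (\<Sum>\<alpha>\<in>gens. g (imul A \<alpha>)) * (1 / 6))"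
    by simp
  also have "\<dots> = (\<Sum>\<alpha>\<in>gens. walk_mean n (\<lambda>B. g (imul B \<alpha>))) * (1 / 6)"
    by (simp only: walk_mean_mult_right walk_mean_sum)
  finally show ?thesis by simp
qed

lemma walk_mean_iconj: "walk_mean n (\<lambda>B. g (iconj B)) = walk_mean n g"
proof (induction n arbitrary: g)
  case 0
  then show ?case by (simp add: ione_def)
next
  case (Suc n)
  have inj: "inj_on iconj gens" by (rule inj_on_inverseI[of _ iconj]) simp
  have "walk_mean (Suc n) (\<lambda>B. g (iconj B)) = (\<Sum>\<alpha>\<in>gens. walk_mean n (\<lambda>B. g (imul B (iconj \<alpha>)))) / 6"
    by (simp add: iconj_imul Suc.IH[of "\<lambda>B. g (imul B _)"])
  also have "\<dots> = (\<Sum>\<alpha>\<in>gens. walk_mean n (\<lambda>B. g (imul B \<alpha>))) / 6"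
    using sum.reindex[OF inj, of "\<lambda>\<alpha>. walk_mean n (\<lambda>B. g (imul B \<alpha>))"] by (simp add: iconj_gens o_def)
  also have "\<dots> = walk_mean (Suc n) g" by (rule walk_mean_Suc_right[symmetric])
  finally show ?case .
qed

definition walk_prob :: "nat \<Rightarrow> iquat \<Rightarrow> real" where
  "walk_prob n A = walk_mean n (\<lambda>B. if B = A then 1 else 0)"

lemma walk_prob_Suc:
  "walk_prob (Suc n) A = (\<Sum>\<alpha>\<in>gens. walk_mean n (\<lambda>B. if imul \<alpha> B = A then 1 else 0)) / 6"
  by (simp add: walk_prob_def)

lemma imul_gen_eq_iff: "\<alpha> \<in> gens \<Longrightarrow> imul \<alpha> B = A \<longleftrightarrow> iscale 5 B = imul (iconj \<alpha>) A"
proof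
  assume "\<alpha> \<in> gens" "imul \<alpha> B = A"
  then show "iscale 5 B = imul (iconj \<alpha>) A" by (auto simp: imul_iconj_imul inorm_gens)
next
  assume a: "\<alpha> \<in> gens" "iscale 5 B = imul (iconj \<alpha>) A"
  have "iscale 5 (imul \<alpha> B) = imul \<alpha> (imul (iconj \<alpha>) A)" by (simp add: a(2)[symmetric] imul_iscale)
  also have "\<dots> = iscale 5 A" using imul_iconj_imul[of "iconj \<alpha>" A] a(1) by (simp add: inorm_gens)
  finally show "imul \<alpha> B = A" by (simp add: iscale_inject)
qed

text \<open>If two generators worked, their difference \<open>D\<close> would too, and multiplication with the
  conjugate of \<open>D\<close> would show that \<open>5\<^sup>k\<close> divides \<open>A\<close> times the norm of \<open>D\<close>, which is a power of
  two.\<close>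
lemma at_most_one_descent:
  assumes "\<not> idvd (5 ^ k) A"
  shows "card {\<alpha>\<in>gens. idvd (5 ^ k) (imul (iconj \<alpha>) A)} \<le> 1"
proof (rule card_le_Suc0_iff_eq[THEN iffD2, unfolded One_nat_def[symmetric]])
  show "\<forall>a\<in>{\<alpha>\<in>gens. idvd (5 ^ k) (imul (iconj \<alpha>) A)}. \<forall>b\<in>{\<alpha>\<in>gens. idvd (5 ^ k) (imul (iconj \<alpha>) A)}. a = b"
  proof (intro ballI, rule ccontr)
    fix \<alpha> \<beta> assume *: "\<alpha> \<in> {\<alpha>\<in>gens. idvd (5 ^ k) (imul (iconj \<alpha>) A)}"
      "\<beta> \<in> {\<alpha>\<in>gens. idvd (5 ^ k) (imul (iconj \<alpha>) A)}" "\<alpha> \<noteq> \<beta>"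
    let ?D = "idiff (iconj \<alpha>) (iconj \<beta>)"
    have "idvd (5 ^ k) (imul ?D A)" using * by (auto intro: idvd_idiff_imul)
    then have "idvd (5 ^ k) (iscale (inorm ?D) A)"
      by (metis idvd_imul imul_iconj_imul)
    moreover have "inorm ?D = 2 ^ 3 \<or> inorm ?D = 2 ^ 4" using inorm_idiff_gens[of \<alpha> \<beta>] * by auto
    then have "coprime (5 ^ k) (inorm ?D)"
    proof -
      have "coprime (5::int) 2" by simp
      then have "coprime ((5::int) ^ k) (2 ^ j)" for j by simp
      then show ?thesis using \<open>inorm ?D = 2 ^ 3 \<or> inorm ?D = 2 ^ 4\<close> by metis
    qed
    ultimately show False using assms idvd_iscale_coprime by blast
  qed
qed simp

text \<open>A first step \<open>\<alpha>\<close> with \<open>A = \<alpha> * B\<close> forces \<open>5 * B = iconj \<alpha> * A\<close>. By \<open>at_most_one_descent\<close> at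
  most one generator leads to a \<open>B\<close> with the same \<open>s\<close>; all others lead to a \<open>B\<close> with \<open>s - 1\<close> in
  place of \<open>s\<close>, or to none at all if \<open>s = 0\<close>. Hence bounds \<open>b\<^sub>s(n)\<close> are inherited if \<open>6 b\<^sub>s(n + 1)
  = b\<^sub>s(n) + 5 b\<^sub>s\<^sub>-\<^sub>1(n)\<close>, and both \<open>25\<^sup>s / 5\<^sup>n\<close> and \<open>5\<^sup>s / 3\<^sup>n\<close> satisfy this recursion. For \<open>s =
  0\<close> the first bound is, up to a constant, the uniform distribution; the second one is better once
  \<open>5\<^sup>s\<close> exceeds \<open>(5/3)\<^sup>n\<close>, where backtracking dominates.\<close>
lemma walk_prob_le:
  assumes "\<not> idvd (5 ^ Suc s) A"
  shows "walk_prob n A \<le> 25 ^ s / 5 ^ n \<and> walk_prob n A \<le> 5 ^ s / 3 ^ n"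
  using assms
proof (induction n arbitrary: s A)
  case 0
  have "walk_prob 0 A \<le> 1" by (simp add: walk_prob_def)
  moreover have "(1::real) \<le> 25 ^ s" "(1::real) \<le> 5 ^ s" by simp_all
  ultimately have "walk_prob 0 A \<le> 25 ^ s" "walk_prob 0 A \<le> 5 ^ s" by linarith+
  then show ?case by simp
next
  case (Suc n)
  define c where "c \<alpha> = walk_mean n (\<lambda>B. if imul \<alpha> B = A then 1 else 0)" for \<alpha>
  define Z where "Z = {\<alpha>\<in>gens. idvd (5 ^ Suc s) (imul (iconj \<alpha>) A)}"
  have Zs: "Z \<subseteq> gens" and finZ: "finite Z" by (auto simp: Z_def)
  have cZ: "card Z \<le> 1" unfolding Z_def by (rule at_most_one_descent[OF Suc.prems])
  have c0: "c \<alpha> = 0" if "\<alpha> \<in> gens" "\<not> idvd 5 (imul (iconj \<alpha>) A)" for \<alpha>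
  proof -
    have "imul \<alpha> B \<noteq> A" for B using that imul_gen_eq_iff[of \<alpha> B A] idvd_iff_iscale by metis
    then show ?thesis by (simp add: c_def)
  qed
  have cB: "\<exists>B. c \<alpha> = walk_prob n B \<and> iscale 5 B = imul (iconj \<alpha>) A \<and> imul \<alpha> B = A"
    if \<alpha>: "\<alpha> \<in> gens" "idvd 5 (imul (iconj \<alpha>) A)" for \<alpha>
  proof -
    obtain B where B: "iscale 5 B = imul (iconj \<alpha>) A" using \<alpha>(2) idvd_iff_iscale by metis
    have "imul \<alpha> B' = A \<longleftrightarrow> B' = B" for B'
      unfolding imul_gen_eq_iff[OF \<alpha>(1)] B[symmetric] by (rule iscale_inject) simp
    then have "c \<alpha> = walk_prob n B" by (simp add: c_def walk_prob_def)
    moreover have "imul \<alpha> B = A" using imul_gen_eq_iff[OF \<alpha>(1)] B by blast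
    ultimately show ?thesis using B by blast
  qed
  have in_Z: "c \<alpha> \<le> 25 ^ s / 5 ^ n \<and> c \<alpha> \<le> 5 ^ s / 3 ^ n" if ag: "\<alpha> \<in> gens" for \<alpha>
  proof (cases "idvd 5 (imul (iconj \<alpha>) A)")
    case True
    obtain B where B: "c \<alpha> = walk_prob n B" "imul \<alpha> B = A" using cB[OF ag True] by blast
    have "\<not> idvd (5 ^ Suc s) B" using Suc.prems B(2) idvd_imul by blast
    then show ?thesis using Suc.IH B(1) by simp
  qed (simp add: c0[OF ag])
  have out_Z: "c \<alpha> \<le> 25 ^ s / 5 ^ n / 25 \<and> c \<alpha> \<le> 5 ^ s / 3 ^ n / 5" if ag: "\<alpha> \<in> gens - Z" for \<alpha>
  proof (cases "idvd 5 (imul (iconj \<alpha>) A)")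
    case True
    obtain B where B: "c \<alpha> = walk_prob n B" "iscale 5 B = imul (iconj \<alpha>) A"
      using cB[OF _ True] ag by blast
    have nd: "\<not> idvd (5 ^ Suc s) (iscale 5 B)" using ag by (simp add: Z_def B(2))
    show ?thesis
    proof (cases s)
      case 0
      then show ?thesis using nd True B(2) by simp
    next
      case (Suc s')
      have "\<not> idvd (5 ^ Suc s') B" using nd idvd_iscale[of 5 "5 ^ Suc s'" B] Suc by simp
      then show ?thesis using Suc.IH[of s' B] B(1) Suc by simp
    qed
  qed (use ag in \<open>simp add: c0\<close>)
  have sum: "(\<Sum>\<alpha>\<in>gens. c \<alpha>) \<le> b + 5 * b'"
    if b: "\<And>\<alpha>. \<alpha> \<in> gens \<Longrightarrow> c \<alpha> \<le> b" "\<And>\<alpha>. \<alpha> \<in> gens - Z \<Longrightarrow> c \<alpha> \<le> b'" "b' \<le> b" for b b'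
  proof -
    have "(\<Sum>\<alpha>\<in>gens. c \<alpha>) = (\<Sum>\<alpha>\<in>gens - Z. c \<alpha>) + (\<Sum>\<alpha>\<in>Z. c \<alpha>)"
      using sum.subset_diff[OF Zs finite_gens] by blast
    also have "\<dots> \<le> (\<Sum>\<alpha>\<in>gens - Z. b') + (\<Sum>\<alpha>\<in>Z. b)"
      using Zs by (intro add_mono sum_mono b) auto
    also have "\<dots> = (6 - real (card Z)) * b' + real (card Z) * b"
      using Zs finZ cZ by (simp add: card_Diff_subset of_nat_diff)
    also have "\<dots> \<le> b + 5 * b'"
    proof -
      have "card Z = 0 \<or> card Z = 1" using cZ by linarith
      then show ?thesis using b(3) by auto
    qed
    finally show ?thesis .
  qed
  have eq: "walk_prob (Suc n) A = (\<Sum>\<alpha>\<in>gens. c \<alpha>) / 6" by (simp add: walk_prob_Suc c_def)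
  have "(\<Sum>\<alpha>\<in>gens. c \<alpha>) \<le> 25 ^ s / 5 ^ n + 5 * (25 ^ s / 5 ^ n / 25)"
    using in_Z out_Z by (intro sum) (auto simp: field_simps)
  also have "\<dots> = 6 * (25 ^ s / 5 ^ Suc n)" by (simp add: field_simps)
  finally have 1: "walk_prob (Suc n) A \<le> 25 ^ s / 5 ^ Suc n" unfolding eq by linarith
  have "(\<Sum>\<alpha>\<in>gens. c \<alpha>) \<le> 5 ^ s / 3 ^ n + 5 * (5 ^ s / 3 ^ n / 5)"
    using in_Z out_Z by (intro sum) (auto simp: field_simps)
  also have "\<dots> = 6 * (5 ^ s / 3 ^ Suc n)" by (simp add: field_simps)
  finally have 2: "walk_prob (Suc n) A \<le> 5 ^ s / 3 ^ Suc n" unfolding eq by linarith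
  show ?case using 1 2 by blast
qed

text \<open>For \<open>H = iconj W * W'\<close> with \<open>W\<close> and \<open>W'\<close> of norm \<open>5\<^sup>k\<close> the inequality says that the unit
  quaternions in direction \<open>W\<close> and \<open>W'\<close> have distance at most \<open>\<delta>\<close>.\<close>
definition near_id :: "real \<Rightarrow> nat \<Rightarrow> iquat set" where
  "near_id \<delta> k = {H. inorm H = 25 ^ k \<and> 2 * 5 ^ k - 2 * real_of_int (fst H) \<le> \<delta>\<^sup>2 * 5 ^ k}"

lemma card_int_interval_le:
  fixes l u :: real
  assumes "l \<le> u"
  shows "real (card {\<lceil>l\<rceil>..\<lfloor>u\<rfloor>}) \<le> u - l + 1"
proof -
  have "real (card {\<lceil>l\<rceil>..\<lfloor>u\<rfloor>}) = max 0 (real_of_int (\<lfloor>u\<rfloor> - \<lceil>l\<rceil> + 1))" by (simp add: max_def)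
  then show ?thesis using assms by linarith
qed

text \<open>The real part of \<open>H\<close> lies in an interval of length \<open>\<delta>\<^sup>2 * 5 ^ k / 2\<close> and the first imaginary
  coordinate is at most \<open>\<delta> * 5 ^ k\<close> in absolute value. Once both are chosen, the other two
  coordinates represent a given integer as a sum of two squares.\<close>
lemma near_id_bound:
  fixes \<epsilon> :: real
  assumes "\<epsilon> > 0"
  obtains C where "C > 0"
    "\<And>\<delta> k. 0 < \<delta> \<Longrightarrow> \<delta> \<le> 1 \<Longrightarrow> finite (near_id \<delta> k) \<and>
      real (card (near_id \<delta> k)) \<le> C * (5 ^ k) powr (2 * \<epsilon>) * (1 + \<delta>\<^sup>2 * 5 ^ k / 2) * (1 + 2 * \<delta> * 5 ^ k)"
proof -
  obtain C0 where C0: "C0 > 0" "\<And>m::int. m > 0 \<Longrightarrow> real (card (two_squares m)) \<le> C0 * real_of_int m powr \<epsilon>"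
    using two_squares_bound[OF assms] by blast
  define C where "C = C0 + 1"
  have C: "C > 0" "C \<ge> 1" "C \<ge> C0" using C0 by (auto simp: C_def)
  show ?thesis
  proof (rule that[of C], rule C(1))
    fix \<delta> :: real and k :: nat assume d: "0 < \<delta>" "\<delta> \<le> 1"
    define y :: real where "y = 5 ^ k"
    have y: "y \<ge> 1" by (simp add: y_def)
    have y2: "y\<^sup>2 = 25 ^ k" by (simp add: y_def power_even_eq power2_eq_square flip: power_mult_distrib)
    define As where "As = {\<lceil>y - \<delta>\<^sup>2 * y / 2\<rceil>..\<lfloor>y\<rfloor>}"
    define Bs where "Bs = {\<lceil>- (\<delta> * y)\<rceil>..\<lfloor>\<delta> * y\<rfloor>}"
    define T where "T a b = two_squares (25 ^ k - a\<^sup>2 - b\<^sup>2)" for a b :: int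
    define S where "S = (SIGMA a:As. SIGMA b:Bs. T a b)"
    have "near_id \<delta> k \<subseteq> S"
    proof
      fix H assume H: "H \<in> near_id \<delta> k"
      obtain a b c e where abce: "H = (a, b, c, e)" by (cases H)
      have n: "a\<^sup>2 + b\<^sup>2 + c\<^sup>2 + e\<^sup>2 = 25 ^ k" and l: "2 * y - 2 * real_of_int a \<le> \<delta>\<^sup>2 * y"
        using H by (auto simp: near_id_def abce y_def)
      have nr: "(real_of_int a)\<^sup>2 + (real_of_int b)\<^sup>2 + (real_of_int c)\<^sup>2 + (real_of_int e)\<^sup>2 = y\<^sup>2"
        unfolding y2 using arg_cong[OF n, of real_of_int] by simp
      have "(real_of_int a)\<^sup>2 \<le> y\<^sup>2" using nr by (smt (verit) zero_le_power2)
      then have ay: "\<bar>real_of_int a\<bar> \<le> y" using y by (metis abs_le_square_iff abs_of_nonneg order_trans zero_le_one)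
      have "(real_of_int b)\<^sup>2 \<le> y\<^sup>2 - (real_of_int a)\<^sup>2" using nr by (smt (verit) zero_le_power2)
      also have "\<dots> = (y - real_of_int a) * (y + real_of_int a)" by (simp add: algebra_simps power2_eq_square)
      also have "\<dots> \<le> (\<delta>\<^sup>2 * y / 2) * (2 * y)" using l ay y by (intro mult_mono) auto
      also have "\<dots> = (\<delta> * y)\<^sup>2" by (simp add: power2_eq_square)
      finally have "\<bar>real_of_int b\<bar> \<le> \<delta> * y"
        using d y by (metis abs_le_square_iff abs_of_nonneg order_trans zero_le_one less_imp_le mult_nonneg_nonneg)
      then have "b \<in> Bs" by (simp add: Bs_def ceiling_le_iff le_floor_iff abs_le_iff)
      moreover have "a \<in> As" using l ay by (simp add: As_def ceiling_le_iff le_floor_iff abs_le_iff)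
      moreover have "(c, e) \<in> T a b" using n by (simp add: T_def two_squares_def)
      ultimately show "H \<in> S" by (simp add: S_def abce)
    qed
    moreover have finS: "finite S" by (simp add: S_def As_def Bs_def T_def)
    ultimately have fin: "finite (near_id \<delta> k)" and cS: "card (near_id \<delta> k) \<le> card S"
      by (auto intro: finite_subset card_mono)
    have cT: "real (card (T a b)) \<le> C * y powr (2 * \<epsilon>)" for a b
    proof -
      let ?m = "25 ^ k - a\<^sup>2 - b\<^sup>2"
      have y1: "1 \<le> y powr (2 * \<epsilon>)" using y assms by (simp add: ge_one_powr_ge_zero)
      consider "?m < 0" | "?m = 0" | "?m > 0" by linarith
      then show ?thesis
      proof cases
        case 1
        have "x\<^sup>2 + y\<^sup>2 \<noteq> ?m" for x y :: int using 1 sum_power2_ge_zero[of x y] by linarith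
        then have "T a b = {}" by (simp add: T_def two_squares_def)
        then show ?thesis using C y1 by simp
      next
        case 2
        then have "T a b \<subseteq> {(0, 0)}" unfolding T_def two_squares_def by (auto simp: sum_power2_eq_zero_iff)
        then have "card (T a b) \<le> 1" using card_mono[of "{(0::int, 0::int)}"] by fastforce
        moreover have "1 * 1 \<le> C * y powr (2 * \<epsilon>)" using C y1 by (intro mult_mono) auto
        ultimately show ?thesis by simp
      next
        case 3
        have "real_of_int ?m \<le> y\<^sup>2" unfolding y2 by simp
        moreover have "0 \<le> real_of_int ?m" using 3 by (simp only: of_int_0_le_iff)
        ultimately have "real_of_int ?m powr \<epsilon> \<le> (y\<^sup>2) powr \<epsilon>" using assms by (intro powr_mono2) simp_all
        also have "(y\<^sup>2) powr \<epsilon> = y powr (2 * \<epsilon>)"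
          using y by (simp add: powr_powr flip: powr_numeral)
        finally have "C0 * real_of_int ?m powr \<epsilon> \<le> C * y powr (2 * \<epsilon>)"
          using C C0 by (intro mult_mono) auto
        then show ?thesis using C0(2)[OF 3] by (simp add: T_def)
      qed
    qed
    have "real (card S) = (\<Sum>a\<in>As. \<Sum>b\<in>Bs. real (card (T a b)))"
      by (simp add: S_def As_def Bs_def T_def)
    also have "\<dots> \<le> (\<Sum>a\<in>As. \<Sum>b\<in>Bs. C * y powr (2 * \<epsilon>))" by (intro sum_mono cT)
    also have "\<dots> = real (card As) * (real (card Bs) * (C * y powr (2 * \<epsilon>)))" by simp
    also have "\<dots> \<le> (1 + \<delta>\<^sup>2 * y / 2) * ((1 + 2 * \<delta> * y) * (C * y powr (2 * \<epsilon>)))"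
    proof (intro mult_mono)
      have "y - \<delta>\<^sup>2 * y / 2 \<le> y" using y by simp
      from card_int_interval_le[OF this] show "real (card As) \<le> 1 + \<delta>\<^sup>2 * y / 2" by (simp add: As_def)
      have "- (\<delta> * y) \<le> \<delta> * y" using y d by simp
      from card_int_interval_le[OF this] show "real (card Bs) \<le> 1 + 2 * \<delta> * y" by (simp add: Bs_def)
    qed (use C y d in auto)
    finally have "real (card S) \<le> C * y powr (2 * \<epsilon>) * (1 + \<delta>\<^sup>2 * y / 2) * (1 + 2 * \<delta> * y)"
      by (simp add: mult_ac)
    moreover have "real (card (near_id \<delta> k)) \<le> real (card S)" using cS by simp
    ultimately show "finite (near_id \<delta> k) \<and>
      real (card (near_id \<delta> k)) \<le> C * (5 ^ k) powr (2 * \<epsilon>) * (1 + \<delta>\<^sup>2 * 5 ^ k / 2) * (1 + 2 * \<delta> * 5 ^ k)"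
      using fin by (simp add: y_def)
  qed
qed

section \<open>Collisions of the walk\<close>

text \<open>The probability that two independent walks of \<open>n\<close> steps end within distance \<open>\<delta>\<close> of each
  other, measured between unit quaternions.\<close>
definition walk_collision :: "real \<Rightarrow> nat \<Rightarrow> real" where
  "walk_collision \<delta> n = walk_mean n (\<lambda>W. walk_mean n (\<lambda>W'.
     if real_of_int (inorm (idiff W W')) \<le> \<delta>\<^sup>2 * 5 ^ n then 1 else 0))"

text \<open>Conjugation permutes the generators, so \<open>iconj W * W'\<close> is distributed like a walk of \<open>2 * n\<close>
  steps.\<close>
lemma walk_collision_eq:
  "walk_collision \<delta> n = walk_mean (2 * n) (\<lambda>H. if 2 * 5 ^ n - 2 * real_of_int (fst H) \<le> \<delta>\<^sup>2 * 5 ^ n then 1 else 0)"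
proof -
  let ?g = "\<lambda>H::iquat. if 2 * 5 ^ n - 2 * real_of_int (fst H) \<le> \<delta>\<^sup>2 * 5 ^ n then 1 else 0 :: real"
  have "walk_collision \<delta> n = walk_mean n (\<lambda>W. walk_mean n (\<lambda>W'. ?g (imul (iconj W) W')))"
    unfolding walk_collision_def by (intro walk_mean_cong) (simp add: inorm_idiff)
  also have "\<dots> = walk_mean n (\<lambda>W. walk_mean n (\<lambda>W'. ?g (imul W W')))"
    using walk_mean_iconj[of n "\<lambda>W. walk_mean n (\<lambda>W'. ?g (imul W W'))"] by simp
  also have "\<dots> = walk_mean (n + n) ?g" by (simp add: walk_mean_add)
  finally show ?thesis by (simp only: mult_2)
qed

lemma five_power_square: "((5::'a::comm_semiring_1) ^ s)\<^sup>2 = 25 ^ s"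
  by (simp add: power2_eq_square flip: power_mult_distrib)

lemma exact_power_of_five:
  assumes "inorm H = 25 ^ n"
  obtains s where "s \<le> n" "idvd (5 ^ s) H" "\<not> idvd (5 ^ Suc s) H"
proof -
  have le: "s \<le> n" if s: "idvd (5 ^ s) H" for s
  proof -
    obtain B where "H = iscale (5 ^ s) B" using s idvd_iff_iscale by blast
    then have "(25::int) ^ n = (5 ^ s)\<^sup>2 * inorm B" using assms inorm_iscale by metis
    also have "((5::int) ^ s)\<^sup>2 = 25 ^ s" by (rule five_power_square)
    finally have "(25::int) ^ s dvd 25 ^ n" by simp
    then have "(25::int) ^ s \<le> 25 ^ n" by (rule zdvd_imp_le) simp
    then show ?thesis by simp
  qed
  define s where "s = Max {s. idvd (5 ^ s) H}"
  have fin: "finite {s. idvd (5 ^ s) H}" by (rule finite_subset[of _ "{..n}"]) (auto intro: le)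
  have ne: "{s. idvd (5 ^ s) H} \<noteq> {}" by (cases H) (auto intro!: exI[of _ 0])
  show ?thesis
  proof (rule that[of s])
    show d: "idvd (5 ^ s) H" using Max_in[OF fin ne] by (simp add: s_def)
    then show "s \<le> n" by (rule le)
    show "\<not> idvd (5 ^ Suc s) H"
    proof
      assume "idvd (5 ^ Suc s) H"
      then have "Suc s \<le> s" unfolding s_def using Max_ge[OF fin, of "Suc s"] by (simp add: s_def)
      then show False by simp
    qed
  qed
qed

text \<open>The volume of a ball of radius \<open>\<delta>\<close> in the three-sphere is of order \<open>\<delta>\<^sup>3\<close>, so this is the
  best possible rate as long as \<open>\<delta>\<^sup>3\<close> is at least \<open>(5/9)\<^sup>n\<close>. The quaternions \<open>H\<close> near the real
  axis are sorted by the exact power \<open>5\<^sup>s\<close> that divides them. Dividing by it leaves an element of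
  \<open>near_id \<delta> (n - s)\<close>, so \<open>near_id_bound\<close> counts the \<open>H\<close> and \<open>walk_prob_le\<close> bounds the probability
  of each of them; the product of the two main terms is \<open>\<delta>\<^sup>3\<close> for every \<open>s\<close>.\<close>
lemma walk_collision_bound:
  fixes \<epsilon> :: real
  assumes "\<epsilon> > 0"
  obtains C where "C > 0" "\<And>\<delta> n. 0 < \<delta> \<Longrightarrow> \<delta> \<le> 1 \<Longrightarrow>
    walk_collision \<delta> n \<le> C * (5 ^ n) powr (3 * \<epsilon>) * (\<delta> ^ 3 + 4 * (5 / 9) ^ n)"
proof -
  obtain C0 where C0: "C0 > 0"
    "\<And>\<delta> k. 0 < \<delta> \<Longrightarrow> \<delta> \<le> 1 \<Longrightarrow> finite (near_id \<delta> k) \<and>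
      real (card (near_id \<delta> k)) \<le> C0 * (5 ^ k) powr (2 * \<epsilon>) * (1 + \<delta>\<^sup>2 * 5 ^ k / 2) * (1 + 2 * \<delta> * 5 ^ k)"
    using near_id_bound[OF assms] by blast
  show ?thesis
  proof (rule that[of "C0 * (1 + 1 / \<epsilon>)"])
    show "C0 * (1 + 1 / \<epsilon>) > 0" using C0 assms by (intro mult_pos_pos) (auto intro: add_pos_pos)
    fix \<delta> :: real and n :: nat assume d: "0 < \<delta>" "\<delta> \<le> 1"
    define S where "S s = {H \<in> near_id \<delta> n. idvd (5 ^ s) H \<and> \<not> idvd (5 ^ Suc s) H}" for s
    define Q :: real where "Q = (5 ^ n) powr (2 * \<epsilon>)"
    define t :: real where "t = \<delta> ^ 3 + 4 * (5 / 9) ^ n"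
    have finN: "finite (near_id \<delta> k)" for k using C0(2)[OF d] by blast
    have "walk_collision \<delta> n \<le> walk_mean (2 * n) (\<lambda>H. \<Sum>s\<le>n. \<Sum>A\<in>S s. if H = A then 1 else 0)"
      unfolding walk_collision_eq
    proof (rule walk_mean_mono)
      fix H assume H: "inorm H = 5 ^ (2 * n)"
      then have H25: "inorm H = 25 ^ n" by (simp add: power_mult)
      show "(if 2 * 5 ^ n - 2 * real_of_int (fst H) \<le> \<delta>\<^sup>2 * 5 ^ n then 1 else 0)
          \<le> (\<Sum>s\<le>n. \<Sum>A\<in>S s. if H = A then 1 else (0::real))"
      proof (cases "2 * 5 ^ n - 2 * real_of_int (fst H) \<le> \<delta>\<^sup>2 * 5 ^ n")
        case True
        obtain s where s: "s \<le> n" "idvd (5 ^ s) H" "\<not> idvd (5 ^ Suc s) H"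
          using exact_power_of_five[OF H25] by blast
        have HS: "H \<in> S s" using True s H25 by (simp add: S_def near_id_def)
        have finS: "finite (S s)" by (rule finite_subset[OF _ finN]) (auto simp: S_def)
        have "1 = (\<Sum>A\<in>S s. if H = A then 1 else (0::real))" using HS finS by simp
        also have "\<dots> \<le> (\<Sum>s\<le>n. \<Sum>A\<in>S s. if H = A then 1 else (0::real))"
          using s(1) by (intro member_le_sum) (auto intro: sum_nonneg)
        finally show ?thesis using True by simp
      qed (auto intro!: sum_nonneg)
    qed
    also have "\<dots> = (\<Sum>s\<le>n. \<Sum>A\<in>S s. walk_prob (2 * n) A)"
      by (simp add: walk_mean_sum walk_prob_def)
    also have "\<dots> \<le> (\<Sum>s\<le>n. C0 * Q * t)"
    proof (rule sum_mono)
      fix s assume "s \<in> {..n}"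
      then have s: "s \<le> n" by simp
      define y :: real where "y = 5 ^ (n - s)"
      have y: "y \<ge> 1" by (simp add: y_def)
      \<comment> \<open>The first bound is used for the main term \<open>\<delta>\<^sup>3 y\<^sup>2\<close> of the count, the second one for the
        lower order terms.\<close>
      define p where "p = min (1 / y\<^sup>2) ((5 / 9) ^ n / y)"
      have p: "walk_prob (2 * n) A \<le> p" if "A \<in> S s" for A
      proof -
        have w: "walk_prob (2 * n) A \<le> 25 ^ s / 5 ^ (2 * n)" "walk_prob (2 * n) A \<le> 5 ^ s / 3 ^ (2 * n)"
          using walk_prob_le[of s A "2 * n"] that by (auto simp: S_def)
        have y5: "5 ^ n = y * 5 ^ s" using s by (simp add: y_def flip: power_add)
        have "(25::real) ^ s / 5 ^ (2 * n) = 1 / y\<^sup>2"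
        proof -
          have "(5::real) ^ (2 * n) = (5 ^ n)\<^sup>2" by (simp add: power_even_eq)
          also have "\<dots> = y\<^sup>2 * 25 ^ s" unfolding y5 by (simp add: power_mult_distrib five_power_square)
          finally show ?thesis by simp
        qed
        moreover have "(5::real) ^ s / 3 ^ (2 * n) = (5 / 9) ^ n / y"
        proof -
          have "(3::real) ^ (2 * n) = 9 ^ n" by (simp only: power_mult) simp
          then show ?thesis using y5 y by (simp add: power_divide field_simps)
        qed
        ultimately show ?thesis using w by (simp add: p_def)
      qed
      have p0: "0 \<le> p" using y by (simp add: p_def)
      have inj: "S s \<subseteq> iscale (5 ^ s) ` near_id \<delta> (n - s)"
      proof
        fix H assume H: "H \<in> S s"
        then obtain B where B: "H = iscale (5 ^ s) B" using idvd_iff_iscale by (auto simp: S_def)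
        have nH: "inorm H = 25 ^ n" and lH: "2 * 5 ^ n - 2 * real_of_int (fst H) \<le> \<delta>\<^sup>2 * 5 ^ n"
          using H by (auto simp: S_def near_id_def)
        have p5: "(5::real) ^ n = 5 ^ s * 5 ^ (n - s)" using s by (simp flip: power_add)
        have "(25::int) ^ s * inorm B = 25 ^ s * 25 ^ (n - s)"
          using nH B inorm_iscale[of "5 ^ s" B] s by (simp add: five_power_square flip: power_add)
        then have "inorm B = 25 ^ (n - s)" by simp
        moreover have "fst H = 5 ^ s * fst B" by (cases B) (simp add: B)
        then have "5 ^ s * (2 * 5 ^ (n - s) - 2 * real_of_int (fst B)) \<le> 5 ^ s * (\<delta>\<^sup>2 * 5 ^ (n - s))"
          using lH p5 by (simp add: algebra_simps)
        then have "2 * 5 ^ (n - s) - 2 * real_of_int (fst B) \<le> \<delta>\<^sup>2 * 5 ^ (n - s)"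
          by (simp only: mult_le_cancel_left_pos zero_less_power zero_less_numeral)
        ultimately show "H \<in> iscale (5 ^ s) ` near_id \<delta> (n - s)" using B by (auto simp: near_id_def)
      qed
      have cS: "real (card (S s)) \<le> C0 * y powr (2 * \<epsilon>) * (1 + \<delta>\<^sup>2 * y / 2) * (1 + 2 * \<delta> * y)"
      proof -
        have "real (card (S s)) \<le> real (card (near_id \<delta> (n - s)))"
          using surj_card_le[OF finN inj] by simp
        also have "\<dots> \<le> C0 * y powr (2 * \<epsilon>) * (1 + \<delta>\<^sup>2 * y / 2) * (1 + 2 * \<delta> * y)"
          using C0(2)[OF d, of "n - s"] unfolding y_def by blast
        finally show ?thesis .
      qed
      have "y powr (2 * \<epsilon>) \<le> Q" unfolding Q_def y_def using assms by (intro powr_mono2) auto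
      then have "C0 * y powr (2 * \<epsilon>) * (1 + \<delta>\<^sup>2 * y / 2) * (1 + 2 * \<delta> * y) \<le> C0 * Q * (1 + \<delta>\<^sup>2 * y / 2) * (1 + 2 * \<delta> * y)"
        using C0 y d by (intro mult_right_mono mult_left_mono) auto
      with cS have cS2: "real (card (S s)) \<le> C0 * Q * ((1 + \<delta>\<^sup>2 * y / 2) * (1 + 2 * \<delta> * y))" by simp
      have pt: "p * ((1 + \<delta>\<^sup>2 * y / 2) * (1 + 2 * \<delta> * y)) \<le> t"
      proof -
        have "p * ((1 + \<delta>\<^sup>2 * y / 2) * (1 + 2 * \<delta> * y)) = p * (\<delta> ^ 3 * y\<^sup>2) + p * (1 + 2 * \<delta> * y + \<delta>\<^sup>2 * y / 2)"
          by (simp add: algebra_simps power2_eq_square power3_eq_cube)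
        also have "\<dots> \<le> 1 / y\<^sup>2 * (\<delta> ^ 3 * y\<^sup>2) + (5 / 9) ^ n / y * (1 + 2 * \<delta> * y + \<delta>\<^sup>2 * y / 2)"
          using d y by (intro add_mono mult_right_mono) (auto simp: p_def)
        also have "\<dots> \<le> \<delta> ^ 3 + (5 / 9) ^ n / y * (4 * y)"
        proof -
          have "\<delta>\<^sup>2 \<le> 1" using d by (simp add: power_le_one)
          then have "\<delta>\<^sup>2 * y \<le> 1 * y" "\<delta> * y \<le> 1 * y" using y d by (intro mult_right_mono; simp)+
          then have "1 + 2 * \<delta> * y + \<delta>\<^sup>2 * y / 2 \<le> 4 * y" using y by linarith
          then have "(5 / 9) ^ n / y * (1 + 2 * \<delta> * y + \<delta>\<^sup>2 * y / 2) \<le> (5 / 9) ^ n / y * (4 * y)"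
            using y by (intro mult_left_mono) auto
          then show ?thesis using y by simp
        qed
        also have "\<dots> = t" using y by (simp add: t_def)
        finally show ?thesis .
      qed
      have "(\<Sum>A\<in>S s. walk_prob (2 * n) A) \<le> (\<Sum>A\<in>S s. p)" by (intro sum_mono p)
      also have "\<dots> = real (card (S s)) * p" by simp
      also have "\<dots> \<le> (C0 * Q * ((1 + \<delta>\<^sup>2 * y / 2) * (1 + 2 * \<delta> * y))) * p"
        by (rule mult_right_mono[OF cS2 p0])
      also have "\<dots> = C0 * Q * (p * ((1 + \<delta>\<^sup>2 * y / 2) * (1 + 2 * \<delta> * y)))" by simp
      also have "\<dots> \<le> C0 * Q * t" using C0 pt by (intro mult_left_mono) (auto simp: Q_def)
      finally show "(\<Sum>A\<in>S s. walk_prob (2 * n) A) \<le> C0 * Q * t" .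
    qed
    also have "\<dots> = C0 * Q * t * (real n + 1)" by simp
    also have "\<dots> \<le> C0 * Q * t * ((1 + 1 / \<epsilon>) * (5 ^ n) powr \<epsilon>)"
    proof (rule mult_left_mono)
      have l5: "1 \<le> ln (5::real)"
        using ln_mono[of "exp 1" "5::real"] exp_le by simp
      have "1 + real n * \<epsilon> \<le> 1 + real n * \<epsilon> * ln 5"
        using l5 assms mult_left_mono[OF l5, of "real n * \<epsilon>"] by simp
      also have "\<dots> \<le> exp (real n * \<epsilon> * ln 5)" by (rule exp_ge_add_one_self)
      also have "\<dots> = (5 ^ n) powr \<epsilon>" by (simp add: powr_def ln_realpow mult_ac)
      finally have "(1 + 1 / \<epsilon>) * (1 + real n * \<epsilon>) \<le> (1 + 1 / \<epsilon>) * (5 ^ n) powr \<epsilon>"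
        using assms by (intro mult_left_mono) auto
      moreover have "real n + 1 \<le> (1 + 1 / \<epsilon>) * (1 + real n * \<epsilon>)"
        using assms by (simp add: field_simps)
      ultimately show "real n + 1 \<le> (1 + 1 / \<epsilon>) * (5 ^ n) powr \<epsilon>" by linarith
    qed (use C0 d in \<open>auto simp: Q_def t_def\<close>)
    also have "\<dots> = C0 * (1 + 1 / \<epsilon>) * (Q * (5 ^ n) powr \<epsilon>) * t" by (simp add: mult_ac)
    also have "Q * (5 ^ n) powr \<epsilon> = (5 ^ n) powr (3 * \<epsilon>)" by (simp add: Q_def powr_add[symmetric])
    finally show "walk_collision \<delta> n \<le> C0 * (1 + 1 / \<epsilon>) * (5 ^ n) powr (3 * \<epsilon>) * (\<delta> ^ 3 + 4 * (5 / 9) ^ n)"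
      by (simp add: t_def)
  qed
qed

section \<open>Rotations by quaternions\<close>

definition qconj :: "quat \<Rightarrow> quat" where
  "qconj q = (fst q, - snd q)"

text \<open>With the conjugate in place of the inverse, the coordinates of \<open>rot q x\<close> are polynomials in
  those of \<open>q\<close>. For unit quaternions the two definitions agree.\<close>
definition rot :: "quat \<Rightarrow> real^3 \<Rightarrow> real^3" where
  "rot q x = snd (qmult (qmult q (0, x)) (qconj q))"

lemmas quat_simps = qmult_def qconj_def cross3_def prod_eq_iff vec_eq_iff forall_3 inner_vec_def sum_3

lemma qmult_assoc: "qmult (qmult p q) s = qmult p (qmult q s)"
  by (simp add: quat_simps algebra_simps)

lemma qconj_qmult: "qconj (qmult p q) = qmult (qconj q) (qconj p)"
  by (simp add: quat_simps algebra_simps)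

lemma norm_quat_sq: "(norm (q::quat))\<^sup>2 = (fst q)\<^sup>2 + (snd q $ 1)\<^sup>2 + (snd q $ 2)\<^sup>2 + (snd q $ 3)\<^sup>2"
proof -
  have "(norm q)\<^sup>2 = (norm (fst q))\<^sup>2 + (norm (snd q))\<^sup>2" by (simp add: norm_prod_def)
  also have "(norm (snd q))\<^sup>2 = (snd q $ 1)\<^sup>2 + (snd q $ 2)\<^sup>2 + (snd q $ 3)\<^sup>2"
    unfolding power2_norm_eq_inner by (simp add: inner_vec_def sum_3 power2_eq_square)
  finally show ?thesis by simp
qed

lemma norm_qmult: "norm (qmult p q) = norm p * norm q"
proof -
  have "(norm (qmult p q))\<^sup>2 = (norm p * norm q)\<^sup>2"
    unfolding power_mult_distrib norm_quat_sq
    by (simp add: quat_simps algebra_simps power2_eq_square)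
  then show ?thesis by (metis norm_ge_zero power2_eq_imp_eq mult_nonneg_nonneg)
qed

lemma norm_qconj [simp]: "norm (qconj q) = norm q"
  by (simp add: norm_prod_def qconj_def)

lemma qmult_qconj: "qmult q (qconj q) = ((norm q)\<^sup>2, 0)" "qmult (qconj q) q = ((norm q)\<^sup>2, 0)"
  unfolding norm_quat_sq by (simp_all add: quat_simps power2_eq_square)

lemma qmult_one [simp]: "qmult (1, 0) q = q" "qmult q (1, 0) = q"
  by (simp_all add: quat_simps)

lemma qmult_diff_left: "qmult (p - q) s = qmult p s - qmult q s"
  by (simp add: quat_simps algebra_simps)

lemma qmult_diff_right: "qmult s (p - q) = qmult s p - qmult s q"
  by (simp add: quat_simps algebra_simps)

lemma qmult_scale: "qmult (c *\<^sub>R p) q = c *\<^sub>R qmult p q" "qmult p (c *\<^sub>R q) = c *\<^sub>R qmult p q"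
  by (simp_all add: quat_simps algebra_simps)

lemma qmult_rot: "qmult (qmult q (0, x)) (qconj q) = (0, rot q x)"
  by (simp add: rot_def quat_simps algebra_simps)

lemma rot_qmult: "rot (qmult p q) x = rot p (rot q x)"
proof -
  have "qmult (qmult (qmult p q) (0, x)) (qconj (qmult p q)) =
      qmult (qmult p (qmult (qmult q (0, x)) (qconj q))) (qconj p)"
    by (simp add: qmult_assoc qconj_qmult)
  then show ?thesis by (simp add: qmult_rot)
qed

lemma norm_rot_general: "norm (rot q x) = (norm q)\<^sup>2 * norm x"
proof -
  have "norm ((0::real), rot q x) = norm (qmult (qmult q (0, x)) (qconj q))" by (simp add: qmult_rot)
  then show ?thesis by (simp add: norm_qmult norm_Pair power2_eq_square)
qed

lemma norm_rot [simp]: "norm q = 1 \<Longrightarrow> norm (rot q x) = norm x"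
  by (simp add: norm_rot_general)

lemma rot_scaleR: "rot q (c *\<^sub>R x) = c *\<^sub>R rot q x"
  by (simp add: rot_def quat_simps algebra_simps)

lemma rot_diff: "rot q (x - y) = rot q x - rot q y"
  by (simp add: rot_def quat_simps algebra_simps)

lemma rot_scale_quat: "rot (c *\<^sub>R q) x = c\<^sup>2 *\<^sub>R rot q x"
  by (simp add: rot_def quat_simps algebra_simps power2_eq_square)

lemma inner_rot: "rot q x \<bullet> y = x \<bullet> rot (qconj q) y"
  by (simp add: rot_def quat_simps algebra_simps)

lemma rot_one [simp]: "rot (1, 0) x = x"
  by (simp add: rot_def quat_simps)

lemma norm_rot_diff_le:
  assumes "norm p = 1" "norm q = 1"
  shows "norm (rot p x - rot q x) \<le> 2 * norm (p - q) * norm x"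
proof -
  have "(0, rot p x - rot q x) = qmult (qmult p (0, x)) (qconj p) - qmult (qmult q (0, x)) (qconj q)"
    by (simp add: qmult_rot)
  also have "\<dots> = qmult (qmult (p - q) (0, x)) (qconj p) + qmult (qmult q (0, x)) (qconj (p - q))"
    by (simp add: quat_simps algebra_simps)
  finally have "(0, rot p x - rot q x) = qmult (qmult (p - q) (0, x)) (qconj p) + qmult (qmult q (0, x)) (qconj (p - q))" .
  then have "norm (rot p x - rot q x) \<le>
      norm (qmult (qmult (p - q) (0, x)) (qconj p)) + norm (qmult (qmult q (0, x)) (qconj (p - q)))"
    by (metis norm_triangle_ineq norm_Pair norm_zero power_zero_numeral add_0 real_sqrt_abs abs_norm_cancel)
  also have "\<dots> = 2 * norm (p - q) * norm x"
    using assms by (simp add: norm_qmult norm_Pair)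
  finally show ?thesis .
qed

fun emb :: "iquat \<Rightarrow> quat" where
  "emb (a, b, c, d) = (real_of_int a, vector [real_of_int b, real_of_int c, real_of_int d])"

lemma emb_imul: "emb (imul A B) = qmult (emb A) (emb B)"
  by (cases A rule: prod_cases4; cases B rule: prod_cases4; hypsubst) (simp add: quat_simps algebra_simps)

lemma emb_iconj: "emb (iconj A) = qconj (emb A)"
  by (cases A rule: prod_cases4; hypsubst) (simp add: quat_simps)

lemma norm_emb: "(norm (emb A))\<^sup>2 = real_of_int (inorm A)"
  by (cases A rule: prod_cases4; hypsubst) (simp add: norm_quat_sq)

lemma norm_emb_diff: "(norm (emb A - emb B))\<^sup>2 = real_of_int (inorm (idiff A B))"
  by (cases A rule: prod_cases4; cases B rule: prod_cases4; hypsubst) (simp add: norm_quat_sq)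

definition uquat :: "iquat \<Rightarrow> quat" where
  "uquat A = (1 / norm (emb A)) *\<^sub>R emb A"

abbreviation act :: "iquat \<Rightarrow> real^3 \<Rightarrow> real^3" where
  "act A \<equiv> rot (uquat A)"

lemma norm_uquat: "inorm A \<noteq> 0 \<Longrightarrow> norm (uquat A) = 1"
  using norm_emb[of A] by (auto simp: uquat_def)

lemma uquat_imul: "uquat (imul A B) = qmult (uquat A) (uquat B)"
  by (simp add: uquat_def emb_imul norm_qmult qmult_scale)

lemma act_imul: "act (imul A B) x = act A (act B x)"
  by (simp add: uquat_imul rot_qmult)

lemma uquat_ione [simp]: "uquat ione = (1, 0)"
proof -
  have "emb ione = (1, 0)" by (simp add: ione_def prod_eq_iff vec_eq_iff forall_3)
  then show ?thesis by (simp add: uquat_def norm_Pair)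
qed

lemma uquat_iconj: "uquat (iconj A) = qconj (uquat A)"
  by (simp add: uquat_def emb_iconj) (simp add: qconj_def prod_eq_iff)

lemma norm_uquat_diff:
  assumes "inorm A = 5 ^ n" "inorm B = 5 ^ n"
  shows "(norm (uquat A - uquat B))\<^sup>2 = real_of_int (inorm (idiff A B)) / 5 ^ n"
proof -
  have n: "(norm (emb A))\<^sup>2 = 5 ^ n" "(norm (emb B))\<^sup>2 = 5 ^ n" using assms by (simp_all add: norm_emb)
  then have eq: "norm (emb A) = norm (emb B)" by (metis norm_ge_zero power2_eq_imp_eq)
  have "uquat A - uquat B = (1 / norm (emb A)) *\<^sub>R (emb A - emb B)"
    by (simp add: uquat_def eq scaleR_diff_right)
  then have "(norm (uquat A - uquat B))\<^sup>2 = (norm (emb A - emb B))\<^sup>2 / (norm (emb A))\<^sup>2"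
    by (simp add: power_divide)
  then show ?thesis by (simp add: n norm_emb_diff)
qed

lemma act_scaled: "inorm A = 5 ^ n \<Longrightarrow> 5 ^ n *\<^sub>R act A x = rot (emb A) x"
  using norm_emb[of A] by (simp add: uquat_def rot_scale_quat power_divide)

text \<open>The first coordinate of \<open>5 ^ n *\<^sub>R act A (axis 1 1)\<close> is \<open>a\<^sup>2 + b\<^sup>2 - c\<^sup>2 - d\<^sup>2\<close>, which has
  the parity of the norm \<open>5\<^sup>n\<close>.\<close>
lemma act_axis_integral:
  assumes "inorm A = 5 ^ n"
  shows "\<exists>m. odd m \<and> (5 ^ n *\<^sub>R act A (axis 1 1)) $ 1 = real_of_int m" "(5 ^ n *\<^sub>R act A (axis 1 1)) $ c \<in> \<int>"
proof -
  obtain a b c' d where A: "A = (a, b, c', d)" by (cases A)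
  have r: "5 ^ n *\<^sub>R act A (axis 1 1) =
     vector [real_of_int (a\<^sup>2 + b\<^sup>2 - c'\<^sup>2 - d\<^sup>2), real_of_int (2 * (b * c' + a * d)), real_of_int (2 * (b * d - a * c'))]"
    unfolding act_scaled[OF assms] unfolding A
    by (simp add: rot_def quat_simps axis_def algebra_simps power2_eq_square)
  have "odd (a\<^sup>2 + b\<^sup>2 + c'\<^sup>2 + d\<^sup>2)" using assms by (simp add: A)
  then have "odd (a\<^sup>2 + b\<^sup>2 - c'\<^sup>2 - d\<^sup>2)" by simp
  then show "\<exists>m. odd m \<and> (5 ^ n *\<^sub>R act A (axis 1 1)) $ 1 = real_of_int m" unfolding r by (metis vector_3(1))
  show "(5 ^ n *\<^sub>R act A (axis 1 1)) $ c \<in> \<int>"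
    unfolding r using exhaust_3[of c] by (auto simp del: of_int_add of_int_diff of_int_mult)
qed

section \<open>Damped averages along the walk\<close>

text \<open>The mean of 1 and \<open>cos\<^sup>2(\<pi> x)\<close>, the squared modulus of \<open>(1 + exp(2 \<pi> \<i> x)) / 2\<close>. In contrast
  to the latter it is bounded away from 0, so that its logarithm is Lipschitz.\<close>
definition damp :: "real \<Rightarrow> real" where
  "damp x = (3 + cos (2 * pi * x)) / 4"

lemma damp_bounds: "1 / 2 \<le> damp x" "damp x \<le> 1" "0 \<le> damp x"
proof -
  have "1 / 2 \<le> (3 + c) / 4 \<and> (3 + c) / 4 \<le> 1 \<and> 0 \<le> (3 + c) / 4" if "-1 \<le> c" "c \<le> 1" for c :: real
    using that by simp
  from this[of "cos (2 * pi * x)"] show "1 / 2 \<le> damp x" "damp x \<le> 1" "0 \<le> damp x"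
    unfolding damp_def by auto
qed

lemma cos_diff_le: "\<bar>cos x - cos y\<bar> \<le> \<bar>x - y :: real\<bar>"
proof -
  have "cos x - cos y = 2 * sin ((x + y) / 2) * sin ((y - x) / 2)" by (rule cos_diff_cos)
  then have "\<bar>cos x - cos y\<bar> = 2 * \<bar>sin ((x + y) / 2)\<bar> * \<bar>sin ((y - x) / 2)\<bar>" by (simp add: abs_mult)
  also have "\<dots> \<le> 2 * 1 * \<bar>(y - x) / 2\<bar>" by (intro mult_mono abs_sin_x_le_abs_x) auto
  finally show ?thesis by simp
qed

lemma damp_log_lipschitz: "damp x \<le> exp (pi * \<bar>x - y\<bar>) * damp y"
proof -
  have "damp x - damp y \<le> \<bar>cos (2 * pi * x) - cos (2 * pi * y)\<bar> / 4"
  proof -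
    have "(3 + a) / 4 - (3 + b) / 4 \<le> \<bar>a - b\<bar> / 4" for a b :: real
      using abs_ge_self[of "a - b"] by (simp add: add_divide_distrib diff_divide_distrib flip: diff_divide_distrib)
    then show ?thesis unfolding damp_def .
  qed
  also have "\<dots> \<le> \<bar>2 * pi * x - 2 * pi * y\<bar> / 4" using cos_diff_le by (intro divide_right_mono) auto
  also have "\<dots> = pi * \<bar>x - y\<bar> * (1 / 2)"
    by (simp add: abs_mult flip: right_diff_distrib)
  also have "\<dots> \<le> pi * \<bar>x - y\<bar> * damp y" by (intro mult_left_mono damp_bounds) auto
  finally have "damp x \<le> (1 + pi * \<bar>x - y\<bar>) * damp y" by (simp add: algebra_simps)
  also have "\<dots> \<le> exp (pi * \<bar>x - y\<bar>) * damp y"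
    by (intro mult_right_mono exp_ge_add_one_self damp_bounds)
  finally show ?thesis .
qed

text \<open>The product of the damping factors along the path of a frequency under \<open>n\<close> random
  contracting rotations, averaged over all paths.\<close>
primrec damped_mean :: "real \<Rightarrow> nat \<Rightarrow> real^3 \<Rightarrow> real" where
  "damped_mean r 0 \<xi> = 1"
| "damped_mean r (Suc n) \<xi> = damp (\<xi> $ 1) * ((\<Sum>\<alpha>\<in>gens. damped_mean r n (r *\<^sub>R act \<alpha> \<xi>)) / 6)"

lemma damped_mean_bounds: "0 \<le> damped_mean r n \<xi> \<and> damped_mean r n \<xi> \<le> 1"
proof (induction n arbitrary: \<xi>)
  case (Suc n)
  have "(\<Sum>\<alpha>\<in>gens. damped_mean r n (r *\<^sub>R act \<alpha> \<xi>)) \<le> (\<Sum>\<alpha>\<in>gens. 1)"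
    using Suc by (intro sum_mono) auto
  moreover have "0 \<le> (\<Sum>\<alpha>\<in>gens. damped_mean r n (r *\<^sub>R act \<alpha> \<xi>))" using Suc by (intro sum_nonneg) auto
  ultimately have "0 \<le> (\<Sum>\<alpha>\<in>gens. damped_mean r n (r *\<^sub>R act \<alpha> \<xi>)) / 6"
    "(\<Sum>\<alpha>\<in>gens. damped_mean r n (r *\<^sub>R act \<alpha> \<xi>)) / 6 \<le> 1" by simp_all
  then show ?case unfolding damped_mean.simps
    using damp_bounds[of "\<xi> $ 1"] by (intro conjI mult_nonneg_nonneg mult_le_one)
qed simp

lemma norm_act: "\<alpha> \<in> gens \<Longrightarrow> norm (act \<alpha> x) = norm x"
  using norm_uquat[of \<alpha>] inorm_gens[of \<alpha>] by simp

text \<open>The path contracts differences by \<open>r\<close> in each step, so the Lipschitz constants of the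
  logarithms of the factors form a geometric series.\<close>
lemma damped_mean_log_lipschitz:
  assumes r: "0 < r" "r < 1"
  shows "damped_mean r n x \<le> exp (pi / (1 - r) * norm (x - y)) * damped_mean r n y"
proof (induction n arbitrary: x y)
  case 0
  have "0 \<le> pi / (1 - r) * norm (x - y)" using r by simp
  then show ?case by simp
next
  case (Suc n)
  let ?S = "\<lambda>x. \<Sum>\<alpha>\<in>gens. damped_mean r n (r *\<^sub>R act \<alpha> x)"
  let ?E = "exp (pi / (1 - r) * (r * norm (x - y)))"
  have "?S x \<le> (\<Sum>\<alpha>\<in>gens. ?E * damped_mean r n (r *\<^sub>R act \<alpha> y))"
  proof (rule sum_mono)
    fix \<alpha> assume a: "\<alpha> \<in> gens"
    have "norm (r *\<^sub>R act \<alpha> x - r *\<^sub>R act \<alpha> y) = r * norm (x - y)"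
      using r norm_act[OF a, of "x - y"] by (simp add: rot_diff flip: scaleR_diff_right)
    then show "damped_mean r n (r *\<^sub>R act \<alpha> x) \<le> ?E * damped_mean r n (r *\<^sub>R act \<alpha> y)"
      using Suc[of "r *\<^sub>R act \<alpha> x" "r *\<^sub>R act \<alpha> y"] by simp
  qed
  also have "\<dots> = ?E * ?S y" by (simp add: sum_distrib_left)
  finally have S: "?S x \<le> ?E * ?S y" .
  have S0: "0 \<le> ?S x" "0 \<le> ?S y" by (auto intro!: sum_nonneg simp: damped_mean_bounds)
  have "\<bar>x $ 1 - y $ 1\<bar> \<le> norm (x - y)" using component_le_norm_cart[of "x - y" 1] by simp
  then have "exp (pi * \<bar>x $ 1 - y $ 1\<bar>) \<le> exp (pi * norm (x - y))" by simp
  then have "exp (pi * \<bar>x $ 1 - y $ 1\<bar>) * damp (y $ 1) \<le> exp (pi * norm (x - y)) * damp (y $ 1)"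
    by (intro mult_right_mono damp_bounds)
  then have d: "damp (x $ 1) \<le> exp (pi * norm (x - y)) * damp (y $ 1)"
    using damp_log_lipschitz[of "x $ 1" "y $ 1"] by linarith
  have "damp (x $ 1) * (?S x / 6) \<le> (exp (pi * norm (x - y)) * damp (y $ 1)) * (?E * ?S y / 6)"
    using S0 S by (intro mult_mono d divide_right_mono) (auto intro!: mult_nonneg_nonneg damp_bounds)
  also have "\<dots> = (exp (pi * norm (x - y)) * ?E) * (damp (y $ 1) * (?S y / 6))" by simp
  also have "exp (pi * norm (x - y)) * ?E = exp (pi / (1 - r) * norm (x - y))"
    using r by (simp flip: exp_add) (simp add: field_simps)
  finally show ?case by simp
qed

lemma walk_mean_act_Suc:
  "(\<Sum>\<alpha>\<in>gens. walk_mean n (\<lambda>W. g (act W (act \<alpha> \<xi>)))) / 6 = walk_mean (Suc n) (\<lambda>W. g (act W \<xi>))"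
  unfolding walk_mean_Suc_right by (simp add: act_imul)

text \<open>What is common to the frequencies that occur when a product of damping factors is expanded
  into cosines: sums of terms \<open>\<plusminus> r\<^sup>j O\<^sub>j e\<^sub>1\<close> with distinct \<open>j < n\<close>, the largest of which is the
  \<open>i\<close> of the definition.\<close>
definition odd_frequency :: "nat \<Rightarrow> nat \<Rightarrow> real^3 \<Rightarrow> bool" where
  "odd_frequency q n v \<longleftrightarrow> (\<exists>i<n. (\<exists>m. odd m \<and> ((5 * real q) ^ i *\<^sub>R v) $ 1 = real_of_int m) \<and>
     (\<forall>c. ((5 * real q) ^ i *\<^sub>R v) $ c \<in> \<int>)) \<and> norm v \<le> (\<Sum>i<n. (1 - 1 / real q) ^ i)"

lemma odd_frequency_mono:
  assumes q: "q > 0" and "odd_frequency q n v" "n \<le> k"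
  shows "odd_frequency q k v"
proof -
  have "(\<Sum>i<n. (1 - 1 / real q) ^ i) \<le> (\<Sum>i<k. (1 - 1 / real q) ^ i)"
    using q assms(3) by (intro sum_mono2) auto
  then show ?thesis using assms unfolding odd_frequency_def by (meson order_less_le_trans order_trans)
qed

text \<open>Multiplied by \<open>(5 * q) ^ n\<close>, the old vector \<open>v\<close> acquires an even first coordinate, because
  at least one factor \<open>q\<close> is not used up by its denominators. The new term contributes \<open>(q - 1) ^
  n\<close> times an odd number.\<close>
lemma odd_frequency_step:
  assumes q: "even q" "q > 0" and A: "inorm A = 5 ^ n"
    and v: "v = 0 \<or> odd_frequency q n v" and s: "\<bar>s\<bar> = 1"
  shows "odd_frequency q (Suc n) (v + (s * (1 - 1 / real q) ^ n) *\<^sub>R act A (axis 1 1))"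
proof -
  define w where "w = act A (axis 1 1)"
  define r where "r = 1 - 1 / real q"
  have rq: "0 \<le> r" "real q * r = real_of_int (int q - 1)" using q by (simp_all add: r_def field_simps)
  have v': "(\<exists>m. even m \<and> ((5 * real q) ^ n *\<^sub>R v) $ 1 = real_of_int m) \<and> (\<forall>c. ((5 * real q) ^ n *\<^sub>R v) $ c \<in> \<int>)"
  proof (cases "v = 0")
    case True
    then show ?thesis by (auto intro: exI[of _ 0])
  next
    case False
    then obtain i m where i: "i < n" "odd m" "((5 * real q) ^ i *\<^sub>R v) $ 1 = real_of_int m"
      "\<And>c. ((5 * real q) ^ i *\<^sub>R v) $ c \<in> \<int>"
      using v unfolding odd_frequency_def by blast
    obtain d where d: "n = Suc (d + i)" using less_imp_Suc_add[OF i(1)] by (metis add.commute add_Suc_right)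
    have eq: "((5 * real q) ^ n *\<^sub>R v) $ c = real_of_int ((5 * int q) ^ Suc d) * ((5 * real q) ^ i *\<^sub>R v) $ c" for c
      by (simp add: d power_add)
    have "even ((5 * int q) ^ Suc d * m)" using q by simp
    moreover have "((5 * real q) ^ n *\<^sub>R v) $ 1 = real_of_int ((5 * int q) ^ Suc d * m)"
      unfolding eq i(3) by simp
    moreover have "((5 * real q) ^ n *\<^sub>R v) $ c \<in> \<int>" for c unfolding eq by (intro Ints_mult i(4)) simp
    ultimately show ?thesis by blast
  qed
  obtain sm :: int where sm: "s = real_of_int sm" "odd sm"
    using s by (cases "s \<ge> 0") (auto intro: that[of 1] that[of "-1"])
  have w': "((5 * real q) ^ n *\<^sub>R ((s * r ^ n) *\<^sub>R w)) $ c = real_of_int (sm * (int q - 1) ^ n) * (5 ^ n *\<^sub>R w) $ c" for c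
  proof -
    have "(5 * real q) ^ n * (s * r ^ n) = s * (real q * r) ^ n * 5 ^ n" by (simp add: power_mult_distrib)
    also have "\<dots> = real_of_int (sm * (int q - 1) ^ n) * 5 ^ n" by (simp only: rq sm of_int_mult of_int_power)
    finally show ?thesis by (simp add: mult.assoc[symmetric])
  qed
  obtain m where m: "odd m" "(5 ^ n *\<^sub>R w) $ 1 = real_of_int m" using act_axis_integral(1)[OF A] w_def by blast
  obtain m' where m': "even m'" "((5 * real q) ^ n *\<^sub>R v) $ 1 = real_of_int m'" using v' by blast
  let ?u = "v + (s * r ^ n) *\<^sub>R w"
  have u: "((5 * real q) ^ n *\<^sub>R ?u) $ c = ((5 * real q) ^ n *\<^sub>R v) $ c + ((5 * real q) ^ n *\<^sub>R ((s * r ^ n) *\<^sub>R w)) $ c" for c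
    by (simp add: distrib_left)
  have "((5 * real q) ^ n *\<^sub>R ?u) $ 1 = real_of_int (m' + sm * (int q - 1) ^ n * m)"
    unfolding u w' m'(2) m(2) by simp
  moreover have "odd (m' + sm * (int q - 1) ^ n * m)" using m m' sm q by simp
  moreover have "((5 * real q) ^ n *\<^sub>R ?u) $ c \<in> \<int>" for c
    unfolding u w' using v' act_axis_integral(2)[OF A, of c]
    by (intro Ints_add Ints_mult) (auto simp: w_def)
  moreover have "norm ?u \<le> (\<Sum>i<Suc n. r ^ i)"
  proof -
    have "norm w = 1" unfolding w_def using norm_uquat[of A] A by simp
    then have "norm ?u \<le> norm v + r ^ n" using norm_triangle_ineq[of v "(s * r ^ n) *\<^sub>R w"] s rq by (simp add: abs_mult)
    moreover have "norm v \<le> (\<Sum>i<n. r ^ i)"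
      using v rq by (auto simp: odd_frequency_def r_def[symmetric] intro!: sum_nonneg)
    ultimately show ?thesis by simp
  qed
  ultimately show ?thesis unfolding odd_frequency_def w_def[symmetric] r_def[symmetric] by blast
qed

text \<open>The lower bound holds since an odd number is at least 1 in absolute value, the upper one by
  summing the geometric series.\<close>
lemma odd_frequency_bounds:
  assumes q: "q > 0" and v: "odd_frequency q n v"
  shows "1 / (5 * real q) ^ n \<le> norm v" "norm v \<le> real q"
proof -
  obtain i m where i: "i < n" "odd m" "((5 * real q) ^ i *\<^sub>R v) $ 1 = real_of_int m"
    using v by (auto simp: odd_frequency_def)
  have "m \<noteq> 0" using i(2) by auto
  then have "1 \<le> \<bar>real_of_int m\<bar>" by linarith
  also have "\<dots> = (5 * real q) ^ i * \<bar>v $ 1\<bar>" using i(3) q by (simp add: abs_mult flip: i(3))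
  also have "\<dots> \<le> (5 * real q) ^ n * norm v"
    using i(1) q by (intro mult_mono component_le_norm_cart power_increasing) auto
  finally show "1 / (5 * real q) ^ n \<le> norm v" using q by (simp add: field_simps)
  have "norm v \<le> (\<Sum>i<n. (1 - 1 / real q) ^ i)" using v by (simp add: odd_frequency_def)
  also have "\<dots> = (1 - (1 - 1 / real q) ^ n) / (1 / real q)"
    using q by (subst sum_gp_strict) auto
  also have "\<dots> \<le> real q" using q by (simp add: field_simps)
  finally show "norm v \<le> real q" .
qed

text \<open>The induction on \<open>L\<close> expands one damping factor at a time: \<open>cos v * damp w\<close> is \<open>3/4\<close> of the
  cosine at \<open>v\<close> plus \<open>1/8\<close> of the cosines at \<open>v + w\<close> and \<open>v - w\<close>. New frequencies are odd, so \<open>\<rho>\<close>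
  applies to them; frequency 0 survives \<open>L\<close> expansions with weight \<open>(3/4)\<^sup>L\<close>.\<close>
lemma damped_mean_sum_twisted:
  fixes y :: "'i \<Rightarrow> real^3"
  assumes q: "even q" "q > 0"
    and \<rho>: "\<And>v. odd_frequency q N v \<Longrightarrow> \<bar>\<Sum>i\<in>I. cos (2 * pi * (v \<bullet> y i))\<bar> \<le> \<rho>"
    and A: "inorm A = 5 ^ n" and v: "v = 0 \<or> odd_frequency q n v" and N: "n + L \<le> N" and \<rho>0: "0 \<le> \<rho>"
  shows "\<bar>\<Sum>i\<in>I. cos (2 * pi * (v \<bullet> y i)) *
      damped_mean (1 - 1 / real q) L ((1 - 1 / real q) ^ n *\<^sub>R act A (y i))\<bar>
    \<le> \<rho> + (if v = 0 then (3 / 4) ^ L * real (card I) else 0)"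
  using A v N
proof (induction L arbitrary: n A v)
  case 0
  show ?case
  proof (cases "v = 0")
    case True
    then show ?thesis using \<rho>0 by simp
  next
    case False
    then have "odd_frequency q N v" using 0 odd_frequency_mono[OF q(2), of n v N] by auto
    then show ?thesis using \<rho>[of v] False by simp
  qed
next
  case (Suc L)
  define r where "r = 1 - 1 / real q"
  define w where "w = r ^ n *\<^sub>R act (iconj A) (axis 1 1)"
  have nA: "inorm (iconj A) = 5 ^ n" using Suc.prems by simp
  define T where "T u \<alpha> = (\<Sum>i\<in>I. cos (2 * pi * (u \<bullet> y i)) * damped_mean r L (r ^ Suc n *\<^sub>R act (imul \<alpha> A) (y i)))" for u \<alpha>
  have wy: "(r ^ n *\<^sub>R act A x) $ 1 = w \<bullet> x" for x
  proof -
    have "act A x $ 1 = act A x \<bullet> axis 1 1" by (simp add: inner_axis)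
    also have "\<dots> = x \<bullet> act (iconj A) (axis 1 1)" by (simp add: inner_rot uquat_iconj)
    finally show ?thesis by (simp add: w_def inner_commute)
  qed
  have split: "cos (2 * pi * (v \<bullet> x)) * damp (w \<bullet> x) =
      3 / 4 * cos (2 * pi * (v \<bullet> x)) + 1 / 8 * cos (2 * pi * ((v + w) \<bullet> x)) + 1 / 8 * cos (2 * pi * ((v - w) \<bullet> x))" for x
    by (simp add: damp_def inner_add_left inner_diff_left distrib_left right_diff_distrib cos_add cos_diff)
  have step: "cos (2 * pi * (v \<bullet> y i)) * damped_mean r (Suc L) (r ^ n *\<^sub>R act A (y i)) =
    (\<Sum>\<alpha>\<in>gens. (3 / 4 * cos (2 * pi * (v \<bullet> y i)) + 1 / 8 * cos (2 * pi * ((v + w) \<bullet> y i)) + 1 / 8 * cos (2 * pi * ((v - w) \<bullet> y i)))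
       * damped_mean r L (r ^ Suc n *\<^sub>R act (imul \<alpha> A) (y i))) / 6" for i
    unfolding split[symmetric] sum_distrib_left[symmetric] damped_mean.simps wy
    by (simp add: rot_scaleR act_imul)
  have eq: "(\<Sum>i\<in>I. cos (2 * pi * (v \<bullet> y i)) * damped_mean r (Suc L) (r ^ n *\<^sub>R act A (y i)))
     = (\<Sum>\<alpha>\<in>gens. 3 / 4 * T v \<alpha> + 1 / 8 * T (v + w) \<alpha> + 1 / 8 * T (v - w) \<alpha>) / 6"
    unfolding step sum_divide_distrib[symmetric]
    by (subst sum.swap) (simp add: T_def distrib_right sum.distrib sum_distrib_left mult.assoc)
  have fw: "odd_frequency q (Suc n) (v + w)" "odd_frequency q (Suc n) (v - w)"
    using odd_frequency_step[OF q nA Suc.prems(2), of 1] odd_frequency_step[OF q nA Suc.prems(2), of "-1"]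
    by (simp_all add: w_def r_def)
  have nz: "u \<noteq> 0" if "odd_frequency q (Suc n) u" for u
  proof -
    have "0 < 1 / (5 * real q) ^ Suc n" using q by simp
    then show ?thesis using odd_frequency_bounds(1)[OF q(2) that] by auto
  qed
  have b: "\<bar>T u \<alpha>\<bar> \<le> \<rho> + (if u = 0 then (3 / 4) ^ L * real (card I) else 0)"
    if "\<alpha> \<in> gens" "u = 0 \<or> odd_frequency q (Suc n) u" for u \<alpha>
    unfolding T_def r_def
    using that Suc.prems by (intro Suc.IH) (auto simp: inorm_imul inorm_gens)
  have v1: "v = 0 \<or> odd_frequency q (Suc n) v" using Suc.prems(2) odd_frequency_mono[OF q(2), of n v "Suc n"] by auto
  let ?B = "\<rho> + (if v = 0 then (3 / 4) ^ Suc L * real (card I) else 0)"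
  have "\<bar>\<Sum>\<alpha>\<in>gens. 3 / 4 * T v \<alpha> + 1 / 8 * T (v + w) \<alpha> + 1 / 8 * T (v - w) \<alpha>\<bar> \<le> (\<Sum>\<alpha>\<in>gens. ?B)"
  proof (rule order_trans[OF sum_abs sum_mono])
    fix \<alpha> assume a: "\<alpha> \<in> gens"
    let ?k = "if v = 0 then (3 / 4) ^ L * real (card I) else 0"
    have lin: "\<bar>3 / 4 * x + 1 / 8 * y + 1 / 8 * z\<bar> \<le> 3 / 4 * (\<rho> + k) + 1 / 4 * \<rho>"
      if "\<bar>x\<bar> \<le> \<rho> + k" "\<bar>y\<bar> \<le> \<rho>" "\<bar>z\<bar> \<le> \<rho>" for x y z k :: real
    proof -
      have "x \<le> \<rho> + k" "- x \<le> \<rho> + k" "y \<le> \<rho>" "- y \<le> \<rho>" "z \<le> \<rho>" "- z \<le> \<rho>"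
        using that by (auto simp: abs_le_iff)
      then show ?thesis by (intro abs_leI) (simp_all add: field_simps)
    qed
    have "\<bar>T (v + w) \<alpha>\<bar> \<le> \<rho>" "\<bar>T (v - w) \<alpha>\<bar> \<le> \<rho>" using b[OF a] fw nz by fastforce+
    then have "\<bar>3 / 4 * T v \<alpha> + 1 / 8 * T (v + w) \<alpha> + 1 / 8 * T (v - w) \<alpha>\<bar> \<le> 3 / 4 * (\<rho> + ?k) + 1 / 4 * \<rho>"
      by (intro lin b[OF a v1])
    also have "\<dots> = ?B" by (simp add: field_simps)
    finally show "\<bar>3 / 4 * T v \<alpha> + 1 / 8 * T (v + w) \<alpha> + 1 / 8 * T (v - w) \<alpha>\<bar> \<le> ?B" .
  qed
  then show ?case unfolding r_def[symmetric] eq by simp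
qed

lemma damped_mean_sum_le:
  fixes y :: "'i \<Rightarrow> real^3"
  assumes "even q" "q > 0"
    and "\<And>v. odd_frequency q L v \<Longrightarrow> \<bar>\<Sum>i\<in>I. cos (2 * pi * (v \<bullet> y i))\<bar> \<le> \<rho>" and "0 \<le> \<rho>"
  shows "(\<Sum>i\<in>I. damped_mean (1 - 1 / real q) L (y i)) \<le> \<rho> + (3 / 4) ^ L * real (card I)"
  using damped_mean_sum_twisted[where A = ione and n = 0 and v = 0 and L = L and N = L and q = q and I = I and y = y and \<rho> = \<rho>] assms
  by (simp add: ione_def[symmetric]) (simp add: ione_def)

section \<open>Packing in the unit sphere\<close>

definition separated :: "real \<Rightarrow> quat set \<Rightarrow> bool" where
  "separated \<delta> S \<longleftrightarrow> (\<forall>x\<in>S. \<forall>y\<in>S. x \<noteq> y \<longrightarrow> \<delta> \<le> dist x y)"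

lemma separated_subset: "separated \<delta> S \<Longrightarrow> T \<subseteq> S \<Longrightarrow> separated \<delta> T"
  unfolding separated_def by blast

text \<open>The balls of radius \<open>\<delta> / 2\<close> about the points are disjoint.\<close>
lemma card_separated_le:
  assumes S: "finite S" "separated \<delta> S" "S \<subseteq> cball x \<rho>" and "\<delta> > 0" "\<rho> \<ge> 0"
  shows "real (card S) * \<delta> ^ 4 \<le> (2 * \<rho> + \<delta>) ^ 4"
proof -
  have dim: "DIM(quat) = 4" by simp
  define V where "V = unit_ball_vol (real DIM(quat))"
  have V: "V > 0" unfolding V_def by (rule unit_ball_vol_pos) simp
  have vol: "measure lebesgue (ball c e) = V * e ^ 4" if "e \<ge> 0" for c :: quat and e
    using content_ball[OF that, of c] unfolding V_def dim by simp
  have volc: "measure lebesgue (cball c e) = V * e ^ 4" if "e \<ge> 0" for c :: quat and e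
    using content_cball[OF that, of c] unfolding V_def dim by simp
  have "real (card S) * (V * (\<delta> / 2) ^ 4) = (\<Sum>z\<in>S. measure lebesgue (ball z (\<delta> / 2)))"
    using vol[of "\<delta> / 2"] assms by simp
  also have "\<dots> = measure lebesgue (\<Union>z\<in>S. ball z (\<delta> / 2))"
  proof (rule measure_finite_Union[symmetric, OF S(1)])
    show "disjoint_family_on (\<lambda>z. ball z (\<delta> / 2)) S"
      unfolding disjoint_family_on_def
    proof (intro ballI impI equals0I)
      fix a b p assume ab: "a \<in> S" "b \<in> S" "a \<noteq> b" "p \<in> ball a (\<delta> / 2) \<inter> ball b (\<delta> / 2)"
      have "dist a b \<le> dist a p + dist b p" by (rule dist_triangle2)
      also have "\<dots> < \<delta>" using ab(4) by auto
      finally show False using S(2) ab by (force simp: separated_def)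
    qed
    show "emeasure lebesgue (ball z (\<delta> / 2)) \<noteq> \<infinity>" for z :: quat
      using fmeasurableD2[OF lmeasurable_ball[of z "\<delta> / 2"]] by (simp only: infinity_ennreal_def not_False_eq_True)
    show "(\<lambda>z. ball z (\<delta> / 2)) ` S \<subseteq> sets lebesgue" by (intro image_subsetI) simp
  qed
  also have "\<dots> \<le> measure lebesgue (cball x (\<rho> + \<delta> / 2))"
  proof (rule measure_mono_fmeasurable)
    show "(\<Union>z\<in>S. ball z (\<delta> / 2)) \<subseteq> cball x (\<rho> + \<delta> / 2)"
    proof
      fix p assume "p \<in> (\<Union>z\<in>S. ball z (\<delta> / 2))"
      then obtain z where z: "z \<in> S" "dist z p < \<delta> / 2" by auto
      have "dist x p \<le> dist x z + dist z p" by (rule dist_triangle)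
      then show "p \<in> cball x (\<rho> + \<delta> / 2)" using z S(3) by force
    qed
  qed (auto intro: S)
  also have "\<dots> = V * (\<rho> + \<delta> / 2) ^ 4" using assms by (intro volc) auto
  finally have "real (card S) * (\<delta> / 2) ^ 4 * V \<le> (\<rho> + \<delta> / 2) ^ 4 * V" by (simp add: mult_ac)
  then have "real (card S) * (\<delta> / 2) ^ 4 \<le> (\<rho> + \<delta> / 2) ^ 4" using V by simp
  then have "(real (card S) * (\<delta> / 2) ^ 4) * 2 ^ 4 \<le> (\<rho> + \<delta> / 2) ^ 4 * 2 ^ 4" by simp
  moreover have "(\<delta> / 2) ^ 4 * 2 ^ 4 = \<delta> ^ 4" unfolding power_mult_distrib[symmetric] by simp
  moreover have "(\<rho> + \<delta> / 2) ^ 4 * 2 ^ 4 = (2 * \<rho> + \<delta>) ^ 4"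
    unfolding power_mult_distrib[symmetric] by (simp add: algebra_simps)
  ultimately show ?thesis by (simp only: mult.assoc)
qed

text \<open>The packing bound in a ball of the four-dimensional space is applied to a thickening of \<open>Z\<close>:
  every point is moved to about \<open>1 / \<delta>\<close> positions along its ray, and the thickened slab to about
  \<open>1 / \<kappa>\<close> positions along its normal. All of these points remain separated.\<close>
lemma card_separated_slab_le:
  fixes a :: quat
  assumes Z: "finite Z" "separated \<delta> Z" "\<And>z. z \<in> Z \<Longrightarrow> norm z = 1"
    and \<delta>: "0 < \<delta>" "\<delta> \<le> 1" and \<kappa>: "\<delta> \<le> \<kappa>" "\<kappa> \<le> 1"
    and a: "norm a \<ge> 1" "\<And>z. z \<in> Z \<Longrightarrow> \<bar>a \<bullet> z\<bar> \<le> \<kappa>"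
  shows "real (card Z) \<le> 24010 * \<kappa> / \<delta> ^ 3"
proof -
  define b where "b = (1 / norm a) *\<^sub>R a"
  have a0: "norm a > 0" using a(1) by linarith
  have b: "norm b = 1" "b \<bullet> b = 1" using a0 by (auto simp: b_def dot_square_norm power2_eq_square field_simps)
  have bz: "\<bar>b \<bullet> z\<bar> \<le> \<kappa>" if "z \<in> Z" for z
  proof -
    have "\<bar>b \<bullet> z\<bar> = \<bar>a \<bullet> z\<bar> / norm a" using a0 by (simp add: b_def abs_mult)
    also have "\<dots> \<le> \<bar>a \<bullet> z\<bar>" using divide_left_mono[of 1 "norm a" "\<bar>a \<bullet> z\<bar>"] a(1) a0 by simp
    finally show ?thesis using a(2)[OF that] by simp
  qed
  define K where "K = nat \<lfloor>1 / \<delta>\<rfloor>"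
  define J where "J = nat \<lfloor>1 / (5 * \<kappa>)\<rfloor> + 1"
  have k0: "\<kappa> > 0" using \<kappa> \<delta> by linarith
  have d1: "1 \<le> 1 / \<delta>" using \<delta> by simp
  have K: "real K \<le> 1 / \<delta>" "1 / (2 * \<delta>) \<le> real K"
  proof -
    have f: "1 \<le> \<lfloor>1 / \<delta>\<rfloor>" using d1 by (simp add: le_floor_iff)
    then have Kf: "real K = real_of_int \<lfloor>1 / \<delta>\<rfloor>" unfolding K_def by (subst of_nat_nat) linarith+
    then show "real K \<le> 1 / \<delta>" by simp
    have "1 / \<delta> < real K + 1" "1 \<le> real K" using Kf f by linarith+
    then have "1 / \<delta> \<le> 2 * real K" by linarith
    then show "1 / (2 * \<delta>) \<le> real K" by simp
  qed
  have J: "real J \<ge> 1 / (5 * \<kappa>)" "real J - 1 \<le> 1 / (5 * \<kappa>)"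
  proof -
    have "0 \<le> \<lfloor>1 / (5 * \<kappa>)\<rfloor>" using k0 by simp
    then have "real J = real_of_int \<lfloor>1 / (5 * \<kappa>)\<rfloor> + 1"
      unfolding J_def of_nat_add of_nat_1 by (subst of_nat_nat) linarith+
    then show "real J \<ge> 1 / (5 * \<kappa>)" "real J - 1 \<le> 1 / (5 * \<kappa>)" by linarith+
  qed
  \<comment> \<open>The thickened slab has half-width at most \<open>2 * \<kappa>\<close>, so shifts by \<open>5 * \<kappa>\<close> keep its copies \<open>\<kappa>\<close>
    apart.\<close>
  define P where "P = (\<lambda>(z, k::nat, j::nat). (1 + real k * \<delta>) *\<^sub>R z + (real j * (5 * \<kappa>)) *\<^sub>R b)"
  define D where "D = Z \<times> {..<K} \<times> {..<J}"
  have kd: "0 \<le> real k * \<delta> \<and> real k * \<delta> \<le> 1" if "k < K" for k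
  proof -
    have "real k * \<delta> \<le> (1 / \<delta>) * \<delta>" using that K(1) \<delta> by (intro mult_right_mono) auto
    then show ?thesis using \<delta> by simp
  qed
  have sep: "\<delta> \<le> dist (P u) (P u')" if u: "u \<in> D" "u' \<in> D" "u \<noteq> u'" for u u'
  proof -
    obtain z k j z' k' j' where uu: "u = (z, k, j)" "u' = (z', k', j')" by (metis prod_cases3)
    have mem: "z \<in> Z" "k < K" "j < J" "z' \<in> Z" "k' < K" "j' < J" using u uu by (auto simp: D_def)
    show ?thesis
    proof (cases "j = j'")
      case False
      have "(P u - P u') \<bullet> b = ((1 + real k * \<delta>) * (b \<bullet> z) - (1 + real k' * \<delta>) * (b \<bullet> z')) + (real j - real j') * (5 * \<kappa>)"
        by (simp add: P_def uu inner_diff_left inner_add_left b inner_commute algebra_simps)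
      moreover have "\<bar>(1 + real i * \<delta>) * (b \<bullet> y)\<bar> \<le> 2 * \<kappa>" if "y \<in> Z" "i < K" for y i
        using kd[OF that(2)] bz[OF that(1)] by (simp only: abs_mult) (intro mult_mono; simp)
      then have "\<bar>(1 + real k * \<delta>) * (b \<bullet> z)\<bar> \<le> 2 * \<kappa>" "\<bar>(1 + real k' * \<delta>) * (b \<bullet> z')\<bar> \<le> 2 * \<kappa>"
        using mem by blast+
      moreover have "5 * \<kappa> \<le> \<bar>(real j - real j') * (5 * \<kappa>)\<bar>"
      proof -
        have "1 \<le> \<bar>real j - real j'\<bar>" using False by (cases "j < j'") auto
        then have "1 * (5 * \<kappa>) \<le> \<bar>real j - real j'\<bar> * (5 * \<kappa>)" using k0 by (intro mult_right_mono) auto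
        then show ?thesis using k0 by (simp add: abs_mult)
      qed
      ultimately have "\<kappa> \<le> \<bar>(P u - P u') \<bullet> b\<bar>" by linarith
      also have "\<dots> \<le> norm (P u - P u')" using Cauchy_Schwarz_ineq2[of "P u - P u'" b] b by simp
      finally show ?thesis using \<kappa> by (simp add: dist_norm)
    next
      case True
      have d: "P u - P u' = (1 + real k * \<delta>) *\<^sub>R z - (1 + real k' * \<delta>) *\<^sub>R z'" by (simp add: P_def uu True)
      show ?thesis
      proof (cases "k = k'")
        case True
        then have "z \<noteq> z'" using \<open>j = j'\<close> u uu by auto
        then have "\<delta> \<le> norm (z - z')" using Z(2) mem by (simp add: separated_def dist_norm)
        moreover have "norm (P u - P u') = (1 + real k * \<delta>) * norm (z - z')"
          using \<delta> unfolding d True by (simp flip: scaleR_diff_right)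
        moreover have "1 * norm (z - z') \<le> (1 + real k * \<delta>) * norm (z - z')"
          using \<delta> by (intro mult_right_mono) auto
        ultimately show ?thesis by (simp add: dist_norm)
      next
        case False
        have "\<bar>norm ((1 + real k * \<delta>) *\<^sub>R z) - norm ((1 + real k' * \<delta>) *\<^sub>R z')\<bar> \<le> norm (P u - P u')"
          unfolding d by (rule norm_triangle_ineq3)
        moreover have "norm ((1 + real i * \<delta>) *\<^sub>R y) = 1 + real i * \<delta>" if "y \<in> Z" for y i
          using Z(3)[OF that] \<delta> by simp
        ultimately have "\<bar>(real k - real k') * \<delta>\<bar> \<le> norm (P u - P u')" using mem by (simp add: algebra_simps)
        moreover have "\<delta> \<le> \<bar>(real k - real k') * \<delta>\<bar>"
        proof -
          have "1 \<le> \<bar>real k - real k'\<bar>" using False by (cases "k < k'") auto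
          then have "1 * \<delta> \<le> \<bar>real k - real k'\<bar> * \<delta>" using \<delta> by (intro mult_right_mono) auto
          then show ?thesis using \<delta> by (simp add: abs_mult)
        qed
        ultimately show ?thesis by (simp add: dist_norm)
      qed
    qed
  qed
  have finD: "finite D" using Z by (simp add: D_def)
  have inj: "inj_on P D"
  proof (rule inj_onI, rule ccontr)
    fix u u' assume "u \<in> D" "u' \<in> D" "P u = P u'" "u \<noteq> u'"
    then show False using sep[of u u'] \<delta> by simp
  qed
  have "real (card (P ` D)) * \<delta> ^ 4 \<le> (2 * 3 + \<delta>) ^ 4"
  proof (rule card_separated_le[where x = 0])
    show "separated \<delta> (P ` D)" unfolding separated_def using sep by blast
    show "P ` D \<subseteq> cball 0 3"
    proof
      fix p assume "p \<in> P ` D"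
      then obtain z k j where p: "p = P (z, k, j)" "z \<in> Z" "k < K" "j < J" by (auto simp: D_def)
      have "real j * (5 * \<kappa>) \<le> (1 / (5 * \<kappa>)) * (5 * \<kappa>)" using p(4) J(2) k0 by (intro mult_right_mono) auto
      then have "real j * (5 * \<kappa>) \<le> 1" using k0 by simp
      moreover have "norm p \<le> norm ((1 + real k * \<delta>) *\<^sub>R z) + norm ((real j * (5 * \<kappa>)) *\<^sub>R b)"
        unfolding p(1) P_def prod.case by (rule norm_triangle_ineq)
      moreover have "norm ((1 + real k * \<delta>) *\<^sub>R z) = 1 + real k * \<delta>" "norm ((real j * (5 * \<kappa>)) *\<^sub>R b) = real j * (5 * \<kappa>)"
        using Z(3)[OF p(2)] b \<delta> k0 by simp_all
      ultimately show "p \<in> cball 0 3" using kd[OF p(3)] by (simp add: dist_norm)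
    qed
  qed (use finD \<delta> in auto)
  also have "\<dots> \<le> 7 ^ 4" using \<delta> by (intro power_mono) auto
  finally have 1: "real (card D) * \<delta> ^ 4 \<le> 2401" using card_image[OF inj] by simp
  have "real (card Z) * ((1 / (2 * \<delta>)) * (1 / (5 * \<kappa>))) \<le> real (card Z) * (real K * real J)"
    using K(2) J(1) \<delta> k0 by (intro mult_left_mono mult_mono) auto
  also have "\<dots> = real (card D)" by (simp add: D_def card_cartesian_product)
  finally have "real (card Z) * ((1 / (2 * \<delta>)) * (1 / (5 * \<kappa>))) * \<delta> ^ 4 \<le> 2401"
    using 1 \<delta> by (meson mult_right_mono order_trans zero_le_power less_imp_le)
  then have "real (card Z) * \<delta> ^ 3 / (10 * \<kappa>) \<le> 2401" using \<delta> by (simp add: power4_eq_xxxx power3_eq_cube mult_ac)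
  then have "real (card Z) * \<delta> ^ 3 \<le> 24010 * \<kappa>" using k0 by (simp add: divide_le_eq)
  then show ?thesis using \<delta> by (simp add: pos_le_divide_eq)
qed

text \<open>For \<open>\<kappa> = 1\<close> the slab is the whole sphere.\<close>
lemma card_separated_sphere_le:
  assumes Z: "finite Z" "separated \<delta> Z" "\<And>z. z \<in> Z \<Longrightarrow> norm z = 1"
    and \<delta>: "0 < \<delta>" "\<delta> \<le> 1"
  shows "real (card Z) \<le> 24010 / \<delta> ^ 3"
proof -
  have "\<bar>((1, 0) :: quat) \<bullet> z\<bar> \<le> 1" if "z \<in> Z" for z
    using Cauchy_Schwarz_ineq2[of "(1, 0) :: quat" z] Z(3)[OF that] by (simp add: norm_Pair)
  then show ?thesis
    using card_separated_slab_le[OF Z \<delta>, of 1 "(1, 0)"] \<delta> by (simp add: norm_Pair)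
qed

definition sphere_net :: "real \<Rightarrow> quat set \<Rightarrow> bool" where
  "sphere_net \<delta> Z \<longleftrightarrow> finite Z \<and> separated \<delta> Z \<and> (\<forall>z\<in>Z. norm z = 1) \<and>
     (\<forall>q. norm q = 1 \<longrightarrow> (\<exists>z\<in>Z. dist q z < \<delta>))"

text \<open>The packing bound allows for a separated set of maximal cardinality, and maximality makes it
  a net.\<close>
lemma sphere_net_exists:
  assumes \<delta>: "0 < \<delta>" "\<delta> \<le> 1"
  obtains Z where "sphere_net \<delta> Z"
proof -
  define P where "P n \<longleftrightarrow> (\<exists>Z. finite Z \<and> separated \<delta> Z \<and> (\<forall>z\<in>Z. norm z = 1) \<and> card Z = n)" for n
  have "P 0" unfolding P_def by (intro exI[of _ "{}"]) (auto simp: separated_def)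
  moreover have "n \<le> nat \<lfloor>24010 / \<delta> ^ 3\<rfloor>" if "P n" for n
  proof -
    from that obtain Z where Z: "finite Z" "separated \<delta> Z" "\<forall>z\<in>Z. norm z = 1" "card Z = n" unfolding P_def by blast
    have "real (card Z) \<le> 24010 / \<delta> ^ 3" using Z by (intro card_separated_sphere_le[OF _ _ _ \<delta>]) blast+
    then show ?thesis unfolding Z(4) by (rule le_nat_floor)
  qed
  ultimately obtain n where n: "P n" "\<And>m. P m \<Longrightarrow> m \<le> n"
    using ex_has_greatest_nat[of P 0 "\<lambda>n. n" "Suc (nat \<lfloor>24010 / \<delta> ^ 3\<rfloor>)"] le_imp_less_Suc by blast
  obtain Z where Z: "finite Z" "separated \<delta> Z" "\<forall>z\<in>Z. norm z = 1" "card Z = n" using n(1) by (auto simp: P_def)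
  have "\<exists>z\<in>Z. dist q z < \<delta>" if q: "norm q = 1" for q
  proof (rule ccontr)
    assume "\<not> (\<exists>z\<in>Z. dist q z < \<delta>)"
    then have far: "\<delta> \<le> dist q z" if "z \<in> Z" for z using that by force
    then have "q \<notin> Z" using \<delta> by fastforce
    moreover have "separated \<delta> (insert q Z)" using Z(2) far by (auto simp: separated_def dist_commute)
    ultimately have "P (Suc n)" unfolding P_def using Z q by (intro exI[of _ "insert q Z"]) auto
    then show False using n(2) by force
  qed
  then show ?thesis using Z that[of Z] by (auto simp: sphere_net_def)
qed

lemma orthogonal_unit_exists:
  obtains d :: "real^3" where "norm d = 1" "d \<bullet> c = 0"
proof -
  obtain y :: "real^3" where y: "y \<noteq> 0" "orthogonal c y"
    using orthogonal_to_vector_exists[of c] by auto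
  show ?thesis
    by (rule that[of "(1 / norm y) *\<^sub>R y"]) (use y in \<open>auto simp: orthogonal_def inner_commute\<close>)
qed

text \<open>A unit quaternion \<open>z\<close> rotates \<open>a\<close> to \<open>b\<close> if and only if the linear map \<open>z \<mapsto> z a - b z\<close>
  vanishes at \<open>z\<close>. It is enough to find one functional of norm at least \<open>\<surd>2\<close> among its components:
  the real part has norm \<open>|a - b|\<close>, and the component along a direction orthogonal to \<open>a + b\<close> has
  norm at least \<open>|a + b|\<close>. One of these two numbers is large enough.\<close>
lemma rotation_to_line_in_slab:
  fixes a b :: "real^3"
  assumes ab: "norm a = 1" "norm b = 1"
  obtains c :: quat where "norm c \<ge> 1"
    "\<And>z \<kappa>. norm z = 1 \<Longrightarrow> norm (rot z a - b) \<le> sqrt 2 * \<kappa> \<Longrightarrow> \<bar>c \<bullet> z\<bar> \<le> \<kappa>"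
proof -
  have L: "norm (qmult z (0, a) - qmult (0, b) z) = norm (rot z a - b)" if z: "norm z = 1" for z
  proof -
    have "(0, rot z a - b) = qmult (qmult z (0, a) - qmult (0, b) z) (qconj z)"
    proof -
      have "qmult (qmult (0, b) z) (qconj z) = (0, b)" using z by (simp add: qmult_assoc qmult_qconj)
      then show ?thesis by (simp add: qmult_diff_left qmult_rot)
    qed
    then have "norm (0::real, rot z a - b) = norm (qmult z (0, a) - qmult (0, b) z) * norm (qconj z)"
      by (metis norm_qmult)
    then show ?thesis using z by (simp add: norm_Pair)
  qed
  have "(norm (a - b))\<^sup>2 + (norm (a + b))\<^sup>2 = 4"
    using ab by (simp add: power2_norm_eq_inner inner_diff_left inner_diff_right inner_add_left inner_add_right inner_commute)
      (simp add: dot_square_norm)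
  then consider "2 \<le> (norm (a - b))\<^sup>2" | "2 \<le> (norm (a + b))\<^sup>2" by linarith
  then show ?thesis
  proof cases
    case 1
    have n: "sqrt 2 \<le> norm (a - b)" using 1 real_le_lsqrt[of 2] by (intro real_le_lsqrt) auto
    show ?thesis
    proof (rule that[of "(1 / sqrt 2) *\<^sub>R (0, b - a)"])
      show "1 \<le> norm ((1 / sqrt 2) *\<^sub>R (0::real, b - a))"
        using n by (simp add: norm_Pair norm_minus_commute)
      fix z \<kappa> assume z: "norm z = 1" "norm (rot z a - b) \<le> sqrt 2 * \<kappa>"
      have "(0, b - a) \<bullet> z = fst (qmult z (0, a) - qmult (0, b) z)"
        by (simp add: qmult_def inner_prod_def inner_diff_left inner_diff_right inner_commute)
      then have "\<bar>(0, b - a) \<bullet> z\<bar> = norm (fst (qmult z (0, a) - qmult (0, b) z))" by (simp only: real_norm_def)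
      also have "\<dots> \<le> norm (qmult z (0, a) - qmult (0, b) z)" using norm_fst_le[of "fst (qmult z (0, a) - qmult (0, b) z)" "snd (qmult z (0, a) - qmult (0, b) z)"] by (simp only: prod.collapse)
      also have "\<dots> = norm (rot z a - b)" by (rule L[OF z(1)])
      finally have "\<bar>(0, b - a) \<bullet> z\<bar> \<le> norm (rot z a - b)" .
      then have "\<bar>(0, b - a) \<bullet> z\<bar> \<le> sqrt 2 * \<kappa>" using z(2) by linarith
      then show "\<bar>((1 / sqrt 2) *\<^sub>R (0, b - a)) \<bullet> z\<bar> \<le> \<kappa>"
        by (simp only: inner_scaleR_left abs_mult) (simp add: divide_le_eq mult.commute)
    qed
  next
    case 2
    have n: "sqrt 2 \<le> norm (a + b)" using 2 by (intro real_le_lsqrt) auto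
    obtain d where d: "norm d = 1" "d \<bullet> (a + b) = 0" using orthogonal_unit_exists by blast
    define c where "c = (d \<bullet> (a - b), cross3 (a + b) d)"
    have "(norm (cross3 (a + b) d))\<^sup>2 = (norm (a + b))\<^sup>2"
      using norm_cross[of "a + b" d] d by (simp add: inner_commute)
    then have "norm (cross3 (a + b) d) = norm (a + b)" by (metis norm_ge_zero power2_eq_imp_eq)
    then have nc: "sqrt 2 \<le> norm c" using n norm_snd_le[of "snd c" "fst c"] by (simp add: c_def)
    show ?thesis
    proof (rule that[of "(1 / sqrt 2) *\<^sub>R c"])
      show "1 \<le> norm ((1 / sqrt 2) *\<^sub>R c)" using nc by simp
      fix z \<kappa> assume z: "norm z = 1" "norm (rot z a - b) \<le> sqrt 2 * \<kappa>"
      have "c \<bullet> z = d \<bullet> snd (qmult z (0, a) - qmult (0, b) z)"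
        by (simp add: c_def quat_simps inner_prod_def algebra_simps)
      also have "\<bar>\<dots>\<bar> \<le> norm d * norm (snd (qmult z (0, a) - qmult (0, b) z))" by (rule Cauchy_Schwarz_ineq2)
      also have "\<dots> = norm (snd (qmult z (0, a) - qmult (0, b) z))" by (simp only: d(1) mult_1)
      also have "\<dots> \<le> norm (qmult z (0, a) - qmult (0, b) z)" using norm_snd_le[of "snd (qmult z (0, a) - qmult (0, b) z)" "fst (qmult z (0, a) - qmult (0, b) z)"] by (simp only: prod.collapse)
      also have "\<dots> = norm (rot z a - b)" by (rule L[OF z(1)])
      finally have "\<bar>c \<bullet> z\<bar> \<le> sqrt 2 * \<kappa>" using z(2) by linarith
      then show "\<bar>((1 / sqrt 2) *\<^sub>R c) \<bullet> z\<bar> \<le> \<kappa>"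
        by (simp only: inner_scaleR_left abs_mult) (simp add: divide_le_eq mult.commute)
    qed
  qed
qed

text \<open>A small cross product means that \<open>rot z \<xi>\<close> is close to the direction of \<open>v\<close> or of \<open>- v\<close>, and
  both confine \<open>z\<close> to a slab.\<close>
lemma card_near_line_le:
  fixes v \<xi> :: "real^3"
  assumes Z: "finite Z" "separated \<delta> Z" "\<And>z. z \<in> Z \<Longrightarrow> norm z = 1"
    and \<delta>: "0 < \<delta>" "\<delta> \<le> 1" and \<kappa>: "\<delta> \<le> \<kappa>" "\<kappa> \<le> 1" and nz: "v \<noteq> 0" "\<xi> \<noteq> 0"
  shows "real (card {z\<in>Z. norm (cross3 (rot z \<xi>) v) \<le> \<kappa> * norm \<xi> * norm v}) \<le> 48020 * \<kappa> / \<delta> ^ 3"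
proof -
  define a where "a = (1 / norm \<xi>) *\<^sub>R \<xi>"
  define b where "b = (1 / norm v) *\<^sub>R v"
  have ab: "norm a = 1" "norm b = 1" "norm (- b) = 1" using nz by (simp_all add: a_def b_def)
  obtain c1 where c1: "norm c1 \<ge> 1" "\<And>z \<kappa>. norm z = 1 \<Longrightarrow> norm (rot z a - b) \<le> sqrt 2 * \<kappa> \<Longrightarrow> \<bar>c1 \<bullet> z\<bar> \<le> \<kappa>"
    using rotation_to_line_in_slab[OF ab(1,2)] by blast
  obtain c2 where c2: "norm c2 \<ge> 1" "\<And>z \<kappa>. norm z = 1 \<Longrightarrow> norm (rot z a - - b) \<le> sqrt 2 * \<kappa> \<Longrightarrow> \<bar>c2 \<bullet> z\<bar> \<le> \<kappa>"
    using rotation_to_line_in_slab[OF ab(1,3)] by blast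
  define Z1 where "Z1 = {z\<in>Z. \<bar>c1 \<bullet> z\<bar> \<le> \<kappa>}"
  define Z2 where "Z2 = {z\<in>Z. \<bar>c2 \<bullet> z\<bar> \<le> \<kappa>}"
  have "{z\<in>Z. norm (cross3 (rot z \<xi>) v) \<le> \<kappa> * norm \<xi> * norm v} \<subseteq> Z1 \<union> Z2"
  proof
    fix z assume "z \<in> {z\<in>Z. norm (cross3 (rot z \<xi>) v) \<le> \<kappa> * norm \<xi> * norm v}"
    then have z: "z \<in> Z" "norm z = 1" "norm (cross3 (rot z \<xi>) v) \<le> \<kappa> * norm \<xi> * norm v" using Z(3) by auto
    define y where "y = rot z a"
    have ny: "norm y = 1" using z ab by (simp add: y_def)
    have "cross3 (rot z \<xi>) v = (norm \<xi> * norm v) *\<^sub>R cross3 y b"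
      using nz by (simp add: y_def a_def b_def rot_scaleR cross_mult_left cross_mult_right)
    then have "norm (cross3 y b) * (norm \<xi> * norm v) \<le> \<kappa> * (norm \<xi> * norm v)" using z(3) by (simp add: mult_ac)
    then have cr: "norm (cross3 y b) \<le> \<kappa>" using nz by simp
    have "(norm (cross3 y b))\<^sup>2 = 1 - (y \<bullet> b)\<^sup>2"
      using norm_cross[of y b] ny ab by simp
    moreover have "(norm (cross3 y b))\<^sup>2 \<le> \<kappa>\<^sup>2" using cr by (intro power_mono) auto
    ultimately have k1: "1 - \<kappa>\<^sup>2 \<le> (y \<bullet> b)\<^sup>2" by linarith
    have yb1: "\<bar>y \<bullet> b\<bar> \<le> 1" using Cauchy_Schwarz_ineq2[of y b] ny ab by simp
    have "(y \<bullet> b)\<^sup>2 \<le> \<bar>y \<bullet> b\<bar>" using yb1 by (metis abs_ge_zero mult_left_le power2_abs power2_eq_square)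
    with k1 have k2: "1 - \<kappa>\<^sup>2 \<le> \<bar>y \<bullet> b\<bar>" by linarith
    have exp: "(norm (y - s *\<^sub>R b))\<^sup>2 = 2 - 2 * s * (y \<bullet> b)" if "s\<^sup>2 = 1" for s
    proof -
      have "y \<bullet> y = 1" "b \<bullet> b = 1" using ny ab by (simp_all add: dot_square_norm)
      moreover have "(norm (y - s *\<^sub>R b))\<^sup>2 = y \<bullet> y - 2 * s * (y \<bullet> b) + s\<^sup>2 * (b \<bullet> b)"
        unfolding power2_norm_eq_inner
        by (simp add: inner_diff_left inner_diff_right inner_commute algebra_simps power2_eq_square)
      ultimately show ?thesis using that by simp
    qed
    have sq: "norm x \<le> sqrt 2 * \<kappa>" if "(norm x)\<^sup>2 \<le> 2 * \<kappa>\<^sup>2" for x :: "real^3"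
    proof (rule power2_le_imp_le)
      have "(sqrt 2 * \<kappa>)\<^sup>2 = 2 * \<kappa>\<^sup>2" by (simp only: power_mult_distrib real_sqrt_pow2)
      then show "(norm x)\<^sup>2 \<le> (sqrt 2 * \<kappa>)\<^sup>2" using that by linarith
      have "0 \<le> \<kappa>" using \<kappa> \<delta> by linarith
      then show "0 \<le> sqrt 2 * \<kappa>" by simp
    qed
    show "z \<in> Z1 \<union> Z2"
    proof (cases "y \<bullet> b \<ge> 0")
      case True
      then have "(norm (y - b))\<^sup>2 \<le> 2 * \<kappa>\<^sup>2" using exp[of 1] k2 by simp
      then have "\<bar>c1 \<bullet> z\<bar> \<le> \<kappa>" using c1(2)[OF z(2)] sq y_def by blast
      then show ?thesis using z by (simp add: Z1_def)
    next
      case False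
      then have "(norm (y - - b))\<^sup>2 \<le> 2 * \<kappa>\<^sup>2" using exp[of "-1"] k2 by simp
      then have "\<bar>c2 \<bullet> z\<bar> \<le> \<kappa>" using c2(2)[OF z(2)] sq y_def by blast
      then show ?thesis using z by (simp add: Z2_def)
    qed
  qed
  then have "card {z\<in>Z. norm (cross3 (rot z \<xi>) v) \<le> \<kappa> * norm \<xi> * norm v} \<le> card (Z1 \<union> Z2)"
    using Z(1) by (intro card_mono) (auto simp: Z1_def Z2_def)
  also have "\<dots> \<le> card Z1 + card Z2" by (rule card_Un_le)
  finally have "real (card {z\<in>Z. norm (cross3 (rot z \<xi>) v) \<le> \<kappa> * norm \<xi> * norm v}) \<le> real (card Z1) + real (card Z2)"
    by linarith
  moreover have "real (card Z1) \<le> 24010 * \<kappa> / \<delta> ^ 3"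
    using Z c1 \<delta> \<kappa> by (intro card_separated_slab_le[where a = c1]) (auto simp: Z1_def intro: separated_subset)
  moreover have "real (card Z2) \<le> 24010 * \<kappa> / \<delta> ^ 3"
    using Z c2 \<delta> \<kappa> by (intro card_separated_slab_le[where a = c2]) (auto simp: Z2_def intro: separated_subset)
  ultimately show ?thesis by simp
qed

section \<open>Damped averages over a net\<close>

lemma sin_ge_half: "0 \<le> y \<Longrightarrow> y \<le> 1 \<Longrightarrow> y / 2 \<le> sin (y::real)"
proof (cases "y = 0")
  case False
  assume y: "0 \<le> y" "y \<le> 1"
  obtain c where c: "0 < c" "c < y" "sin y - sin 0 = (y - 0) * cos c"
    using MVT2[of 0 y sin cos] y False by (auto intro!: derivative_eq_intros)
  have "1 < pi / 3" using pi_gt3 by simp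
  then have "cos (pi / 3) \<le> cos c" using c y by (intro cos_monotone_0_pi_le) auto
  then have "1 / 2 \<le> cos c" by (simp add: cos_60)
  then have "y * (1 / 2) \<le> y * cos c" using y by (intro mult_left_mono) auto
  then show ?thesis using c by simp
qed simp

lemma norm_sum_cis_le:
  fixes x :: real
  assumes x: "x \<noteq> 0" "\<bar>x\<bar> \<le> 1 / 4"
  shows "cmod (\<Sum>k<n. cis (2 * pi * x * real k)) \<le> 1 / \<bar>x\<bar>"
proof -
  define z where "z = cis (2 * pi * x)"
  have zk: "cis (2 * pi * x * real k) = z ^ k" for k
    unfolding z_def Complex.DeMoivre by (rule arg_cong[of _ _ cis]) simp
  have half: "\<bar>x\<bar> \<le> \<bar>sin (pi * x)\<bar>"
  proof -
    have "pi * \<bar>x\<bar> \<le> 4 * (1 / 4)" using x pi_less_4 by (intro mult_mono) auto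
    then have "pi * \<bar>x\<bar> / 2 \<le> sin (pi * \<bar>x\<bar>)" by (intro sin_ge_half) auto
    moreover have "2 * \<bar>x\<bar> \<le> pi * \<bar>x\<bar>" using pi_gt3 by (intro mult_right_mono) auto
    moreover have "sin (pi * \<bar>x\<bar>) \<le> \<bar>sin (pi * x)\<bar>" by (cases "x \<ge> 0") auto
    ultimately show ?thesis by linarith
  qed
  have "(cmod (1 - z))\<^sup>2 = (2 * sin (pi * x))\<^sup>2"
  proof -
    have "(cmod (1 - z))\<^sup>2 = (1 - cos (2 * pi * x))\<^sup>2 + (sin (2 * pi * x))\<^sup>2"
      by (simp add: z_def cmod_power2)
    also have "\<dots> = 2 - 2 * cos (2 * pi * x)"
      using sin_cos_squared_add[of "2 * pi * x"] by (simp add: power2_eq_square algebra_simps)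
    also have "\<dots> = (2 * sin (pi * x))\<^sup>2"
      using cos_double_sin[of "pi * x"] by (simp add: power2_eq_square mult.assoc)
    finally show ?thesis .
  qed
  then have c: "cmod (1 - z) = 2 * \<bar>sin (pi * x)\<bar>"
    by (metis abs_mult abs_numeral abs_power2 norm_ge_zero power2_abs power2_eq_imp_eq abs_ge_zero)
  then have c2: "2 * \<bar>x\<bar> \<le> cmod (1 - z)" using half by simp
  then have "z \<noteq> 1" using x by auto
  then have "(\<Sum>k<n. z ^ k) = (1 - z ^ n) / (1 - z)" by (simp add: sum_gp_strict)
  then have "cmod (\<Sum>k<n. z ^ k) = cmod (1 - z ^ n) / cmod (1 - z)" by (simp add: norm_divide)
  also have "\<dots> \<le> 2 / (2 * \<bar>x\<bar>)"
  proof (rule frac_le)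
    have "cmod (1 - z ^ n) \<le> cmod 1 + cmod (z ^ n)" by (rule norm_triangle_ineq4)
    then show "cmod (1 - z ^ n) \<le> 2" by (simp add: z_def norm_power)
  qed (use c2 x in auto)
  finally show ?thesis by (simp add: zk)
qed

text \<open>The phase is affine in \<open>(i, j, k)\<close>, so the exponential sum is a product of three geometric
  sums.\<close>
lemma grid_cos_sum_le:
  fixes a b c d :: real and n :: nat
  defines "E \<equiv> \<lambda>x. cmod (\<Sum>k<n. cis (2 * pi * x * real k))"
  shows "\<bar>\<Sum>(i, j, k)\<in>{..<n} \<times> {..<n} \<times> {..<n}. cos (2 * pi * (d + a * real i + b * real j + c * real k))\<bar>
    \<le> E a * E b * E c"
proof -
  let ?s = "\<lambda>x. \<Sum>k<n. cis (2 * pi * x * real k)"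
  have "(\<Sum>(i, j, k)\<in>{..<n} \<times> {..<n} \<times> {..<n}. cis (2 * pi * (d + a * real i + b * real j + c * real k)))
    = (\<Sum>i<n. \<Sum>j<n. \<Sum>k<n. cis (2 * pi * d) * (cis (2 * pi * a * real i) * (cis (2 * pi * b * real j) * cis (2 * pi * c * real k))))"
    unfolding sum.cartesian_product[symmetric]
    by (intro sum.cong refl) (simp add: cis_mult algebra_simps)
  also have "\<dots> = cis (2 * pi * d) * (?s a * (?s b * ?s c))"
    by (simp add: sum_distrib_left sum_distrib_right) (simp add: sum_distrib_left[symmetric] sum_distrib_right[symmetric])
  finally have eq: "(\<Sum>(i, j, k)\<in>{..<n} \<times> {..<n} \<times> {..<n}. cis (2 * pi * (d + a * real i + b * real j + c * real k)))
    = cis (2 * pi * d) * (?s a * (?s b * ?s c))" .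
  have "(\<Sum>(i, j, k)\<in>{..<n} \<times> {..<n} \<times> {..<n}. cos (2 * pi * (d + a * real i + b * real j + c * real k)))
    = Re (\<Sum>(i, j, k)\<in>{..<n} \<times> {..<n} \<times> {..<n}. cis (2 * pi * (d + a * real i + b * real j + c * real k)))"
    unfolding Re_sum by (intro sum.cong) auto
  then show ?thesis unfolding eq E_def
    using abs_Re_le_cmod[of "cis (2 * pi * d) * (?s a * (?s b * ?s c))"] by (simp add: norm_mult mult.assoc)
qed

lemma norm_sum_cis_trivial: "cmod (\<Sum>k<n. cis (2 * pi * x * real k)) \<le> real n"
  using norm_sum[of "\<lambda>k. cis (2 * pi * x * real k)" "{..<n}"] by simp

text \<open>To first order in \<open>s\<close> its rotation is \<open>y \<mapsto> y + s \<times> y\<close>.\<close>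
definition rotation_step :: "real^3 \<Rightarrow> quat" where
  "rotation_step s = (1 / sqrt (1 + (norm s)\<^sup>2 / 4)) *\<^sub>R (1, (1 / 2) *\<^sub>R s)"

lemma norm_rotation_step [simp]: "norm (rotation_step s) = 1"
proof -
  have n: "norm ((1::real), (1 / 2) *\<^sub>R s) = sqrt (1 + (norm s)\<^sup>2 / 4)"
    by (simp add: norm_Pair power_divide)
  have "sqrt (1 + (norm s)\<^sup>2 / 4) > 0" by (simp add: add_pos_nonneg)
  then show ?thesis unfolding rotation_step_def norm_scaleR n by simp
qed

lemma rotation_step_approx:
  assumes s: "norm s \<le> 2"
  shows "norm (rot (rotation_step s) y - (y + cross3 s y)) \<le> 2 * (norm s)\<^sup>2 * norm y"
proof -
  define k where "k = (norm s)\<^sup>2 / 4"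
  have k: "0 \<le> k" by (simp add: k_def)
  have ss: "s \<bullet> s = 4 * k" by (simp add: k_def dot_square_norm)
  define N where "N = (1 - k) *\<^sub>R y + ((s \<bullet> y) / 2) *\<^sub>R s + cross3 s y"
  have ss': "s $ 1 * s $ 1 + s $ 2 * s $ 2 + s $ 3 * s $ 3 = 4 * k"
    using ss by (simp add: inner_vec_def sum_3)
  have "rot (1, (1 / 2) *\<^sub>R s) y = N"
  proof -
    have keq: "k = (s $ 1 * s $ 1 + s $ 2 * s $ 2 + s $ 3 * s $ 3) / 4" using ss' by simp
    show ?thesis unfolding N_def keq
      by (simp add: rot_def quat_simps field_simps)
  qed
  then have R: "rot (rotation_step s) y = (1 / (1 + k)) *\<^sub>R N"
    unfolding rotation_step_def rot_scale_quat k_def[symmetric] using k by (simp add: power_divide)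
  define M where "M = (- (k + k)) *\<^sub>R y + ((s \<bullet> y) / 2) *\<^sub>R s - k *\<^sub>R cross3 s y"
  have "N = (1 + k) *\<^sub>R (y + cross3 s y) + M" by (simp add: N_def M_def vec_eq_iff algebra_simps)
  then have "(1 / (1 + k)) *\<^sub>R N = (y + cross3 s y) + (1 / (1 + k)) *\<^sub>R M"
    using k by (simp only: scaleR_add_right scaleR_scaleR) simp
  then have "rot (rotation_step s) y - (y + cross3 s y) = (1 / (1 + k)) *\<^sub>R M" using R by simp
  then have "norm (rot (rotation_step s) y - (y + cross3 s y)) = norm M / (1 + k)" using k by simp
  also have "\<dots> \<le> norm M / 1" using k by (intro divide_left_mono) auto
  also have "norm M \<le> norm ((- (k + k)) *\<^sub>R y) + norm (((s \<bullet> y) / 2) *\<^sub>R s) + norm (k *\<^sub>R cross3 s y)"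
    unfolding M_def by (meson norm_triangle_ineq norm_triangle_ineq4 order_trans add_right_mono)
  also have "\<dots> \<le> 2 * k * norm y + (norm s * norm y / 2) * norm s + k * (norm s * norm y)"
  proof (intro add_mono)
    show "norm ((- (k + k)) *\<^sub>R y) \<le> 2 * k * norm y" using k by simp
    have "\<bar>s \<bullet> y\<bar> * norm s \<le> (norm s * norm y) * norm s"
      by (intro mult_right_mono Cauchy_Schwarz_ineq2) auto
    then show "norm (((s \<bullet> y) / 2) *\<^sub>R s) \<le> (norm s * norm y / 2) * norm s" by simp
    have "(norm (cross3 s y))\<^sup>2 \<le> (norm s * norm y)\<^sup>2" using norm_cross_dot[of s y] by (smt (verit) zero_le_power2)
    then have "norm (cross3 s y) \<le> norm s * norm y" by (rule power2_le_imp_le) simp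
    then show "norm (k *\<^sub>R cross3 s y) \<le> k * (norm s * norm y)" using k by (simp add: mult_left_mono)
  qed
  also have "\<dots> = (norm s)\<^sup>2 * norm y * (1 + norm s / 4)"
    by (simp add: k_def power2_eq_square algebra_simps)
  also have "\<dots> \<le> (norm s)\<^sup>2 * norm y * 2" using s by (intro mult_left_mono) auto
  finally show ?thesis by (simp add: mult_ac)
qed

text \<open>Sums over a net are almost invariant under the rotation by \<open>u = rotation_step s\<close>. Sending
  \<open>z\<close> to a net point near \<open>u\<^sup>-\<^sup>1 z\<close> hits every point at most 81 times by the packing bound, and
  changes the argument of the damped mean by a bounded amount, as the net resolves the scale \<open>1 /
  |\<xi>|\<close>; replacing the rotation by its linearisation changes it by \<open>O(|s|\<^sup>2 |\<xi>|)\<close>. The damped mean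
  is log-Lipschitz, so all this costs a constant factor.\<close>
lemma net_damped_sum_shift:
  fixes \<xi> s :: "real^3"
  assumes r: "0 < r" "r < 1" and Z: "sphere_net \<delta> Z" and \<delta>: "0 < \<delta>" "\<delta> * norm \<xi> \<le> 1"
    and s: "norm s \<le> 2" "(norm s)\<^sup>2 * norm \<xi> \<le> 3"
  shows "(\<Sum>z\<in>Z. damped_mean r L (rot z \<xi>))
    \<le> 81 * exp (8 * pi / (1 - r)) * (\<Sum>z\<in>Z. damped_mean r L (rot z \<xi> + cross3 s (rot z \<xi>)))"
proof -
  define K where "K = pi / (1 - r)"
  have K: "K > 0" using r by (simp add: K_def)
  have finZ: "finite Z" and sepZ: "separated \<delta> Z" and nZ: "\<And>z. z \<in> Z \<Longrightarrow> norm z = 1"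
    and cov: "\<And>p. norm p = 1 \<Longrightarrow> \<exists>z\<in>Z. dist p z < \<delta>"
    using Z by (auto simp: sphere_net_def)
  define u where "u = rotation_step s"
  have u: "norm u = 1" by (simp add: u_def)
  define G where "G = damped_mean r L"
  have G0: "0 \<le> G x" for x by (simp add: G_def damped_mean_bounds)
  have lip: "G x \<le> exp (K * c) * G y" if "norm (x - y) \<le> c" for x y c
  proof -
    have "G x \<le> exp (K * norm (x - y)) * G y" unfolding G_def K_def by (rule damped_mean_log_lipschitz[OF r])
    also have "\<dots> \<le> exp (K * c) * G y" using that K by (intro mult_right_mono G0) auto
    finally show ?thesis .
  qed
  define \<tau> where "\<tau> z = (SOME z'. z' \<in> Z \<and> dist (qmult (qconj u) z) z' < \<delta>)" for z
  have \<tau>: "\<tau> z \<in> Z" "dist (qmult (qconj u) z) (\<tau> z) < \<delta>" if "z \<in> Z" for z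
  proof -
    have "norm (qmult (qconj u) z) = 1" using nZ[OF that] u by (simp only: norm_qmult norm_qconj mult_1)
    then have "\<exists>z'. z' \<in> Z \<and> dist (qmult (qconj u) z) z' < \<delta>" using cov by blast
    from someI_ex[OF this] show "\<tau> z \<in> Z" "dist (qmult (qconj u) z) (\<tau> z) < \<delta>"
      unfolding \<tau>_def by blast+
  qed
  have \<tau>d: "dist (qmult u (\<tau> z)) z < \<delta>" if "z \<in> Z" for z
  proof -
    have "qmult u (\<tau> z) - z = qmult u (\<tau> z - qmult (qconj u) z)"
      using u by (simp add: qmult_diff_right qmult_qconj flip: qmult_assoc)
    then have "dist (qmult u (\<tau> z)) z = dist (\<tau> z) (qmult (qconj u) z)"
      using u by (simp add: dist_norm norm_qmult)
    then show ?thesis using \<tau>(2)[OF that] by (simp add: dist_commute)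
  qed
  define H where "H z = G (rot z \<xi> + cross3 s (rot z \<xi>))" for z
  have GH: "G (rot z \<xi>) \<le> exp (8 * K) * H (\<tau> z)" if z: "z \<in> Z" for z
  proof -
    have "norm (rot z \<xi> - rot (qmult u (\<tau> z)) \<xi>) \<le> 2 * norm (z - qmult u (\<tau> z)) * norm \<xi>"
      using nZ[OF z] nZ[OF \<tau>(1)[OF z]] u by (intro norm_rot_diff_le) (auto simp: norm_qmult)
    also have "\<dots> \<le> 2 * \<delta> * norm \<xi>"
      using \<tau>d[OF z] by (intro mult_right_mono mult_left_mono) (auto simp: dist_norm norm_minus_commute)
    also have "\<dots> \<le> 2" using \<delta> by simp
    finally have 1: "norm (rot z \<xi> - rot u (rot (\<tau> z) \<xi>)) \<le> 2" by (simp add: rot_qmult)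
    have "norm (rot u (rot (\<tau> z) \<xi>) - (rot (\<tau> z) \<xi> + cross3 s (rot (\<tau> z) \<xi>))) \<le> 2 * (norm s)\<^sup>2 * norm (rot (\<tau> z) \<xi>)"
      unfolding u_def by (rule rotation_step_approx[OF s(1)])
    also have "\<dots> \<le> 6" using s(2) norm_rot[OF nZ[OF \<tau>(1)[OF z]], of \<xi>] by (simp add: mult.commute)
    finally have 2: "norm (rot u (rot (\<tau> z) \<xi>) - (rot (\<tau> z) \<xi> + cross3 s (rot (\<tau> z) \<xi>))) \<le> 6" .
    have "norm (rot z \<xi> - (rot (\<tau> z) \<xi> + cross3 s (rot (\<tau> z) \<xi>))) \<le> 8"
      using norm_diff_triangle_le[OF 1 2] by (simp only: numeral_plus_numeral semiring_norm)
    from lip[OF this] show ?thesis by (simp add: H_def mult.commute)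
  qed
  have fib: "real (card {z\<in>Z. \<tau> z = z'}) \<le> 81" for z'
  proof -
    have "real (card {z\<in>Z. \<tau> z = z'}) * \<delta> ^ 4 \<le> (2 * \<delta> + \<delta>) ^ 4"
    proof (rule card_separated_le[where x = "qmult u z'"])
      show "{z\<in>Z. \<tau> z = z'} \<subseteq> cball (qmult u z') \<delta>" using \<tau>d by fastforce
      show "separated \<delta> {z\<in>Z. \<tau> z = z'}" by (rule separated_subset[OF sepZ]) blast
    qed (use finZ \<delta> in auto)
    also have "\<dots> = 81 * \<delta> ^ 4" by (simp add: power_mult_distrib)
    finally show ?thesis using \<delta> by simp
  qed
  have "(\<Sum>z\<in>Z. G (rot z \<xi>)) \<le> (\<Sum>z\<in>Z. exp (8 * K) * H (\<tau> z))" by (intro sum_mono GH)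
  also have "\<dots> = exp (8 * K) * (\<Sum>z\<in>Z. H (\<tau> z))" by (simp add: sum_distrib_left)
  also have "(\<Sum>z\<in>Z. H (\<tau> z)) = (\<Sum>z'\<in>Z. \<Sum>z\<in>{z\<in>Z. \<tau> z = z'}. H (\<tau> z))"
    using finZ \<tau>(1) by (intro sum.group[symmetric]) auto
  also have "\<dots> = (\<Sum>z'\<in>Z. real (card {z\<in>Z. \<tau> z = z'}) * H z')"
    by (intro sum.cong refl) simp
  also have "\<dots> \<le> (\<Sum>z'\<in>Z. 81 * H z')" by (intro sum_mono mult_right_mono fib) (simp add: H_def G0)
  also have "\<dots> = 81 * (\<Sum>z'\<in>Z. H z')" by (simp add: sum_distrib_left)
  finally show ?thesis by (simp add: G_def H_def K_def mult_ac)
qed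

lemma some_component_large:
  fixes \<theta> :: "real^3"
  obtains c where "norm \<theta> \<le> 2 * \<bar>\<theta> $ c\<bar>"
proof -
  have "\<exists>c. norm \<theta> \<le> 2 * \<bar>\<theta> $ c\<bar>"
  proof (rule ccontr)
    assume "\<not> ?thesis"
    then have "2 * \<bar>\<theta> $ c\<bar> < norm \<theta>" for c by (simp add: not_le)
    then have "(2 * \<bar>\<theta> $ c\<bar>)\<^sup>2 < (norm \<theta>)\<^sup>2" for c by (intro power_strict_mono) auto
    then have "4 * (\<theta> $ c)\<^sup>2 < (norm \<theta>)\<^sup>2" for c by (simp add: power_mult_distrib)
    from this[of 1] this[of 2] this[of 3]
    have "4 * ((\<theta> $ 1)\<^sup>2 + (\<theta> $ 2)\<^sup>2 + (\<theta> $ 3)\<^sup>2) < 3 * (norm \<theta>)\<^sup>2" by simp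
    moreover have "(norm \<theta>)\<^sup>2 = (\<theta> $ 1)\<^sup>2 + (\<theta> $ 2)\<^sup>2 + (\<theta> $ 3)\<^sup>2"
      unfolding power2_norm_eq_inner by (simp add: inner_vec_def sum_3 power2_eq_square)
    moreover have False if "4 * x < 3 * m" "m = x" "0 \<le> m" for x m :: real using that by linarith
    ultimately show False using zero_le_power2[of "norm \<theta>"] by blast
  qed
  then show ?thesis using that by blast
qed

text \<open>As a function of \<open>s\<close>, the phase \<open>v \<bullet> (y + s \<times> y)\<close> has gradient \<open>y \<times> v\<close>. The geometric sum in
  a coordinate in which the gradient is large gives the gain.\<close>
lemma grid_frequency_sum_le:
  fixes y v :: "real^3" and n :: nat
  assumes h: "h > 0" and hv: "h * norm y * norm v \<le> 1 / 4" and nz: "cross3 y v \<noteq> 0"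
  shows "\<bar>\<Sum>(i, j, k)\<in>{..<n} \<times> {..<n} \<times> {..<n}.
      cos (2 * pi * (v \<bullet> (y + cross3 (h *\<^sub>R vector [real i, real j, real k]) y)))\<bar>
    \<le> 2 * (real n)\<^sup>2 / (h * norm (cross3 y v))"
proof -
  define \<theta> where "\<theta> = cross3 y v"
  define E where "E x = cmod (\<Sum>k<n. cis (2 * pi * x * real k))" for x
  have E: "E x \<le> real n" "0 \<le> E x" for x unfolding E_def using norm_sum_cis_trivial by auto
  have ph: "v \<bullet> (y + cross3 (h *\<^sub>R vector [real i, real j, real k]) y) =
     v \<bullet> y + h * \<theta> $ 1 * real i + h * \<theta> $ 2 * real j + h * \<theta> $ 3 * real k" for i j k
    by (simp add: \<theta>_def cross3_def inner_vec_def sum_3 algebra_simps)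
  have le: "\<bar>\<Sum>(i, j, k)\<in>{..<n} \<times> {..<n} \<times> {..<n}.
      cos (2 * pi * (v \<bullet> (y + cross3 (h *\<^sub>R vector [real i, real j, real k]) y)))\<bar>
      \<le> E (h * \<theta> $ 1) * E (h * \<theta> $ 2) * E (h * \<theta> $ 3)"
    unfolding ph E_def by (rule grid_cos_sum_le)
  obtain c where c: "norm \<theta> \<le> 2 * \<bar>\<theta> $ c\<bar>" by (rule some_component_large)
  have t0: "norm \<theta> > 0" using nz by (simp add: \<theta>_def)
  have "(norm \<theta>)\<^sup>2 \<le> (norm y * norm v)\<^sup>2" unfolding \<theta>_def using norm_cross_dot[of y v] by (smt (verit) zero_le_power2)
  then have "norm \<theta> \<le> norm y * norm v" by (rule power2_le_imp_le) simp
  then have "\<bar>h * \<theta> $ c\<bar> \<le> h * (norm y * norm v)"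
    using h component_le_norm_cart[of \<theta> c] by (simp add: abs_mult)
  then have small: "\<bar>h * \<theta> $ c\<bar> \<le> 1 / 4" using hv by (simp add: mult.assoc)
  have "E (h * \<theta> $ c) \<le> 1 / \<bar>h * \<theta> $ c\<bar>"
    unfolding E_def using c t0 h small by (intro norm_sum_cis_le) auto
  also have "\<dots> \<le> 1 / (h * (norm \<theta> / 2))"
  proof (rule divide_left_mono)
    have tc: "0 < \<bar>\<theta> $ c\<bar>" "norm \<theta> / 2 \<le> \<bar>\<theta> $ c\<bar>" using c t0 by linarith+
    show "h * (norm \<theta> / 2) \<le> \<bar>h * \<theta> $ c\<bar>" using tc h by (simp only: abs_mult abs_of_pos mult_left_mono less_imp_le)
    show "0 < \<bar>h * \<theta> $ c\<bar> * (h * (norm \<theta> / 2))" using tc h t0 by (simp only: abs_mult) (intro mult_pos_pos; simp)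
  qed simp
  finally have Ec: "E (h * \<theta> $ c) \<le> 2 / (h * norm \<theta>)" by simp
  have p0: "0 \<le> 2 / (h * norm \<theta>)" using h t0 by simp
  have "E (h * \<theta> $ 1) * E (h * \<theta> $ 2) * E (h * \<theta> $ 3) \<le> (real n)\<^sup>2 * (2 / (h * norm \<theta>))"
  proof -
    have m: "x * y' * z \<le> (real n)\<^sup>2 * w" if "0 \<le> x" "0 \<le> y'" "0 \<le> z" "x \<le> real n" "y' \<le> real n" "z \<le> w" for x y' z w
      unfolding power2_eq_square using that by (intro mult_mono) auto
    consider "c = 1" | "c = 2" | "c = 3" using exhaust_3[of c] by blast
    then show ?thesis
    proof cases
      case 1
      then show ?thesis using m[of "E (h * \<theta> $ 2)" "E (h * \<theta> $ 3)" "E (h * \<theta> $ 1)" "2 / (h * norm \<theta>)"] E Ec by (simp add: mult_ac)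
    next
      case 2
      then show ?thesis using m[of "E (h * \<theta> $ 1)" "E (h * \<theta> $ 3)" "E (h * \<theta> $ 2)" "2 / (h * norm \<theta>)"] E Ec by (simp add: mult_ac)
    next
      case 3
      then show ?thesis using m[of "E (h * \<theta> $ 1)" "E (h * \<theta> $ 2)" "E (h * \<theta> $ 3)" "2 / (h * norm \<theta>)"] E Ec by (simp add: mult_ac)
    qed
  qed
  with le show ?thesis by (simp add: \<theta>_def mult_ac)
qed

text \<open>The net sum is averaged over the small rotations \<open>s\<close> in an \<open>n\<times>n\<times>n\<close> grid of mesh \<open>h\<close>. The
  expansion into cosines then reduces the claim to grid sums at odd frequencies \<open>v\<close>, which are
  small unless \<open>rot z \<xi>\<close> is within an angle \<open>\<kappa>\<close> of the line through \<open>v\<close>. These exceptional \<open>z\<close> are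
  a proportion of order \<open>\<kappa>\<close> of the net.\<close>
lemma net_damped_sum_le:
  fixes \<xi> :: "real^3" and n q :: nat
  assumes q: "even q" "q > 0" and Z: "sphere_net \<delta> Z" and \<delta>: "0 < \<delta>" "\<delta> \<le> 1" "\<delta> * norm \<xi> \<le> 1"
    and \<xi>: "\<xi> \<noteq> 0" and h: "h > 0" "h * real n \<le> 1" "(h * real n)\<^sup>2 * norm \<xi> \<le> 1" "h * norm \<xi> * real q \<le> 1 / 4"
    and n: "n > 0" and \<kappa>: "\<delta> \<le> \<kappa>" "\<kappa> \<le> 1"
  shows "(\<Sum>z\<in>Z. damped_mean (1 - 1 / real q) L (rot z \<xi>)) \<le>
    81 * exp (8 * pi * real q) * (24010 / \<delta> ^ 3) *
      ((3 / 4) ^ L + 2 * \<kappa> + 2 * (5 * real q) ^ L / (h * real n * \<kappa> * norm \<xi>))"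
proof -
  define r where "r = 1 - 1 / real q"
  have q2: "2 \<le> q" using q by (auto elim!: evenE)
  have r: "0 < r" "r < 1" "8 * pi / (1 - r) = 8 * pi * real q" using q2 by (auto simp: r_def)
  define N where "N = 24010 / \<delta> ^ 3"
  have finZ: "finite Z" and sepZ: "separated \<delta> Z" and nZ: "\<And>z. z \<in> Z \<Longrightarrow> norm z = 1"
    using Z by (auto simp: sphere_net_def)
  have cZ: "real (card Z) \<le> N" unfolding N_def by (rule card_separated_sphere_le[OF finZ sepZ nZ \<delta>(1,2)])
  have N0: "0 \<le> N" using \<delta> by (simp add: N_def)
  define I where "I = {..<n} \<times> {..<n} \<times> {..<n}"
  define s :: "nat \<times> nat \<times> nat \<Rightarrow> real^3" where "s = (\<lambda>(i, j, k). h *\<^sub>R vector [real i, real j, real k])"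
  define y where "y = (\<lambda>(z, t). rot z \<xi> + cross3 (s t) (rot z \<xi>))"
  have cI: "real (card I) = (real n) ^ 3" by (simp add: I_def card_cartesian_product power3_eq_cube)
  have sb: "(norm (s t))\<^sup>2 \<le> 3 * (h * real n)\<^sup>2" if tI: "t \<in> I" for t
  proof -
    obtain i j k where t: "t = (i, j, k)" "i < n" "j < n" "k < n" using tI by (auto simp: I_def)
    have "(norm (vector [real i, real j, real k] :: real^3))\<^sup>2 = (real i)\<^sup>2 + (real j)\<^sup>2 + (real k)\<^sup>2"
      unfolding power2_norm_eq_inner by (simp add: inner_vec_def sum_3 power2_eq_square)
    also have "\<dots> \<le> (real n)\<^sup>2 + (real n)\<^sup>2 + (real n)\<^sup>2" using t by (intro add_mono power_mono) auto
    finally have "h\<^sup>2 * (norm (vector [real i, real j, real k] :: real^3))\<^sup>2 \<le> h\<^sup>2 * (3 * (real n)\<^sup>2)"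
      by (intro mult_left_mono) auto
    then show ?thesis using h by (simp add: s_def t power_mult_distrib mult_ac)
  qed
  have shift: "(\<Sum>z\<in>Z. damped_mean r L (rot z \<xi>)) \<le> 81 * exp (8 * pi * real q) * (\<Sum>z\<in>Z. damped_mean r L (y (z, t)))" if t: "t \<in> I" for t
  proof -
    have "(h * real n)\<^sup>2 \<le> 1\<^sup>2" using h by (intro power_mono) auto
    then have "(norm (s t))\<^sup>2 \<le> 2\<^sup>2" using sb[OF t] by simp
    then have "norm (s t) \<le> 2" by (rule power2_le_imp_le) simp
    moreover have "(norm (s t))\<^sup>2 * norm \<xi> \<le> 3 * (h * real n)\<^sup>2 * norm \<xi>" using sb[OF t] by (intro mult_right_mono) auto
    then have "(norm (s t))\<^sup>2 * norm \<xi> \<le> 3" using h by linarith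
    ultimately show ?thesis
      using net_damped_sum_shift[OF r(1,2) Z \<delta>(1,3), of "s t" L] by (simp add: y_def r(3))
  qed
  have "real (card I) * (\<Sum>z\<in>Z. damped_mean r L (rot z \<xi>)) = (\<Sum>t\<in>I. \<Sum>z\<in>Z. damped_mean r L (rot z \<xi>))" by simp
  also have "\<dots> \<le> (\<Sum>t\<in>I. 81 * exp (8 * pi * real q) * (\<Sum>z\<in>Z. damped_mean r L (y (z, t))))"
    by (intro sum_mono shift)
  also have "\<dots> = 81 * exp (8 * pi * real q) * (\<Sum>t\<in>I. \<Sum>z\<in>Z. damped_mean r L (y (z, t)))"
    by (simp add: sum_distrib_left)
  also have "(\<Sum>t\<in>I. \<Sum>z\<in>Z. damped_mean r L (y (z, t))) = (\<Sum>p\<in>Z \<times> I. damped_mean r L (y p))"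
    by (subst sum.swap) (simp add: sum.cartesian_product)
  finally have A: "real (card I) * (\<Sum>z\<in>Z. damped_mean r L (rot z \<xi>))
    \<le> 81 * exp (8 * pi * real q) * (\<Sum>p\<in>Z \<times> I. damped_mean r L (y p))" .
  define g where "g = 2 * (5 * real q) ^ L / (h * real n * \<kappa> * norm \<xi>)"
  have k0: "\<kappa> > 0" using \<kappa> \<delta> by linarith
  have g0: "0 \<le> g" using h k0 by (simp add: g_def)
  have "(\<Sum>p\<in>Z \<times> I. damped_mean r L (y p)) \<le> real (card I) * (N * (2 * \<kappa> + g)) + (3 / 4) ^ L * real (card (Z \<times> I))"
    unfolding r_def
  proof (rule damped_mean_sum_le[OF q])
    show "0 \<le> real (card I) * (N * (2 * \<kappa> + g))" using N0 g0 k0 by simp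
    fix v assume v: "odd_frequency q L v"
    note vb = odd_frequency_bounds[OF q(2) v]
    have "0 < 1 / (5 * real q) ^ L" using q by simp
    then have v0: "norm v > 0" "v \<noteq> 0" using vb(1) by auto
    define F where "F z = (\<Sum>t\<in>I. cos (2 * pi * (v \<bullet> y (z, t))))" for z
    define Bad where "Bad = {z\<in>Z. norm (cross3 (rot z \<xi>) v) \<le> \<kappa> * norm \<xi> * norm v}"
    have cB: "real (card Bad) \<le> 2 * \<kappa> * N"
      using card_near_line_le[OF finZ sepZ nZ \<delta>(1,2) \<kappa> v0(2) \<xi>] by (simp add: Bad_def N_def)
    have FB: "\<bar>F z\<bar> \<le> real (card I)" for z
    proof -
      have "\<bar>F z\<bar> \<le> (\<Sum>t\<in>I. \<bar>cos (2 * pi * (v \<bullet> y (z, t)))\<bar>)" unfolding F_def by (rule sum_abs)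
      also have "\<dots> \<le> (\<Sum>t\<in>I. 1)" by (intro sum_mono) simp
      finally show ?thesis by simp
    qed
    have FG: "\<bar>F z\<bar> \<le> real (card I) * g" if z: "z \<in> Z - Bad" for z
    proof -
      let ?y = "rot z \<xi>"
      have ny: "norm ?y = norm \<xi>" using nZ z by simp
      have big: "\<kappa> * norm \<xi> * norm v < norm (cross3 ?y v)" using z by (auto simp: Bad_def)
      moreover have pos: "0 < \<kappa> * norm \<xi> * norm v" using k0 \<xi> v0 by simp
      ultimately have nz: "cross3 ?y v \<noteq> 0" by auto
      have "h * norm \<xi> * norm v \<le> h * norm \<xi> * real q" using vb(2) h by (intro mult_left_mono) auto
      then have "h * norm ?y * norm v \<le> 1 / 4" using h(4) unfolding ny by linarith
      from grid_frequency_sum_le[OF h(1) this nz, of n]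
      have "\<bar>F z\<bar> \<le> 2 * (real n)\<^sup>2 / (h * norm (cross3 ?y v))"
        by (simp add: F_def I_def y_def s_def case_prod_unfold)
      also have "\<dots> \<le> 2 * (real n)\<^sup>2 / (h * (\<kappa> * norm \<xi> * norm v))"
        using big pos h k0 v0 \<xi> nz by (intro divide_left_mono mult_left_mono mult_pos_pos) auto
      also have "\<dots> = 2 * (real n)\<^sup>2 / (h * \<kappa> * norm \<xi>) * (1 / norm v)" by (simp add: mult_ac)
      also have "\<dots> \<le> 2 * (real n)\<^sup>2 / (h * \<kappa> * norm \<xi>) * (5 * real q) ^ L"
      proof (rule mult_left_mono)
        show "1 / norm v \<le> (5 * real q) ^ L" using vb(1) v0 q by (simp add: field_simps)
      qed (use h k0 in auto)
      also have "\<dots> = real (card I) * g" unfolding cI g_def using n h(1) k0 \<xi> by (simp add: power2_eq_square power3_eq_cube field_simps)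
      finally show ?thesis .
    qed
    have "\<bar>\<Sum>p\<in>Z \<times> I. cos (2 * pi * (v \<bullet> y p))\<bar> = \<bar>\<Sum>z\<in>Z. F z\<bar>"
      unfolding F_def by (simp add: sum.cartesian_product)
    also have "\<dots> \<le> (\<Sum>z\<in>Z. \<bar>F z\<bar>)" by (rule sum_abs)
    also have "\<dots> = (\<Sum>z\<in>Z - Bad. \<bar>F z\<bar>) + (\<Sum>z\<in>Bad. \<bar>F z\<bar>)"
      using finZ by (intro sum.subset_diff) (auto simp: Bad_def)
    also have "\<dots> \<le> (\<Sum>z\<in>Z - Bad. real (card I) * g) + (\<Sum>z\<in>Bad. real (card I))"
      by (intro add_mono sum_mono FG FB)
    also have "\<dots> = real (card (Z - Bad)) * (real (card I) * g) + real (card Bad) * real (card I)" by simp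
    also have "\<dots> \<le> N * (real (card I) * g) + (2 * \<kappa> * N) * real (card I)"
    proof (intro add_mono mult_right_mono)
      have "card (Z - Bad) \<le> card Z" using finZ by (intro card_mono) auto
      then show "real (card (Z - Bad)) \<le> N" using cZ by simp
    qed (use cB g0 in auto)
    also have "\<dots> = real (card I) * (N * (2 * \<kappa> + g))" by (simp add: algebra_simps)
    finally show "\<bar>\<Sum>p\<in>Z \<times> I. cos (2 * pi * (v \<bullet> y p))\<bar> \<le> real (card I) * (N * (2 * \<kappa> + g))" .
  qed
  also have "(3 / 4) ^ L * real (card (Z \<times> I)) \<le> real (card I) * (N * (3 / 4) ^ L)"
  proof -
    have "real (card Z) * (real (card I) * (3 / 4) ^ L) \<le> N * (real (card I) * (3 / 4) ^ L)"
      using cZ by (intro mult_right_mono) auto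
    then show ?thesis by (simp add: card_cartesian_product mult_ac)
  qed
  finally have B: "(\<Sum>p\<in>Z \<times> I. damped_mean r L (y p)) \<le> real (card I) * (N * ((3 / 4) ^ L + 2 * \<kappa> + g))"
    by (simp add: algebra_simps)
  have "real (card I) * (\<Sum>z\<in>Z. damped_mean r L (rot z \<xi>))
    \<le> 81 * exp (8 * pi * real q) * (real (card I) * (N * ((3 / 4) ^ L + 2 * \<kappa> + g)))"
    by (rule order_trans[OF A mult_left_mono[OF B]]) simp
  also have "\<dots> = real (card I) * (81 * exp (8 * pi * real q) * N * ((3 / 4) ^ L + 2 * \<kappa> + g))" by simp
  finally have "(\<Sum>z\<in>Z. damped_mean r L (rot z \<xi>)) \<le> 81 * exp (8 * pi * real q) * N * ((3 / 4) ^ L + 2 * \<kappa> + g)"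
    using n by (simp add: cI)
  then show ?thesis by (simp add: r_def N_def g_def)
qed

section \<open>Decay of damped functions\<close>

text \<open>The walk is moved to the nearest points of the net, which costs a constant factor as the
  damped mean is log-Lipschitz. Then Cauchy-Schwarz applies: the sum of squares of the weights of
  the net points is at most the collision probability, and the damped mean is at most 1, so the
  sum of its squares is at most its sum.\<close>
lemma walk_mean_damped_le:
  fixes \<xi> :: "real^3"
  assumes r: "0 < r" "r < 1" and Z: "sphere_net \<delta> Z" and \<delta>: "0 < \<delta>" "\<delta> * norm \<xi> \<le> 1"
    and S: "(\<Sum>z\<in>Z. damped_mean r L (rot z \<xi>)) \<le> S"
  shows "walk_mean n (\<lambda>W. damped_mean r L (act W \<xi>))
    \<le> exp (2 * pi / (1 - r)) * sqrt (walk_collision (2 * \<delta>) n * S)"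
proof -
  define G where "G z = damped_mean r L (rot z \<xi>)" for z
  have G01: "0 \<le> G z" "G z \<le> 1" for z by (simp_all add: G_def damped_mean_bounds)
  have finZ: "finite Z" and nZ: "\<And>z. z \<in> Z \<Longrightarrow> norm z = 1"
    and cov: "\<And>p. norm p = 1 \<Longrightarrow> \<exists>z. z \<in> Z \<and> dist p z < \<delta>"
    using Z by (auto simp: sphere_net_def Bex_def)
  define \<nu> where "\<nu> W = (SOME z. z \<in> Z \<and> dist (uquat W) z < \<delta>)" for W
  have \<nu>: "\<nu> W \<in> Z \<and> dist (uquat W) (\<nu> W) < \<delta>" if "inorm W = 5 ^ n" for W
  proof -
    have "norm (uquat W) = 1" using that by (intro norm_uquat) simp
    then show ?thesis unfolding \<nu>_def by (rule someI_ex[OF cov])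
  qed
  define E where "E = exp (2 * pi / (1 - r))"
  define w where "w z = walk_mean n (\<lambda>W. if \<nu> W = z then 1 else 0)" for z
  have w0: "0 \<le> w z" for z unfolding w_def by (intro walk_mean_nonneg) auto
  have "walk_mean n (\<lambda>W. damped_mean r L (act W \<xi>)) \<le> walk_mean n (\<lambda>W. E * (\<Sum>z\<in>Z. G z * (if \<nu> W = z then 1 else 0)))"
  proof (rule walk_mean_mono)
    fix W :: iquat assume W: "inorm W = 5 ^ n"
    note vW = \<nu>[OF W]
    have "norm (rot (uquat W) \<xi> - rot (\<nu> W) \<xi>) \<le> 2 * norm (uquat W - \<nu> W) * norm \<xi>"
      using W vW nZ by (intro norm_rot_diff_le norm_uquat) auto
    also have "\<dots> \<le> 2 * \<delta> * norm \<xi>"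
      using vW by (intro mult_right_mono mult_left_mono) (auto simp: dist_norm)
    also have "\<dots> \<le> 2" using \<delta> by simp
    finally have d: "norm (rot (uquat W) \<xi> - rot (\<nu> W) \<xi>) \<le> 2" .
    have "damped_mean r L (act W \<xi>) \<le> exp (pi / (1 - r) * norm (rot (uquat W) \<xi> - rot (\<nu> W) \<xi>)) * G (\<nu> W)"
      unfolding G_def by (rule damped_mean_log_lipschitz[OF r])
    also have "\<dots> \<le> E * G (\<nu> W)"
    proof (rule mult_right_mono[OF _ G01(1)])
      have "pi / (1 - r) * norm (rot (uquat W) \<xi> - rot (\<nu> W) \<xi>) \<le> pi / (1 - r) * 2"
        using r d by (intro mult_left_mono) auto
      then show "exp (pi / (1 - r) * norm (rot (uquat W) \<xi> - rot (\<nu> W) \<xi>)) \<le> E"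
        by (simp add: E_def mult.commute)
    qed
    also have "G (\<nu> W) = (\<Sum>z\<in>Z. if \<nu> W = z then G z else 0)" using vW finZ by simp
    also have "\<dots> = (\<Sum>z\<in>Z. G z * (if \<nu> W = z then 1 else 0))" by (intro sum.cong) auto
    finally show "damped_mean r L (act W \<xi>) \<le> E * (\<Sum>z\<in>Z. G z * (if \<nu> W = z then 1 else 0))" .
  qed
  also have "\<dots> = E * (\<Sum>z\<in>Z. G z * w z)"
    by (simp only: walk_mean_mult_left walk_mean_sum w_def)
  also have "\<dots> \<le> E * sqrt (walk_collision (2 * \<delta>) n * S)"
  proof (rule mult_left_mono)
    have "(\<Sum>z\<in>Z. G z * w z)\<^sup>2 \<le> (\<Sum>z\<in>Z. (G z)\<^sup>2) * (\<Sum>z\<in>Z. (w z)\<^sup>2)"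
      by (rule Cauchy_Schwarz_ineq_sum)
    also have "\<dots> \<le> S * walk_collision (2 * \<delta>) n"
    proof (rule mult_mono)
      have "(\<Sum>z\<in>Z. (G z)\<^sup>2) \<le> (\<Sum>z\<in>Z. G z)"
        using G01 by (intro sum_mono) (simp add: power2_eq_square mult_left_le)
      then show GS: "(\<Sum>z\<in>Z. (G z)\<^sup>2) \<le> S" using S by (simp add: G_def)
      show "0 \<le> S" using order_trans[OF sum_nonneg GS] by simp
      have "(\<Sum>z\<in>Z. (w z)\<^sup>2) = walk_mean n (\<lambda>W. walk_mean n (\<lambda>W'. \<Sum>z\<in>Z. (if \<nu> W = z then 1 else 0) * (if \<nu> W' = z then 1 else 0)))"
        by (simp only: walk_mean_sum walk_mean_mult_left walk_mean_mult_right w_def power2_eq_square)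
      also have "\<dots> \<le> walk_collision (2 * \<delta>) n"
        unfolding walk_collision_def
      proof (intro walk_mean_mono)
        fix W W' :: iquat assume W: "inorm W = 5 ^ n" "inorm W' = 5 ^ n"
        show "(\<Sum>z\<in>Z. (if \<nu> W = z then 1 else 0) * (if \<nu> W' = z then 1 else 0))
          \<le> (if real_of_int (inorm (idiff W W')) \<le> (2 * \<delta>)\<^sup>2 * 5 ^ n then 1 else (0::real))"
        proof (cases "\<nu> W = \<nu> W'")
          case True
          have "dist (uquat W) (uquat W') \<le> dist (uquat W) (\<nu> W) + dist (uquat W') (\<nu> W)" by (rule dist_triangle2)
          also have "\<dots> \<le> 2 * \<delta>" using \<nu>[OF W(1)] \<nu>[OF W(2)] True by simp
          finally have "(norm (uquat W - uquat W'))\<^sup>2 \<le> (2 * \<delta>)\<^sup>2"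
            by (intro power_mono) (auto simp: dist_norm)
          then have "real_of_int (inorm (idiff W W')) \<le> (2 * \<delta>)\<^sup>2 * 5 ^ n"
            unfolding norm_uquat_diff[OF W] by (simp add: divide_le_eq)
          moreover have "(\<Sum>z\<in>Z. (if \<nu> W = z then 1 else 0) * (if \<nu> W' = z then 1 else 0)) = (\<Sum>z\<in>Z. if \<nu> W = z then 1 else (0::real))"
            using True by (intro sum.cong) auto
          ultimately show ?thesis using finZ by simp
        next
          case False
          then have "(\<Sum>z\<in>Z. (if \<nu> W = z then 1 else 0) * (if \<nu> W' = z then 1 else 0)) = (\<Sum>z\<in>Z. (0::real))"
            by (intro sum.cong) auto
          then show ?thesis by simp
        qed
      qed
      finally show "(\<Sum>z\<in>Z. (w z)\<^sup>2) \<le> walk_collision (2 * \<delta>) n" .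
    qed (auto intro: sum_nonneg)
    finally show "(\<Sum>z\<in>Z. G z * w z) \<le> sqrt (walk_collision (2 * \<delta>) n * S)"
      by (simp add: real_le_rsqrt mult.commute)
  qed (simp add: E_def)
  finally show ?thesis by (simp add: E_def)
qed

lemma nat_floor_ge_half: "1 \<le> x \<Longrightarrow> x / 2 \<le> real (nat \<lfloor>x\<rfloor>)" "1 \<le> x \<Longrightarrow> real (nat \<lfloor>x\<rfloor>) \<le> x" for x :: real
proof -
  assume x: "1 \<le> x"
  have f: "1 \<le> \<lfloor>x\<rfloor>" using x by (simp add: le_floor_iff)
  then have eq: "real (nat \<lfloor>x\<rfloor>) = real_of_int \<lfloor>x\<rfloor>" by (subst of_nat_nat) linarith+
  then show "real (nat \<lfloor>x\<rfloor>) \<le> x" by simp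
  have "1 \<le> real (nat \<lfloor>x\<rfloor>)" "x < real (nat \<lfloor>x\<rfloor>) + 1" using f eq by linarith+
  then show "x / 2 \<le> real (nat \<lfloor>x\<rfloor>)" by linarith
qed

text \<open>All parameters of \<open>net_damped_sum_le\<close> become powers of \<open>R\<close>: the angle is \<open>R powr (- 1 / 16)\<close>
  and the grid has the largest diameter, about \<open>1 / \<surd>|\<xi>|\<close>, for which the linearisation of the
  rotations is harmless.\<close>
lemma sphere_damped_sum_le:
  fixes q :: nat
  assumes q: "even q" "q > 0"
  obtains C where "C > 0"
    "\<And>R (\<xi>::real^3) Z L. 1 \<le> R \<Longrightarrow> R powr (1 / 2) \<le> norm \<xi> \<Longrightarrow> norm \<xi> \<le> R \<Longrightarrow> sphere_net (1 / R) Z \<Longrightarrow>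
      (5 * real q) ^ L \<le> R powr (1 / 16) \<Longrightarrow>
      (\<Sum>z\<in>Z. damped_mean (1 - 1 / real q) L (rot z \<xi>)) \<le> C * R ^ 3 * ((3 / 4) ^ L + 6 * R powr (- 1 / 16))"
proof (rule that[of "81 * exp (8 * pi * real q) * 24010"])
  fix R :: real and \<xi> :: "real^3" and Z L
  assume R: "1 \<le> R" and \<xi>: "R powr (1 / 2) \<le> norm \<xi>" "norm \<xi> \<le> R" and Z: "sphere_net (1 / R) Z"
    and L: "(5 * real q) ^ L \<le> R powr (1 / 16)"
  define \<rho> where "\<rho> = norm \<xi>"
  have R0: "R > 0" using R by simp
  have "1 \<le> R powr (1 / 2)" using R by (simp add: ge_one_powr_ge_zero)
  then have \<rho>1: "1 \<le> \<rho>" using \<xi> by (simp add: \<rho>_def)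
  define h where "h = 1 / (4 * real q * \<rho>)"
  define x where "x = 4 * real q * sqrt \<rho>"
  define N where "N = nat \<lfloor>x\<rfloor>"
  define \<kappa> where "\<kappa> = R powr (- 1 / 16)"
  have q1: "1 \<le> real q" using q by simp
  have s1: "1 \<le> sqrt \<rho>" using \<rho>1 by simp
  have "1 * 1 \<le> 4 * real q * sqrt \<rho>" using q1 s1 by (intro mult_mono) auto
  then have x1: "1 \<le> x" by (simp add: x_def)
  have N: "x / 2 \<le> real N" "real N \<le> x" unfolding N_def using nat_floor_ge_half[OF x1] by auto
  have h0: "h > 0" using q1 \<rho>1 by (simp add: h_def)
  have ss: "sqrt \<rho> * sqrt \<rho> = \<rho>" using \<rho>1 by simp
  have hx: "h * x = 1 / sqrt \<rho>"
  proof -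
    have "h * x = sqrt \<rho> / \<rho>" using q1 \<rho>1 by (simp add: h_def x_def)
    also have "\<dots> = 1 / sqrt \<rho>" using ss s1 by (simp add: field_simps)
    finally show ?thesis .
  qed
  have hN: "h * real N \<le> 1 / sqrt \<rho>" "1 / (2 * sqrt \<rho>) \<le> h * real N"
    using mult_left_mono[OF N(2), of h] mult_left_mono[OF N(1), of h] h0 hx by auto
  have A: "(\<Sum>z\<in>Z. damped_mean (1 - 1 / real q) L (rot z \<xi>)) \<le>
    81 * exp (8 * pi * real q) * (24010 / (1 / R) ^ 3) *
      ((3 / 4) ^ L + 2 * \<kappa> + 2 * (5 * real q) ^ L / (h * real N * \<kappa> * norm \<xi>))"
  proof (rule net_damped_sum_le[OF q Z])
    show "1 / R * norm \<xi> \<le> 1" using \<xi> R by simp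
    show "\<xi> \<noteq> 0" using \<rho>1 by (auto simp: \<rho>_def)
    have "1 / sqrt \<rho> \<le> 1" using s1 by simp
    then show "h * real N \<le> 1" using hN by linarith
    have "(h * real N)\<^sup>2 \<le> (1 / sqrt \<rho>)\<^sup>2" using hN h0 by (intro power_mono) auto
    then have "(h * real N)\<^sup>2 * \<rho> \<le> (1 / sqrt \<rho>)\<^sup>2 * \<rho>" using \<rho>1 by (intro mult_right_mono) auto
    moreover have "(1 / sqrt \<rho>)\<^sup>2 * \<rho> = 1" using \<rho>1 by (simp add: power_divide)
    ultimately show "(h * real N)\<^sup>2 * norm \<xi> \<le> 1" by (simp only: \<rho>_def)
    show "h * norm \<xi> * real q \<le> 1 / 4" using q1 \<rho>1 by (simp add: h_def \<rho>_def)
    have "0 < real N" using N(1) x1 by linarith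
    then show "N > 0" by simp
    have "R powr (-1) \<le> \<kappa>" unfolding \<kappa>_def using R by (intro powr_mono) auto
    then show "1 / R \<le> \<kappa>" using R0 by (simp add: powr_minus_divide)
    show "\<kappa> \<le> 1" unfolding \<kappa>_def using R powr_mono[of "- 1 / 16" 0 R] by simp
  qed (use R h0 in auto)
  have k0: "\<kappa> > 0" using R0 by (simp add: \<kappa>_def)
  have "2 * (5 * real q) ^ L / (h * real N * \<kappa> * norm \<xi>) \<le> 2 * R powr (1 / 16) / (1 / (2 * sqrt \<rho>) * \<kappa> * norm \<xi>)"
  proof (rule frac_le)
    show "1 / (2 * sqrt \<rho>) * \<kappa> * norm \<xi> \<le> h * real N * \<kappa> * norm \<xi>"
      using hN(2) k0 by (intro mult_right_mono) auto
    show "0 < 1 / (2 * sqrt \<rho>) * \<kappa> * norm \<xi>"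
      using k0 s1 \<rho>1 unfolding \<rho>_def[symmetric] by (intro mult_pos_pos divide_pos_pos) linarith+
  qed (use L R in auto)
  also have "\<dots> = 4 * R powr (1 / 16) / (sqrt \<rho> * \<kappa>)"
    using ss s1 k0 \<rho>1 by (simp add: \<rho>_def[symmetric] field_simps)
  also have "\<dots> \<le> 4 * R powr (1 / 16) / (R powr (1 / 4) * \<kappa>)"
  proof (intro divide_left_mono mult_right_mono)
    have "R powr (1 / 4) = (R powr (1 / 2)) powr (1 / 2)" using R by (simp add: powr_powr)
    also have "\<dots> \<le> \<rho> powr (1 / 2)" using \<xi> by (intro powr_mono2) (auto simp: \<rho>_def)
    also have "\<dots> = sqrt \<rho>" using \<rho>1 by (simp add: powr_half_sqrt)
    finally show "R powr (1 / 4) \<le> sqrt \<rho>" .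
  qed (use k0 R s1 in auto)
  also have "\<dots> = 4 * R powr (1 / 16 - (1 / 4 + - 1 / 16))"
    unfolding \<kappa>_def powr_add[symmetric] powr_diff by simp
  also have "\<dots> \<le> 4 * \<kappa>" unfolding \<kappa>_def using R by (intro mult_left_mono powr_mono) auto
  finally have B: "2 * (5 * real q) ^ L / (h * real N * \<kappa> * norm \<xi>) \<le> 4 * \<kappa>" .
  have "24010 / (1 / R) ^ 3 = 24010 * R ^ 3" by (simp add: power_divide)
  note A[unfolded this]
  also have "81 * exp (8 * pi * real q) * (24010 * R ^ 3) *
      ((3 / 4) ^ L + 2 * \<kappa> + 2 * (5 * real q) ^ L / (h * real N * \<kappa> * norm \<xi>))
    \<le> 81 * exp (8 * pi * real q) * (24010 * R ^ 3) * ((3 / 4) ^ L + 6 * \<kappa>)"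
    using B R by (intro mult_left_mono) auto
  finally show "(\<Sum>z\<in>Z. damped_mean (1 - 1 / real q) L (rot z \<xi>))
      \<le> 81 * exp (8 * pi * real q) * 24010 * R ^ 3 * ((3 / 4) ^ L + 6 * R powr (- 1 / 16))"
    by (simp add: \<kappa>_def mult.assoc)
qed simp

text \<open>The functional inequality that self-similarity imposes on the squared Fourier transform.\<close>
definition mean_damped :: "real \<Rightarrow> (real^3 \<Rightarrow> real) \<Rightarrow> bool" where
  "mean_damped r f \<longleftrightarrow> (\<forall>\<xi>. 0 \<le> f \<xi> \<and> f \<xi> \<le> 1 \<and>
     f \<xi> \<le> damp (\<xi> $ 1) * ((\<Sum>\<alpha>\<in>gens. f (r *\<^sub>R act \<alpha> \<xi>)) / 6))"

lemma mean_damped_walk: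
  assumes f: "mean_damped r f"
  shows "f \<xi> \<le> walk_mean n (\<lambda>W. f (r ^ n *\<^sub>R act W \<xi>))"
proof (induction n arbitrary: \<xi>)
  case 0
  show ?case by simp
next
  case (Suc n)
  have "f \<xi> \<le> damp (\<xi> $ 1) * ((\<Sum>\<alpha>\<in>gens. f (r *\<^sub>R act \<alpha> \<xi>)) / 6)" using f by (simp add: mean_damped_def)
  also have "\<dots> \<le> 1 * ((\<Sum>\<alpha>\<in>gens. f (r *\<^sub>R act \<alpha> \<xi>)) / 6)"
    using f by (intro mult_right_mono damp_bounds) (auto simp: mean_damped_def intro!: sum_nonneg)
  also have "\<dots> \<le> (\<Sum>\<alpha>\<in>gens. walk_mean n (\<lambda>W. f (r ^ n *\<^sub>R act W (r *\<^sub>R act \<alpha> \<xi>)))) / 6"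
    using Suc by (simp add: sum_mono divide_right_mono)
  also have "\<dots> = (\<Sum>\<alpha>\<in>gens. walk_mean n (\<lambda>W. f (r ^ Suc n *\<^sub>R act W (act \<alpha> \<xi>)))) / 6"
    by (simp add: rot_scaleR mult.commute)
  also have "\<dots> = walk_mean (Suc n) (\<lambda>W. f (r ^ Suc n *\<^sub>R act W \<xi>))"
    by (rule walk_mean_act_Suc)
  finally show ?case .
qed

lemma mean_damped_le:
  assumes f: "mean_damped r f" and r: "0 < r" and M: "\<And>\<zeta>::real^3. norm \<zeta> = r ^ L * norm \<xi> \<Longrightarrow> f \<zeta> \<le> M"
  shows "f \<xi> \<le> damped_mean r L \<xi> * M"
  using M
proof (induction L arbitrary: \<xi>)
  case 0
  then show ?case by simp
next
  case (Suc L)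
  have "f \<xi> \<le> damp (\<xi> $ 1) * ((\<Sum>\<alpha>\<in>gens. f (r *\<^sub>R act \<alpha> \<xi>)) / 6)" using f by (simp add: mean_damped_def)
  also have "\<dots> \<le> damp (\<xi> $ 1) * ((\<Sum>\<alpha>\<in>gens. damped_mean r L (r *\<^sub>R act \<alpha> \<xi>) * M) / 6)"
  proof (intro mult_left_mono divide_right_mono sum_mono Suc.IH damp_bounds)
    fix \<alpha> and \<zeta> :: "real^3" assume "\<alpha> \<in> gens" "norm \<zeta> = r ^ L * norm (r *\<^sub>R act \<alpha> \<xi>)"
    then show "f \<zeta> \<le> M" using r by (intro Suc.prems) (simp add: norm_act)
  qed simp
  also have "\<dots> = damped_mean r (Suc L) \<xi> * M" by (simp add: sum_distrib_right)
  finally show ?case .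
qed

text \<open>The first \<open>n\<close> steps only randomise the direction of the frequency, and their damping is
  thrown away; the other \<open>L\<close> steps damp.\<close>
lemma mean_damped_block:
  assumes f: "mean_damped r f" and r: "0 < r" and M: "\<And>\<zeta>::real^3. norm \<zeta> = r ^ (n + L) * norm \<xi> \<Longrightarrow> f \<zeta> \<le> M"
  shows "f \<xi> \<le> walk_mean n (\<lambda>W. damped_mean r L (act W (r ^ n *\<^sub>R \<xi>))) * M"
proof -
  have "f \<xi> \<le> walk_mean n (\<lambda>W. f (r ^ n *\<^sub>R act W \<xi>))" by (rule mean_damped_walk[OF f])
  also have "\<dots> \<le> walk_mean n (\<lambda>W. damped_mean r L (act W (r ^ n *\<^sub>R \<xi>)) * M)"
  proof (rule walk_mean_mono)
    fix W :: iquat assume "inorm W = 5 ^ n"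
    then have n: "norm (act W \<xi>) = norm \<xi>" by (intro norm_rot norm_uquat) simp
    have "f (r ^ n *\<^sub>R act W \<xi>) \<le> damped_mean r L (r ^ n *\<^sub>R act W \<xi>) * M"
      using n r by (intro mean_damped_le[OF f r] M) (simp add: power_add mult_ac)
    then show "f (r ^ n *\<^sub>R act W \<xi>) \<le> damped_mean r L (act W (r ^ n *\<^sub>R \<xi>)) * M" by (simp add: rot_scaleR)
  qed
  finally show ?thesis by (simp add: walk_mean_mult_right)
qed

lemma ln_five_le_two: "1 \<le> ln (5::real)" "ln (5::real) \<le> 2"
proof -
  have "exp (1::real) \<le> 5" using exp_le by simp
  then have "ln (exp (1::real)) \<le> ln 5" by (subst ln_le_cancel_iff) auto
  then show "1 \<le> ln (5::real)" by simp
  have "(5::real) \<le> exp 2"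
  proof -
    have "1 + 1 + (1::real)\<^sup>2 / 2 \<le> exp 1" using exp_lower_Taylor_quadratic[of 1] by simp
    then have "(5 / 2)\<^sup>2 \<le> (exp (1::real))\<^sup>2" by (intro power_mono) auto
    also have "(exp (1::real))\<^sup>2 = exp 2" by (simp add: power2_eq_square flip: exp_add)
    finally show ?thesis by (simp add: power2_eq_square)
  qed
  then have "ln 5 \<le> ln (exp (2::real))" by (subst ln_le_cancel_iff) auto
  then show "ln (5::real) \<le> 2" by simp
qed

lemma ln_numeric: "1 / 2 \<le> ln (9 / 5 :: real)" "1 / 4 \<le> ln (4 / 3 :: real)"
proof -
  have "(exp (1 / 2 :: real))\<^sup>2 = exp 1" by (simp add: power2_eq_square flip: exp_add)
  also have "\<dots> \<le> (9 / 5)\<^sup>2" using exp_le by (simp add: power2_eq_square)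
  finally have "exp (1 / 2 :: real) \<le> 9 / 5" by (rule power2_le_imp_le) simp
  then have "ln (exp (1 / 2 :: real)) \<le> ln (9 / 5)" by (subst ln_le_cancel_iff) auto
  then show "1 / 2 \<le> ln (9 / 5 :: real)" by simp
  have "1 - 1 / (4 / 3) \<le> ln (4 / 3 :: real)" using ln_le_minus_one[of "3 / 4 :: real"] ln_inverse[of "3 / 4 :: real"] by simp
  then show "1 / 4 \<le> ln (4 / 3 :: real)" by simp
qed

text \<open>With \<open>n\<close> about \<open>6 ln R\<close> the term \<open>(5/9)\<^sup>n\<close> in the collision bound is below \<open>R\<^sup>-\<^sup>3\<close>, and
  \<open>R\<^sup>-\<^sup>3\<close> cancels the cardinality of a net of mesh \<open>1 / R\<close>. What remains is the gain from \<open>L\<close>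
  damped steps. The restriction \<open>(5 * q) ^ L \<le> R powr (1 / 16)\<close>, under which the frequencies in
  the expansion are not too small, makes \<open>L\<close> of order \<open>ln R / ln (5 * q)\<close>, so the gain is a power
  of \<open>R\<close> with exponent of order \<open>1 / ln (5 * q)\<close>. As \<open>n + L\<close> is at most \<open>8 ln R\<close>, the frequency
  does not drop below \<open>R powr (1 - 16 / q)\<close>.\<close>
lemma mean_damped_decay_step:
  fixes q :: nat
  assumes q: "even q" "q \<ge> 32"
  defines "r \<equiv> 1 - 1 / real q"
  obtains C where "C > 0"
    "\<And>R. exp 1 \<le> R \<Longrightarrow> \<exists>m. R powr (1 - 16 / real q) \<le> r ^ m * R \<and>
       (\<forall>f \<xi> M. mean_damped r f \<longrightarrow> norm \<xi> = R \<longrightarrow> 0 \<le> M \<longrightarrow> (\<forall>\<zeta>. norm \<zeta> = r ^ m * R \<longrightarrow> f \<zeta> \<le> M) \<longrightarrow>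
          f \<xi> \<le> C * R powr (- 1 / (256 * ln (5 * real q))) * M)"
proof -
  define l where "l = ln (5 * real q)"
  define c where "c = 1 / (64 * l)"
  have q0: "q > 0" "real q \<ge> 32" using q by auto
  have l1: "1 \<le> l"
  proof -
    have "ln 5 \<le> l" unfolding l_def using q0 by (subst ln_le_cancel_iff) auto
    then show ?thesis using ln_five_le_two by linarith
  qed
  have c0: "0 < c" "c \<le> 1 / 64" using l1 by (auto simp: c_def field_simps)
  have r: "0 < r" "r < 1" using q0 by (auto simp: r_def field_simps)
  obtain C1 where C1: "C1 > 0"
    "\<And>R (\<xi>::real^3) Z L. 1 \<le> R \<Longrightarrow> R powr (1 / 2) \<le> norm \<xi> \<Longrightarrow> norm \<xi> \<le> R \<Longrightarrow> sphere_net (1 / R) Z \<Longrightarrow>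
      (5 * real q) ^ L \<le> R powr (1 / 16) \<Longrightarrow>
      (\<Sum>z\<in>Z. damped_mean r L (rot z \<xi>)) \<le> C1 * R ^ 3 * ((3 / 4) ^ L + 6 * R powr (- 1 / 16))"
    unfolding r_def using sphere_damped_sum_le[OF q(1) q0(1)] by blast
  have e0: "c / 84 > 0" using c0 by simp
  obtain C2 where C2: "C2 > 0" "\<And>\<delta> n. 0 < \<delta> \<Longrightarrow> \<delta> \<le> 1 \<Longrightarrow>
    walk_collision \<delta> n \<le> C2 * (5 ^ n) powr (3 * (c / 84)) * (\<delta> ^ 3 + 4 * (5 / 9) ^ n)"
    using walk_collision_bound[OF e0] by blast
  define C where "C = exp (2 * pi / (1 - r)) * sqrt (12 * C2 * (8 * C1))"
  show ?thesis
  proof (rule that[of C])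
    show "C > 0" using C1 C2 by (simp add: C_def)
    fix R :: real assume R: "exp 1 \<le> R"
    define x where "x = ln R"
    have R0: "R > 0" using R by (meson exp_gt_zero order_less_le_trans)
    have x1: "1 \<le> x" unfolding x_def using R R0 by (simp add: ln_ge_iff)
    have Rx: "R = exp x" using R0 by (simp add: x_def)
    have eR: "exp a * R = exp (a + x)" for a unfolding exp_add by (simp flip: Rx)
    have R2: "2 \<le> R" using R exp_ge_add_one_self[of 1] by linarith
    have Rp: "R powr a = exp (a * x)" for a using R0 by (simp add: powr_def x_def)
    define n where "n = nat \<lceil>6 * x\<rceil>"
    define L where "L = nat \<lfloor>x / (16 * l)\<rfloor>"
    have n: "6 * x \<le> real n" "real n \<le> 7 * x"
    proof -
      show "6 * x \<le> real n" unfolding n_def by (rule real_nat_ceiling_ge)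
      have "real n = real_of_int \<lceil>6 * x\<rceil>" unfolding n_def using x1 by (subst of_nat_nat) auto
      then show "real n \<le> 7 * x" using x1 by linarith
    qed
    have L: "real L \<le> x / (16 * l)" "x / (16 * l) - 1 \<le> real L"
    proof -
      have p: "0 \<le> x / (16 * l)" using x1 l1 by simp
      then have "real L = real_of_int \<lfloor>x / (16 * l)\<rfloor>" unfolding L_def by (subst of_nat_nat) auto
      then show "real L \<le> x / (16 * l)" "x / (16 * l) - 1 \<le> real L" by linarith+
    qed
    have Lx: "real L \<le> x"
    proof -
      have "x / (16 * l) \<le> x / 1" using x1 l1 by (intro divide_left_mono) auto
      then show ?thesis using L by simp
    qed
    have lnr: "- 2 / real q \<le> ln r"
    proof -
      define y where "y = 1 / real q"
      have b: "0 \<le> y" "y \<le> 1 / 2" using q0 by (auto simp: y_def field_simps)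
      have "- y - 2 * y\<^sup>2 \<le> ln (1 - y)"
        using b by (intro ln_one_minus_pos_lower_bound) auto
      moreover have "y * y \<le> y * (1 / 2)"
        using b by (intro mult_left_mono) auto
      ultimately have "- (2 * y) \<le> ln (1 - y)" by (simp add: power2_eq_square)
      then show ?thesis by (simp add: y_def r_def)
    qed
    have rpow: "exp (- 2 * real k / real q) \<le> r ^ k" for k
    proof -
      have "exp (real k * (- 2 / real q)) \<le> exp (real k * ln r)" using lnr by (simp only: exp_le_cancel_iff) (intro mult_left_mono; simp)
      also have "\<dots> = r ^ k" using r by (simp add: exp_of_nat_mult)
      finally show ?thesis by (simp add: mult.commute)
    qed
    show "\<exists>m. R powr (1 - 16 / real q) \<le> r ^ m * R \<and>
       (\<forall>f \<xi> M. mean_damped r f \<longrightarrow> norm \<xi> = R \<longrightarrow> 0 \<le> M \<longrightarrow> (\<forall>\<zeta>. norm \<zeta> = r ^ m * R \<longrightarrow> f \<zeta> \<le> M) \<longrightarrow>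
          f \<xi> \<le> C * R powr (- 1 / (256 * ln (5 * real q))) * M)"
    proof (intro exI[of _ "n + L"] conjI allI impI)
      have "real (n + L) \<le> 8 * x" using n Lx by simp
      then have "2 * real (n + L) / real q \<le> 2 * (8 * x) / real q" by (intro divide_right_mono mult_left_mono) auto
      then have "x - 2 * (8 * x) / real q \<le> - (2 * real (n + L) / real q) + x" by linarith
      moreover have "(1 - 16 / real q) * x = x - 2 * (8 * x) / real q" by (simp add: left_diff_distrib)
      moreover have "- 2 * real (n + L) / real q = - (2 * real (n + L) / real q)"
        by (simp only: mult_minus_left minus_divide_left)
      ultimately have "(1 - 16 / real q) * x \<le> - 2 * real (n + L) / real q + x" by (simp only:)
      then have "R powr (1 - 16 / real q) \<le> exp (- 2 * real (n + L) / real q) * R"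
        unfolding Rp eR by (simp only: exp_le_cancel_iff)
      also have "\<dots> \<le> r ^ (n + L) * R" by (intro mult_right_mono rpow less_imp_le[OF R0])
      finally show "R powr (1 - 16 / real q) \<le> r ^ (n + L) * R" .
    next
      fix f :: "real^3 \<Rightarrow> real" and \<xi> :: "real^3" and M
      assume f: "mean_damped r f" and \<xi>: "norm \<xi> = R" and M: "0 \<le> M" "\<forall>\<zeta>. norm \<zeta> = r ^ (n + L) * R \<longrightarrow> f \<zeta> \<le> M"
      define \<xi>' where "\<xi>' = r ^ n *\<^sub>R \<xi>"
      have n': "norm \<xi>' = r ^ n * R" using r \<xi> by (simp add: \<xi>'_def)
      have up: "norm \<xi>' \<le> R" unfolding n' using r R0 by (simp add: power_le_one mult_left_le_one_le)
      have "2 * real n / real q \<le> 2 * (7 * x) / 32"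
        using n q0 x1 by (intro frac_le) auto
      moreover have "- 2 * real n / real q = - (2 * real n / real q)"
        by (simp only: mult_minus_left minus_divide_left)
      ultimately have "1 / 2 * x \<le> - 2 * real n / real q + x" using x1 by linarith
      then have "R powr (1 / 2) \<le> exp (- 2 * real n / real q) * R"
        unfolding Rp eR by (simp only: exp_le_cancel_iff)
      also have "\<dots> \<le> r ^ n * R" by (intro mult_right_mono rpow less_imp_le[OF R0])
      finally have low: "R powr (1 / 2) \<le> norm \<xi>'" by (simp add: n')
      have d: "0 < 1 / R" "1 / R \<le> 1" using R2 by auto
      obtain Z where Z: "sphere_net (1 / R) Z" using sphere_net_exists[OF d] by blast
      have L16: "(5 * real q) ^ L \<le> R powr (1 / 16)"
      proof -
        have "(5 * real q) ^ L = exp (real L * l)" using q0 by (simp add: l_def exp_of_nat_mult)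
        also have "\<dots> \<le> exp (x / (16 * l) * l)" unfolding exp_le_cancel_iff using L l1 by (intro mult_right_mono) linarith+
        also have "x / (16 * l) * l = 1 / 16 * x" using l1 by simp
        finally show ?thesis by (simp add: Rp)
      qed
      have R1: "1 \<le> R" using R2 by simp
      have pw: "(3 / 4) ^ L \<le> 4 / 3 * R powr (- c)"
      proof -
        have "(3 / 4 :: real) ^ L = exp (- (real L * ln (4 / 3)))"
          by (simp add: exp_minus exp_of_nat_mult power_divide)
        also have "\<dots> \<le> exp (- ((x / (16 * l) - 1) * ln (4 / 3)))"
          unfolding exp_le_cancel_iff neg_le_iff_le using L ln_numeric by (intro mult_right_mono) linarith+
        also have "\<dots> = 4 / 3 * exp (- (x / (16 * l) * ln (4 / 3)))"
        proof -
          have "- ((u - 1) * ln (4 / 3)) = ln (4 / 3) + - (u * ln (4 / 3))" for u :: real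
            by (simp add: left_diff_distrib)
          then show ?thesis by (simp only: exp_add) simp
        qed
        also have "\<dots> \<le> 4 / 3 * exp (- (x / (16 * l) * (1 / 4)))"
        proof -
          have "x / (16 * l) * (1 / 4) \<le> x / (16 * l) * ln (4 / 3)"
            using ln_numeric x1 l1 by (intro mult_left_mono) auto
          then show ?thesis by (intro mult_left_mono) auto
        qed
        also have "- (x / (16 * l) * (1 / 4)) = - c * x" by (simp add: c_def)
        finally show ?thesis by (simp add: Rp)
      qed
      have "R powr (- 1 / 16) \<le> R powr (- c)" using c0 R1 by (intro powr_mono) auto
      then have "(3 / 4) ^ L + 6 * R powr (- 1 / 16) \<le> 8 * R powr (- c)"
        using pw powr_ge_zero[of R "- c"] by linarith
      then have "C1 * R ^ 3 * ((3 / 4) ^ L + 6 * R powr (- 1 / 16)) \<le> C1 * R ^ 3 * (8 * R powr (- c))"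
        using C1 R0 by (intro mult_left_mono) auto
      then have S: "(\<Sum>z\<in>Z. damped_mean r L (rot z \<xi>')) \<le> C1 * R ^ 3 * (8 * R powr (- c))"
        using C1(2)[OF R1 low up Z L16] by linarith
      have du: "1 / R * norm \<xi>' \<le> 1" using up R0 by simp
      note W = walk_mean_damped_le[OF r Z d(1) du S, of n]
      have col: "walk_collision (2 * (1 / R)) n \<le> 12 * C2 * R powr (c / 2) * R powr (- 3)"
      proof -
        have "walk_collision (2 * (1 / R)) n \<le> C2 * (5 ^ n) powr (3 * (c / 84)) * ((2 * (1 / R)) ^ 3 + 4 * (5 / 9) ^ n)"
          using R2 by (intro C2(2)) auto
        also have "\<dots> \<le> C2 * R powr (c / 2) * (12 * R powr (- 3))"
        proof (intro mult_mono)
          have "((5::real) ^ n) powr (3 * (c / 84)) = exp (3 * (c / 84) * (real n * ln 5))"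
            by (simp add: powr_def ln_realpow)
          also have "\<dots> \<le> exp (3 * (c / 84) * ((7 * x) * 2))"
            using n c0 x1 ln_five_le_two by (simp only: exp_le_cancel_iff) (intro mult_left_mono mult_mono; simp)
          also have "\<dots> = R powr (c / 2)" by (simp add: Rp)
          finally show "(5 ^ n) powr (3 * (c / 84)) \<le> R powr (c / 2)" .
          have "(5 / 9 :: real) ^ n = exp (- (real n * ln (9 / 5)))"
            by (simp add: exp_minus exp_of_nat_mult power_divide)
          also have "\<dots> \<le> exp (- ((6 * x) * (1 / 2)))"
            using n x1 ln_numeric by (simp only: exp_le_cancel_iff neg_le_iff_le) (intro mult_mono; simp)
          also have "\<dots> = R powr (- 3)" by (simp add: Rp)
          finally have "(5 / 9 :: real) ^ n \<le> R powr (- 3)" .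
          moreover have "(2 * (1 / R)) ^ 3 = 8 * R powr (- 3)"
            using R0 by (simp add: power_divide powr_minus_divide)
          ultimately show "(2 * (1 / R)) ^ 3 + 4 * (5 / 9) ^ n \<le> 12 * R powr (- 3)" by linarith
        qed (use C2 R0 in auto)
        finally show ?thesis by (simp add: mult_ac)
      qed
      have "walk_collision (2 * (1 / R)) n * (C1 * R ^ 3 * (8 * R powr (- c)))
         \<le> (12 * C2 * R powr (c / 2) * R powr (- 3)) * (C1 * R ^ 3 * (8 * R powr (- c)))"
        using C1 R0 by (intro mult_right_mono col) auto
      also have "\<dots> = 12 * C2 * (8 * C1) * (R powr (c / 2) * R powr (- c) * (R powr (- 3) * R powr 3))"
        using R0 by (simp add: mult_ac)
      also have "R powr (c / 2) * R powr (- c) * (R powr (- 3) * R powr 3) = (R powr (- c / 4))\<^sup>2"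
        using R0 by (simp add: power2_eq_square del: powr_numeral flip: powr_add)
      finally have "sqrt (walk_collision (2 * (1 / R)) n * (C1 * R ^ 3 * (8 * R powr (- c))))
         \<le> sqrt (12 * C2 * (8 * C1)) * R powr (- c / 4)"
        by (metis powr_ge_zero real_sqrt_abs abs_of_nonneg real_sqrt_le_iff real_sqrt_mult)
      then have "exp (2 * pi / (1 - r)) * sqrt (walk_collision (2 * (1 / R)) n * (C1 * R ^ 3 * (8 * R powr (- c))))
         \<le> exp (2 * pi / (1 - r)) * (sqrt (12 * C2 * (8 * C1)) * R powr (- c / 4))"
        by (intro mult_left_mono) auto
      also have "\<dots> = C * R powr (- 1 / (256 * ln (5 * real q)))"
        by (simp add: C_def c_def l_def)
      finally have "walk_mean n (\<lambda>W. damped_mean r L (act W \<xi>')) \<le> C * R powr (- 1 / (256 * ln (5 * real q)))"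
        using W by linarith
      then have "walk_mean n (\<lambda>W. damped_mean r L (act W \<xi>')) * M \<le> C * R powr (- 1 / (256 * ln (5 * real q))) * M"
        using M by (intro mult_right_mono)
      moreover have "f \<xi> \<le> walk_mean n (\<lambda>W. damped_mean r L (act W \<xi>')) * M"
        unfolding \<xi>'_def using M(2) \<xi> by (intro mean_damped_block[OF f r(1)]) auto
      ultimately show "f \<xi> \<le> C * R powr (- 1 / (256 * ln (5 * real q))) * M" by linarith
    qed
  qed
qed

text \<open>The exponent of the decay grows by \<open>c / 2\<close> in each round: a decay \<open>R\<^sup>-\<^sup>b\<close> at the smaller
  frequency amounts to \<open>R powr (- (1 - 16 / q) * b)\<close>, the step gains \<open>R\<^sup>-\<^sup>c\<close>, and \<open>16 * b / q\<close> is
  at most \<open>c / 2\<close> while \<open>b\<close> is at most 12. This last condition is the inequality between \<open>q\<close> and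
  its logarithm.\<close>
lemma mean_damped_decay:
  fixes f :: "real^3 \<Rightarrow> real" and q :: nat
  assumes q: "even q" "q \<ge> 32" and qc: "98304 * ln (5 * real q) \<le> real q"
    and f: "mean_damped (1 - 1 / real q) f"
  obtains K where "K > 0" "\<And>\<xi>. 1 \<le> norm \<xi> \<Longrightarrow> f \<xi> \<le> K * norm \<xi> powr (- 12)"
proof -
  define r where "r = 1 - 1 / real q"
  define c where "c = 1 / (256 * ln (5 * real q))"
  obtain C where C0: "C > 0"
    "\<And>R. exp 1 \<le> R \<Longrightarrow> \<exists>m. R powr (1 - 16 / real q) \<le> (1 - 1 / real q) ^ m * R \<and>
       (\<forall>f \<xi> M. mean_damped (1 - 1 / real q) f \<longrightarrow> norm \<xi> = R \<longrightarrow> 0 \<le> M \<longrightarrow>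
          (\<forall>\<zeta>. norm \<zeta> = (1 - 1 / real q) ^ m * R \<longrightarrow> f \<zeta> \<le> M) \<longrightarrow>
          f \<xi> \<le> C * R powr (- 1 / (256 * ln (5 * real q))) * M)"
    by (rule mean_damped_decay_step[OF q], rule that, assumption, assumption)
  have ceq: "- 1 / (256 * ln (5 * real q)) = - c" by (simp add: c_def)
  note C = C0(1) C0(2)[unfolded ceq, folded r_def]
  have ln5q: "0 < ln (5 * real q)" using q by (intro ln_gt_zero) simp
  then have c0: "0 < c" by (simp add: c_def)
  have qc': "192 / real q \<le> c / 2"
    using qc ln5q q by (simp add: c_def field_simps)
  have main: "real j * (c / 2) \<le> 12 + c / 2 \<Longrightarrow>
      \<exists>K>0. \<forall>\<xi>. 1 \<le> norm \<xi> \<longrightarrow> f \<xi> \<le> K * norm \<xi> powr (- (real j * (c / 2)))" for j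
  proof (induction j)
    case 0
    have "f \<xi> \<le> 1 * norm \<xi> powr (- (real 0 * (c / 2)))" if "1 \<le> norm \<xi>" for \<xi>
      using f that by (auto simp: mean_damped_def)
    then show ?case by (intro exI[of _ 1]) auto
  next
    case (Suc j)
    define b where "b = real j * (c / 2)"
    have b: "0 \<le> b" "b \<le> 12" "real (Suc j) * (c / 2) = b + c / 2"
      using Suc.prems c0 by (auto simp: b_def algebra_simps)
    obtain K where K: "K > 0" "\<And>\<xi>. 1 \<le> norm \<xi> \<Longrightarrow> f \<xi> \<le> K * norm \<xi> powr (- b)"
      using Suc.IH Suc.prems b(2) c0 unfolding b_def by auto
    define K' where "K' = exp (b + c / 2) + C * K"
    have "f \<xi> \<le> K' * norm \<xi> powr (- (b + c / 2))" if x: "1 \<le> norm \<xi>" for \<xi>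
    proof -
      define R where "R = norm \<xi>"
      have R1: "1 \<le> R" using x by (simp add: R_def)
      show ?thesis
      proof (cases "exp 1 \<le> R")
        case False
        have "f \<xi> \<le> 1" using f by (simp add: mean_damped_def)
        also have "\<dots> \<le> exp (b + c / 2) * R powr (- (b + c / 2))"
        proof -
          have "ln R \<le> ln (exp 1)" using False R1 by (subst ln_le_cancel_iff) auto
          then have "(b + c / 2) * ln R \<le> (b + c / 2) * 1" using b c0 by (intro mult_left_mono) auto
          then have "0 \<le> b + c / 2 + - (b + c / 2) * ln R" by (simp add: algebra_simps)
          then show ?thesis using R1 by (simp add: powr_def flip: exp_add)
        qed
        also have "\<dots> \<le> K' * R powr (- (b + c / 2))"
          using C K by (intro mult_right_mono) (auto simp: K'_def)
        finally show ?thesis by (simp add: R_def)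
      next
        case True
        obtain m where m: "R powr (1 - 16 / real q) \<le> r ^ m * R"
          "\<And>f \<xi> M. mean_damped r f \<Longrightarrow> norm \<xi> = R \<Longrightarrow> 0 \<le> M \<Longrightarrow> (\<And>\<zeta>. norm \<zeta> = r ^ m * R \<Longrightarrow> f \<zeta> \<le> M) \<Longrightarrow>
          f \<xi> \<le> C * R powr (- c) * M"
          using C(2)[OF True] by blast
        define M where "M = K * (R powr (1 - 16 / real q)) powr (- b)"
        have R1': "1 \<le> R powr (1 - 16 / real q)" using R1 q by (intro ge_one_powr_ge_zero) auto
        have "f \<xi> \<le> C * R powr (- c) * M"
        proof (rule m(2))
          show "mean_damped r f" using f by (simp add: r_def)
          show "norm \<xi> = R" by (simp add: R_def)
          show "0 \<le> M" using K by (simp add: M_def)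
          fix \<zeta> :: "real^3" assume z: "norm \<zeta> = r ^ m * R"
          have "f \<zeta> \<le> K * norm \<zeta> powr (- b)" using m(1) R1' z by (intro K(2)) linarith
          also have "\<dots> \<le> M" unfolding M_def
            using m(1) z b K R1' by (intro mult_left_mono powr_mono2') auto
          finally show "f \<zeta> \<le> M" .
        qed
        also have "\<dots> = C * K * R powr (- c - (1 - 16 / real q) * b)"
          using R1 by (simp add: M_def powr_powr flip: powr_add)
        also have "\<dots> \<le> C * K * R powr (- (b + c / 2))"
        proof (intro mult_left_mono powr_mono)
          have "16 / real q * b \<le> 16 / real q * 12" using b by (intro mult_left_mono) auto
          then have "16 / real q * b \<le> c / 2" using qc' by linarith
          then show "- c - (1 - 16 / real q) * b \<le> - (b + c / 2)" by (simp add: algebra_simps)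
        qed (use C K R1 in auto)
        also have "\<dots> \<le> K' * R powr (- (b + c / 2))"
          by (intro mult_right_mono) (auto simp: K'_def)
        finally show ?thesis by (simp add: R_def)
      qed
    qed
    moreover have "K' > 0" using C K by (simp add: K'_def add_pos_pos)
    ultimately show ?case unfolding b(3) by blast
  qed
  \<comment> \<open>Just enough rounds of size \<open>c / 2\<close> to reach the exponent 12.\<close>
  define j where "j = nat \<lceil>24 / c\<rceil>"
  have j: "24 / c \<le> real j" "real j \<le> 24 / c + 1"
  proof -
    show "24 / c \<le> real j" unfolding j_def by (rule real_nat_ceiling_ge)
    have "0 < 24 / c" using c0 by simp
    then have "real j = real_of_int \<lceil>24 / c\<rceil>" unfolding j_def by (subst of_nat_nat) linarith+
    then show "real j \<le> 24 / c + 1" by linarith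
  qed
  have "real j * (c / 2) \<le> (24 / c + 1) * (c / 2)" using j c0 by (intro mult_right_mono) auto
  also have "\<dots> = 12 + c / 2" using c0 by (simp add: field_simps)
  finally obtain K where K: "K > 0" "\<And>\<xi>. 1 \<le> norm \<xi> \<Longrightarrow> f \<xi> \<le> K * norm \<xi> powr (- (real j * (c / 2)))"
    using main by blast
  have "24 / c * (c / 2) \<le> real j * (c / 2)" using j c0 by (intro mult_right_mono) auto
  then have j12: "12 \<le> real j * (c / 2)" using c0 by simp
  show ?thesis
  proof (rule that[OF K(1)])
    fix \<xi> :: "real^3" assume x: "1 \<le> norm \<xi>"
    have "norm \<xi> powr (- (real j * (c / 2))) \<le> norm \<xi> powr (- 12)" using j12 x by (intro powr_mono) auto
    then show "f \<xi> \<le> K * norm \<xi> powr (- 12)" using K(2)[OF x] K(1) by (meson mult_left_mono less_imp_le order_trans)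
  qed
qed

lemma scale_constraint: "98304 * ln (5 * real (2097152::nat)) \<le> real (2097152::nat)"
proof -
  have "ln (5 * real (2097152::nat)) \<le> ln (2 ^ 24)" by (subst ln_le_cancel_iff) auto
  also have "ln ((2::real) ^ 24) = real 24 * ln 2" by (rule ln_realpow)
  also have "\<dots> \<le> real 24 * (25 / 36)" using ln2_le_25_over_36 by (intro mult_left_mono) auto
  finally have "98304 * ln (5 * real (2097152::nat)) \<le> 98304 * (real 24 * (25 / 36))" by (rule mult_left_mono) simp
  also have "\<dots> \<le> real (2097152::nat)" by simp
  finally show ?thesis .
qed

section \<open>The self-similar measure\<close>

text \<open>The symbol \<open>(\<alpha>, b, c)\<close> names a map of the system by the generator and the two translation
  digits.\<close>
type_synonym symbol = "iquat \<times> bool \<times> bool"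

definition ifs_map :: "real \<Rightarrow> symbol \<Rightarrow> R4 \<Rightarrow> R4" where
  "ifs_map r = (\<lambda>(\<alpha>, b, c) (x, y). (r *\<^sub>R act \<alpha> x + of_bool b *\<^sub>R axis 1 1, r * y + of_bool c))"

text \<open>A small \<open>e\<close> makes the vertical digits predictable, while rotations and horizontal digits
  remain uniform.\<close>
definition symbol_pmf :: "real \<Rightarrow> symbol pmf" where
  "symbol_pmf e = pair_pmf (pmf_of_set gens) (pair_pmf (bernoulli_pmf (1 / 2)) (bernoulli_pmf e))"

text \<open>The zero quaternion has no direction; its \<open>uquat\<close> is 0.\<close>
lemma norm_uquat_le: "norm (uquat A) \<le> 1"
  by (simp add: uquat_def)

lemma norm_act_le: "norm (act A x) \<le> norm x"
proof -
  have "(norm (uquat A))\<^sup>2 \<le> 1\<^sup>2" by (intro power_mono norm_uquat_le) simp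
  then have "(norm (uquat A))\<^sup>2 * norm x \<le> 1 * norm x" by (intro mult_right_mono) auto
  then show ?thesis by (simp add: norm_rot_general)
qed

lemma ifs_map_contracts:
  assumes "0 \<le> r"
  shows "dist (ifs_map r j p) (ifs_map r j p') \<le> r * dist p p'"
proof -
  obtain \<alpha> b c where j: "j = (\<alpha>, b, c)" by (cases j)
  obtain x y where p: "p = (x, y)" by (cases p)
  obtain x' y' where p': "p' = (x', y')" by (cases p')
  have "r *\<^sub>R act \<alpha> x - r *\<^sub>R act \<alpha> x' = r *\<^sub>R act \<alpha> (x - x')" by (simp add: rot_diff scaleR_diff_right)
  then have "dist (r *\<^sub>R act \<alpha> x + of_bool b *\<^sub>R axis 1 1) (r *\<^sub>R act \<alpha> x' + of_bool b *\<^sub>R axis 1 1) = r * norm (act \<alpha> (x - x'))"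
    using assms by (simp add: dist_norm)
  also have "\<dots> \<le> r * dist x x'" using norm_act_le[of \<alpha> "x - x'"] assms by (simp add: dist_norm mult_left_mono)
  finally have 1: "(dist (r *\<^sub>R act \<alpha> x + of_bool b *\<^sub>R axis 1 1) (r *\<^sub>R act \<alpha> x' + of_bool b *\<^sub>R axis 1 1))\<^sup>2 \<le> (r * dist x x')\<^sup>2"
    by (intro power_mono) auto
  have 2: "dist (r * y + of_bool c) (r * y' + of_bool c) = r * dist y y'"
    using assms by (simp add: dist_real_def abs_mult flip: right_diff_distrib)
  have "dist (ifs_map r j p) (ifs_map r j p') \<le> sqrt ((r * dist x x')\<^sup>2 + (r * dist y y')\<^sup>2)"
    unfolding ifs_map_def j p p' dist_prod_def using 1 2 by simp
  also have "\<dots> = r * dist p p'"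
    using assms by (simp add: p p' dist_prod_def power_mult_distrib real_sqrt_mult flip: distrib_left)
  finally show ?thesis .
qed

lemma continuous_ifs_map: "0 \<le> r \<Longrightarrow> continuous_on UNIV (ifs_map r j)"
proof -
  assume r: "0 \<le> r"
  have "r-lipschitz_on UNIV (ifs_map r j)"
    using ifs_map_contracts[OF r] r by (intro lipschitz_onI) auto
  then show ?thesis by (rule lipschitz_on_continuous_on)
qed

lemma measurable_ifs_map [measurable]: "0 \<le> r \<Longrightarrow> ifs_map r j \<in> borel_measurable borel"
  by (intro borel_measurable_continuous_onI continuous_ifs_map)

primrec ifs_iterate :: "real \<Rightarrow> nat \<Rightarrow> symbol stream \<Rightarrow> R4" where
  "ifs_iterate r 0 \<omega> = 0"
| "ifs_iterate r (Suc n) \<omega> = ifs_map r (shd \<omega>) (ifs_iterate r n (stl \<omega>))"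

lemma norm_ifs_map_zero: "norm (ifs_map r j 0) \<le> 2"
proof -
  obtain \<alpha> b c where j: "j = (\<alpha>, b, c)" by (cases j)
  have z: "(0::R4) = (0, 0)" by (simp add: prod_eq_iff)
  have r0: "rot q 0 = 0" for q by (simp add: rot_def quat_simps)
  have "ifs_map r j 0 = (of_bool b *\<^sub>R axis 1 1, of_bool c)" by (simp add: ifs_map_def j z r0)
  then have "norm (ifs_map r j 0) \<le> norm (of_bool b *\<^sub>R axis 1 1 :: real^3) + norm (of_bool c :: real)"
    by (simp add: norm_Pair sqrt_sum_squares_le_sum)
  also have "\<dots> \<le> 1 + 1" by (intro add_mono) auto
  finally show ?thesis by simp
qed

lemma ifs_iterate_step:
  assumes "0 \<le> r"
  shows "dist (ifs_iterate r (Suc n) \<omega>) (ifs_iterate r n \<omega>) \<le> 2 * r ^ n"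
proof (induction n arbitrary: \<omega>)
  case 0
  then show ?case using norm_ifs_map_zero by simp
next
  case (Suc n)
  have "dist (ifs_iterate r (Suc (Suc n)) \<omega>) (ifs_iterate r (Suc n) \<omega>)
     \<le> r * dist (ifs_iterate r (Suc n) (stl \<omega>)) (ifs_iterate r n (stl \<omega>))"
    using ifs_map_contracts[OF assms] by simp
  also have "\<dots> \<le> r * (2 * r ^ n)" using Suc assms by (intro mult_left_mono) auto
  finally show ?case by (simp add: mult_ac)
qed

definition coding :: "real \<Rightarrow> symbol stream \<Rightarrow> R4" where
  "coding r \<omega> = lim (\<lambda>n. ifs_iterate r n \<omega>)"

lemma ifs_iterate_tendsto:
  assumes r: "0 \<le> r" "r < 1"
  shows "(\<lambda>n. ifs_iterate r n \<omega>) \<longlonglongrightarrow> coding r \<omega>"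
proof -
  have "summable (\<lambda>n. ifs_iterate r (Suc n) \<omega> - ifs_iterate r n \<omega>)"
  proof (rule summable_norm_cancel, rule summable_comparison_test')
    show "summable (\<lambda>n. 2 * r ^ n)" using r by (intro summable_mult summable_geometric) auto
    show "norm (norm (ifs_iterate r (Suc n) \<omega> - ifs_iterate r n \<omega>)) \<le> 2 * r ^ n" if "n \<ge> 0" for n
      using ifs_iterate_step[OF r(1), of n \<omega>] by (simp add: dist_norm)
  qed
  then have "convergent (\<lambda>n. \<Sum>i<n. ifs_iterate r (Suc i) \<omega> - ifs_iterate r i \<omega>)"
    by (simp only: summable_iff_convergent)
  then have "convergent (\<lambda>n. ifs_iterate r n \<omega>)"
  proof -
    have "(\<Sum>i<n. ifs_iterate r (Suc i) \<omega> - ifs_iterate r i \<omega>) = ifs_iterate r n \<omega>" for n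
      using sum_lessThan_telescope[of "\<lambda>i. ifs_iterate r i \<omega>" n] by simp
    with \<open>convergent _\<close> show ?thesis by (simp only:)
  qed
  then show ?thesis by (simp add: coding_def convergent_LIMSEQ_iff)
qed

lemma coding_Stream:
  assumes r: "0 \<le> r" "r < 1"
  shows "coding r (j ## \<omega>) = ifs_map r j (coding r \<omega>)"
proof (rule LIMSEQ_unique)
  show "(\<lambda>n. ifs_iterate r (Suc n) (j ## \<omega>)) \<longlonglongrightarrow> coding r (j ## \<omega>)"
    by (rule LIMSEQ_Suc[OF ifs_iterate_tendsto[OF r]])
  have "isCont (ifs_map r j) (coding r \<omega>)"
    using continuous_ifs_map[OF r(1)] continuous_on_eq_continuous_at[OF open_UNIV] by blast
  then have "(\<lambda>n. ifs_map r j (ifs_iterate r n \<omega>)) \<longlonglongrightarrow> ifs_map r j (coding r \<omega>)"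
    by (rule isCont_tendsto_compose[OF _ ifs_iterate_tendsto[OF r]])
  then show "(\<lambda>n. ifs_iterate r (Suc n) (j ## \<omega>)) \<longlonglongrightarrow> ifs_map r j (coding r \<omega>)" by simp
qed

lemma ifs_iterate_bounds:
  assumes r: "0 \<le> r" "r < 1"
  shows "norm (ifs_iterate r n \<omega>) \<le> 2 / (1 - r) \<and> 0 \<le> snd (ifs_iterate r n \<omega>) \<and> snd (ifs_iterate r n \<omega>) \<le> 1 / (1 - r)"
proof (induction n arbitrary: \<omega>)
  case 0
  then show ?case using r by simp
next
  case (Suc n)
  let ?p = "ifs_iterate r n (stl \<omega>)"
  obtain \<alpha> b c where j: "shd \<omega> = (\<alpha>, b, c)" by (cases "shd \<omega>")
  obtain x y where p: "?p = (x, y)" by (cases ?p)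
  have y: "0 \<le> y" "y \<le> 1 / (1 - r)" using Suc[of "stl \<omega>"] p by auto
  have s: "snd (ifs_iterate r (Suc n) \<omega>) = r * y + of_bool c" by (simp add: ifs_map_def j p)
  have "r * y + of_bool c \<le> r * (1 / (1 - r)) + 1" using y r by (intro add_mono mult_left_mono) auto
  also have "\<dots> = 1 / (1 - r)" using r by (simp add: field_simps)
  finally have 1: "r * y + of_bool c \<le> 1 / (1 - r)" .
  have "norm (ifs_iterate r (Suc n) \<omega>) \<le> dist (ifs_map r (shd \<omega>) ?p) (ifs_map r (shd \<omega>) 0) + norm (ifs_map r (shd \<omega>) 0)"
    using dist_triangle[of "ifs_map r (shd \<omega>) ?p" 0 "ifs_map r (shd \<omega>) 0"] by simp
  also have "\<dots> \<le> r * norm ?p + 2"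
    using ifs_map_contracts[OF r(1), of "shd \<omega>" ?p 0] norm_ifs_map_zero[of r "shd \<omega>"] by simp
  also have "\<dots> \<le> r * (2 / (1 - r)) + 2" using Suc[of "stl \<omega>"] r by (intro add_mono mult_left_mono) auto
  also have "\<dots> = 2 / (1 - r)" using r by (simp add: field_simps)
  finally show ?case using s 1 y r by simp
qed

lemma coding_bounds:
  assumes r: "0 \<le> r" "r < 1"
  shows "norm (coding r \<omega>) \<le> 2 / (1 - r)" "snd (coding r \<omega>) \<in> {0..1 / (1 - r)}"
proof -
  note t = ifs_iterate_tendsto[OF r, of \<omega>]
  show "norm (coding r \<omega>) \<le> 2 / (1 - r)"
    by (rule Lim_bounded[OF tendsto_norm[OF t], of 0]) (use ifs_iterate_bounds[OF r] in auto)
  have "snd (coding r \<omega>) \<le> 1 / (1 - r)"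
    by (rule Lim_bounded[OF tendsto_snd[OF t], of 0]) (use ifs_iterate_bounds[OF r] in auto)
  moreover have "0 \<le> snd (coding r \<omega>)"
    by (rule Lim_bounded2[OF tendsto_snd[OF t], of 0]) (use ifs_iterate_bounds[OF r] in auto)
  ultimately show "snd (coding r \<omega>) \<in> {0..1 / (1 - r)}" by simp
qed

definition code_space :: "real \<Rightarrow> symbol stream measure" where
  "code_space e = stream_space (measure_pmf (symbol_pmf e))"

text \<open>The law of the limit point of a random sequence of maps with independent symbols.\<close>
definition ifs_measure :: "real \<Rightarrow> real \<Rightarrow> R4 measure" where
  "ifs_measure r e = distr (code_space e) borel (coding r)"

lemma prob_space_code_space: "prob_space (code_space e)"
  unfolding code_space_def by (rule prob_space.prob_space_stream_space[OF prob_space_measure_pmf])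

lemma space_code_space [simp]: "space (code_space e) = UNIV"
  by (simp add: code_space_def space_stream_space)

lemma measurable_ifs_iterate [measurable]:
  assumes r: "0 \<le> r"
  shows "ifs_iterate r n \<in> borel_measurable (code_space e)"
proof (induction n)
  case 0
  show ?case by simp
next
  case (Suc n)
  have stl: "stl \<in> measurable (code_space e) (code_space e)" unfolding code_space_def by measurable
  have shd: "shd \<in> measurable (code_space e) (count_space UNIV)"
    unfolding code_space_def using measurable_shd[of "measure_pmf (symbol_pmf e)"]
    by (simp add: measurable_cong_sets[OF refl, of "measure_pmf (symbol_pmf e)" "count_space UNIV"])
  have "(\<lambda>\<omega>. (\<lambda>j \<omega>. ifs_map r j (ifs_iterate r n (stl \<omega>))) (shd \<omega>) \<omega>) \<in> borel_measurable (code_space e)"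
  proof (rule measurable_compose_countable[OF _ shd])
    fix j
    show "(\<lambda>\<omega>. ifs_map r j (ifs_iterate r n (stl \<omega>))) \<in> borel_measurable (code_space e)"
      using measurable_compose[OF measurable_compose[OF stl Suc] measurable_ifs_map[OF r]] by simp
  qed
  then show ?case by simp
qed

lemma measurable_coding [measurable]:
  assumes r: "0 \<le> r" "r < 1"
  shows "coding r \<in> borel_measurable (code_space e)"
  by (rule borel_measurable_LIMSEQ_metric[where f = "ifs_iterate r"])
     (use measurable_ifs_iterate[OF r(1)] ifs_iterate_tendsto[OF r] in auto)

lemma sets_ifs_measure [simp, measurable_cong]: "sets (ifs_measure r e) = sets borel"
  by (simp add: ifs_measure_def)

lemma space_ifs_measure [simp]: "space (ifs_measure r e) = UNIV"
  by (simp add: ifs_measure_def)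

lemma prob_space_ifs_measure: "0 \<le> r \<Longrightarrow> r < 1 \<Longrightarrow> prob_space (ifs_measure r e)"
  unfolding ifs_measure_def by (intro prob_space.prob_space_distr prob_space_code_space measurable_coding)

lemma AE_ifs_measure_bounds:
  assumes r: "0 \<le> r" "r < 1"
  shows "AE p in ifs_measure r e. norm p \<le> 2 / (1 - r)" "AE p in ifs_measure r e. snd p \<in> {0..1 / (1 - r)}"
proof -
  have c: "closed {p::R4. norm p \<le> 2 / (1 - r)}" "closed {p::R4. snd p \<in> {0..1 / (1 - r)}}"
    unfolding atLeastAtMost_iff by (intro closed_Collect_le closed_Collect_conj continuous_intros)+
  show "AE p in ifs_measure r e. norm p \<le> 2 / (1 - r)" "AE p in ifs_measure r e. snd p \<in> {0..1 / (1 - r)}"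
    unfolding ifs_measure_def
    by (rule AE_distr_iff[OF measurable_coding[OF r], THEN iffD2],
        use c[THEN borel_closed] in simp, intro AE_I2 coding_bounds[OF r])+
qed

lemma gens_nonempty [simp]: "gens \<noteq> {}"
  by (simp add: gens_def)

lemma expectation_symbol_pmf:
  fixes g :: "symbol \<Rightarrow> 'b::{banach, second_countable_topology}"
  assumes e: "0 \<le> e" "e \<le> 1"
  shows "measure_pmf.expectation (symbol_pmf e) g =
     (\<Sum>\<alpha>\<in>gens. (1 / 6) *\<^sub>R ((1 / 2) *\<^sub>R ((1 - e) *\<^sub>R g (\<alpha>, False, False) + e *\<^sub>R g (\<alpha>, False, True))
        + (1 / 2) *\<^sub>R ((1 - e) *\<^sub>R g (\<alpha>, True, False) + e *\<^sub>R g (\<alpha>, True, True))))"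
proof -
  let ?A = "gens \<times> UNIV \<times> UNIV :: symbol set"
  have "measure_pmf.expectation (symbol_pmf e) g = (\<Sum>a\<in>?A. pmf (symbol_pmf e) a *\<^sub>R g a)"
    by (rule integral_measure_pmf) (auto simp: symbol_pmf_def set_pmf_of_set)
  also have "\<dots> = (\<Sum>\<alpha>\<in>gens. \<Sum>b\<in>UNIV. \<Sum>c\<in>UNIV. pmf (symbol_pmf e) (\<alpha>, b, c) *\<^sub>R g (\<alpha>, b, c))"
    by (simp add: sum.cartesian_product)
  also have "\<dots> = (\<Sum>\<alpha>\<in>gens. (1 / 6) *\<^sub>R ((1 / 2) *\<^sub>R ((1 - e) *\<^sub>R g (\<alpha>, False, False) + e *\<^sub>R g (\<alpha>, False, True))
        + (1 / 2) *\<^sub>R ((1 - e) *\<^sub>R g (\<alpha>, True, False) + e *\<^sub>R g (\<alpha>, True, True))))"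
    using e by (intro sum.cong refl) (simp add: symbol_pmf_def pmf_pair UNIV_bool scaleR_add_right)
  finally show ?thesis .
qed

text \<open>The first symbol is independent of the remaining ones, and these are distributed like the
  whole sequence.\<close>
lemma integral_ifs_measure:
  fixes g :: "R4 \<Rightarrow> 'b::{banach, second_countable_topology}"
  assumes r: "0 \<le> r" "r < 1" and g [measurable]: "g \<in> borel_measurable borel" and bnd: "\<And>p. norm (g p) \<le> B"
  shows "(\<integral>p. g p \<partial>ifs_measure r e) = measure_pmf.expectation (symbol_pmf e) (\<lambda>j. \<integral>p. g (ifs_map r j p) \<partial>ifs_measure r e)"
proof -
  interpret C: prob_space "code_space e" by (rule prob_space_code_space)
  interpret P: pair_prob_space "measure_pmf (symbol_pmf e)" "code_space e" ..
  note [measurable] = measurable_coding[OF r]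
  have S[measurable]: "(\<lambda>(j, \<omega>). j ## \<omega>) \<in> measurable (measure_pmf (symbol_pmf e) \<Otimes>\<^sub>M code_space e) (code_space e)"
    unfolding code_space_def by measurable
  have eq: "distr (measure_pmf (symbol_pmf e) \<Otimes>\<^sub>M code_space e) (code_space e) (\<lambda>(j, \<omega>). j ## \<omega>) = code_space e"
  proof (rule measure_eqI)
    fix X assume "X \<in> sets (distr (measure_pmf (symbol_pmf e) \<Otimes>\<^sub>M code_space e) (code_space e) (\<lambda>(j, \<omega>). j ## \<omega>))"
    then have X[measurable]: "X \<in> sets (code_space e)" by simp
    have "emeasure (distr (measure_pmf (symbol_pmf e) \<Otimes>\<^sub>M code_space e) (code_space e) (\<lambda>(j, \<omega>). j ## \<omega>)) X
      = (\<integral>\<^sup>+z. indicator X (case z of (j, \<omega>) \<Rightarrow> j ## \<omega>) \<partial>(measure_pmf (symbol_pmf e) \<Otimes>\<^sub>M code_space e))"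
      using X S by (subst nn_integral_indicator[symmetric], simp) (subst nn_integral_distr, auto)
    also have "\<dots> = (\<integral>\<^sup>+j. \<integral>\<^sup>+\<omega>. indicator X (j ## \<omega>) \<partial>code_space e \<partial>measure_pmf (symbol_pmf e))"
      by (subst C.nn_integral_fst[symmetric]) (auto simp: measurable_compose[OF S])
    also have "\<dots> = (\<integral>\<^sup>+\<omega>. indicator X \<omega> \<partial>code_space e)"
      using X unfolding code_space_def
      by (intro prob_space.nn_integral_stream_space[OF prob_space_measure_pmf, symmetric]) simp
    finally show "emeasure (distr (measure_pmf (symbol_pmf e) \<Otimes>\<^sub>M code_space e) (code_space e) (\<lambda>(j, \<omega>). j ## \<omega>)) X = emeasure (code_space e) X"
      by simp
  qed simp
  have "(\<integral>p. g p \<partial>ifs_measure r e) = (\<integral>\<omega>. g (coding r \<omega>) \<partial>code_space e)"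
    unfolding ifs_measure_def by (intro integral_distr) auto
  also have "\<dots> = (\<integral>z. g (coding r (case z of (j, \<omega>) \<Rightarrow> j ## \<omega>)) \<partial>(measure_pmf (symbol_pmf e) \<Otimes>\<^sub>M code_space e))"
    by (subst eq[symmetric], rule integral_distr[OF S]) measurable
  also have "\<dots> = (\<integral>z. (case z of (j, \<omega>) \<Rightarrow> g (ifs_map r j (coding r \<omega>))) \<partial>(measure_pmf (symbol_pmf e) \<Otimes>\<^sub>M code_space e))"
    by (intro Bochner_Integration.integral_cong) (auto simp: coding_Stream[OF r])
  also have "\<dots> = (\<integral>j. \<integral>\<omega>. g (ifs_map r j (coding r \<omega>)) \<partial>code_space e \<partial>measure_pmf (symbol_pmf e))"
  proof -
    have "(\<lambda>z. g (coding r (case z of (j, \<omega>) \<Rightarrow> j ## \<omega>))) \<in> borel_measurable (measure_pmf (symbol_pmf e) \<Otimes>\<^sub>M code_space e)"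
      by measurable
    then have m: "(\<lambda>(j, \<omega>). g (ifs_map r j (coding r \<omega>))) \<in> borel_measurable (measure_pmf (symbol_pmf e) \<Otimes>\<^sub>M code_space e)"
      by (rule measurable_cong[THEN iffD1, rotated]) (auto simp: coding_Stream[OF r])
    have "integrable (measure_pmf (symbol_pmf e) \<Otimes>\<^sub>M code_space e) (\<lambda>(j, \<omega>). g (ifs_map r j (coding r \<omega>)))"
      by (rule P.P.integrable_const_bound[of _ B]) (use m in \<open>simp_all add: split_beta bnd\<close>)
    from P.integral_fst'[OF this] show ?thesis by simp
  qed
  also have "\<dots> = (\<integral>j. \<integral>p. g (ifs_map r j p) \<partial>ifs_measure r e \<partial>measure_pmf (symbol_pmf e))"
    unfolding ifs_measure_def
    by (intro Bochner_Integration.integral_cong refl integral_distr[symmetric])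
       (auto intro!: measurable_compose[OF measurable_ifs_map[OF r(1)] g])
  finally show ?thesis .
qed

section \<open>Its Fourier transform\<close>

lemma uquat_gens: "\<alpha> \<in> gens \<Longrightarrow> uquat \<alpha> = (1 / sqrt 5) *\<^sub>R emb \<alpha>"
proof -
  assume "\<alpha> \<in> gens"
  then have "(norm (emb \<alpha>))\<^sup>2 = 5" by (simp add: norm_emb inorm_gens)
  then have "norm (emb \<alpha>) = sqrt 5" by (metis norm_ge_zero real_sqrt_abs abs_of_nonneg)
  then show ?thesis by (simp add: uquat_def)
qed

text \<open>The real part is odd and positive, and three squares of even numbers cannot sum to more than
  4, so one of them is 4 and the real part is 1.\<close>
lemma Omega_5: "Omega 5 = uquat ` gens"
proof
  show "Omega 5 \<subseteq> uquat ` gens"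
  proof
    fix w assume "w \<in> Omega 5"
    then obtain a b c d :: int where w: "w = (1 / sqrt (real 5)) *\<^sub>R (real_of_int a, vector [real_of_int b, real_of_int c, real_of_int d])"
      and eq: "a\<^sup>2 + b\<^sup>2 + c\<^sup>2 + d\<^sup>2 = int 5" and par: "a > 0" "odd a" "even b" "even c" "even d"
      unfolding Omega_def by blast
    have sq: "0 \<le> x\<^sup>2" for x :: int by simp
    have ev: "x = -2 \<or> x = 0 \<or> x = 2" if "even x" "x\<^sup>2 \<le> 5" for x :: int
    proof -
      have "\<bar>x\<bar> < 3"
      proof (rule ccontr)
        assume "\<not> \<bar>x\<bar> < 3"
        then have "3\<^sup>2 \<le> \<bar>x\<bar>\<^sup>2" by (intro power_mono) auto
        then show False using that by simp
      qed
      then have "x \<in> {-2, -1, 0, 1, 2}" by auto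
      then show ?thesis using that(1) by auto
    qed
    have le: "a\<^sup>2 \<le> 5" "b\<^sup>2 \<le> 5" "c\<^sup>2 \<le> 5" "d\<^sup>2 \<le> 5" using eq sq[of a] sq[of b] sq[of c] sq[of d] by linarith+
    have "a = 1"
    proof -
      have "a < 3"
      proof (rule ccontr)
        assume "\<not> a < 3"
        then have "3\<^sup>2 \<le> a\<^sup>2" by (intro power_mono) auto
        then show False using le by simp
      qed
      then have "a = 1 \<or> a = 2" using par by auto
      then show ?thesis using par by auto
    qed
    then have "b\<^sup>2 + c\<^sup>2 + d\<^sup>2 = 4" using eq by simp
    then have "(a, b, c, d) \<in> gens"
      using ev[OF par(3) le(2)] ev[OF par(4) le(3)] ev[OF par(5) le(4)] \<open>a = 1\<close>
      by (elim disjE; simp add: gens_def)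
    then show "w \<in> uquat ` gens" unfolding w by (intro image_eqI[of _ _ "(a, b, c, d)"]) (simp_all add: uquat_gens)
  qed
  show "uquat ` gens \<subseteq> Omega 5"
  proof
    fix w assume "w \<in> uquat ` gens"
    then obtain \<alpha> where \<alpha>: "\<alpha> \<in> gens" "w = uquat \<alpha>" by blast
    obtain a b c d where abcd: "\<alpha> = (a, b, c, d)" by (cases \<alpha>)
    have P: "a\<^sup>2 + b\<^sup>2 + c\<^sup>2 + d\<^sup>2 = int 5 \<and> a > 0 \<and> odd a \<and> even b \<and> even c \<and> even d"
      using \<alpha>(1) unfolding abcd by (auto simp: gens_def)
    have E: "uquat (a, b, c, d) = (1 / sqrt (real 5)) *\<^sub>R (real_of_int a, vector [real_of_int b, real_of_int c, real_of_int d])"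
      using uquat_gens[OF \<alpha>(1)] unfolding abcd by (simp only: emb.simps of_nat_numeral)
    show "w \<in> Omega 5" unfolding Omega_def \<alpha>(2) abcd
      by (rule CollectI, rule exI[of _ a], rule exI[of _ b], rule exI[of _ c], rule exI[of _ d], rule conjI) (rule E, rule P)
  qed
qed

lemma Ad_unit: "norm w = 1 \<Longrightarrow> Ad w = rot w"
  by (intro ext) (simp add: Ad_def rot_def qinverse_def qconj_def)

lemma Ramanujan_5: "Ramanujan 5 = act ` gens"
proof -
  have "norm (uquat \<alpha>) = 1" if "\<alpha> \<in> gens" for \<alpha> using inorm_gens[OF that] by (intro norm_uquat) simp
  then show ?thesis unfolding Ramanujan_def Omega_5 image_image by (intro image_cong) (auto simp: Ad_unit)
qed

text \<open>The index set of the system contains the rotations as functions, so a generator must be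
  recovered from its rotation: three off-diagonal matrix entries suffice.\<close>
lemma inj_on_act: "inj_on act gens"
proof (rule inj_onI)
  fix \<alpha> \<beta> assume ab: "\<alpha> \<in> gens" "\<beta> \<in> gens" "act \<alpha> = act \<beta>"
  have n: "inorm \<alpha> = 5 ^ 1" "inorm \<beta> = 5 ^ 1" using ab inorm_gens by auto
  have eq: "rot (emb \<alpha>) x = rot (emb \<beta>) x" for x
    using act_scaled[OF n(1), of x] act_scaled[OF n(2), of x] ab(3) by metis
  define h where "h A = (rot (emb A) (axis 1 1) $ 2, rot (emb A) (axis 1 1) $ 3, rot (emb A) (axis 2 1) $ 3)" for A
  have "h (a, b, c, d) = (2 * (real_of_int b * real_of_int c + real_of_int a * real_of_int d),
      2 * (real_of_int b * real_of_int d - real_of_int a * real_of_int c), 2 * (real_of_int c * real_of_int d + real_of_int a * real_of_int b))" for a b c d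
    by (simp add: h_def rot_def quat_simps axis_def algebra_simps)
  moreover have "h \<alpha> = h \<beta>" by (simp add: h_def eq)
  ultimately show "\<alpha> = \<beta>" using ab(1,2) unfolding gens_def by auto
qed

lemma Phi_act: "Phi r (act \<alpha>, of_bool b, of_bool c) = ifs_map r (\<alpha>, b, c)"
  by (simp add: Phi_def ifs_map_def)

lemma sum_Phi_index:
  fixes g :: "(real^3 \<Rightarrow> real^3) \<times> real \<times> real \<Rightarrow> 'b::comm_monoid_add"
  shows "(\<Sum>i\<in>Phi_index. g i) = (\<Sum>\<alpha>\<in>gens. g (act \<alpha>, 0, 0) + g (act \<alpha>, 0, 1) + (g (act \<alpha>, 1, 0) + g (act \<alpha>, 1, 1)))"
proof -
  have "(\<Sum>i\<in>Phi_index. g i) = (\<Sum>Q\<in>act ` gens. \<Sum>b\<in>{0, 1}. \<Sum>c\<in>{0, 1}. g (Q, b, c))"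
    unfolding Phi_index_def Ramanujan_5 by (simp add: sum.cartesian_product del: sum.insert)
  also have "\<dots> = (\<Sum>\<alpha>\<in>gens. \<Sum>b\<in>{0, 1}. \<Sum>c\<in>{0, 1}. g (act \<alpha>, b, c))"
    by (subst sum.reindex[OF inj_on_act]) (simp add: o_def)
  finally show ?thesis by (simp add: add.assoc)
qed

lemma self_similar_ifs_measure:
  assumes r: "0 \<le> r" "r < 1" and e: "0 < e" "e < 1"
  shows "self_similar_measure Phi_index (Phi r) (ifs_measure r e)"
proof -
  interpret prob_space "ifs_measure r e" by (rule prob_space_ifs_measure[OF r])
  define p :: "(real^3 \<Rightarrow> real^3) \<times> real \<times> real \<Rightarrow> real" where "p = (\<lambda>(Q, b, c). (1 / 12) * (if c = 1 then e else 1 - e))"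
  show ?thesis
    unfolding self_similar_measure_def
  proof (intro conjI exI[of _ p] ballI)
    show "sets (ifs_measure r e) = sets borel" by simp
    show "emeasure (ifs_measure r e) UNIV = 1" using emeasure_space_1 by simp
    show "0 < p i" for i using e by (cases i) (simp add: p_def)
    show "sum p Phi_index = 1" unfolding sum_Phi_index by (simp add: p_def field_simps)
    fix A :: "R4 set" assume A[measurable]: "A \<in> sets borel"
    define M where "M j = measure (distr (ifs_measure r e) borel (ifs_map r j)) A" for j
    have M: "M j = (\<integral>x. indicator A (ifs_map r j x) \<partial>ifs_measure r e)" for j
    proof -
      have m: "ifs_map r j \<in> measurable (ifs_measure r e) borel"
        using measurable_ifs_map[OF r(1)] by (simp add: measurable_cong_sets[OF sets_ifs_measure refl])
      have "M j = (\<integral>x. indicator A x \<partial>distr (ifs_measure r e) borel (ifs_map r j))"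
        by (simp add: M_def)
      also have "\<dots> = (\<integral>x. indicator A (ifs_map r j x) \<partial>ifs_measure r e)" by (rule integral_distr[OF m]) simp
      finally show ?thesis .
    qed
    have "measure (ifs_measure r e) A = (\<integral>x. indicator A x \<partial>ifs_measure r e)" by simp
    also have "\<dots> = measure_pmf.expectation (symbol_pmf e) M"
      unfolding M by (rule integral_ifs_measure[OF r, of _ 1]) (auto simp: indicator_def)
    also have "\<dots> = (\<Sum>\<alpha>\<in>gens. (1 / 6) * ((1 / 2) * ((1 - e) * M (\<alpha>, False, False) + e * M (\<alpha>, False, True))
        + (1 / 2) * ((1 - e) * M (\<alpha>, True, False) + e * M (\<alpha>, True, True))))"
      using e by (subst expectation_symbol_pmf) auto
    also have "\<dots> = (\<Sum>i\<in>Phi_index. p i * measure (distr (ifs_measure r e) borel (Phi r i)) A)"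
    proof -
      have Mp: "measure (distr (ifs_measure r e) borel (Phi r (act \<alpha>, of_bool b, of_bool c))) A = M (\<alpha>, b, c)" for \<alpha> b c
        by (simp only: M_def Phi_act)
      note Mp[of _ False False] Mp[of _ False True] Mp[of _ True False] Mp[of _ True True]
      note this[unfolded of_bool_eq]
      then show ?thesis unfolding sum_Phi_index by (intro sum.cong) (simp_all add: p_def field_simps)
    qed
    finally show "measure (ifs_measure r e) A = (\<Sum>i\<in>Phi_index. p i * measure (distr (ifs_measure r e) borel (Phi r i)) A)" .
  qed
qed

definition wave :: "real \<Rightarrow> complex" where
  "wave u = exp (- 2 * of_real pi * \<i> * of_real u)"

lemma wave_eq_cis: "wave u = cis (- (2 * pi * u))"
  by (simp add: wave_def cis_conv_exp mult_ac)

lemma wave_add: "wave (u + v) = wave u * wave v"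
  by (simp add: wave_eq_cis cis_mult algebra_simps)

lemma norm_wave [simp]: "cmod (wave u) = 1"
  by (simp add: wave_def norm_exp_eq_Re)

lemma wave_zero [simp]: "wave 0 = 1"
  by (simp add: wave_def)

lemma continuous_wave [continuous_intros]: "continuous_on S f \<Longrightarrow> continuous_on S (\<lambda>x. wave (f x))"
  unfolding wave_def by (intro continuous_intros)

lemma measurable_wave [measurable]: "wave \<in> borel_measurable borel"
  by (intro borel_measurable_continuous_onI continuous_intros)

lemma fourier_wave: "fourier \<nu> \<xi> = (\<integral>x. wave (x \<bullet> \<xi>) \<partial>\<nu>)"
  by (simp add: fourier_def wave_def)

lemma norm_fourier_le:
  assumes "prob_space \<nu>"
  shows "cmod (fourier \<nu> \<xi>) \<le> 1"
proof -
  interpret prob_space \<nu> by fact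
  have "cmod (fourier \<nu> \<xi>) \<le> (\<integral>x. cmod (wave (x \<bullet> \<xi>)) \<partial>\<nu>)" unfolding fourier_wave by (rule integral_norm_bound)
  then show ?thesis by (simp add: prob_space)
qed

text \<open>The transposed rotations that appear under the Fourier transform are again rotations of the
  system, because the generators are closed under conjugation.\<close>
lemma fourier_ifs_measure:
  assumes r: "0 \<le> r" "r < 1" and e: "0 < e" "e < 1"
  shows "fourier (ifs_measure r e) (\<xi>, t) = (1 + wave (\<xi> $ 1)) / 2 * ((1 - of_real e) + of_real e * wave t) *
     ((\<Sum>\<alpha>\<in>gens. fourier (ifs_measure r e) (r *\<^sub>R act \<alpha> \<xi>, r * t)) / 6)"
proof -
  let ?f = "fourier (ifs_measure r e)"
  define I where "I j = (\<integral>p. wave (ifs_map r j p \<bullet> (\<xi>, t)) \<partial>ifs_measure r e)" for j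
  have I: "I (\<alpha>, b, c) = wave (of_bool b * \<xi> $ 1) * wave (of_bool c * t) * ?f (r *\<^sub>R act (iconj \<alpha>) \<xi>, r * t)" for \<alpha> b c
  proof -
    have "ifs_map r (\<alpha>, b, c) p \<bullet> (\<xi>, t) = of_bool b * \<xi> $ 1 + (of_bool c * t + p \<bullet> (r *\<^sub>R act (iconj \<alpha>) \<xi>, r * t))" for p
    proof -
      obtain x y where p: "p = (x, y)" by (cases p)
      have "act \<alpha> x \<bullet> \<xi> = x \<bullet> act (iconj \<alpha>) \<xi>" by (simp add: inner_rot uquat_iconj)
      then show ?thesis unfolding p
        by (simp add: ifs_map_def inner_add_left distrib_right distrib_left inner_axis' mult_ac)
    qed
    then have "I (\<alpha>, b, c) = (\<integral>p. wave (of_bool b * \<xi> $ 1) * wave (of_bool c * t) * wave (p \<bullet> (r *\<^sub>R act (iconj \<alpha>) \<xi>, r * t)) \<partial>ifs_measure r e)"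
      by (simp add: I_def wave_add mult.assoc)
    then show ?thesis by (simp add: fourier_wave)
  qed
  have "?f (\<xi>, t) = measure_pmf.expectation (symbol_pmf e) I"
    unfolding fourier_wave I_def
    by (rule integral_ifs_measure[OF r, of _ 1]) (auto intro!: borel_measurable_continuous_onI continuous_intros)
  also have "\<dots> = (\<Sum>\<alpha>\<in>gens. (1 / 6) *\<^sub>R ((1 / 2) *\<^sub>R ((1 - e) *\<^sub>R I (\<alpha>, False, False) + e *\<^sub>R I (\<alpha>, False, True))
        + (1 / 2) *\<^sub>R ((1 - e) *\<^sub>R I (\<alpha>, True, False) + e *\<^sub>R I (\<alpha>, True, True))))"
    using e by (subst expectation_symbol_pmf) auto
  also have "\<dots> = (\<Sum>\<alpha>\<in>gens. (1 + wave (\<xi> $ 1)) / 2 * ((1 - of_real e) + of_real e * wave t) * ?f (r *\<^sub>R act (iconj \<alpha>) \<xi>, r * t) / 6)"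
    by (intro sum.cong refl) (simp add: I scaleR_conv_of_real field_simps)
  also have "\<dots> = (1 + wave (\<xi> $ 1)) / 2 * ((1 - of_real e) + of_real e * wave t) * ((\<Sum>\<alpha>\<in>gens. ?f (r *\<^sub>R act (iconj \<alpha>) \<xi>, r * t)) / 6)"
    by (simp add: sum_distrib_left sum_divide_distrib)
  also have "(\<Sum>\<alpha>\<in>gens. ?f (r *\<^sub>R act (iconj \<alpha>) \<xi>, r * t)) = (\<Sum>\<alpha>\<in>gens. ?f (r *\<^sub>R act \<alpha> \<xi>, r * t))"
  proof -
    have inj: "inj_on iconj gens" by (rule inj_on_inverseI[of _ iconj]) simp
    show ?thesis using sum.reindex[OF inj, of "\<lambda>\<alpha>. ?f (r *\<^sub>R act \<alpha> \<xi>, r * t)"] by (simp add: iconj_gens o_def)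
  qed
  finally show ?thesis .
qed

lemma norm_half_wave: "(cmod ((1 + wave u) / 2))\<^sup>2 \<le> damp u"
proof -
  have "(cmod (1 + wave u))\<^sup>2 = (1 + cos (2 * pi * u))\<^sup>2 + (sin (2 * pi * u))\<^sup>2"
    by (simp add: wave_eq_cis cmod_power2)
  also have "\<dots> = 2 + 2 * cos (2 * pi * u)"
    using sin_cos_squared_add[of "2 * pi * u"] by (simp add: power2_eq_square algebra_simps)
  finally have "(cmod ((1 + wave u) / 2))\<^sup>2 = (1 + cos (2 * pi * u)) / 2"
    by (simp add: norm_divide power_divide)
  also have "\<dots> \<le> damp u"
  proof -
    have "(1 + c) / 2 \<le> (3 + c) / 4" if "c \<le> 1" for c :: real using that by simp
    then show ?thesis unfolding damp_def by simp
  qed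
  finally show ?thesis .
qed

text \<open>The vertical factor has modulus at most 1, and the supremum over \<open>t\<close> makes the statement
  independent of it. The square of the average over the generators is at most the average of the
  squares.\<close>
lemma mean_damped_ifs_measure:
  assumes r: "0 \<le> r" "r < 1" and e: "0 < e" "e < 1"
  shows "mean_damped r (\<lambda>\<xi>. SUP t. (cmod (fourier (ifs_measure r e) (\<xi>, t)))\<^sup>2)"
proof -
  define g where "g \<xi> t = (cmod (fourier (ifs_measure r e) (\<xi>, t)))\<^sup>2" for \<xi> t
  define F where "F \<xi> = (SUP t. g \<xi> t)" for \<xi>
  have g1: "0 \<le> g \<xi> t" "g \<xi> t \<le> 1" for \<xi> t
    using norm_fourier_le[OF prob_space_ifs_measure[OF r], of e "(\<xi>, t)"] by (auto simp: g_def power_le_one)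
  have bdd: "bdd_above (range (g \<xi>))" for \<xi> using g1 by (intro bdd_aboveI[of _ 1]) auto
  have gF: "g \<xi> t \<le> F \<xi>" for \<xi> t unfolding F_def by (rule cSUP_upper[OF _ bdd]) simp
  have F1: "0 \<le> F \<xi>" "F \<xi> \<le> 1" for \<xi>
  proof -
    show "0 \<le> F \<xi>" using g1(1)[of \<xi> 0] gF[of \<xi> 0] by linarith
    show "F \<xi> \<le> 1" unfolding F_def by (rule cSUP_least) (auto simp: g1)
  qed
  have step: "g \<xi> t \<le> damp (\<xi> $ 1) * ((\<Sum>\<alpha>\<in>gens. F (r *\<^sub>R act \<alpha> \<xi>)) / 6)" for \<xi> t
  proof -
    define h where "h \<alpha> = cmod (fourier (ifs_measure r e) (r *\<^sub>R act \<alpha> \<xi>, r * t))" for \<alpha>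
    define \<psi> where "\<psi> = (1 - of_real e) + of_real e * wave t"
    have \<psi>: "cmod \<psi> \<le> 1"
    proof -
      have "cmod \<psi> \<le> cmod (of_real (1 - e)) + cmod (of_real e * wave t)"
        unfolding \<psi>_def of_real_diff of_real_1 by (rule norm_triangle_ineq)
      then show ?thesis using e by (simp add: norm_mult del: of_real_diff)
    qed
    have "g \<xi> t = (cmod ((1 + wave (\<xi> $ 1)) / 2))\<^sup>2 * (cmod \<psi>)\<^sup>2 * (cmod (\<Sum>\<alpha>\<in>gens. fourier (ifs_measure r e) (r *\<^sub>R act \<alpha> \<xi>, r * t)) / 6)\<^sup>2"
      unfolding g_def \<psi>_def
      by (subst fourier_ifs_measure[OF r e]) (simp only: norm_mult norm_divide power_mult_distrib norm_numeral)
    also have "\<dots> \<le> damp (\<xi> $ 1) * 1 * ((\<Sum>\<alpha>\<in>gens. (h \<alpha>)\<^sup>2) / 6)"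
    proof (intro mult_mono norm_half_wave)
      show "(cmod \<psi>)\<^sup>2 \<le> 1" using \<psi> by (simp add: power_le_one)
      have "(cmod (\<Sum>\<alpha>\<in>gens. fourier (ifs_measure r e) (r *\<^sub>R act \<alpha> \<xi>, r * t)) / 6)\<^sup>2 \<le> ((\<Sum>\<alpha>\<in>gens. h \<alpha>) / 6)\<^sup>2"
        unfolding h_def by (intro power_mono divide_right_mono norm_sum) auto
      also have "(\<Sum>\<alpha>\<in>gens. h \<alpha> * 1)\<^sup>2 \<le> (\<Sum>\<alpha>\<in>gens. (h \<alpha>)\<^sup>2) * (\<Sum>\<alpha>\<in>gens. 1\<^sup>2)" by (rule Cauchy_Schwarz_ineq_sum)
      then have "((\<Sum>\<alpha>\<in>gens. h \<alpha>) / 6)\<^sup>2 \<le> (\<Sum>\<alpha>\<in>gens. (h \<alpha>)\<^sup>2) / 6" by (simp add: power_divide)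
      finally show "(cmod (\<Sum>\<alpha>\<in>gens. fourier (ifs_measure r e) (r *\<^sub>R act \<alpha> \<xi>, r * t)) / 6)\<^sup>2 \<le> (\<Sum>\<alpha>\<in>gens. (h \<alpha>)\<^sup>2) / 6" .
    qed (auto intro: damp_bounds mult_nonneg_nonneg)
    also have "\<dots> \<le> damp (\<xi> $ 1) * ((\<Sum>\<alpha>\<in>gens. F (r *\<^sub>R act \<alpha> \<xi>)) / 6)"
      unfolding mult_1_right
    proof (intro mult_left_mono divide_right_mono sum_mono damp_bounds)
      fix \<alpha>
      show "(h \<alpha>)\<^sup>2 \<le> F (r *\<^sub>R act \<alpha> \<xi>)" using gF[of "r *\<^sub>R act \<alpha> \<xi>" "r * t"] by (simp add: g_def h_def)
    qed simp
    finally show ?thesis .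
  qed
  have "F \<xi> \<le> damp (\<xi> $ 1) * ((\<Sum>\<alpha>\<in>gens. F (r *\<^sub>R act \<alpha> \<xi>)) / 6)" for \<xi>
    unfolding F_def[of \<xi>] by (rule cSUP_least[OF UNIV_not_empty step])
  then show ?thesis using F1 unfolding mean_damped_def F_def g_def by blast
qed

lemma fourier_ifs_measure_decay:
  fixes e :: real and q :: nat
  assumes q: "even q" "q \<ge> 32" "98304 * ln (5 * real q) \<le> real q" and e: "0 < e" "e < 1"
  obtains K where "K > 0"
    "\<And>\<xi> t. 1 \<le> norm \<xi> \<Longrightarrow> cmod (fourier (ifs_measure (1 - 1 / real q) e) (\<xi>, t)) \<le> K * norm \<xi> powr (- 6)"
proof -
  define r where "r = 1 - 1 / real q"
  have r: "0 \<le> r" "r < 1" using q by (auto simp: r_def)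
  let ?g = "\<lambda>\<xi> t. (cmod (fourier (ifs_measure r e) (\<xi>, t)))\<^sup>2"
  obtain K where K: "K > 0" "\<And>\<xi>. 1 \<le> norm \<xi> \<Longrightarrow> (SUP t. ?g \<xi> t) \<le> K * norm \<xi> powr (- 12)"
    by (rule mean_damped_decay[OF q mean_damped_ifs_measure[OF r e, unfolded r_def]]) (auto simp: r_def)
  show ?thesis
  proof (rule that[of "sqrt K"])
    fix \<xi> :: "real^3" and t assume x: "1 \<le> norm \<xi>"
    have "bdd_above (range (?g \<xi>))"
      using norm_fourier_le[OF prob_space_ifs_measure[OF r]] by (intro bdd_aboveI[of _ 1]) (auto simp: power_le_one)
    then have "?g \<xi> t \<le> (SUP t. ?g \<xi> t)" by (intro cSUP_upper) auto
    also have "\<dots> \<le> K * norm \<xi> powr (- 12)" by (rule K(2)[OF x])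
    also have "\<dots> = (sqrt K * norm \<xi> powr (- 6))\<^sup>2"
      using K by (simp add: power_mult_distrib power2_eq_square[of "norm \<xi> powr _"] flip: powr_add)
    finally show "cmod (fourier (ifs_measure (1 - 1 / real q) e) (\<xi>, t)) \<le> sqrt K * norm \<xi> powr (- 6)"
      unfolding r_def[symmetric] by (rule power2_le_imp_le) (use K in simp)
  qed (use K in simp)
qed

lemma power_le_imp_base_le:
  fixes a b C :: real
  assumes "0 < a" "0 < b" "\<And>n. a ^ n \<le> C * b ^ n"
  shows "a \<le> b"
proof (rule ccontr)
  assume "\<not> a \<le> b"
  then have "1 < a / b" using assms by simp
  then obtain n where "C < (a / b) ^ n" using real_arch_pow by blast
  then show False using assms(2) assms(3)[of n] by (simp add: power_divide field_simps)
qed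

text \<open>On the vertical axis the recursion for the Fourier transform \<open>f\<close> has only the vertical
  factor, of modulus at least \<open>1 - 2 * e\<close>. Hence \<open>f (t / r ^ n)\<close> is at least \<open>(1 - 2 * e) ^ n * f
  t\<close>, and \<open>f t\<close> is at least \<open>1 / 2\<close> for a small \<open>t\<close> since the measure has bounded support.\<close>
lemma fourier_dim_ifs_measure_le:
  assumes r: "0 < r" "r < 1" and e: "0 < e" "e < 1 / 2"
  shows "fourier_dim (ifs_measure r e) \<le> 2 * ln (1 - 2 * e) / ln r"
proof -
  have r': "0 \<le> r" using r by simp
  interpret prob_space "ifs_measure r e" by (rule prob_space_ifs_measure[OF r' r(2)])
  have pU: "prob UNIV = 1" using prob_space by (simp only: space_ifs_measure)
  define f where "f t = cmod (fourier (ifs_measure r e) (0, t))" for t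
  have e1: "0 < e" "e < 1" using e by auto
  have r0: "rot q 0 = 0" for q by (simp add: rot_def quat_simps)
  have step: "(1 - 2 * e) * f (r * t) \<le> f t" for t
  proof -
    have "fourier (ifs_measure r e) (0, t) = ((1 - of_real e) + of_real e * wave t) * fourier (ifs_measure r e) (0, r * t)"
      using fourier_ifs_measure[OF r' r(2) e1, of 0 t] by (simp add: r0)
    then have "f t = cmod ((1 - of_real e) + of_real e * wave t) * f (r * t)" by (simp add: f_def norm_mult)
    moreover have "cmod (of_real (1 - e)) - cmod (of_real e * wave t) \<le> cmod (of_real (1 - e) + of_real e * wave t)"
      by (rule norm_diff_ineq)
    then have "1 - 2 * e \<le> cmod ((1 - of_real e) + of_real e * wave t)"
      using e by (simp add: norm_mult del: of_real_diff) simp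
    ultimately show ?thesis by (simp add: mult_right_mono f_def)
  qed
  have iter: "(1 - 2 * e) ^ n * f (r ^ n * t) \<le> f t" for n t
  proof (induction n arbitrary: t)
    case (Suc n)
    have "(1 - 2 * e) ^ Suc n * f (r ^ Suc n * t) = (1 - 2 * e) * ((1 - 2 * e) ^ n * f (r ^ n * (r * t)))" by (simp add: mult_ac)
    also have "\<dots> \<le> (1 - 2 * e) * f (r * t)" using e Suc by (intro mult_left_mono) auto
    also have "\<dots> \<le> f t" by (rule step)
    finally show ?case .
  qed simp
  \<comment> \<open>The vertical coordinate lies in an interval of length \<open>1 / (1 - r)\<close>, so at this frequency the
    wave stays within \<open>1 / 2\<close> of 1.\<close>
  define s0 where "s0 = (1 - r) / (4 * pi)"
  have s0: "s0 > 0" using r by (simp add: s0_def)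
  have half: "1 / 2 \<le> f s0"
  proof -
    have iw: "integrable (ifs_measure r e) (\<lambda>p. wave (p \<bullet> (0, s0)))"
      by (rule integrable_const_bound[of _ 1]) (auto intro!: borel_measurable_continuous_onI continuous_intros simp: measurable_cong_sets[OF sets_ifs_measure refl])
    have "cmod (1 - fourier (ifs_measure r e) (0, s0)) = cmod (\<integral>p. 1 - wave (p \<bullet> (0, s0)) \<partial>ifs_measure r e)"
      unfolding fourier_wave using iw prob_space by simp
    also have "\<dots> \<le> (\<integral>p. cmod (1 - wave (p \<bullet> (0, s0))) \<partial>ifs_measure r e)" by (rule integral_norm_bound)
    also have "\<dots> \<le> (\<integral>p. 1 / 2 \<partial>ifs_measure r e)"
    proof (rule integral_mono_AE)
      show "AE p in ifs_measure r e. cmod (1 - wave (p \<bullet> (0, s0))) \<le> 1 / 2"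
        using AE_ifs_measure_bounds(2)[OF r' r(2), of e]
      proof (rule AE_mp, intro AE_I2 impI)
        fix p :: R4 assume p: "snd p \<in> {0..1 / (1 - r)}"
        define y where "y = snd p"
        have ip: "p \<bullet> (0, s0) = y * s0" by (simp add: inner_prod_def y_def)
        have "cmod (1 - wave (y * s0)) \<le> 2 * pi * (y * s0)"
        proof -
          have y0: "0 \<le> 2 * pi * (y * s0)" using p s0 by (simp add: y_def)
          have "cmod (wave (y * s0) - 1) \<le> \<bar>- (2 * pi * (y * s0))\<bar>"
            using iexp_approx1[of "- (2 * pi * (y * s0))" 0] unfolding wave_eq_cis cis_conv_exp by simp
          then show ?thesis using y0 by (simp add: norm_minus_commute)
        qed
        also have "\<dots> \<le> 2 * pi * (1 / (1 - r) * s0)"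
          using p s0 by (intro mult_left_mono mult_right_mono) (auto simp: y_def)
        also have "\<dots> = 1 / 2" using r by (simp add: s0_def)
        finally show "cmod (1 - wave (p \<bullet> (0, s0))) \<le> 1 / 2" by (simp add: ip)
      qed
    qed (use iw in auto)
    also have "\<dots> = 1 / 2" by (simp add: pU)
    finally have "cmod (1 - fourier (ifs_measure r e) (0, s0)) \<le> 1 / 2" .
    then show ?thesis unfolding f_def
      using norm_triangle_ineq2[of 1 "1 - fourier (ifs_measure r e) (0, s0)"] by simp
  qed
  show ?thesis
    unfolding fourier_dim_def
  proof (rule cSup_least)
    have "cmod (fourier (ifs_measure r e) \<xi>) \<le> 1 * norm \<xi> powr (- 0 / 2)" if "\<xi> \<noteq> 0" for \<xi>
      using that norm_fourier_le[OF prob_space_ifs_measure[OF r' r(2)]] by simp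
    then show "{s. 0 \<le> s \<and> s \<le> real DIM(R4) \<and> (\<exists>C. \<forall>\<xi>. \<xi> \<noteq> 0 \<longrightarrow> cmod (fourier (ifs_measure r e) \<xi>) \<le> C * norm \<xi> powr (- s / 2))} \<noteq> {}"
      by (intro ex_in_conv[THEN iffD1] exI[of _ 0] CollectI conjI exI[of _ 1]) auto
    fix s assume "s \<in> {s. 0 \<le> s \<and> s \<le> real DIM(R4) \<and> (\<exists>C. \<forall>\<xi>. \<xi> \<noteq> 0 \<longrightarrow> cmod (fourier (ifs_measure r e) \<xi>) \<le> C * norm \<xi> powr (- s / 2))}"
    then obtain C where C: "\<And>\<xi>. \<xi> \<noteq> 0 \<Longrightarrow> cmod (fourier (ifs_measure r e) \<xi>) \<le> C * norm \<xi> powr (- s / 2)" by blast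
    have pw: "(1 - 2 * e) ^ n \<le> (2 * C * s0 powr (- s / 2)) * (r powr (s / 2)) ^ n" for n
    proof -
      define t where "t = s0 / r ^ n"
      have t: "t > 0" "r ^ n * t = s0" using s0 r by (auto simp: t_def)
      have "(1 - 2 * e) ^ n * (1 / 2) \<le> (1 - 2 * e) ^ n * f s0" using half e by (intro mult_left_mono) auto
      also have "\<dots> \<le> f t" using iter[of n t] t by simp
      also have "\<dots> \<le> C * t powr (- s / 2)"
        using C[of "(0, t)"] t by (simp add: f_def norm_Pair zero_prod_def)
      also have "t powr (- s / 2) = s0 powr (- s / 2) * (r powr (s / 2)) ^ n"
      proof -
        have "t powr (- s / 2) = s0 powr (- s / 2) / (r ^ n) powr (- s / 2)" using s0 r by (simp add: t_def powr_divide)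
        also have "(r ^ n) powr (- s / 2) = inverse ((r powr (s / 2)) ^ n)"
          using r by (simp add: powr_realpow[symmetric] powr_powr powr_minus mult.commute)
        also have "x / inverse y = x * y" for x y :: real by (simp add: divide_inverse)
        finally show ?thesis .
      qed
      finally show ?thesis by simp
    qed
    have "1 - 2 * e \<le> r powr (s / 2)"
      by (rule power_le_imp_base_le[OF _ _ pw]) (use e r in simp_all)
    then have "ln (1 - 2 * e) \<le> ln (r powr (s / 2))" using e r by (subst ln_le_cancel_iff) auto
    also have "\<dots> = s / 2 * ln r" using r by (simp add: ln_powr)
    finally have "2 * ln (1 - 2 * e) \<le> s * ln r" by simp
    then show "s \<le> 2 * ln (1 - 2 * e) / ln r" using r by (simp add: neg_le_divide_eq)
  qed
qed

section \<open>The singular vertical marginal\<close>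

definition words :: "nat \<Rightarrow> bool list set" where
  "words n = {w. length w = n}"

definition bern :: "real \<Rightarrow> bool \<Rightarrow> real" where
  "bern e c = (if c then e else 1 - e)"

definition word_weight :: "real \<Rightarrow> bool list \<Rightarrow> real" where
  "word_weight e w = prod_list (map (bern e) w)"

definition word_map :: "real \<Rightarrow> bool list \<Rightarrow> real \<Rightarrow> real" where
  "word_map r w y = foldr (\<lambda>c y. r * y + of_bool c) w y"

lemma finite_words [simp]: "finite (words n)"
  using finite_lists_length_eq[of "UNIV :: bool set" n] by (simp add: words_def)

lemma sum_words_Suc:
  "(\<Sum>w\<in>words (Suc n). F w) = (\<Sum>w\<in>words n. F (True # w)) + (\<Sum>w\<in>words n. F (False # w))"
proof -
  have "words (Suc n) = (#) True ` words n \<union> (#) False ` words n"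
    by (auto simp: words_def length_Suc_conv)
  moreover have "(#) True ` words n \<inter> (#) False ` words n = {}" by auto
  ultimately have "(\<Sum>w\<in>words (Suc n). F w) = (\<Sum>w\<in>(#) True ` words n. F w) + (\<Sum>w\<in>(#) False ` words n. F w)"
    by (simp add: sum.union_disjoint)
  then show ?thesis by (simp add: sum.reindex o_def)
qed

lemma sum_words_prod_list: "(\<Sum>w\<in>words n. prod_list (map f w)) = (f True + f False) ^ n" for f :: "bool \<Rightarrow> real"
proof (induction n)
  case 0
  have "words 0 = {[]}" by (auto simp: words_def)
  then show ?case by simp
next
  case (Suc n)
  then show ?case by (simp add: sum_words_Suc sum_distrib_left[symmetric] distrib_right)
qed

lemma word_map_affine: "word_map r w y = word_map r w 0 + r ^ length w * y"
  by (induction w) (simp_all add: word_map_def algebra_simps)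

lemma word_weight_nonneg: "0 < e \<Longrightarrow> e < 1 \<Longrightarrow> 0 \<le> word_weight e w"
  by (induction w) (auto simp: word_weight_def bern_def)

lemma marginal_words:
  assumes r: "0 \<le> r" "r < 1" and e: "0 < e" "e < 1"
  shows "A \<in> sets borel \<Longrightarrow> measure (ifs_measure r e) {p. snd p \<in> A} =
    (\<Sum>w\<in>words n. word_weight e w * measure (ifs_measure r e) {p. word_map r w (snd p) \<in> A})"
proof (induction n arbitrary: A)
  case 0
  have "words 0 = {[]}" by (auto simp: words_def)
  then show ?case by (simp add: word_weight_def word_map_def)
next
  case (Suc n)
  have sel: "{p::R4. f (snd p) \<in> A} \<in> sets borel" if "A \<in> sets borel" "f \<in> borel_measurable borel" for A and f :: "real \<Rightarrow> real"
  proof -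
    have "(\<lambda>p::R4. f (snd p)) \<in> borel_measurable borel"
      by (rule measurable_compose[OF _ that(2)]) (intro borel_measurable_continuous_onI continuous_intros)
    from measurable_sets[OF this that(1)] show ?thesis by (simp add: vimage_def)
  qed
  define M where "M c = measure (ifs_measure r e) {p. r * snd p + of_bool c \<in> A}" for c
  have "measure (ifs_measure r e) {p. snd p \<in> A} = (\<integral>p. indicator {p. snd p \<in> A} p \<partial>ifs_measure r e)" by simp
  also have "\<dots> = measure_pmf.expectation (symbol_pmf e) (\<lambda>j. \<integral>p. indicator {p. snd p \<in> A} (ifs_map r j p) \<partial>ifs_measure r e)"
  proof (rule integral_ifs_measure[OF r, of _ 1])
    show "indicator {p. snd p \<in> A} \<in> borel_measurable (borel :: R4 measure)"
      using sel[OF Suc.prems, of "\<lambda>x. x"] by (intro borel_measurable_indicator) simp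
    show "norm (indicator {p. snd p \<in> A} p :: real) \<le> 1" for p :: R4 by (simp split: split_indicator)
  qed
  also have "\<dots> = measure_pmf.expectation (symbol_pmf e) (\<lambda>j. M (snd (snd j)))"
  proof (intro Bochner_Integration.integral_cong refl)
    fix j
    have eq: "indicat_real {p. snd p \<in> A} (ifs_map r j p) = indicator {p. r * snd p + of_bool (snd (snd j)) \<in> A} p" for p
      by (cases j; cases p) (simp add: ifs_map_def indicator_def)
    show "(\<integral>p. indicator {p. snd p \<in> A} (ifs_map r j p) \<partial>ifs_measure r e) = M (snd (snd j))"
      unfolding eq M_def Bochner_Integration.integral_indicator by (simp only: space_ifs_measure Int_UNIV_right)
  qed
  also have "\<dots> = bern e True * M True + bern e False * M False"
    using e by (subst expectation_symbol_pmf) (auto simp: bern_def field_simps)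
  finally have E: "measure (ifs_measure r e) {p. snd p \<in> A} = bern e True * M True + bern e False * M False" .
  have Mc: "M c = (\<Sum>w\<in>words n. word_weight e w * measure (ifs_measure r e) {p. word_map r (c # w) (snd p) \<in> A})" for c
  proof -
    have "(\<lambda>y. r * y + of_bool c) \<in> borel_measurable borel" by simp
    from measurable_sets[OF this Suc.prems] have "{y. r * y + of_bool c \<in> A} \<in> sets borel" by (simp add: vimage_def)
    from Suc.IH[OF this] show ?thesis by (simp add: M_def word_map_def)
  qed
  have "word_weight e (c # w) = bern e c * word_weight e w" for c w by (simp add: word_weight_def)
  then show ?case unfolding E Mc by (simp only: sum_words_Suc sum_distrib_left mult.assoc)
qed

text \<open>Only the words of length \<open>n\<close> with weight at least \<open>\<kappa> ^ n\<close> matter. There are at most \<open>\<kappa>\<^sup>-\<^sup>n\<close>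
  of them, and each confines the vertical coordinate to an interval of length \<open>O(r\<^sup>n)\<close>, so the
  union \<open>A n\<close> of these intervals has measure \<open>O((r / \<kappa>)\<^sup>n)\<close>. The remaining words have total weight
  at most the sum of \<open>\<surd>\<kappa> ^ n\<close> times the square root of the weight, which is \<open>(\<surd>\<kappa> (\<surd>e + \<surd>(1 -
  e)))\<^sup>n\<close>. This is summable, so almost every point lies in \<open>A n\<close> for all large \<open>n\<close> by
  Borel-Cantelli.\<close>
lemma singular_marginal:
  assumes r: "0 < r" "r < 1" and e: "0 < e" "e < 1"
    and \<kappa>: "r < \<kappa>" "sqrt \<kappa> * (sqrt e + sqrt (1 - e)) < 1"
  obtains N :: "real set" where "N \<in> sets borel" "emeasure lborel N = 0" "AE p in ifs_measure r e. snd p \<in> N"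
proof -
  define \<nu> where "\<nu> = ifs_measure r e"
  have r': "0 \<le> r" using r by simp
  interpret prob_space \<nu> unfolding \<nu>_def by (rule prob_space_ifs_measure[OF r' r(2)])
  have sp: "space \<nu> = UNIV" and st: "sets \<nu> = sets borel" by (simp_all add: \<nu>_def)
  define D where "D = 1 / (1 - r)"
  have k0: "0 < \<kappa>" using \<kappa> r by linarith
  define T where "T n = {w \<in> words n. \<kappa> ^ n \<le> word_weight e w}" for n
  define A where "A n = (\<Union>w\<in>T n. {word_map r w 0..word_map r w 0 + r ^ n * D})" for n
  define \<theta> where "\<theta> = sqrt \<kappa> * (sqrt e + sqrt (1 - e))"
  have \<theta>: "0 \<le> \<theta>" "\<theta> < 1" using \<kappa> k0 e by (auto simp: \<theta>_def)
  have finT: "finite (T n)" for n by (simp add: T_def)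
  have A[measurable]: "A n \<in> sets borel" for n unfolding A_def using finT by (intro sets.finite_UN) auto
  have wsum: "(\<Sum>w\<in>words n. word_weight e w) = 1" for n
    unfolding word_weight_def using sum_words_prod_list[of "bern e" n] by (simp add: bern_def)
  have wn: "0 \<le> word_weight e w" for w by (rule word_weight_nonneg[OF e])
  have bad: "(\<Sum>w\<in>words n - T n. word_weight e w) \<le> \<theta> ^ n" for n
  proof -
    have "(\<Sum>w\<in>words n - T n. word_weight e w) \<le> (\<Sum>w\<in>words n - T n. sqrt \<kappa> ^ n * sqrt (word_weight e w))"
    proof (rule sum_mono)
      fix w assume "w \<in> words n - T n"
      then have "word_weight e w \<le> \<kappa> ^ n" by (auto simp: T_def)
      then have "sqrt (word_weight e w) \<le> sqrt \<kappa> ^ n" by (simp flip: real_sqrt_power)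
      then have "sqrt (word_weight e w) * sqrt (word_weight e w) \<le> sqrt \<kappa> ^ n * sqrt (word_weight e w)"
        using wn by (intro mult_right_mono) auto
      then show "word_weight e w \<le> sqrt \<kappa> ^ n * sqrt (word_weight e w)" using wn[of w] by simp
    qed
    also have "\<dots> \<le> (\<Sum>w\<in>words n. sqrt \<kappa> ^ n * sqrt (word_weight e w))"
      using wn k0 by (intro sum_mono2) auto
    also have "\<dots> = sqrt \<kappa> ^ n * (\<Sum>w\<in>words n. prod_list (map (\<lambda>c. sqrt (bern e c)) w))"
    proof -
      have "sqrt (word_weight e w) = prod_list (map (\<lambda>c. sqrt (bern e c)) w)" for w
        by (induction w) (simp_all add: word_weight_def real_sqrt_mult)
      then show ?thesis by (simp add: sum_distrib_left)
    qed
    also have "\<dots> = \<theta> ^ n" unfolding sum_words_prod_list by (simp add: \<theta>_def bern_def power_mult_distrib)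
    finally show ?thesis .
  qed
  have snd_m[measurable]: "(snd :: R4 \<Rightarrow> real) \<in> borel_measurable \<nu>"
    unfolding measurable_cong_sets[OF st refl] by (intro borel_measurable_continuous_onI continuous_intros)
  have good: "1 - \<theta> ^ n \<le> measure \<nu> {p. snd p \<in> A n}" for n
  proof -
    have full: "measure \<nu> {p. word_map r w (snd p) \<in> A n} = 1" if w: "w \<in> T n" for w
    proof -
      have len: "length w = n" using w by (simp add: T_def words_def)
      have "(\<lambda>y. word_map r w 0 + r ^ n * y) \<in> borel_measurable borel" by simp
      from measurable_sets[OF measurable_compose[OF snd_m this] A[of n]]
      have m: "{p \<in> space \<nu>. word_map r w (snd p) \<in> A n} \<in> sets \<nu>"
        unfolding word_map_affine[of r w "snd _"] len by (simp only: vimage_def sp Int_UNIV_right UNIV_I simp_thms mem_Collect_eq)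
      have "AE p in \<nu>. word_map r w (snd p) \<in> A n"
        using AE_ifs_measure_bounds(2)[OF r' r(2), of e] unfolding \<nu>_def[symmetric]
      proof (rule AE_mp, intro AE_I2 impI)
        fix p :: R4 assume p: "snd p \<in> {0..1 / (1 - r)}"
        have "r ^ n * snd p \<le> r ^ n * D" "0 \<le> r ^ n * snd p"
          using p r by (auto simp: D_def intro!: mult_left_mono simp del: times_divide_eq_right)
        then have "word_map r w (snd p) \<in> {word_map r w 0..word_map r w 0 + r ^ n * D}"
          unfolding word_map_affine[of r w "snd p"] len by simp
        then show "word_map r w (snd p) \<in> A n" unfolding A_def using w by blast
      qed
      then have "prob {p \<in> space \<nu>. word_map r w (snd p) \<in> A n} = 1" by (rule prob_Collect_eq_1[OF m, THEN iffD2])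
      then show ?thesis by (simp only: sp UNIV_I simp_thms)
    qed
    have "1 - \<theta> ^ n \<le> (\<Sum>w\<in>words n. word_weight e w) - (\<Sum>w\<in>words n - T n. word_weight e w)"
      using bad[of n] wsum[of n] by simp
    also have "\<dots> = (\<Sum>w\<in>T n. word_weight e w)"
      by (subst sum_diff) (auto simp: T_def)
    also have "\<dots> = (\<Sum>w\<in>T n. word_weight e w * measure \<nu> {p. word_map r w (snd p) \<in> A n})" by (simp add: full)
    also have "\<dots> \<le> (\<Sum>w\<in>words n. word_weight e w * measure \<nu> {p. word_map r w (snd p) \<in> A n})"
      using wn by (intro sum_mono2) (auto simp: T_def)
    also have "\<dots> = measure \<nu> {p. snd p \<in> A n}"
      unfolding \<nu>_def by (rule marginal_words[OF r' r(2) e A, symmetric])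
    finally show ?thesis .
  qed
  define N where "N = (\<Union>k. \<Inter>n\<in>{k..}. A n)"
  show ?thesis
  proof (rule that[of N])
    show Nm: "N \<in> sets borel" unfolding N_def by (intro sets.countable_UN' sets.countable_INT') auto
    have Anull: "emeasure lborel (A n) \<le> ennreal (D * (r / \<kappa>) ^ n)" for n
    proof -
      have "real (card (T n)) * \<kappa> ^ n \<le> (\<Sum>w\<in>T n. word_weight e w)"
        using sum_mono[of "T n" "\<lambda>_. \<kappa> ^ n" "word_weight e"] by (simp add: T_def)
      also have "\<dots> \<le> (\<Sum>w\<in>words n. word_weight e w)" using wn by (intro sum_mono2) (auto simp: T_def)
      finally have cT: "real (card (T n)) * \<kappa> ^ n \<le> 1" by (simp add: wsum)
      have "emeasure lborel (A n) \<le> (\<Sum>w\<in>T n. emeasure lborel {word_map r w 0..word_map r w 0 + r ^ n * D})"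
        unfolding A_def using finT by (intro emeasure_subadditive_finite) auto
      also have "\<dots> = (\<Sum>w\<in>T n. ennreal (r ^ n * D))" using r by (intro sum.cong refl) (simp add: D_def)
      also have "\<dots> = ennreal (real (card (T n)) * (r ^ n * D))"
      proof -
        have "0 \<le> r ^ n * D" using r by (simp add: D_def)
        then show ?thesis by (simp add: ennreal_mult ennreal_of_nat_eq_real_of_nat)
      qed
      also have "\<dots> \<le> ennreal (D * (r / \<kappa>) ^ n)"
      proof (rule ennreal_leI)
        have "real (card (T n)) \<le> 1 / \<kappa> ^ n" using cT k0 by (simp add: pos_le_divide_eq)
        then have "real (card (T n)) * (r ^ n * D) \<le> 1 / \<kappa> ^ n * (r ^ n * D)"
          using r by (intro mult_right_mono) (auto simp: D_def)
        then show "real (card (T n)) * (r ^ n * D) \<le> D * (r / \<kappa>) ^ n" by (simp add: power_divide mult_ac)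
      qed
      finally show ?thesis .
    qed
    have lim: "(\<lambda>n. ennreal (D * (r / \<kappa>) ^ n)) \<longlonglongrightarrow> 0"
    proof -
      have "(\<lambda>n. D * (r / \<kappa>) ^ n) \<longlonglongrightarrow> D * 0"
        using \<kappa> r k0 by (intro tendsto_intros LIMSEQ_power_zero) auto
      then show ?thesis using tendsto_ennrealI by fastforce
    qed
    have null: "emeasure lborel (\<Inter>n\<in>{k..}. A n) = 0" for k
    proof -
      have "emeasure lborel (\<Inter>n\<in>{k..}. A n) \<le> 0"
      proof (rule LIMSEQ_le_const[OF lim], intro exI[of _ k] allI impI)
        fix n assume "k \<le> n"
        then have "(\<Inter>n\<in>{k..}. A n) \<subseteq> A n" by auto
        then have "emeasure lborel (\<Inter>n\<in>{k..}. A n) \<le> emeasure lborel (A n)" by (intro emeasure_mono) auto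
        then show "emeasure lborel (\<Inter>n\<in>{k..}. A n) \<le> ennreal (D * (r / \<kappa>) ^ n)" using Anull order_trans by blast
      qed
      then show ?thesis by simp
    qed
    have "(\<Inter>n\<in>{k..}. A n) \<in> null_sets lborel" for k
      using null by (intro null_setsI sets.countable_INT') auto
    then have "N \<in> null_sets lborel" unfolding N_def by (intro null_sets_UN') auto
    then show "emeasure lborel N = 0" by auto
    have "AE p in \<nu>. eventually (\<lambda>n. p \<in> space \<nu> - {p. snd p \<notin> A n}) sequentially"
    proof (rule borel_cantelli_AE1)
      have m: "{p. snd p \<in> A n} \<in> sets \<nu>" for n
        using measurable_sets[OF snd_m A[of n]] by (simp add: vimage_def sp)
      have c: "{p. snd p \<notin> A n} = space \<nu> - {p. snd p \<in> A n}" for n by (auto simp: sp)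
      show "{p. snd p \<notin> A n} \<in> sets \<nu>" for n unfolding c using m by blast
      show "emeasure \<nu> {p. snd p \<notin> A n} < \<infinity>" for n by (simp add: emeasure_eq_measure)
      have le: "measure \<nu> {p. snd p \<notin> A n} \<le> \<theta> ^ n" for n
        unfolding c using prob_compl[OF m[of n]] good[of n] by simp
      show "summable (\<lambda>n. measure \<nu> {p. snd p \<notin> A n})"
        using \<theta> le by (intro summable_comparison_test'[OF summable_geometric[of \<theta>]]) auto
    qed
    then show "AE p in ifs_measure r e. snd p \<in> N"
      unfolding \<nu>_def[symmetric]
    proof (rule AE_mp, intro AE_I2 impI)
      fix p assume "eventually (\<lambda>n. p \<in> space \<nu> - {p. snd p \<notin> A n}) sequentially"
      then obtain k where "\<And>n. n \<ge> k \<Longrightarrow> snd p \<in> A n" by (auto simp: eventually_sequentially)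
      then show "snd p \<in> N" unfolding N_def by auto
    qed
  qed
qed

lemma ifs_measure_singular:
  assumes N: "N \<in> sets borel" "emeasure lborel N = 0" and AE: "AE p in ifs_measure r e. snd p \<in> N"
  shows "mutually_singular (ifs_measure r e) lborel"
  unfolding mutually_singular_def
proof (intro bexI conjI)
  have eq: "{p::R4. snd p \<notin> N} = UNIV \<times> (- N)" by auto
  have m: "{p::R4. snd p \<notin> N} \<in> sets borel"
    unfolding eq borel_prod[symmetric] using N by (intro pair_measureI) auto
  show "{p. snd p \<notin> N} \<in> sets (ifs_measure r e) \<inter> sets lborel" using m by simp
  show "emeasure (ifs_measure r e) {p. snd p \<notin> N} = 0"
    using AE_iff_measurable[of "{p. snd p \<notin> N}" "ifs_measure r e" "\<lambda>p. snd p \<in> N"] AE m by simp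
  have "space lborel - {p::R4. snd p \<notin> N} = UNIV \<times> N" by auto
  moreover have "emeasure (lborel :: R4 measure) (UNIV \<times> N) = 0"
    unfolding lborel_prod[symmetric] using N by (subst lborel.emeasure_pair_measure_Times) auto
  ultimately show "emeasure lborel (space lborel - {p::R4. snd p \<notin> N}) = 0" by simp
qed

section \<open>Lebesgue measure and Gaussians on a subspace\<close>

lemma normal_density_wave:
  assumes s: "\<sigma> > 0"
  shows "integrable lborel (\<lambda>u. normal_density 0 \<sigma> u *\<^sub>R wave (c * u))"
    "(\<integral>u. normal_density 0 \<sigma> u *\<^sub>R wave (c * u) \<partial>lborel) = of_real (exp (- 2 * pi\<^sup>2 * \<sigma>\<^sup>2 * c\<^sup>2))"
proof -
  have "(\<lambda>u::real. wave (a * u)) \<in> borel_measurable borel" for a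
    by (intro borel_measurable_continuous_onI continuous_intros)
  then have m: "(\<lambda>u. wave (a * u)) \<in> borel_measurable lborel" for a by simp
  show "integrable lborel (\<lambda>u. normal_density 0 \<sigma> u *\<^sub>R wave (c * u))"
  proof (rule Bochner_Integration.integrable_bound)
    show "integrable lborel (normal_density 0 \<sigma>)" using s by (rule integrable_normal_density)
    show "AE u in lborel. norm (normal_density 0 \<sigma> u *\<^sub>R wave (c * u)) \<le> norm (normal_density 0 \<sigma> u)" by simp
  qed (use m in measurable)
  have "(\<integral>u. normal_density 0 \<sigma> u *\<^sub>R wave (c * u) \<partial>lborel)
    = \<bar>\<sigma>\<bar> *\<^sub>R (\<integral>u. normal_density 0 \<sigma> (0 + \<sigma> * u) *\<^sub>R wave (c * (0 + \<sigma> * u)) \<partial>lborel)"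
    using s by (intro lborel_integral_real_affine) simp
  also have "\<dots> = (\<integral>u. \<bar>\<sigma>\<bar> *\<^sub>R (normal_density 0 \<sigma> (\<sigma> * u) *\<^sub>R wave (c * (\<sigma> * u))) \<partial>lborel)"
    by (simp only: add_0_left Bochner_Integration.integral_scaleR_right)
  also have "\<dots> = (\<integral>u. std_normal_density u *\<^sub>R iexp ((- 2 * pi * c * \<sigma>) * u) \<partial>lborel)"
  proof (intro Bochner_Integration.integral_cong refl)
    fix u
    have "\<bar>\<sigma>\<bar> * normal_density 0 \<sigma> (\<sigma> * u) = std_normal_density u"
      using s by (simp add: normal_density_def power_mult_distrib real_sqrt_mult)
    moreover have "wave (c * (\<sigma> * u)) = iexp ((- 2 * pi * c * \<sigma>) * u)" by (simp add: wave_def mult_ac)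
    ultimately show "\<bar>\<sigma>\<bar> *\<^sub>R (normal_density 0 \<sigma> (\<sigma> * u) *\<^sub>R wave (c * (\<sigma> * u))) = std_normal_density u *\<^sub>R iexp ((- 2 * pi * c * \<sigma>) * u)"
      by (simp only: scaleR_scaleR)
  qed
  also have "\<dots> = char std_normal_distribution (- 2 * pi * c * \<sigma>)"
    unfolding char_def by (subst integral_density) auto
  also have "\<dots> = of_real (exp (- 2 * pi\<^sup>2 * \<sigma>\<^sup>2 * c\<^sup>2))"
    unfolding char_std_normal_distribution by (simp add: power_mult_distrib mult_ac)
  finally show "(\<integral>u. normal_density 0 \<sigma> u *\<^sub>R wave (c * u) \<partial>lborel) = of_real (exp (- 2 * pi\<^sup>2 * \<sigma>\<^sup>2 * c\<^sup>2))" .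
qed

lemma integrable_inverse_one_plus_square: "integrable lborel (\<lambda>u::real. 1 / (1 + u\<^sup>2))"
proof -
  have "einterval (-\<infinity>) \<infinity> = UNIV" by (simp add: einterval_def)
  then show ?thesis using integrable_inverse_1_plus_square by (simp add: set_integrable_def inverse_eq_divide)
qed

text \<open>A linear subspace \<open>W\<close>, equipped with the orthonormal basis \<open>B\<close> that enters the definition of
  \<^term>\<open>leb_on W\<close>. The map \<open>synth\<close> builds a vector from its coordinates, and turns product Lebesgue
  measure \<open>coords\<close> into \<open>L\<close>.\<close>
locale euclidean_subspace =
  fixes W :: "'a::euclidean_space set"
  assumes subspace_W: "subspace W"
begin

definition B :: "'a set" where
  "B = (SOME B. orthonormal_basis_of W B)"

definition L :: "'a measure" where
  "L = leb_on W"

definition synth :: "('a \<Rightarrow> real) \<Rightarrow> 'a" where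
  "synth g = (\<Sum>b\<in>B. g b *\<^sub>R b)"

definition coords :: "('a \<Rightarrow> real) measure" where
  "coords = (\<Pi>\<^sub>M b\<in>B. lborel)"

sublocale P: product_sigma_finite "\<lambda>_::'a. lborel :: real measure" ..

lemma orthonormal_B: "orthonormal_basis_of W B"
  unfolding B_def by (rule someI_ex[OF ex_orthonormal_basis_of[OF subspace_W]])

lemma span_B: "span B = W" and norm_B: "b \<in> B \<Longrightarrow> norm b = 1" and B_subset: "B \<subseteq> W"
  using orthonormal_B span_superset[of B] by (auto simp: orthonormal_basis_of_def)

lemma independent_B: "independent B"
proof (rule pairwise_orthogonal_independent)
  show "pairwise orthogonal B" using orthonormal_B by (simp add: orthonormal_basis_of_def)
  show "0 \<notin> B" using norm_B by force
qed

lemma finite_B [simp]: "finite B"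
  by (rule independent_imp_finite[OF independent_B])

lemma card_B: "card B = dim W"
  using dim_eq_card_independent[OF independent_B] dim_span[of B] span_B by simp

lemma inner_B: "b \<in> B \<Longrightarrow> b' \<in> B \<Longrightarrow> b \<bullet> b' = (if b = b' then 1 else 0)"
  using orthonormal_B norm_B[of b] by (auto simp: orthonormal_basis_of_def pairwise_def orthogonal_def dot_square_norm)

lemma synth_in_W: "synth g \<in> W"
  unfolding synth_def using subspace_W B_subset by (intro subspace_sum subspace_scale) auto

lemma synth_inner: "b \<in> B \<Longrightarrow> synth g \<bullet> b = g b"
proof -
  assume b: "b \<in> B"
  have "synth g \<bullet> b = (\<Sum>b'\<in>B. g b' * (if b' = b then 1 else 0))"
    unfolding synth_def inner_sum_left using b by (intro sum.cong) (auto simp: inner_B)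
  then show ?thesis using b by (simp add: if_distrib cong: if_cong)
qed

lemma expand: "x \<in> W \<Longrightarrow> x = synth (\<lambda>b. x \<bullet> b)"
proof -
  assume x: "x \<in> W"
  define y where "y = x - synth (\<lambda>b. x \<bullet> b)"
  have "y \<bullet> b = 0" if "b \<in> B" for b using that by (simp add: y_def inner_diff_left synth_inner)
  then have "orthogonal y z" if "z \<in> span B" for z
    using that orthogonal_to_span[of z B y] by (auto simp: orthogonal_def)
  moreover have "y \<in> span B" unfolding span_B y_def using x synth_in_W subspace_W by (simp add: subspace_diff)
  ultimately have "orthogonal y y" by blast
  then show ?thesis by (simp add: y_def orthogonal_self)
qed

lemma inner_expand: "x \<in> W \<Longrightarrow> x \<bullet> y = (\<Sum>b\<in>B. (x \<bullet> b) * (y \<bullet> b))"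
  using arg_cong[OF expand, of x "\<lambda>z. z \<bullet> y"] by (simp add: synth_def inner_sum_left inner_commute[of y])

lemma measurable_synth [measurable]: "synth \<in> borel_measurable coords"
  unfolding synth_def coords_def by measurable

lemma L_eq: "L = distr coords borel synth"
  by (simp add: L_def leb_on_def B_def[symmetric] synth_def[symmetric] coords_def Let_def)

lemma sets_L [simp, measurable_cong]: "sets L = sets borel" and space_L [simp]: "space L = UNIV"
  by (simp_all add: L_eq)

lemma AE_L_in_W: "AE x in L. x \<in> W"
proof -
  have "W \<in> sets borel" using closed_subspace[OF subspace_W] by (rule borel_closed)
  then show ?thesis unfolding L_eq by (subst AE_distr_iff) (auto simp: synth_in_W)
qed

lemma nn_integral_L:
  "f \<in> borel_measurable borel \<Longrightarrow> (\<integral>\<^sup>+x. f x \<partial>L) = (\<integral>\<^sup>+g. f (synth g) \<partial>coords)"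
  unfolding L_eq by (intro nn_integral_distr) auto

lemma integral_L_prod:
  fixes f :: "'a \<Rightarrow> real \<Rightarrow> 'c::{real_normed_field,banach,second_countable_topology}"
  assumes "\<And>b. b \<in> B \<Longrightarrow> integrable lborel (f b)"
  shows "integrable L (\<lambda>x. \<Prod>b\<in>B. f b (x \<bullet> b))" "(\<integral>x. (\<Prod>b\<in>B. f b (x \<bullet> b)) \<partial>L) = (\<Prod>b\<in>B. integral\<^sup>L lborel (f b))"
proof -
  have [measurable]: "b \<in> B \<Longrightarrow> f b \<in> borel_measurable borel" for b using borel_measurable_integrable[OF assms] by simp
  have m: "(\<lambda>x. \<Prod>b\<in>B. f b (x \<bullet> b)) \<in> borel_measurable borel" by measurable
  have eq: "(\<lambda>g. \<Prod>b\<in>B. f b (synth g \<bullet> b)) = (\<lambda>g. \<Prod>b\<in>B. f b (g b))"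
    by (intro ext prod.cong refl) (simp add: synth_inner)
  show "integrable L (\<lambda>x. \<Prod>b\<in>B. f b (x \<bullet> b))"
    unfolding L_eq by (subst integrable_distr_eq[OF measurable_synth m], unfold eq coords_def)
      (rule P.product_integrable_prod[OF finite_B assms])
  show "(\<integral>x. (\<Prod>b\<in>B. f b (x \<bullet> b)) \<partial>L) = (\<Prod>b\<in>B. integral\<^sup>L lborel (f b))"
    unfolding L_eq by (subst integral_distr[OF measurable_synth m], unfold eq coords_def)
      (rule P.product_integral_prod[OF finite_B assms])
qed

lemma box_measurable: "{y. \<forall>b\<in>B. \<bar>(y - x) \<bullet> b\<bar> \<le> s} \<in> sets borel"
proof -
  have "{y. \<forall>b\<in>B. \<bar>(y - x) \<bullet> b\<bar> \<le> s} = (\<Inter>b\<in>B. {y. \<bar>(y - x) \<bullet> b\<bar> \<le> s})" by blast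
  also have "closed \<dots>" by (intro closed_INT ballI closed_Collect_le continuous_intros)
  finally show ?thesis by (rule borel_closed)
qed

lemma emeasure_L_box:
  assumes "s \<ge> 0"
  shows "emeasure L {y. \<forall>b\<in>B. \<bar>(y - x) \<bullet> b\<bar> \<le> s} = ennreal ((2 * s) ^ card B)"
proof -
  have "emeasure L {y. \<forall>b\<in>B. \<bar>(y - x) \<bullet> b\<bar> \<le> s} = emeasure coords (synth -` {y. \<forall>b\<in>B. \<bar>(y - x) \<bullet> b\<bar> \<le> s} \<inter> space coords)"
    unfolding L_eq by (rule emeasure_distr[OF measurable_synth box_measurable])
  also have "synth -` {y. \<forall>b\<in>B. \<bar>(y - x) \<bullet> b\<bar> \<le> s} \<inter> space coords = Pi\<^sub>E B (\<lambda>b. {x \<bullet> b - s..x \<bullet> b + s})"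
  proof (rule Set.set_eqI)
    fix g
    have "(\<forall>b\<in>B. \<bar>(synth g - x) \<bullet> b\<bar> \<le> s) \<longleftrightarrow> (\<forall>b\<in>B. x \<bullet> b - s \<le> g b \<and> g b \<le> x \<bullet> b + s)"
      by (intro ball_cong refl) (simp add: inner_diff_left synth_inner abs_le_iff, linarith)
    then show "g \<in> synth -` {y. \<forall>b\<in>B. \<bar>(y - x) \<bullet> b\<bar> \<le> s} \<inter> space coords \<longleftrightarrow> g \<in> Pi\<^sub>E B (\<lambda>b. {x \<bullet> b - s..x \<bullet> b + s})"
      by (auto simp: coords_def space_PiM PiE_iff)
  qed
  also have "emeasure coords \<dots> = (\<Prod>b\<in>B. emeasure lborel {x \<bullet> b - s..x \<bullet> b + s})"
    unfolding coords_def by (rule P.emeasure_PiM) auto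
  also have "\<dots> = (\<Prod>b\<in>B. ennreal (2 * s))" using assms by (intro prod.cong refl) simp
  also have "\<dots> = ennreal ((2 * s) ^ card B)" using assms by (simp add: ennreal_power)
  finally show ?thesis .
qed

lemma emeasure_L_ball: "emeasure L (cball 0 \<rho>) < \<infinity>"
proof (cases "\<rho> \<ge> 0")
  case True
  have "cball 0 \<rho> \<subseteq> {y. \<forall>b\<in>B. \<bar>(y - 0) \<bullet> b\<bar> \<le> \<rho>}"
  proof
    fix y :: 'a assume y: "y \<in> cball 0 \<rho>"
    have "\<bar>(y - 0) \<bullet> b\<bar> \<le> \<rho>" if "b \<in> B" for b
      using Cauchy_Schwarz_ineq2[of y b] norm_B[OF that] y by simp
    then show "y \<in> {y. \<forall>b\<in>B. \<bar>(y - 0) \<bullet> b\<bar> \<le> \<rho>}" by blast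
  qed
  then have "emeasure L (cball 0 \<rho>) \<le> emeasure L {y. \<forall>b\<in>B. \<bar>(y - 0) \<bullet> b\<bar> \<le> \<rho>}"
    using box_measurable by (intro emeasure_mono) auto
  also have "\<dots> < \<infinity>" unfolding emeasure_L_box[OF True] by simp
  finally show ?thesis .
qed simp

sublocale L: sigma_finite_measure L
proof (rule sigma_finite_measure.intro)
  define A where "A = range (\<lambda>n::nat. cball (0::'a) (real n))"
  have "countable A" "A \<subseteq> sets L" by (auto simp: A_def)
  moreover have "x \<in> \<Union> A" for x
  proof -
    obtain n where "norm x \<le> real n" using real_arch_simple by blast
    then show ?thesis by (auto simp: A_def)
  qed
  moreover have "emeasure L a \<noteq> \<infinity>" if a: "a \<in> A" for a
  proof -
    obtain n where n: "a = cball 0 (real n)" using a by (auto simp: A_def)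
    show ?thesis using emeasure_L_ball[of "real n"] unfolding n by simp
  qed
  ultimately show "\<exists>A. countable A \<and> A \<subseteq> sets L \<and> \<Union> A = space L \<and> (\<forall>a\<in>A. emeasure L a \<noteq> \<infinity>)"
    by (intro exI[of _ A]) auto
qed

lemma gaussian_fourier:
  assumes s: "\<sigma> > 0" and y: "y \<in> W"
  shows "(\<integral>\<xi>. of_real (\<Prod>b\<in>B. normal_density 0 \<sigma> (\<xi> \<bullet> b)) * wave (y \<bullet> \<xi>) \<partial>L) = of_real (exp (- 2 * pi\<^sup>2 * \<sigma>\<^sup>2 * (norm y)\<^sup>2))"
proof -
  define f where "f b u = normal_density 0 \<sigma> u *\<^sub>R wave ((y \<bullet> b) * u)" for b u
  have i: "integrable lborel (f b)" for b unfolding f_def by (rule normal_density_wave(1)[OF s])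
  have wp: "wave (\<Sum>b\<in>S. h b) = (\<Prod>b\<in>S. wave (h b))" if "finite S" for S and h :: "'a \<Rightarrow> real"
    using that by (induction S) (simp_all add: wave_add)
  have "of_real (\<Prod>b\<in>B. normal_density 0 \<sigma> (\<xi> \<bullet> b)) * wave (y \<bullet> \<xi>) = (\<Prod>b\<in>B. f b (\<xi> \<bullet> b))" for \<xi>
    by (subst inner_expand[OF y]) (simp add: f_def wp scaleR_conv_of_real prod.distrib mult.commute)
  then have "(\<integral>\<xi>. of_real (\<Prod>b\<in>B. normal_density 0 \<sigma> (\<xi> \<bullet> b)) * wave (y \<bullet> \<xi>) \<partial>L) = (\<Prod>b\<in>B. integral\<^sup>L lborel (f b))"
    using integral_L_prod(2)[of f] i by simp
  also have "\<dots> = (\<Prod>b\<in>B. of_real (exp (- 2 * pi\<^sup>2 * \<sigma>\<^sup>2 * (y \<bullet> b)\<^sup>2)))"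
    unfolding f_def by (intro prod.cong refl normal_density_wave(2)[OF s])
  also have "\<dots> = of_real (exp (\<Sum>b\<in>B. - 2 * pi\<^sup>2 * \<sigma>\<^sup>2 * (y \<bullet> b)\<^sup>2))"
    by (simp add: exp_sum)
  also have "(\<Sum>b\<in>B. - 2 * pi\<^sup>2 * \<sigma>\<^sup>2 * (y \<bullet> b)\<^sup>2) = - 2 * pi\<^sup>2 * \<sigma>\<^sup>2 * (norm y)\<^sup>2"
    unfolding power2_norm_eq_inner inner_expand[OF y, of y] by (simp add: sum_distrib_left power2_eq_square)
  finally show ?thesis .
qed

text \<open>The Gaussian is the Fourier transform of a normal distribution on the frequency side. By
  Fubini the integral on the left is an average of \<open>fourier \<mu>\<close>, multiplied by waves, against that
  distribution, whose density is nowhere larger than \<open>1 / (sqrt (2 * pi) * \<sigma>) ^ card B\<close>.\<close>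
lemma gaussian_smoothing_le:
  assumes \<mu>: "prob_space \<mu>" "sets \<mu> = sets borel" "AE x in \<mu>. x \<in> W"
    and F: "integrable L (\<lambda>\<xi>. cmod (fourier \<mu> \<xi>))" and s: "\<sigma> > 0" and y: "y \<in> W"
  shows "(\<integral>x. exp (- 2 * pi\<^sup>2 * \<sigma>\<^sup>2 * (norm (y - x))\<^sup>2) \<partial>\<mu>)
    \<le> (\<integral>\<xi>. cmod (fourier \<mu> \<xi>) \<partial>L) / (sqrt (2 * pi) * \<sigma>) ^ card B"
proof -
  interpret \<mu>: prob_space \<mu> by fact
  note [measurable_cong] = \<mu>(2)
  define d where "d \<xi> = (\<Prod>b\<in>B. normal_density 0 \<sigma> (\<xi> \<bullet> b))" for \<xi>
  have d0: "0 \<le> d \<xi>" for \<xi> unfolding d_def by (intro prod_nonneg) simp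
  have dm[measurable]: "d \<in> borel_measurable borel" unfolding d_def by measurable
  have di: "integrable L d" "integral\<^sup>L L d = 1"
    using integral_L_prod[of "\<lambda>_. normal_density 0 \<sigma>"] s unfolding d_def by simp_all
  define N where "N = density L (\<lambda>\<xi>. ennreal (d \<xi>))"
  have N: "prob_space N"
  proof
    have "emeasure N (space N) = (\<integral>\<^sup>+\<xi>. ennreal (d \<xi>) \<partial>L)"
      unfolding N_def by (subst emeasure_density) auto
    also have "\<dots> = 1" using nn_integral_eq_integral[OF di(1)] d0 di(2) by simp
    finally show "emeasure N (space N) = 1" .
  qed
  interpret N: prob_space N by fact
  interpret pair_prob_space \<mu> N ..
  have setsN[measurable_cong]: "sets N = sets borel" by (simp add: N_def)
  have Nint: "(\<integral>\<xi>. f \<xi> \<partial>N) = (\<integral>\<xi>. d \<xi> *\<^sub>R f \<xi> \<partial>L)" if "f \<in> borel_measurable borel" for f :: "'a \<Rightarrow> 'c::{banach, second_countable_topology}"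
    unfolding N_def using that d0 by (intro integral_density) auto
  have w2: "(\<lambda>p. wave ((y - fst p) \<bullet> snd p)) \<in> borel_measurable (\<mu> \<Otimes>\<^sub>M N)"
  proof -
    have "(\<lambda>p::'a \<times> 'a. wave ((y - fst p) \<bullet> snd p)) \<in> borel_measurable borel"
      by (intro borel_measurable_continuous_onI continuous_intros)
    moreover have "sets (\<mu> \<Otimes>\<^sub>M N) = sets (borel :: ('a \<times> 'a) measure)"
      unfolding borel_prod[symmetric] by (intro sets_pair_measure_cong \<mu>(2) setsN)
    ultimately show ?thesis by (simp cong: measurable_cong_sets)
  qed
  have wi: "integrable (\<mu> \<Otimes>\<^sub>M N) (\<lambda>(x, \<xi>). wave ((y - x) \<bullet> \<xi>))"
    using w2 by (intro P.integrable_const_bound[of _ 1]) (auto simp: split_beta)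
  have "of_real (\<integral>x. exp (- 2 * pi\<^sup>2 * \<sigma>\<^sup>2 * (norm (y - x))\<^sup>2) \<partial>\<mu>) = (\<integral>x. complex_of_real (exp (- 2 * pi\<^sup>2 * \<sigma>\<^sup>2 * (norm (y - x))\<^sup>2)) \<partial>\<mu>)"
    by (rule integral_complex_of_real[symmetric])
  also have "\<dots> = (\<integral>x. (\<integral>\<xi>. wave ((y - x) \<bullet> \<xi>) \<partial>N) \<partial>\<mu>)"
  proof (rule integral_cong_AE)
    show "AE x in \<mu>. complex_of_real (exp (- 2 * pi\<^sup>2 * \<sigma>\<^sup>2 * (norm (y - x))\<^sup>2)) = (\<integral>\<xi>. wave ((y - x) \<bullet> \<xi>) \<partial>N)"
      using \<mu>(3)
    proof (rule AE_mp, intro AE_I2 impI)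
      fix x assume "x \<in> W"
      then have yx: "y - x \<in> W" using y subspace_W by (simp add: subspace_diff)
      have "(\<integral>\<xi>. wave ((y - x) \<bullet> \<xi>) \<partial>N) = (\<integral>\<xi>. d \<xi> *\<^sub>R wave ((y - x) \<bullet> \<xi>) \<partial>L)"
        by (rule Nint) (intro borel_measurable_continuous_onI continuous_intros)
      also have "\<dots> = of_real (exp (- 2 * pi\<^sup>2 * \<sigma>\<^sup>2 * (norm (y - x))\<^sup>2))"
        using gaussian_fourier[OF s yx] by (simp add: d_def scaleR_conv_of_real)
      finally show "complex_of_real (exp (- 2 * pi\<^sup>2 * \<sigma>\<^sup>2 * (norm (y - x))\<^sup>2)) = (\<integral>\<xi>. wave ((y - x) \<bullet> \<xi>) \<partial>N)" by simp
    qed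
    show "(\<lambda>x. complex_of_real (exp (- 2 * pi\<^sup>2 * \<sigma>\<^sup>2 * (norm (y - x))\<^sup>2))) \<in> borel_measurable \<mu>" by measurable
    show "(\<lambda>x. \<integral>\<xi>. wave ((y - x) \<bullet> \<xi>) \<partial>N) \<in> borel_measurable \<mu>"
      using N.borel_measurable_lebesgue_integral[of "\<lambda>x \<xi>. wave ((y - x) \<bullet> \<xi>)" \<mu>] borel_measurable_integrable[OF wi] by simp
  qed
  also have "\<dots> = (\<integral>\<xi>. (\<integral>x. wave ((y - x) \<bullet> \<xi>) \<partial>\<mu>) \<partial>N)"
    by (rule Fubini_integral[OF wi, symmetric])
  finally have eq: "of_real (\<integral>x. exp (- 2 * pi\<^sup>2 * \<sigma>\<^sup>2 * (norm (y - x))\<^sup>2) \<partial>\<mu>) = (\<integral>\<xi>. (\<integral>x. wave ((y - x) \<bullet> \<xi>) \<partial>\<mu>) \<partial>N)" .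
  have inner: "cmod (\<integral>x. wave ((y - x) \<bullet> \<xi>) \<partial>\<mu>) = cmod (fourier \<mu> \<xi>)" for \<xi>
  proof -
    have "wave ((y - x) \<bullet> \<xi>) = wave (y \<bullet> \<xi>) * cnj (wave (x \<bullet> \<xi>))" for x
      by (simp add: wave_eq_cis inner_diff_left cis_cnj cis_mult algebra_simps)
    then have "(\<integral>x. wave ((y - x) \<bullet> \<xi>) \<partial>\<mu>) = wave (y \<bullet> \<xi>) * cnj (fourier \<mu> \<xi>)"
      unfolding fourier_wave by simp
    then show ?thesis by (simp add: norm_mult)
  qed
  have Fm: "(\<lambda>\<xi>. cmod (fourier \<mu> \<xi>)) \<in> borel_measurable borel" using borel_measurable_integrable[OF F] by simp
  have db: "d \<xi> \<le> 1 / (sqrt (2 * pi) * \<sigma>) ^ card B" for \<xi>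
  proof -
    have "d \<xi> \<le> (\<Prod>b\<in>B. 1 / (sqrt (2 * pi) * \<sigma>))"
      unfolding d_def
    proof (intro prod_mono conjI)
      fix b
      have "exp (- (\<xi> \<bullet> b - 0)\<^sup>2 / (2 * \<sigma>\<^sup>2)) \<le> 1" using s by simp
      moreover have "sqrt (2 * pi * \<sigma>\<^sup>2) = sqrt (2 * pi) * \<sigma>" using s by (simp add: real_sqrt_mult)
      ultimately show "normal_density 0 \<sigma> (\<xi> \<bullet> b) \<le> 1 / (sqrt (2 * pi) * \<sigma>)"
        using s unfolding normal_density_def by (simp add: divide_right_mono)
    qed simp
    then show ?thesis by (simp add: power_one_over)
  qed
  have "(\<integral>x. exp (- 2 * pi\<^sup>2 * \<sigma>\<^sup>2 * (norm (y - x))\<^sup>2) \<partial>\<mu>) \<le> cmod (of_real (\<integral>x. exp (- 2 * pi\<^sup>2 * \<sigma>\<^sup>2 * (norm (y - x))\<^sup>2) \<partial>\<mu>))"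
    by simp
  also have "\<dots> \<le> (\<integral>\<xi>. cmod (\<integral>x. wave ((y - x) \<bullet> \<xi>) \<partial>\<mu>) \<partial>N)" unfolding eq by (rule integral_norm_bound)
  also have "\<dots> = (\<integral>\<xi>. d \<xi> * cmod (fourier \<mu> \<xi>) \<partial>L)"
    unfolding inner using Nint[OF Fm] by simp
  also have "\<dots> \<le> (\<integral>\<xi>. 1 / (sqrt (2 * pi) * \<sigma>) ^ card B * cmod (fourier \<mu> \<xi>) \<partial>L)"
  proof (rule integral_mono)
    show "integrable L (\<lambda>\<xi>. 1 / (sqrt (2 * pi) * \<sigma>) ^ card B * cmod (fourier \<mu> \<xi>))" using F by simp
    then show "integrable L (\<lambda>\<xi>. d \<xi> * cmod (fourier \<mu> \<xi>))"
    proof (rule Bochner_Integration.integrable_bound)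
      show "(\<lambda>\<xi>. d \<xi> * cmod (fourier \<mu> \<xi>)) \<in> borel_measurable L" using Fm by measurable
      show "AE \<xi> in L. norm (d \<xi> * cmod (fourier \<mu> \<xi>)) \<le> norm (1 / (sqrt (2 * pi) * \<sigma>) ^ card B * cmod (fourier \<mu> \<xi>))"
      proof (intro AE_I2)
        fix \<xi>
        show "norm (d \<xi> * cmod (fourier \<mu> \<xi>)) \<le> norm (1 / (sqrt (2 * pi) * \<sigma>) ^ card B * cmod (fourier \<mu> \<xi>))"
          unfolding real_norm_def abs_mult abs_of_nonneg[OF d0] by (intro mult_right_mono order_trans[OF db abs_ge_self]) simp
      qed
    qed
    show "d \<xi> * cmod (fourier \<mu> \<xi>) \<le> 1 / (sqrt (2 * pi) * \<sigma>) ^ card B * cmod (fourier \<mu> \<xi>)" for \<xi>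
      by (intro mult_right_mono db) simp
  qed
  finally show ?thesis by simp
qed

end

section \<open>Bounded densities\<close>

context euclidean_subspace begin

text \<open>The Gaussian \<open>G x y\<close> of width \<open>1 / \<sigma>\<close> is integrated over \<open>x\<close> and over \<open>y \<in> U\<close> in both
  orders. Seen from \<open>x \<in> A\<close>, a box of side \<open>2 / \<sigma>\<close> lies in \<open>U\<close>, so the integral over \<open>y\<close> is at
  least a constant times \<open>\<sigma>\<^sup>-\<^sup>k\<close>; seen from \<open>y\<close>, the integral over \<open>x\<close> is at most a constant times
  \<open>\<sigma>\<^sup>-\<^sup>k\<close>. The powers of \<open>\<sigma>\<close> cancel, so \<open>a\<close> does not depend on \<open>\<delta>\<close>.\<close>
lemma near_measure_le:
  assumes \<mu>: "prob_space \<mu>" "sets \<mu> = sets borel" "AE x in \<mu>. x \<in> W"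
    and F: "integrable L (\<lambda>\<xi>. cmod (fourier \<mu> \<xi>))"
  obtains a where "a > 0"
    "\<And>A U \<delta>. A \<in> sets borel \<Longrightarrow> U \<in> sets borel \<Longrightarrow> \<delta> > 0 \<Longrightarrow> (\<And>x y. x \<in> A \<Longrightarrow> norm (y - x) < \<delta> \<Longrightarrow> y \<in> U)
      \<Longrightarrow> ennreal a * emeasure \<mu> A \<le> emeasure L U"
proof -
  interpret \<mu>: prob_space \<mu> by fact
  note [measurable_cong] = \<mu>(2)
  interpret pair_sigma_finite \<mu> L ..
  define k where "k = card B"
  define C where "C = (\<integral>\<xi>. cmod (fourier \<mu> \<xi>) \<partial>L) + 1"
  define E where "E = exp (- 2 * pi\<^sup>2 * real k)"
  define a where "a = E * (2 * sqrt (2 * pi)) ^ k / C"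
  have C: "C > 0" unfolding C_def by (intro add_nonneg_pos integral_nonneg) auto
  have E: "E > 0" by (simp add: E_def)
  have "a > 0" unfolding a_def using C E by simp
  moreover have "ennreal a * emeasure \<mu> A \<le> emeasure L U"
    if A: "A \<in> sets borel" and U: "U \<in> sets borel" and \<delta>: "\<delta> > 0" and near: "\<And>x y. x \<in> A \<Longrightarrow> norm (y - x) < \<delta> \<Longrightarrow> y \<in> U"
    for A U \<delta>
  proof -
    \<comment> \<open>A box of half-side \<open>1 / \<sigma>\<close> has radius at most \<open>k / \<sigma>\<close>, which must stay below \<open>\<delta>\<close>, also for
      \<open>k = 0\<close>.\<close>
    define \<sigma> where "\<sigma> = (real k + 1) / \<delta>"
    have s: "\<sigma> > 0" using \<delta> by (simp add: \<sigma>_def)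
    have ks: "real k / \<sigma> < \<delta>" using \<delta> by (simp add: \<sigma>_def field_simps)
    define G where "G x y = ennreal (exp (- 2 * pi\<^sup>2 * \<sigma>\<^sup>2 * (norm (y - x))\<^sup>2))" for x y :: 'a
    define D where "D = C / (sqrt (2 * pi) * \<sigma>) ^ k"
    have D: "D > 0" using C s by (simp add: D_def)
    have Gm[measurable]: "case_prod G \<in> borel_measurable (borel \<Otimes>\<^sub>M borel)" unfolding G_def by measurable
    have "ennreal (E * (2 * (1 / \<sigma>)) ^ k) * emeasure \<mu> A = (\<integral>\<^sup>+x. ennreal (E * (2 * (1 / \<sigma>)) ^ k) * indicator A x \<partial>\<mu>)"
      using A \<mu>(2) by (simp add: nn_integral_cmult_indicator)
    also have "\<dots> \<le> (\<integral>\<^sup>+x. (\<integral>\<^sup>+y. indicator U y * G x y \<partial>L) \<partial>\<mu>)"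
    proof (rule nn_integral_mono_AE, use \<mu>(3) in \<open>rule AE_mp\<close>, intro AE_I2 impI)
      fix x assume x: "x \<in> W"
      show "ennreal (E * (2 * (1 / \<sigma>)) ^ k) * indicator A x \<le> (\<integral>\<^sup>+y. indicator U y * G x y \<partial>L)"
      proof (cases "x \<in> A")
        case True
        let ?box = "{y. \<forall>b\<in>B. \<bar>(y - x) \<bullet> b\<bar> \<le> 1 / \<sigma>}"
        have "ennreal (E * (2 * (1 / \<sigma>)) ^ k) = ennreal E * emeasure L ?box"
          using s E by (subst emeasure_L_box) (auto simp: ennreal_mult k_def)
        also have "\<dots> = (\<integral>\<^sup>+y. ennreal E * indicator ?box y \<partial>L)"
          using box_measurable[of x "1 / \<sigma>"] by (simp add: nn_integral_cmult_indicator)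
        also have "\<dots> \<le> (\<integral>\<^sup>+y. indicator U y * G x y \<partial>L)"
        proof (rule nn_integral_mono_AE, use AE_L_in_W in \<open>rule AE_mp\<close>, intro AE_I2 impI)
          fix y assume "y \<in> W"
          then have yx: "y - x \<in> W" using x subspace_W by (simp add: subspace_diff)
          show "ennreal E * indicator ?box y \<le> indicator U y * G x y"
          proof (cases "y \<in> ?box")
            case box: True
            have "(norm (y - x))\<^sup>2 = (\<Sum>b\<in>B. ((y - x) \<bullet> b)\<^sup>2)"
              unfolding power2_norm_eq_inner inner_expand[OF yx, of "y - x"] by (simp add: power2_eq_square)
            also have "\<dots> \<le> (\<Sum>b\<in>B. (1 / \<sigma>)\<^sup>2)"
              using box s by (intro sum_mono) (auto simp: abs_le_square_iff[symmetric])
            also have "\<dots> = real k * (1 / \<sigma>)\<^sup>2" by (simp add: k_def)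
            finally have n: "(norm (y - x))\<^sup>2 \<le> real k * (1 / \<sigma>)\<^sup>2" .
            also have "\<dots> \<le> (real k)\<^sup>2 * (1 / \<sigma>)\<^sup>2"
              by (intro mult_right_mono; cases k) (simp_all add: power2_eq_square field_simps)
            finally have "norm (y - x) \<le> real k * (1 / \<sigma>)"
              using s by (simp add: power_mult_distrib[symmetric] abs_le_square_iff[symmetric])
            then have "norm (y - x) < \<delta>" using ks by simp
            then have "y \<in> U" using near True by blast
            moreover have "ennreal E \<le> G x y"
            proof -
              have "\<sigma>\<^sup>2 * (norm (y - x))\<^sup>2 \<le> \<sigma>\<^sup>2 * (real k * (1 / \<sigma>)\<^sup>2)" using n by (intro mult_left_mono) auto
              also have "\<dots> = real k" using s by (simp add: power_divide)
              finally have "2 * pi\<^sup>2 * (\<sigma>\<^sup>2 * (norm (y - x))\<^sup>2) \<le> 2 * pi\<^sup>2 * real k" by (intro mult_left_mono) auto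
              then show ?thesis unfolding G_def E_def by (intro ennreal_leI) (simp add: mult.assoc)
            qed
            ultimately show ?thesis using box by simp
          qed simp
        qed
        finally show ?thesis using True by simp
      qed simp
    qed
    also have "\<dots> = (\<integral>\<^sup>+y. (\<integral>\<^sup>+x. indicator U y * G x y \<partial>\<mu>) \<partial>L)"
    proof (rule Fubini'[symmetric])
      note [measurable] = U
      show "(\<lambda>(x, y). indicator U y * G x y) \<in> borel_measurable (\<mu> \<Otimes>\<^sub>M L)" unfolding G_def by measurable
    qed
    also have "\<dots> \<le> (\<integral>\<^sup>+y. ennreal D * indicator U y \<partial>L)"
    proof (rule nn_integral_mono_AE, use AE_L_in_W in \<open>rule AE_mp\<close>, intro AE_I2 impI)
      fix y assume y: "y \<in> W"
      have gi: "integrable \<mu> (\<lambda>x. exp (- 2 * pi\<^sup>2 * \<sigma>\<^sup>2 * (norm (y - x))\<^sup>2))"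
        by (rule \<mu>.integrable_const_bound[of _ 1]) auto
      have "(\<integral>\<^sup>+x. G x y \<partial>\<mu>) = ennreal (\<integral>x. exp (- 2 * pi\<^sup>2 * \<sigma>\<^sup>2 * (norm (y - x))\<^sup>2) \<partial>\<mu>)"
        unfolding G_def by (rule nn_integral_eq_integral[OF gi]) simp
      also have "\<dots> \<le> ennreal D"
      proof (rule ennreal_leI)
        show "(\<integral>x. exp (- 2 * pi\<^sup>2 * \<sigma>\<^sup>2 * (norm (y - x))\<^sup>2) \<partial>\<mu>) \<le> D"
          using s unfolding D_def C_def k_def
          by (intro order_trans[OF gaussian_smoothing_le[OF \<mu> F s y]] divide_right_mono) auto
      qed
      finally have "(\<integral>\<^sup>+x. G x y \<partial>\<mu>) \<le> ennreal D" .
      then show "(\<integral>\<^sup>+x. indicator U y * G x y \<partial>\<mu>) \<le> ennreal D * indicator U y"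
        by (simp split: split_indicator)
    qed
    also have "\<dots> = ennreal D * emeasure L U" using U by (simp add: nn_integral_cmult_indicator)
    finally have "ennreal (1 / D) * (ennreal (E * (2 * (1 / \<sigma>)) ^ k) * emeasure \<mu> A) \<le> ennreal (1 / D) * (ennreal D * emeasure L U)"
      by (rule mult_left_mono) simp
    moreover have "1 / D * (E * (2 * (1 / \<sigma>)) ^ k) = a"
      using s C by (simp add: D_def a_def power_mult_distrib power_divide)
    moreover have "1 / D * D = 1" using D by simp
    ultimately show ?thesis using D E s by (simp add: ennreal_mult[symmetric] mult.assoc[symmetric] del: times_divide_eq_left)
  qed
  ultimately show ?thesis by (rule that)
qed

text \<open>An open set is exhausted by the sets of points whose distance to the complement is at least
  \<open>1 / (n + 1)\<close>; the passage from open to Borel sets is outer regularity. The latter holds for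
  finite measures, which is why \<open>L\<close> is cut off outside a ball that contains almost all of \<open>\<mu>\<close>.\<close>
lemma dominated_measure:
  assumes \<mu>: "prob_space \<mu>" "sets \<mu> = sets borel" "AE x in \<mu>. x \<in> W" "AE x in \<mu>. norm x \<le> \<rho>"
    and F: "integrable L (\<lambda>\<xi>. cmod (fourier \<mu> \<xi>))"
  obtains a where "a > 0" "\<And>A. A \<in> sets borel \<Longrightarrow> ennreal a * emeasure \<mu> A \<le> emeasure L A"
proof -
  interpret \<mu>: prob_space \<mu> by fact
  note [measurable_cong] = \<mu>(2)
  obtain a where a: "a > 0" and
    near: "\<And>A U \<delta>. A \<in> sets borel \<Longrightarrow> U \<in> sets borel \<Longrightarrow> \<delta> > 0 \<Longrightarrow> (\<And>x y. x \<in> A \<Longrightarrow> norm (y - x) < \<delta> \<Longrightarrow> y \<in> U)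
      \<Longrightarrow> ennreal a * emeasure \<mu> A \<le> emeasure L U"
    using near_measure_le[OF \<mu>(1,2,3) F] by blast
  have op: "ennreal a * emeasure \<mu> U \<le> emeasure L U" if U: "open U" for U
  proof -
    define V where "V n = {x. ball x (1 / real (Suc n)) \<subseteq> U}" for n
    have "closed (V n)" for n
    proof -
      have "V n = - (\<Union>y\<in>-U. ball y (1 / real (Suc n)))" by (auto simp: V_def dist_commute)
      then show ?thesis by (simp only:) (intro closed_Compl open_UN ballI open_ball)
    qed
    then have Vb: "V n \<in> sets borel" for n by (rule borel_closed)
    have inc: "incseq V"
    proof (rule incseq_SucI)
      fix n
      have "1 / real (Suc (Suc n)) \<le> 1 / real (Suc n)" by (simp add: field_simps)
      then show "V n \<le> V (Suc n)" unfolding V_def by (auto dest: subset_ball)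
    qed
    have un: "(\<Union>n. V n) = U"
    proof
      show "(\<Union>n. V n) \<subseteq> U" by (force simp: V_def)
      show "U \<subseteq> (\<Union>n. V n)"
      proof
        fix x assume "x \<in> U"
        then obtain d where d: "d > 0" "ball x d \<subseteq> U" using U open_contains_ball by blast
        obtain n where "1 / real (Suc n) < d" using nat_approx_posE[OF d(1)] by blast
        then have "ball x (1 / real (Suc n)) \<subseteq> U" using d(2) by (meson order_trans less_imp_le subset_ball)
        then show "x \<in> (\<Union>n. V n)" by (auto simp: V_def)
      qed
    qed
    have step: "ennreal a * emeasure \<mu> (V n) \<le> emeasure L U" for n
    proof (rule near[OF Vb])
      show "U \<in> sets borel" using U by simp
      show "0 < 1 / real (Suc n)" by simp
      show "y \<in> U" if "x \<in> V n" "norm (y - x) < 1 / real (Suc n)" for x y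
        using that by (auto simp: V_def dist_norm norm_minus_commute subset_iff)
    qed
    have "ennreal a * emeasure \<mu> U = ennreal a * (SUP n. emeasure \<mu> (V n))"
      using SUP_emeasure_incseq[of V \<mu>] Vb inc \<mu>(2) un by (simp add: image_subset_iff)
    also have "\<dots> = (SUP n. ennreal a * emeasure \<mu> (V n))" by (rule SUP_mult_left_ennreal)
    also have "\<dots> \<le> emeasure L U" by (intro SUP_least step)
    finally show ?thesis .
  qed
  have "ennreal a * emeasure \<mu> A \<le> emeasure L A" if A: "A \<in> sets borel" for A
  proof -
    define M where "M = density L (indicator (ball 0 (\<rho> + 1)))"
    have M: "emeasure M X = emeasure L (X \<inter> ball 0 (\<rho> + 1))" if "X \<in> sets borel" for X
      using that unfolding M_def by (subst emeasure_density) (auto simp: indicator_inter_arith[symmetric] mult.commute intro!: borel_measurable_indicator)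
    have "emeasure L (ball 0 (\<rho> + 1)) \<le> emeasure L (cball 0 (\<rho> + 1))" by (intro emeasure_mono) auto
    then have fin: "emeasure M (space M) \<noteq> \<infinity>" using emeasure_L_ball[of "\<rho> + 1"] by (simp add: M[of UNIV] M_def[THEN arg_cong, of space])
    have "ennreal a * emeasure \<mu> A \<le> emeasure M U" if U: "A \<subseteq> U" "open U" for U
    proof -
      have "emeasure \<mu> A \<le> emeasure \<mu> (U \<inter> ball 0 (\<rho> + 1))"
      proof (rule emeasure_mono_AE)
        show "AE x in \<mu>. x \<in> A \<longrightarrow> x \<in> U \<inter> ball 0 (\<rho> + 1)"
          using \<mu>(4) by (rule AE_mp) (use U(1) in \<open>intro AE_I2, auto\<close>)
        show "U \<inter> ball 0 (\<rho> + 1) \<in> sets \<mu>" using U(2) \<mu>(2) by simp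
      qed
      then have "ennreal a * emeasure \<mu> A \<le> ennreal a * emeasure \<mu> (U \<inter> ball 0 (\<rho> + 1))" by (rule mult_left_mono) simp
      also have "\<dots> \<le> emeasure L (U \<inter> ball 0 (\<rho> + 1))" using U(2) by (intro op open_Int open_ball)
      also have "\<dots> = emeasure M U" using U(2) by (simp add: M)
      finally show ?thesis .
    qed
    then have "ennreal a * emeasure \<mu> A \<le> (INF U\<in>{U. A \<subseteq> U \<and> open U}. emeasure M U)" by (intro INF_greatest) blast
    also have "\<dots> = emeasure M A" using outer_regular[OF _ fin A] by (simp add: M_def)
    also have "\<dots> \<le> emeasure L A" unfolding M[OF A] using A by (intro emeasure_mono) auto
    finally show ?thesis .
  qed
  with a show ?thesis by (rule that)
qed

text \<open>A Radon-Nikodym density \<open>f\<close> with respect to \<open>L\<close> is essentially bounded by \<open>2 / a\<close>: the set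
  where it is larger would have at most half of its own measure.\<close>
lemma bounded_density:
  assumes \<mu>: "prob_space \<mu>" "sets \<mu> = sets borel" "AE x in \<mu>. x \<in> W" "AE x in \<mu>. norm x \<le> \<rho>"
    and F: "integrable L (\<lambda>\<xi>. cmod (fourier \<mu> \<xi>))"
  obtains h where "h \<in> borel_measurable borel" "\<And>x. 0 \<le> h x" "\<mu> = density L (\<lambda>x. ennreal (h x))"
    "integrable L (\<lambda>x. (h x)\<^sup>2)"
proof -
  interpret \<mu>: prob_space \<mu> by fact
  obtain a where a: "a > 0" and dom: "\<And>A. A \<in> sets borel \<Longrightarrow> ennreal a * emeasure \<mu> A \<le> emeasure L A"
    using dominated_measure[OF \<mu> F] by blast
  have "absolutely_continuous L \<mu>"
  proof (unfold absolutely_continuous_def, rule subsetI)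
    fix N assume N: "N \<in> null_sets L"
    then have "ennreal a * emeasure \<mu> N \<le> 0" using dom[of N] by (auto simp: null_sets_def)
    then show "N \<in> null_sets \<mu>" using a N \<mu>(2) by (auto simp: null_sets_def)
  qed
  then obtain f where f: "f \<in> borel_measurable L" "density L f = \<mu>"
    using L.Radon_Nikodym[of \<mu>] \<mu>(2) by auto
  have fm[measurable]: "f \<in> borel_measurable borel" using f(1) by simp
  define c where "c = 2 / a"
  have c: "c > 0" using a by (simp add: c_def)
  have bound: "AE x in L. f x < ennreal c"
  proof -
    define E where "E = {x. ennreal c \<le> f x}"
    have E[measurable]: "E \<in> sets borel" unfolding E_def by measurable
    have "ennreal c * emeasure L E = (\<integral>\<^sup>+x. ennreal c * indicator E x \<partial>L)" by (simp add: nn_integral_cmult_indicator)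
    also have "\<dots> \<le> (\<integral>\<^sup>+x. f x * indicator E x \<partial>L)"
      by (intro nn_integral_mono) (auto simp: E_def split: split_indicator)
    also have "\<dots> = emeasure \<mu> E" unfolding f(2)[symmetric] by (subst emeasure_density) auto
    finally have 1: "ennreal c * emeasure L E \<le> emeasure \<mu> E" .
    have "ennreal a * (ennreal c * emeasure L E) \<le> ennreal a * emeasure \<mu> E" using 1 by (rule mult_left_mono) simp
    also have "\<dots> \<le> emeasure L E" by (rule dom[OF E])
    finally have "ennreal (a * c) * emeasure L E \<le> emeasure L E" using a c by (simp add: ennreal_mult mult.assoc)
    then have 2: "2 * emeasure L E \<le> emeasure L E" using a by (simp add: c_def)
    have "ennreal c * emeasure L E \<le> 1" using 1 \<mu>.emeasure_le_1 order_trans by blast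
    then have "emeasure L E \<noteq> \<infinity>" using c by (auto simp: ennreal_mult_top top_unique)
    then obtain l where l: "emeasure L E = ennreal l" "l \<ge> 0" by (cases "emeasure L E") auto
    have "ennreal (2 * l) \<le> ennreal l" using 2 l by (simp add: ennreal_mult)
    then have "l = 0" using l by simp
    then have "E \<in> null_sets L" using l E by (simp add: null_sets_def)
    then show ?thesis using AE_not_in[of E L] by (simp add: E_def not_le)
  qed
  define h where "h x = enn2real (min (f x) (ennreal c))" for x
  have hm[measurable]: "h \<in> borel_measurable borel" unfolding h_def by measurable
  have h0: "0 \<le> h x" for x by (simp add: h_def)
  have hc: "h x \<le> c" for x
  proof -
    have "h x \<le> enn2real (ennreal c)" unfolding h_def by (intro enn2real_mono) auto
    then show ?thesis using c by simp
  qed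
  have hf: "AE x in L. f x = ennreal (h x)"
    using bound
  proof (rule AE_mp, intro AE_I2 impI)
    fix x assume "f x < ennreal c"
    moreover from this have "f x < Orderings.top" by (rule order.strict_trans) simp
    ultimately show "f x = ennreal (h x)" unfolding h_def by (simp add: min_absorb1 less_imp_le)
  qed
  have dens: "\<mu> = density L (\<lambda>x. ennreal (h x))"
    unfolding f(2)[symmetric] using hf by (intro density_cong) auto
  have "(\<integral>\<^sup>+x. ennreal (h x) \<partial>L) = emeasure \<mu> (space \<mu>)"
    unfolding dens by (subst emeasure_density) auto
  then have hi: "integrable L h" using h0 \<mu>.emeasure_space_1 by (intro integrableI_nonneg) auto
  have "integrable L (\<lambda>x. c * h x)" using hi by simp
  then have "integrable L (\<lambda>x. (h x)\<^sup>2)"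
  proof (rule Bochner_Integration.integrable_bound)
    show "AE x in L. norm ((h x)\<^sup>2) \<le> norm (c * h x)"
    proof (intro AE_I2)
      fix x
      have "h x * h x \<le> c * h x" by (intro mult_right_mono hc h0)
      then show "norm ((h x)\<^sup>2) \<le> norm (c * h x)" using h0[of x] c by (simp add: power2_eq_square)
    qed
  qed measurable
  with hm h0 dens show ?thesis by (rule that)
qed

end

section \<open>Projections to subspaces\<close>

context euclidean_subspace begin

text \<open>The definite description in \<open>proj_on\<close> is resolved by the expansion in the basis.\<close>
lemma proj_on_eq: "proj_on W x = synth (\<lambda>b. x \<bullet> b)"
proof -
  let ?y = "synth (\<lambda>b. x \<bullet> b)"
  have orth: "orthogonal (x - ?y) w" if "w \<in> W" for w
  proof -
    have "(x - ?y) \<bullet> b = 0" if "b \<in> B" for b using that by (simp add: inner_diff_left synth_inner)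
    then show ?thesis using that orthogonal_to_span[of w B "x - ?y"] by (auto simp: orthogonal_def span_B)
  qed
  show ?thesis unfolding proj_on_def
  proof (rule the_equality)
    show "?y \<in> W \<and> (\<forall>w\<in>W. orthogonal (x - ?y) w)" using synth_in_W orth by blast
    fix y assume y: "y \<in> W \<and> (\<forall>w\<in>W. orthogonal (x - y) w)"
    then have "y - ?y \<in> W" using synth_in_W subspace_W by (simp add: subspace_diff)
    then have "(x - ?y) \<bullet> (y - ?y) = 0" "(x - y) \<bullet> (y - ?y) = 0" using y orth by (auto simp: orthogonal_def)
    then have "(y - ?y) \<bullet> (y - ?y) = 0" by (simp add: inner_diff_left)
    then show "y = ?y" by simp
  qed
qed

lemma proj_on_in: "proj_on W x \<in> W"
  unfolding proj_on_eq by (rule synth_in_W)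

lemma inner_proj_on: "\<xi> \<in> W \<Longrightarrow> proj_on W x \<bullet> \<xi> = x \<bullet> \<xi>"
proof -
  assume \<xi>: "\<xi> \<in> W"
  have "proj_on W x \<bullet> \<xi> = (\<Sum>b\<in>B. (x \<bullet> b) * (b \<bullet> \<xi>))"
    unfolding proj_on_eq synth_def by (simp only: inner_sum_left inner_scaleR_left)
  also have "\<dots> = (\<Sum>b\<in>B. (\<xi> \<bullet> b) * (x \<bullet> b))"
    by (intro sum.cong refl) (simp only: inner_commute[of \<xi>] mult.commute)
  also have "\<dots> = \<xi> \<bullet> x" by (rule inner_expand[OF \<xi>, symmetric])
  finally show ?thesis by (simp only: inner_commute)
qed

lemma norm_proj_on_le: "norm (proj_on W x) \<le> norm x"
proof -
  have "norm (proj_on W x) * norm (proj_on W x) = x \<bullet> proj_on W x"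
    using inner_proj_on[OF proj_on_in, of x x] by (metis power2_norm_eq_inner power2_eq_square)
  also have "\<dots> \<le> norm x * norm (proj_on W x)" by (rule norm_cauchy_schwarz)
  finally show ?thesis by (cases "norm (proj_on W x) = 0") (auto simp: mult_le_cancel_right)
qed

lemma measurable_proj_on [measurable]: "proj_on W \<in> borel_measurable borel"
proof -
  have "(\<lambda>x. synth (\<lambda>b. x \<bullet> b)) \<in> borel_measurable borel" unfolding synth_def by measurable
  then show ?thesis by (simp add: proj_on_eq[abs_def])
qed

lemma fourier_proj_measure:
  assumes "sets \<nu> = sets borel" "\<xi> \<in> W"
  shows "fourier (proj_measure W \<nu>) \<xi> = fourier \<nu> \<xi>"
proof -
  note [measurable_cong] = assms(1)
  have "fourier (proj_measure W \<nu>) \<xi> = (\<integral>x. wave (proj_on W x \<bullet> \<xi>) \<partial>\<nu>)"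
    unfolding fourier_wave proj_measure_def by (subst integral_distr) auto
  then show ?thesis by (simp add: fourier_wave inner_proj_on assms(2))
qed

lemma prob_space_proj_measure:
  assumes "prob_space \<nu>" "sets \<nu> = sets borel"
  shows "prob_space (proj_measure W \<nu>)"
proof -
  interpret prob_space \<nu> by fact
  note [measurable_cong] = assms(2)
  show ?thesis unfolding proj_measure_def by (rule prob_space_distr) measurable
qed

text \<open>As there are at most three basis vectors, \<open>1 / (1 + |\<xi>|\<^sup>2)\<^sup>3\<close> is below the product of the
  functions \<open>1 / (1 + (\<xi> \<bullet> b)\<^sup>2)\<close> and so integrable. This covers both the Fourier transform itself
  and its square with a weight of order up to \<open>(1 + |\<xi>|\<^sup>2)\<^sup>3\<close>.\<close>
lemma regular_of_fourier_decay:
  assumes \<nu>: "prob_space \<nu>" "sets \<nu> = sets borel" "AE x in \<nu>. norm x \<le> \<rho>"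
    and decay: "\<And>\<xi>. \<xi> \<in> W \<Longrightarrow> cmod (fourier \<nu> \<xi>) \<le> K / (1 + (norm \<xi>)\<^sup>2) ^ 3" and k: "dim W \<le> 3"
  shows "absolutely_continuous L (proj_measure W \<nu>)" "t \<le> 3 \<Longrightarrow> in_sobolev t W (proj_measure W \<nu>)"
proof -
  define \<mu> where "\<mu> = proj_measure W \<nu>"
  note [measurable_cong] = \<nu>(2)
  have prob: "prob_space \<mu>" unfolding \<mu>_def by (rule prob_space_proj_measure[OF \<nu>(1,2)])
  interpret \<mu>: prob_space \<mu> by (rule prob)
  have sets[measurable_cong]: "sets \<mu> = sets borel" by (simp add: \<mu>_def proj_measure_def)
  have Wb: "W \<in> sets borel" using closed_subspace[OF subspace_W] by (rule borel_closed)
  have inW: "AE x in \<mu>. x \<in> W"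
    unfolding \<mu>_def proj_measure_def using Wb by (subst AE_distr_iff) (auto simp: proj_on_in)
  have "AE x in \<nu>. norm (proj_on W x) \<le> \<rho>"
    using \<nu>(3) by (rule AE_mp) (intro AE_I2 impI order_trans[OF norm_proj_on_le])
  then have bd: "AE x in \<mu>. norm x \<le> \<rho>"
    unfolding \<mu>_def proj_measure_def by (subst AE_distr_iff) auto
  have fm[measurable]: "fourier \<mu> \<in> borel_measurable borel"
  proof -
    have "(\<lambda>(\<xi>, x). wave (x \<bullet> \<xi>)) \<in> borel_measurable (borel \<Otimes>\<^sub>M \<mu>)" by measurable
    from \<mu>.borel_measurable_lebesgue_integral[OF this] show ?thesis by (simp add: fourier_wave[abs_def])
  qed
  define w where "w \<xi> = (\<Prod>b\<in>B. 1 / (1 + (\<xi> \<bullet> b)\<^sup>2))" for \<xi>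
  have wi: "integrable L w" unfolding w_def by (intro integral_L_prod integrable_inverse_one_plus_square)
  have w: "1 / (1 + (norm \<xi>)\<^sup>2) ^ 3 \<le> w \<xi>" if \<xi>: "\<xi> \<in> W" for \<xi>
  proof -
    have "(\<Prod>b\<in>B. 1 + (\<xi> \<bullet> b)\<^sup>2) \<le> (\<Prod>b\<in>B. 1 + (norm \<xi>)\<^sup>2)"
    proof (intro prod_mono conjI add_left_mono)
      fix b assume "b \<in> B"
      then have "\<bar>\<xi> \<bullet> b\<bar> \<le> norm \<xi>" using Cauchy_Schwarz_ineq2[of \<xi> b] norm_B by simp
      then show "(\<xi> \<bullet> b)\<^sup>2 \<le> (norm \<xi>)\<^sup>2" by (simp add: abs_le_square_iff[symmetric])
    qed simp
    also have "\<dots> = (1 + (norm \<xi>)\<^sup>2) ^ dim W" by (simp add: card_B)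
    also have "\<dots> \<le> (1 + (norm \<xi>)\<^sup>2) ^ 3" using k by (intro power_increasing) auto
    finally have "(\<Prod>b\<in>B. 1 + (\<xi> \<bullet> b)\<^sup>2) \<le> (1 + (norm \<xi>)\<^sup>2) ^ 3" .
    moreover have "0 < (\<Prod>b\<in>B. 1 + (\<xi> \<bullet> b)\<^sup>2)" by (intro prod_pos) (simp add: add_pos_nonneg)
    ultimately have "1 / (1 + (norm \<xi>)\<^sup>2) ^ 3 \<le> 1 / (\<Prod>b\<in>B. 1 + (\<xi> \<bullet> b)\<^sup>2)"
      by (intro divide_left_mono mult_pos_pos zero_less_power add_pos_nonneg) auto
    then show ?thesis by (simp add: w_def prod_dividef)
  qed
  have K: "0 \<le> K" using order_trans[OF norm_ge_zero decay[of 0]] subspace_0[OF subspace_W] by simp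
  have F: "cmod (fourier \<mu> \<xi>) \<le> K / (1 + (norm \<xi>)\<^sup>2) ^ 3" if "\<xi> \<in> W" for \<xi>
    using decay[OF that] fourier_proj_measure[OF \<nu>(2) that] by (simp add: \<mu>_def)
  have Fi: "integrable L (\<lambda>\<xi>. cmod (fourier \<mu> \<xi>))"
  proof (rule Bochner_Integration.integrable_bound)
    show "integrable L (\<lambda>\<xi>. K * w \<xi>)" using wi by simp
    show "AE \<xi> in L. norm (cmod (fourier \<mu> \<xi>)) \<le> norm (K * w \<xi>)"
    proof (use AE_L_in_W in \<open>rule AE_mp\<close>, intro AE_I2 impI)
      fix \<xi> assume \<xi>: "\<xi> \<in> W"
      have "K * (1 / (1 + (norm \<xi>)\<^sup>2) ^ 3) \<le> K * w \<xi>" by (intro mult_left_mono w \<xi> K)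
      then show "norm (cmod (fourier \<mu> \<xi>)) \<le> norm (K * w \<xi>)" using F[OF \<xi>] by simp
    qed
  qed measurable
  obtain h where h: "h \<in> borel_measurable borel" "\<And>x. 0 \<le> h x" "\<mu> = density L (\<lambda>x. ennreal (h x))" "integrable L (\<lambda>x. (h x)\<^sup>2)"
    using bounded_density[OF prob sets inW bd Fi] by blast
  show "absolutely_continuous L (proj_measure W \<nu>)"
    unfolding \<mu>_def[symmetric] h(3) using h(1) by (intro absolutely_continuousI_density) simp
  show "in_sobolev t W (proj_measure W \<nu>)" if t: "t \<le> 3"
  proof -
    have "integrable L (\<lambda>\<xi>. (1 + (norm \<xi>)\<^sup>2) powr t * (cmod (fourier \<mu> \<xi>))\<^sup>2)"
    proof (rule Bochner_Integration.integrable_bound)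
      show "integrable L (\<lambda>\<xi>. K\<^sup>2 * w \<xi>)" using wi by simp
      show "AE \<xi> in L. norm ((1 + (norm \<xi>)\<^sup>2) powr t * (cmod (fourier \<mu> \<xi>))\<^sup>2) \<le> norm (K\<^sup>2 * w \<xi>)"
      proof (use AE_L_in_W in \<open>rule AE_mp\<close>, intro AE_I2 impI)
        fix \<xi> assume \<xi>: "\<xi> \<in> W"
        define m where "m = 1 + (norm \<xi>)\<^sup>2"
        have m: "m \<ge> 1" by (simp add: m_def)
        have "m powr t \<le> m powr 3" using m t by (intro powr_mono)
        also have "\<dots> = m ^ 3" using m by simp
        finally have "m powr t * (cmod (fourier \<mu> \<xi>))\<^sup>2 \<le> m ^ 3 * (K / m ^ 3)\<^sup>2"
          using F[OF \<xi>] m by (intro mult_mono power_mono) (auto simp: m_def)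
        also have "\<dots> = K\<^sup>2 * (1 / m ^ 3)" 
        proof -
          have "y * (K / y)\<^sup>2 = K\<^sup>2 * (1 / y)" if "y \<noteq> 0" for y using that by (simp add: power2_eq_square)
          then show ?thesis using m by (metis power_not_zero not_one_le_zero)
        qed
        also have "\<dots> \<le> K\<^sup>2 * w \<xi>" unfolding m_def by (intro mult_left_mono w \<xi>) simp
        finally show "norm ((1 + (norm \<xi>)\<^sup>2) powr t * (cmod (fourier \<mu> \<xi>))\<^sup>2) \<le> norm (K\<^sup>2 * w \<xi>)"
          by (simp add: m_def)
      qed
    qed measurable
    then show ?thesis
      unfolding in_sobolev_def L_def[symmetric] \<mu>_def[symmetric] using h by blast
  qed
qed

text \<open>Fubini with respect to a basis vector \<open>b\<close> that is not orthogonal to \<open>u\<close>: on lines in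
  direction \<open>b\<close> the function \<open>x \<bullet> u\<close> is affine and not constant.\<close>
lemma null_preimage:
  assumes u: "u \<in> W" "u \<noteq> 0" and N: "N \<in> sets borel" "emeasure lborel N = 0"
  shows "emeasure L {x. x \<bullet> u \<in> N} = 0"
proof -
  have "\<exists>b\<in>B. u \<bullet> b \<noteq> 0"
  proof (rule ccontr)
    assume "\<not> ?thesis"
    then have "u = 0" using expand[OF u(1)] by (simp add: synth_def)
    then show False using u by simp
  qed
  then obtain b where b: "b \<in> B" "u \<bullet> b \<noteq> 0" by blast
  define I where "I = B - {b}"
  have I: "B = insert b I" "finite I" "b \<notin> I" using b by (auto simp: I_def)
  define S where "S = {x. x \<bullet> u \<in> N}"
  have "(\<lambda>x. x \<bullet> u) -` N \<inter> space borel \<in> sets borel" by (rule measurable_sets[OF _ N(1)]) measurable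
  then have S[measurable]: "S \<in> sets borel" by (simp add: S_def vimage_def)
  have line: "(\<integral>\<^sup>+y. indicator N (d + (u \<bullet> b) * y) \<partial>lborel) = (0::ennreal)" for d
  proof -
    have "emeasure lborel N = (\<integral>\<^sup>+y. indicator N y \<partial>lborel)" using N(1) by simp
    also have "\<dots> = ennreal \<bar>u \<bullet> b\<bar> * (\<integral>\<^sup>+y. indicator N (d + (u \<bullet> b) * y) \<partial>lborel)"
      using N(1) b(2) by (intro nn_integral_real_affine) auto
    finally show ?thesis using N(2) b(2) by simp
  qed
  have sm: "synth \<in> borel_measurable (Pi\<^sub>M (insert b I) (\<lambda>_. lborel))" using measurable_synth unfolding coords_def I(1) .
  have "emeasure L S = (\<integral>\<^sup>+x. indicator S x \<partial>L)" by simp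
  also have "\<dots> = (\<integral>\<^sup>+g. indicator S (synth g) \<partial>coords)" by (rule nn_integral_L) measurable
  also have "\<dots> = (\<integral>\<^sup>+g. (\<integral>\<^sup>+y. indicator S (synth (g(b := y))) \<partial>lborel) \<partial>Pi\<^sub>M I (\<lambda>_. lborel))"
    unfolding coords_def I(1) by (intro P.product_nn_integral_insert I) (use sm in measurable)
  also have "\<dots> = 0"
  proof -
    have "indicator S (synth (g(b := y))) = (indicator N ((\<Sum>c\<in>I. g c * (c \<bullet> u)) + (u \<bullet> b) * y) :: ennreal)" for g y
    proof -
      have "(\<Sum>c\<in>I. (g(b := y)) c * (c \<bullet> u)) = (\<Sum>c\<in>I. g c * (c \<bullet> u))" using I(3) by (intro sum.cong) auto
      then have "synth (g(b := y)) \<bullet> u = (\<Sum>c\<in>I. g c * (c \<bullet> u)) + (u \<bullet> b) * y"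
        unfolding synth_def I(1) inner_sum_left using I by (simp add: inner_commute mult.commute)
      then show ?thesis by (simp add: S_def indicator_def)
    qed
    then show ?thesis by (simp add: line)
  qed
  finally show ?thesis by (simp add: S_def)
qed

text \<open>The projection does not change the inner product with \<open>u \<in> W\<close>, so the projected measure
  lives on the preimage of \<open>N\<close>.\<close>
lemma not_absolutely_continuous_proj_measure:
  assumes \<nu>: "prob_space \<nu>" "sets \<nu> = sets borel" and u: "u \<in> W" "u \<noteq> 0"
    and N: "N \<in> sets borel" "emeasure lborel N = 0" "AE x in \<nu>. x \<bullet> u \<in> N"
  shows "\<not> absolutely_continuous L (proj_measure W \<nu>)"
proof
  assume ac: "absolutely_continuous L (proj_measure W \<nu>)"
  interpret \<nu>: prob_space \<nu> by fact
  note [measurable_cong] = \<nu>(2)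
  define S where "S = {x. x \<bullet> u \<in> N}"
  have "(\<lambda>x. x \<bullet> u) -` N \<inter> space borel \<in> sets borel" by (rule measurable_sets[OF _ N(1)]) measurable
  then have S[measurable]: "S \<in> sets borel" by (simp add: S_def vimage_def)
  have "S \<in> null_sets L" using null_preimage[OF u N(1,2)] S by (simp add: null_sets_def S_def)
  then have "S \<in> null_sets (proj_measure W \<nu>)" using ac by (auto simp: absolutely_continuous_def)
  then have "AE x in proj_measure W \<nu>. x \<notin> S" by (rule AE_not_in)
  then have "AE x in \<nu>. proj_on W x \<notin> S"
    unfolding proj_measure_def by (subst (asm) AE_distr_iff) auto
  then have "AE x in \<nu>. False"
    using N(3)
  proof eventually_elim
    case (elim x)
    then show ?case by (simp add: S_def inner_proj_on[OF u(1)])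
  qed
  then show False by simp
qed

end

text \<open>A subspace that does not contain \<open>e4\<close> meets the vertical axis only in 0, so \<open>fst\<close> is
  injective on it and bounded below by a multiple of the norm.\<close>
lemma transversal_decay:
  fixes F :: "R4 \<Rightarrow> complex"
  assumes W: "subspace W" "e4 \<notin> W" and K: "K > 0"
    and decay: "\<And>(\<xi> :: real^3) t. 1 \<le> norm \<xi> \<Longrightarrow> cmod (F (\<xi>, t)) \<le> K * norm \<xi> powr (-6)"
    and bound: "\<And>p. cmod (F p) \<le> 1"
  obtains K' where "\<And>p. p \<in> W \<Longrightarrow> cmod (F p) \<le> K' / (1 + (norm p)\<^sup>2) ^ 3"
proof -
  have inj: "p = 0" if p: "p \<in> W" "fst p = 0" for p
  proof (rule ccontr)
    assume "p \<noteq> 0"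
    then have "snd p \<noteq> 0" using p(2) by (simp add: prod_eq_iff)
    then have "e4 = (1 / snd p) *\<^sub>R p" using p(2) by (simp add: e4_def prod_eq_iff)
    then show False using W p(1) by (metis subspace_scale)
  qed
  obtain c where c: "c > 0" and iso: "\<And>p. p \<in> W \<Longrightarrow> c * norm p \<le> norm (fst p)"
  proof -
    have "\<exists>c>0. \<forall>p\<in>W. c * norm p \<le> norm (fst p)"
      by (rule injective_imp_isometric[OF closed_subspace[OF W(1)] W(1) bounded_linear_fst]) (use inj in blast)
    then show ?thesis using that by blast
  qed
  define A where "A = 1 + 1 / c\<^sup>2"
  have A: "A > 0" by (simp add: A_def add_pos_nonneg)
  have "cmod (F p) \<le> (max K 1 * A ^ 3) / (1 + (norm p)\<^sup>2) ^ 3" if p: "p \<in> W" for p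
  proof -
    define x where "x = norm (fst p)"
    have "(c * norm p)\<^sup>2 \<le> x\<^sup>2" unfolding x_def using c iso[OF p] by (intro power_mono) auto
    then have n: "(norm p)\<^sup>2 \<le> x\<^sup>2 / c\<^sup>2" using c by (simp add: power_mult_distrib field_simps)
    have m0: "0 < 1 + (norm p)\<^sup>2" by (simp add: add_pos_nonneg)
    have "cmod (F p) * (1 + (norm p)\<^sup>2) ^ 3 \<le> max K 1 * A ^ 3"
    proof (cases "1 \<le> x")
      case True
      have "1 + (norm p)\<^sup>2 \<le> A * x\<^sup>2"
      proof -
        have "1 \<le> x\<^sup>2" using True by simp
        then show ?thesis using n by (simp add: A_def distrib_right)
      qed
      then have 1: "(1 + (norm p)\<^sup>2) ^ 3 \<le> (A * x\<^sup>2) ^ 3" using m0 by (intro power_mono) auto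
      have "cmod (F p) \<le> K * x powr (-6)" using decay[of "fst p" "snd p"] True by (simp add: x_def)
      also have "x powr (-6) = 1 / x ^ 6" using True by (simp add: powr_minus powr_numeral divide_inverse)
      finally have 2: "cmod (F p) \<le> K * (1 / x ^ 6)" .
      have "cmod (F p) * (1 + (norm p)\<^sup>2) ^ 3 \<le> (K * (1 / x ^ 6)) * (A * x\<^sup>2) ^ 3"
        using 1 2 m0 K by (intro mult_mono) auto
      also have "\<dots> = K * A ^ 3"
        using True by (simp add: power_mult_distrib power_mult[symmetric])
      also have "\<dots> \<le> max K 1 * A ^ 3" using A by (intro mult_right_mono) auto
      finally show ?thesis .
    next
      case False
      then have "x\<^sup>2 \<le> 1" by (simp add: x_def power_le_one)
      then have "x\<^sup>2 / c\<^sup>2 \<le> 1 / c\<^sup>2" by (intro divide_right_mono) auto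
      then have "1 + (norm p)\<^sup>2 \<le> A" using n by (simp add: A_def)
      then have "(1 + (norm p)\<^sup>2) ^ 3 \<le> A ^ 3" using m0 by (intro power_mono) auto
      then show ?thesis using bound[of p] m0 A by (intro mult_mono) auto
    qed
    then show ?thesis using m0 by (simp add: pos_le_divide_eq)
  qed
  then show ?thesis by (rule that)
qed

section \<open>Singular measures with regular projections\<close>

theorem corollary1p5:
  fixes \<eta> \<tau> :: real
  assumes "\<eta> > 0" and "\<tau> > 0"
  shows "\<exists>(r::real) (\<nu> :: R4 measure).
    0 < r \<and> r < 1 \<and>
    self_similar_measure Phi_index (Phi r) \<nu> \<and>
    mutually_singular \<nu> lborel \<and>
    fourier_dim \<nu> < \<eta> \<and>
    (\<forall>k::nat. 1 \<le> k \<and> k \<le> 3 \<longrightarrow> (\<forall>W \<in> grassmannian k.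
       (absolutely_continuous (leb_on W) (proj_measure W \<nu>) \<longleftrightarrow> e4 \<notin> W) \<and>
       (e4 \<notin> W \<longrightarrow>
         (\<forall>t::real. 0 \<le> t \<and> t < (4 - real k) / 2 - \<tau> \<longrightarrow>
            in_sobolev t W (proj_measure W \<nu>)))))"
proof -
  \<comment> \<open>The even number \<open>2\<^sup>2\<^sup>1\<close> is large enough for \<open>scale_constraint\<close>. The ratio and thus the decay
    of the Fourier transform are fixed before \<open>e\<close> is chosen.\<close>
  define q :: nat where "q = 2097152"
  define r where "r = 1 - 1 / real q"
  define \<kappa> where "\<kappa> = (1 + r) / 2"
  have r: "0 < r" "r < 1" by (simp_all add: r_def q_def)
  then have \<kappa>: "r < \<kappa>" "\<kappa> < 1" by (simp_all add: \<kappa>_def)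
  \<comment> \<open>As \<open>e\<close> tends to 0, the bound on the Fourier dimension tends to 0 and the singularity
    criterion to \<open>sqrt \<kappa> < 1\<close>.\<close>
  obtain e where e: "0 < e" "e < 1 / 2" "2 * ln (1 - 2 * e) / ln r < \<eta>" "sqrt \<kappa> * (sqrt e + sqrt (1 - e)) < 1"
  proof -
    have "((\<lambda>e. 2 * ln (1 - 2 * e) / ln r) \<longlongrightarrow> 2 * ln (1 - 2 * 0) / ln r) (at_right 0)"
      using r by (intro tendsto_intros) auto
    then have "\<forall>\<^sub>F e in at_right 0. 2 * ln (1 - 2 * e) / ln r < \<eta>"
      using assms(1) by (intro order_tendstoD(2)) auto
    moreover have "((\<lambda>e. sqrt \<kappa> * (sqrt e + sqrt (1 - e))) \<longlongrightarrow> sqrt \<kappa> * (sqrt 0 + sqrt (1 - 0))) (at_right 0)"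
      by (intro tendsto_intros)
    then have "\<forall>\<^sub>F e in at_right 0. sqrt \<kappa> * (sqrt e + sqrt (1 - e)) < 1"
      by (rule order_tendstoD(2)) (use \<kappa> in simp)
    moreover have "\<forall>\<^sub>F e::real in at_right 0. 0 < e \<and> e < 1 / 2"
      using eventually_at_right_real[of 0 "1 / 2"] by simp
    ultimately have "\<forall>\<^sub>F e in at_right 0. 0 < e \<and> e < 1 / 2 \<and> 2 * ln (1 - 2 * e) / ln r < \<eta> \<and> sqrt \<kappa> * (sqrt e + sqrt (1 - e)) < 1"
      by eventually_elim blast
    then show ?thesis using that eventually_happens'[OF trivial_limit_at_right_real] by blast
  qed
  define \<nu> where "\<nu> = ifs_measure r e"
  have r0: "0 \<le> r" and e1: "e < 1" using r e by auto
  have prob: "prob_space \<nu>" and sets: "sets \<nu> = sets borel"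
    unfolding \<nu>_def by (rule prob_space_ifs_measure[OF r0 r(2)], rule sets_ifs_measure)
  obtain N where N: "N \<in> sets borel" "emeasure lborel N = 0" "AE p in \<nu>. snd p \<in> N"
    unfolding \<nu>_def using singular_marginal[OF r e(1) e1 \<kappa>(1) e(4)] by blast
  obtain K where K: "K > 0" and decay: "\<And>(\<xi> :: real^3) t. 1 \<le> norm \<xi> \<Longrightarrow> cmod (fourier \<nu> (\<xi>, t)) \<le> K * norm \<xi> powr (- 6)"
    using fourier_ifs_measure_decay[of q e] scale_constraint e(1) e1 unfolding \<nu>_def r_def q_def by auto
  have bounded: "AE p in \<nu>. norm p \<le> 2 / (1 - r)"
    unfolding \<nu>_def by (rule AE_ifs_measure_bounds(1)[OF r0 r(2)])
  have slices: "(absolutely_continuous (leb_on W) (proj_measure W \<nu>) \<longleftrightarrow> e4 \<notin> W) \<and>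
      (e4 \<notin> W \<longrightarrow> (\<forall>t::real. 0 \<le> t \<and> t < (4 - real k) / 2 - \<tau> \<longrightarrow> in_sobolev t W (proj_measure W \<nu>)))"
    if k: "1 \<le> k \<and> k \<le> 3" and W: "W \<in> grassmannian k" for k W
  proof -
    have subspace: "subspace W" and dim: "dim W = k" using W by (auto simp: grassmannian_def)
    interpret euclidean_subspace W by (rule euclidean_subspace.intro[OF subspace])
    show ?thesis
    proof (cases "e4 \<in> W")
      case True
      have "e4 \<noteq> 0" by (simp add: e4_def prod_eq_iff)
      moreover have "AE p in \<nu>. p \<bullet> e4 \<in> N" using N(3) by (simp add: e4_def inner_prod_def)
      ultimately have "\<not> absolutely_continuous L (proj_measure W \<nu>)"
        using not_absolutely_continuous_proj_measure[OF prob sets True] N(1,2) by blast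
      then show ?thesis using True by (simp add: L_def)
    next
      case False
      obtain K' where K': "\<And>p. p \<in> W \<Longrightarrow> cmod (fourier \<nu> p) \<le> K' / (1 + (norm p)\<^sup>2) ^ 3"
        using transversal_decay[OF subspace False K decay norm_fourier_le[OF prob]] by blast
      have d3: "dim W \<le> 3" using dim k by simp
      note regular = regular_of_fourier_decay[OF prob sets bounded K' d3]
      have "in_sobolev t W (proj_measure W \<nu>)" if t: "0 \<le> t \<and> t < (4 - real k) / 2 - \<tau>" for t
      proof (rule regular(2))
        have "(4 - real k) / 2 \<le> 2" by simp
        then show "t \<le> 3" using t assms(2) by linarith
      qed
      then show ?thesis using regular(1) False by (simp add: L_def)
    qed
  qed
  show ?thesis
  proof (intro exI[of _ r] exI[of _ \<nu>] conjI)
    show "0 < r" "r < 1" by fact+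
    show "self_similar_measure Phi_index (Phi r) \<nu>"
      unfolding \<nu>_def by (rule self_similar_ifs_measure[OF r0 r(2) e(1) e1])
    show "mutually_singular \<nu> lborel"
      unfolding \<nu>_def by (rule ifs_measure_singular[OF N(1,2) N(3)[unfolded \<nu>_def]])
    show "fourier_dim \<nu> < \<eta>"
      using fourier_dim_ifs_measure_le[OF r e(1,2)] e(3) unfolding \<nu>_def by linarith
    show "\<forall>k::nat. 1 \<le> k \<and> k \<le> 3 \<longrightarrow> (\<forall>W \<in> grassmannian k.
       (absolutely_continuous (leb_on W) (proj_measure W \<nu>) \<longleftrightarrow> e4 \<notin> W) \<and>
       (e4 \<notin> W \<longrightarrow>
         (\<forall>t::real. 0 \<le> t \<and> t < (4 - real k) / 2 - \<tau> \<longrightarrow>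
            in_sobolev t W (proj_measure W \<nu>))))"
      using slices by blast
  qed
qed

end
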